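(* Let $\mathcal J=\{\mathcal N_s\}_{s\in S}\subset\mathcal C(\mathcal H_A,\mathcal H_B)$ with $|S|<\infty$ define an arbitrarily varying quantum channel (AVQC). Then: (1) If $\overline{\mathcal A}_{d,CET}(\mathcal J)\neq\{(0,0)\}$, then $\overline{\mathcal A}_{d,CET}(\mathcal J)=\overline{\mathcal A}_{r,CET}(\mathcal J)=\overline C_{CET}(\mathrm{conv}(\mathcal J))$, where $\mathrm{conv}(\mathcal J):=\{\sum_{s}q(s)\mathcal N_s:q\in\mathcal P(S)\}$ and $\overline C_{CET}(\mathrm{conv}(\mathcal J))$ is the average-error CET capacity region of the compound channel generated by $\mathrm{conv}(\mathcal J)$. (2) $\overline{\mathcal A}_{d,CET}(\mathcal J)=\{(0,0)\}$ if and only if $\mathcal J$ is symmetrizable.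
   Context: All Hilbert spaces are finite-dimensional; $\mathcal C(\cdot,\cdot)$ CPTP maps, $\mathcal C^\downarrow$ completely positive trace non-increasing maps, $F(\rho,\sigma)=\|\sqrt\rho\sqrt\sigma\|_1^2$, $\log$ base 2. For $s^l=(s_1,\dots,s_l)\in S^l$, $\mathcal N_{s^l}:=\mathcal N_{s_1}\otimes\cdots\otimes\mathcal N_{s_l}$; the AVQC is the family $\{\mathcal N_{s^l}:s^l\in S^l\}_{l\in\mathbb N}$. A deterministic $(l,M_1,M_2)$ CET code is $(\mathcal P^{(m)},\mathcal R^{(m)})_{m=1}^{M_1}$ with Hilbert spaces $\mathcal F_A\subset\mathcal F_B$, $\dim\mathcal F_A=M_2$, $\mathcal P^{(m)}\in\mathcal C(\mathcal F_A,\mathcal H_A^{\otimes l})$, $\mathcal R^{(m)}\in\mathcal C^\downarrow(\mathcal H_B^{\otimes l},\mathcal F_B)$, $\sum_m\mathcal R^{(m)}$ trace preserving. With $\mathcal R=\sum_m|m\rangle\langle m|\otimes\mathcal R^{(m)}$ and $\Phi$ maximally entangled on $\mathcal F_A\otimes\mathcal F_A$, $g_{s^l}(\mathcal P^{(m)},\mathcal R^{(m)}):=F(|m\rangle\langle m|\otimes\Phi,(\mathrm{id}\otimes\mathcal R\circ\mathcal N_{s^l}\circ\mathcal P^{(m)})(\Phi))$. A random $(l,M_1,M_2)$ CET code is a probability measure $\mu_l$ on the set of such deterministic codes (with a sigma-algebra containing singletons making all $g_{s^l}$ measurable). $(R_1,R_2)\ge0$ is an achievable random (resp. deterministic) CET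 rate pair if there is a sequence of random (resp. deterministic) $(l,M_{1,l},M_{2,l})$ codes with $\liminf_l\frac1l\log M_{i,l}\ge R_i$ and $\lim_{l}\inf_{s^l\in S^l}\int\frac1{M_{1,l}}\sum_m g_{s^l}\,d\mu_l=1$ (resp. without integral). $\overline{\mathcal A}_{r,CET}(\mathcal J)$, $\overline{\mathcal A}_{d,CET}(\mathcal J)$ are the sets of such pairs. For a compound channel $\mathcal K=\{\mathcal M_t\}_{t\in T}$, $\overline C_{CET}(\mathcal K)$ is the set of $(R_1,R_2)\ge0$ such that for all $\epsilon,\delta>0$ and all large $n$ there is an $(n,M_{1,n},M_{2,n})$ CET code with $\frac1n\log M_{i,n}\ge R_i-\delta$ and $\inf_t\frac1{M_{1,n}}\sum_m F(|m\rangle\langle m|\otimes\Phi,(\mathrm{id}\otimes\mathcal R\circ\mathcal M_t^{\otimes n}\circ\mathcal P^{(m)})(\Phi))\ge1-\epsilon$. $\mathcal J$ is $l$-symmetrizable if for every finite set $\{\rho_1,\dots,\rho_K\}\subset\mathcal S(\mathcal H_A^{\otimes l})$ there is a map $p:\{\rho_1,\dots,\rho_K\}\to\mathcal P(S^l)$ with $\sum_{s^l}p(\rho_i)(s^l)\mathcal N_{s^l}(\rho_j)=\sum_{s^l}p(\rho_j)(s^l)\mathcal N_{s^l}(\rho_i)$ for all $i,j$; $\mathcal J$ is symmetrizable if it is $l$-symmetrizable for every $l\in\mathbb N$. *)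

theory Defs
  imports "HOL-Probability.Probability" "Jordan_Normal_Form.Matrix"
begin

type_synonym cmap = "complex mat \<Rightarrow> complex mat"

definition mtrace :: "complex mat \<Rightarrow> complex" where
  "mtrace A = (\<Sum>i<dim_row A. A $$ (i,i))"

definition adj :: "complex mat \<Rightarrow> complex mat" where
  "adj A = Matrix.mat (dim_col A) (dim_row A) (\<lambda>(i,j). cnj (A $$ (j,i)))"

definition psd :: "complex mat \<Rightarrow> bool" where
  "psd A \<longleftrightarrow> dim_col A = dim_row A \<and> adj A = A \<and>
     (\<forall>v :: nat \<Rightarrow> complex.
        let q = (\<Sum>i<dim_row A. \<Sum>j<dim_row A. cnj (v i) * A $$ (i,j) * v j)
        in Im q = 0 \<and> Re q \<ge> 0)"

definition msqrt :: "complex mat \<Rightarrow> complex mat" where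
  "msqrt A = (THE B. psd B \<and> B * B = A)"

definition tnorm :: "complex mat \<Rightarrow> real" where
  "tnorm A = Re (mtrace (msqrt (adj A * A)))"

definition fidelity :: "complex mat \<Rightarrow> complex mat \<Rightarrow> real" where
  "fidelity \<rho> \<sigma> = (tnorm (msqrt \<rho> * msqrt \<sigma>))\<^sup>2"

definition dens_op :: "nat \<Rightarrow> complex mat \<Rightarrow> bool" where
  "dens_op d \<rho> \<longleftrightarrow> \<rho> \<in> carrier_mat d d \<and> psd \<rho> \<and> mtrace \<rho> = 1"

definition munit :: "nat \<Rightarrow> nat \<Rightarrow> nat \<Rightarrow> complex mat" where
  "munit d i j = Matrix.mat d d (\<lambda>(a,b). if a = i \<and> b = j then 1 else 0)"

definition kron :: "complex mat \<Rightarrow> complex mat \<Rightarrow> complex mat" where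
  "kron A B = Matrix.mat (dim_row A * dim_row B) (dim_col A * dim_col B)
     (\<lambda>(i,j). A $$ (i div dim_row B, j div dim_col B) * B $$ (i mod dim_row B, j mod dim_col B))"

definition msum :: "nat \<Rightarrow> ('i \<Rightarrow> complex mat) \<Rightarrow> 'i set \<Rightarrow> complex mat" where
  "msum n f I = Matrix.mat n n (\<lambda>ij. \<Sum>x\<in>I. f x $$ ij)"

text \<open>Tensor product \<open>N1 \<otimes> N2\<close> of linear maps \<open>N1 : M_d1 \<rightarrow> M_d1'\<close>, \<open>N2 : M_d2 \<rightarrow> M_d2'\<close>,
  defined by linear extension from matrix units.\<close>
definition tensor2 :: "nat \<Rightarrow> nat \<Rightarrow> nat \<Rightarrow> nat \<Rightarrow> cmap \<Rightarrow> cmap \<Rightarrow> cmap" where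
  "tensor2 d1 d1' d2 d2' N1 N2 X =
     msum (d1' * d2')
       (\<lambda>(i,j,k,l). X $$ (i * d2 + k, j * d2 + l) \<cdot>\<^sub>m kron (N1 (munit d1 i j)) (N2 (munit d2 k l)))
       ({..<d1} \<times> {..<d1} \<times> {..<d2} \<times> {..<d2})"

definition lin_map :: "nat \<Rightarrow> nat \<Rightarrow> cmap \<Rightarrow> bool" where
  "lin_map d d' N \<longleftrightarrow>
     (\<forall>X \<in> carrier_mat d d. N X \<in> carrier_mat d' d') \<and>
     (\<forall>X \<in> carrier_mat d d. \<forall>Y \<in> carrier_mat d d. N (X + Y) = N X + N Y) \<and>
     (\<forall>X \<in> carrier_mat d d. \<forall>c. N (c \<cdot>\<^sub>m X) = c \<cdot>\<^sub>m N X)"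

definition cp_map :: "nat \<Rightarrow> nat \<Rightarrow> cmap \<Rightarrow> bool" where
  "cp_map d d' N \<longleftrightarrow> lin_map d d' N \<and>
     (\<forall>n X. X \<in> carrier_mat (n * d) (n * d) \<and> psd X \<longrightarrow> psd (tensor2 n n d d' (\<lambda>Y. Y) N X))"

definition cptp :: "nat \<Rightarrow> nat \<Rightarrow> cmap \<Rightarrow> bool" where
  "cptp d d' N \<longleftrightarrow> cp_map d d' N \<and> (\<forall>X \<in> carrier_mat d d. mtrace (N X) = mtrace X)"

definition cptni :: "nat \<Rightarrow> nat \<Rightarrow> cmap \<Rightarrow> bool" where
  "cptni d d' N \<longleftrightarrow> cp_map d d' N \<and>
     (\<forall>X \<in> carrier_mat d d. psd X \<longrightarrow> Re (mtrace (N X)) \<le> Re (mtrace X))"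

fun tensor_list :: "nat \<Rightarrow> nat \<Rightarrow> cmap list \<Rightarrow> cmap" where
  "tensor_list d d' [] = (\<lambda>X. X)"
| "tensor_list d d' (N # Ns) =
     tensor2 d d' (d ^ length Ns) (d' ^ length Ns) N (tensor_list d d' Ns)"

definition chan_seq :: "nat \<Rightarrow> nat \<Rightarrow> ('s \<Rightarrow> cmap) \<Rightarrow> 's list \<Rightarrow> cmap" where
  "chan_seq dA dB N ss = tensor_list dA dB (map N ss)"

text \<open>A deterministic code: \<open>(dim F_B, P, R)\<close>; \<open>F_A\<close> is the span of the first \<open>M2\<close>
  basis vectors of \<open>F_B = \<complex>^{dim F_B}\<close>; messages are \<open>m < M1\<close>.\<close>
type_synonym code = "nat \<times> (nat \<Rightarrow> cmap) \<times> (nat \<Rightarrow> cmap)"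

definition is_code :: "nat \<Rightarrow> nat \<Rightarrow> nat \<Rightarrow> nat \<Rightarrow> nat \<Rightarrow> code \<Rightarrow> bool" where
  "is_code dA dB l M1 M2 c \<longleftrightarrow> (case c of (dFB, P, R) \<Rightarrow>
     1 \<le> M1 \<and> 1 \<le> M2 \<and> M2 \<le> dFB \<and>
     (\<forall>m < M1. cptp M2 (dA ^ l) (P m) \<and> cptni (dB ^ l) dFB (R m)) \<and>
     (\<forall>X \<in> carrier_mat (dB ^ l) (dB ^ l). (\<Sum>m<M1. mtrace (R m X)) = mtrace X))"

definition dec_map :: "nat \<Rightarrow> nat \<Rightarrow> (nat \<Rightarrow> cmap) \<Rightarrow> cmap" where
  "dec_map M1 dFB R X = msum (M1 * dFB) (\<lambda>m'. kron (munit M1 m' m') (R m' X)) {..<M1}"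

definition maxent :: "nat \<Rightarrow> complex mat" where
  "maxent M = Matrix.mat (M * M) (M * M)
     (\<lambda>(r,c). if r div M = r mod M \<and> c div M = c mod M then 1 / of_nat M else 0)"

text \<open>\<open>|m\<rangle>\<langle>m| \<otimes> \<Phi>\<close> (with \<open>\<Phi>\<close> on \<open>F_A \<otimes> F_A \<subseteq> F_A \<otimes> F_B\<close>), written in the tensor
  ordering \<open>F_A \<otimes> \<complex>^{M1} \<otimes> F_B\<close> of the output of \<open>id \<otimes> \<R>\<close>.\<close>
definition target :: "nat \<Rightarrow> nat \<Rightarrow> nat \<Rightarrow> nat \<Rightarrow> complex mat" where
  "target M1 M2 dFB m = Matrix.mat (M2 * (M1 * dFB)) (M2 * (M1 * dFB))
     (\<lambda>(r,c). let ok = (\<lambda>x. (x mod (M1 * dFB)) div dFB = m \<and>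
                            (x mod (M1 * dFB)) mod dFB = x div (M1 * dFB) \<and>
                            x div (M1 * dFB) < M2)
            in if ok r \<and> ok c then 1 / of_nat M2 else 0)"

definition gfid :: "nat \<Rightarrow> nat \<Rightarrow> nat \<Rightarrow> nat \<Rightarrow> nat \<Rightarrow> cmap \<Rightarrow> code \<Rightarrow> nat \<Rightarrow> real" where
  "gfid dA dB l M1 M2 W c m = (case c of (dFB, P, R) \<Rightarrow>
     fidelity (target M1 M2 dFB m)
       (tensor2 M2 M2 M2 (M1 * dFB) (\<lambda>Y. Y) (dec_map M1 dFB R \<circ> W \<circ> P m) (maxent M2)))"

definition avg_fid :: "nat \<Rightarrow> nat \<Rightarrow> nat \<Rightarrow> nat \<Rightarrow> nat \<Rightarrow> cmap \<Rightarrow> code \<Rightarrow> real" where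
  "avg_fid dA dB l M1 M2 W c = (1 / real M1) * (\<Sum>m<M1. gfid dA dB l M1 M2 W c m)"

definition is_rcode :: "nat \<Rightarrow> nat \<Rightarrow> ('s \<Rightarrow> cmap) \<Rightarrow> nat \<Rightarrow> nat \<Rightarrow> nat \<Rightarrow> code measure \<Rightarrow> bool" where
  "is_rcode dA dB N l M1 M2 \<mu> \<longleftrightarrow> prob_space \<mu> \<and>
     space \<mu> = {c. is_code dA dB l M1 M2 c} \<and>
     (\<forall>c \<in> space \<mu>. {c} \<in> sets \<mu>) \<and>
     (\<forall>ss m. length ss = l \<longrightarrow> m < M1 \<longrightarrow>
        (\<lambda>c. gfid dA dB l M1 M2 (chan_seq dA dB N ss) c m) \<in> borel_measurable \<mu>)"

definition A_d :: "nat \<Rightarrow> nat \<Rightarrow> ('s \<Rightarrow> cmap) \<Rightarrow> (real \<times> real) set" where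
  "A_d dA dB N = {(R1, R2). R1 \<ge> 0 \<and> R2 \<ge> 0 \<and>
     (\<exists>(M1 :: nat \<Rightarrow> nat) (M2 :: nat \<Rightarrow> nat) (c :: nat \<Rightarrow> code).
        (\<forall>l. is_code dA dB l (M1 l) (M2 l) (c l)) \<and>
        ereal R1 \<le> liminf (\<lambda>l. ereal (log 2 (real (M1 l)) / real l)) \<and>
        ereal R2 \<le> liminf (\<lambda>l. ereal (log 2 (real (M2 l)) / real l)) \<and>
        (\<lambda>l. INF ss \<in> {ss. length ss = l}.
               avg_fid dA dB l (M1 l) (M2 l) (chan_seq dA dB N ss) (c l)) \<longlonglongrightarrow> 1)}"

definition A_r :: "nat \<Rightarrow> nat \<Rightarrow> ('s \<Rightarrow> cmap) \<Rightarrow> (real \<times> real) set" where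
  "A_r dA dB N = {(R1, R2). R1 \<ge> 0 \<and> R2 \<ge> 0 \<and>
     (\<exists>(M1 :: nat \<Rightarrow> nat) (M2 :: nat \<Rightarrow> nat) (\<mu> :: nat \<Rightarrow> code measure).
        (\<forall>l. is_rcode dA dB N l (M1 l) (M2 l) (\<mu> l)) \<and>
        ereal R1 \<le> liminf (\<lambda>l. ereal (log 2 (real (M1 l)) / real l)) \<and>
        ereal R2 \<le> liminf (\<lambda>l. ereal (log 2 (real (M2 l)) / real l)) \<and>
        (\<lambda>l. INF ss \<in> {ss. length ss = l}.
               (LINT c|\<mu> l. avg_fid dA dB l (M1 l) (M2 l) (chan_seq dA dB N ss) c)) \<longlonglongrightarrow> 1)}"

definition C_CET :: "nat \<Rightarrow> nat \<Rightarrow> cmap set \<Rightarrow> (real \<times> real) set" where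
  "C_CET dA dB K = {(R1, R2). R1 \<ge> 0 \<and> R2 \<ge> 0 \<and>
     (\<forall>\<epsilon> > 0. \<forall>\<delta> > 0. \<exists>n0. \<forall>n \<ge> n0. \<exists>M1 M2 c.
        is_code dA dB n M1 M2 c \<and>
        log 2 (real M1) / real n \<ge> R1 - \<delta> \<and>
        log 2 (real M2) / real n \<ge> R2 - \<delta> \<and>
        (INF W \<in> K. avg_fid dA dB n M1 M2 (tensor_list dA dB (replicate n W)) c) \<ge> 1 - \<epsilon>)}"

definition conv_chan :: "nat \<Rightarrow> ('s::finite \<Rightarrow> cmap) \<Rightarrow> cmap set" where
  "conv_chan dB N = {(\<lambda>X. msum dB (\<lambda>s. complex_of_real (q s) \<cdot>\<^sub>m N s X) UNIV) | q.
                        (\<forall>s. q s \<ge> 0) \<and> sum q UNIV = 1}"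

definition l_symmetrizable :: "nat \<Rightarrow> nat \<Rightarrow> ('s \<Rightarrow> cmap) \<Rightarrow> nat \<Rightarrow> bool" where
  "l_symmetrizable dA dB N l \<longleftrightarrow>
     (\<forall>Rs. finite Rs \<and> Rs \<subseteq> {\<rho>. dens_op (dA ^ l) \<rho>} \<longrightarrow>
        (\<exists>p :: complex mat \<Rightarrow> 's list \<Rightarrow> real.
           (\<forall>\<rho> \<in> Rs. (\<forall>ss. p \<rho> ss \<ge> 0) \<and> (\<Sum>ss \<in> {ss. length ss = l}. p \<rho> ss) = 1) \<and>
           (\<forall>\<rho> \<in> Rs. \<forall>\<sigma> \<in> Rs.
              msum (dB ^ l) (\<lambda>ss. complex_of_real (p \<rho> ss) \<cdot>\<^sub>m chan_seq dA dB N ss \<sigma>) {ss. length ss = l}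
            = msum (dB ^ l) (\<lambda>ss. complex_of_real (p \<sigma> ss) \<cdot>\<^sub>m chan_seq dA dB N ss \<rho>) {ss. length ss = l})))"

definition symmetrizable :: "nat \<Rightarrow> nat \<Rightarrow> ('s \<Rightarrow> cmap) \<Rightarrow> bool" where
  "symmetrizable dA dB N \<longleftrightarrow> (\<forall>l \<ge> 1. l_symmetrizable dA dB N l)"

end

theory Submission
  imports Defs "HOL-Library.Complex_Order" "HOL-Real_Asymp.Real_Asymp"
begin

text \<open>
  As soon as some positive rate is achievable deterministically, a short prefix can transmit a random
  index, and by the method of conditional expectations \<open>O(l)\<close> deterministic codes suffice to simulate a
  random code of length \<open>l\<close>; hence random and deterministic regions agree. A code for the compound channel
  generated by \<open>conv J\<close> becomes a random code for the AVQC when it is used on randomly chosen positions: the states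
  met there are a sample without replacement from the state sequence, which up to a constant factor is
  dominated by an i.i.d. sample.

  A jammer with a symmetrizing strategy simulates the transmission of a random other message, so that
  no two messages can be distinguished. If \<open>J\<close> is not \<open>l\<close>-symmetrizable, the least-norm asymmetry
  between the inputs defines a POVM and a score, antisymmetric in two inputs, whose mean favours the true
  input against every competitor and every jammer. On a random codebook the tournament
  decoder for this score attains a positive rate; the unions over competitors and state sequences are controlled by
  counting long lists of conditionally independent bad pairs.
\<close>

unbundle no vec_syntax
hide_const (open) Finite_Cartesian_Product.mat

section \<open>Square roots and the fidelity with a pure state\<close>

text \<open>The argument is carried out with kernels over words on an arbitrary finite position set
  \<open>T\<close>, not with matrices. Prefixing, scattering over sampled positions and grouping
  into blocks then become disjoint unions and reindexings of \<open>T\<close>, and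
  \<open>gram\<close> reduces complete positivity to sums, products and pullbacks. The bridge to the
  definitions is that the target state is pure: its fidelity with the output is a linear functional,
  so mixing states or codes averages fidelities exactly. Positive rate without symmetrizability
  meets two obstacles. A separate optimal measurement for each pair of codewords could not be
  performed jointly; hence one product measurement is fixed before the codebook, and only its
  classical outcomes are processed further. Moreover, a single bad pair has a probability
  exponentially small in the block length, yet possibly larger than the reciprocal of the number of
  state sequences. Lists of \<open>k\<close> fresh pairs, \<open>k\<close> fixed, push the
  probability below that level, at the price of fewer than \<open>2 * k\<close> spoiled messages,
  which the average error tolerates.\<close>

definition qf :: "nat \<Rightarrow> (nat \<Rightarrow> nat \<Rightarrow> complex) \<Rightarrow> (nat \<Rightarrow> complex) \<Rightarrow> complex" where
  "qf n K v = (\<Sum>i<n. \<Sum>j<n. cnj (v i) * K i j * v j)"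

text \<open>Powers live on functions of two indices so that the power series in
  \<open>sqrt_kernel_1\<close> can be summed entry by entry as complex series.\<close>

fun kpow :: "nat \<Rightarrow> (nat \<Rightarrow> nat \<Rightarrow> complex) \<Rightarrow> nat \<Rightarrow> nat \<Rightarrow> nat \<Rightarrow> complex" where
  "kpow n X 0 i j = (if i = j then 1 else 0)"
| "kpow n X (Suc k) i j = (\<Sum>l<n. X i l * kpow n X k l j)"

lemma kpow_add: "i < n \<Longrightarrow> kpow n X (k + m) i j = (\<Sum>l<n. kpow n X k i l * kpow n X m l j)"
proof (induction k arbitrary: i)
  case 0
  have "(\<Sum>l<n. kpow n X 0 i l * kpow n X m l j) = (\<Sum>l<n. if l = i then kpow n X m l j else 0)"
    by (rule sum.cong) auto
  then show ?case using 0 by simp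
next
  case (Suc k)
  have "kpow n X (Suc k + m) i j = (\<Sum>l<n. X i l * (\<Sum>l'<n. kpow n X k l l' * kpow n X m l' j))"
    using Suc.IH by simp
  also have "\<dots> = (\<Sum>l'<n. \<Sum>l<n. X i l * (kpow n X k l l' * kpow n X m l' j))"
    unfolding sum_distrib_left by (rule sum.swap)
  also have "\<dots> = (\<Sum>l<n. kpow n X (Suc k) i l * kpow n X m l j)"
    by (simp add: sum_distrib_right mult.assoc)
  finally show ?case .
qed

lemma kpow_1: "i < n \<Longrightarrow> j < n \<Longrightarrow> kpow n X (Suc 0) i j = X i j"
proof -
  assume "j < n"
  have "(\<Sum>l<n. X i l * kpow n X 0 l j) = (\<Sum>l<n. if l = j then X i l else 0)"
    by (rule sum.cong) auto
  with \<open>j < n\<close> show ?thesis by simp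
qed

definition kact :: "nat \<Rightarrow> (nat \<Rightarrow> nat \<Rightarrow> complex) \<Rightarrow> (nat \<Rightarrow> complex) \<Rightarrow> nat \<Rightarrow> complex" where
  "kact n X v i = (\<Sum>j<n. X i j * v j)"

lemma qf_kpow_Suc_Suc:
  assumes herm: "\<And>i j. i < n \<Longrightarrow> j < n \<Longrightarrow> X j i = cnj (X i j)"
  shows "qf n (kpow n X (Suc (Suc k))) v = qf n (kpow n X k) (kact n X v)"
proof -
  have s: "kpow n X (Suc (Suc k)) i j = (\<Sum>a<n. \<Sum>b<n. X i a * kpow n X k a b * X b j)"
    if "i < n" "j < n" for i j
  proof -
    have "kpow n X (Suc k) a j = (\<Sum>b<n. kpow n X k a b * X b j)" if "a < n" for a
      using kpow_add[OF that, of X k "Suc 0" j] \<open>j < n\<close> by (simp add: kpow_1 del: kpow.simps)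
    then show ?thesis by (simp add: sum_distrib_left mult.assoc del: kpow.simps(1) kpow.simps(2)[of n X "k"])
       
  qed
  have "qf n (kpow n X (Suc (Suc k))) v
     = (\<Sum>i<n. \<Sum>j<n. \<Sum>a<n. \<Sum>b<n. cnj (v i) * X i a * kpow n X k a b * X b j * v j)"
    unfolding qf_def using s
    by (auto intro!: sum.cong simp: sum_distrib_left sum_distrib_right mult.assoc simp del: kpow.simps)
  also have "\<dots> = (\<Sum>(i,j,a,b)\<in>{..<n}\<times>{..<n}\<times>{..<n}\<times>{..<n}. cnj (v i) * X i a * kpow n X k a b * X b j * v j)"
    by (simp add: sum.cartesian_product)
  also have "\<dots> = (\<Sum>(a,b,i,j)\<in>{..<n}\<times>{..<n}\<times>{..<n}\<times>{..<n}. cnj (v i) * X i a * kpow n X k a b * X b j * v j)"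
    by (rule sum.reindex_bij_witness[where i="\<lambda>(a,b,i,j). (i,j,a,b)" and j="\<lambda>(i,j,a,b). (a,b,i,j)"]) auto
  also have "\<dots> = (\<Sum>a<n. \<Sum>b<n. \<Sum>i<n. \<Sum>j<n. cnj (v i) * X i a * kpow n X k a b * X b j * v j)"
    by (simp add: sum.cartesian_product)
  also have "\<dots> = qf n (kpow n X k) (kact n X v)"
    unfolding qf_def kact_def
  proof (intro sum.cong refl)
    fix a b assume ab: "a \<in> {..<n}" "b \<in> {..<n}"
    have hx: "X i a = cnj (X a i)" if "i < n" for i using herm[of a i] ab that by simp
    have "(\<Sum>i<n. \<Sum>j<n. cnj (v i) * X i a * kpow n X k a b * X b j * v j)
       = (\<Sum>i<n. \<Sum>j<n. (cnj (X a i) * cnj (v i)) * kpow n X k a b * (X b j * v j))"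
      by (intro sum.cong refl) (simp add: hx)
    also have "\<dots> = (\<Sum>i<n. cnj (X a i) * cnj (v i)) * kpow n X k a b * (\<Sum>j<n. X b j * v j)"
      unfolding sum_distrib_left sum_distrib_right by (rule sum.swap)
    also have "\<dots> = cnj (\<Sum>j<n. X a j * v j) * kpow n X k a b * (\<Sum>j<n. X b j * v j)"
      by simp
    finally show "(\<Sum>i<n. \<Sum>j<n. cnj (v i) * X i a * kpow n X k a b * X b j * v j)
       = cnj (\<Sum>j<n. X a j * v j) * kpow n X k a b * (\<Sum>j<n. X b j * v j)" .
  qed
  finally show ?thesis .
qed

definition nsq :: "nat \<Rightarrow> (nat \<Rightarrow> complex) \<Rightarrow> complex" where
  "nsq n v = (\<Sum>i<n. cnj (v i) * v i)"

lemma nsq_nonneg: "0 \<le> nsq n v"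
  unfolding nsq_def by (rule sum_nonneg) (simp add: mult.commute complex_mult_cnj less_eq_complex_def)

lemma qf_kpow_0: "qf n (kpow n X 0) v = nsq n v"
proof -
  have "(\<Sum>j<n. cnj (v i) * kpow n X 0 i j * v j) = (\<Sum>j<n. if j = i then cnj (v i) * v i else 0)" for i
    by (rule sum.cong) auto
  then show ?thesis unfolding qf_def nsq_def by simp
qed

lemma qf_kpow_1: "qf n (kpow n X (Suc 0)) v = qf n X v"
  unfolding qf_def by (simp add: kpow_1 del: kpow.simps)

text \<open>For \<open>0 \<le> X \<le> 1\<close>: \<open>X - X\<^sup>2 = (1 - X) X (1 - X) + X (1 - X) X\<close>.\<close>

lemma qf_kpow_2_le:
  assumes herm: "\<And>i j. i < n \<Longrightarrow> j < n \<Longrightarrow> X j i = cnj (X i j)"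
    and pos: "\<And>v. 0 \<le> qf n X v" and le1: "\<And>v. qf n X v \<le> nsq n v"
  shows "nsq n (kact n X v) \<le> nsq n v"
proof -
  let ?Y = "\<lambda>i. v i - kact n X v i"
  have l: "qf n X w = (\<Sum>i<n. cnj (w i) * kact n X w i)" for w
    unfolding qf_def kact_def by (simp add: sum_distrib_left mult.assoc)
  have sa: "(\<Sum>i<n. cnj (u i) * kact n X w i) = (\<Sum>i<n. cnj (kact n X u i) * w i)" for u w
  proof -
    have "(\<Sum>i<n. cnj (u i) * kact n X w i) = (\<Sum>i<n. \<Sum>j<n. cnj (u i) * X i j * w j)"
      unfolding kact_def by (simp add: sum_distrib_left mult.assoc)
    also have "\<dots> = (\<Sum>j<n. \<Sum>i<n. cnj (u i) * X i j * w j)" by (rule sum.swap)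
    also have "\<dots> = (\<Sum>j<n. \<Sum>i<n. cnj (X j i * u i) * w j)"
      by (intro sum.cong refl) (metis complex_cnj_cnj complex_cnj_mult herm lessThan_iff mult.commute)
    also have "\<dots> = (\<Sum>i<n. cnj (kact n X u i) * w i)"
      unfolding kact_def by (simp add: sum_distrib_right)
    finally show ?thesis .
  qed
  have ky: "kact n X ?Y i = kact n X v i - kact n X (kact n X v) i" for i
    unfolding kact_def by (simp add: right_diff_distrib sum_subtractf)
  let ?u = "kact n X v"
  let ?w = "kact n X ?u"
  have e1: "qf n X ?Y = (\<Sum>i<n. cnj (v i) * ?u i) - 2 * nsq n ?u + (\<Sum>i<n. cnj (?u i) * ?w i)"
  proof -
    have "qf n X ?Y = (\<Sum>i<n. cnj (?Y i) * (?u i - ?w i))" unfolding l ky ..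
    also have "\<dots> = (\<Sum>i<n. cnj (v i) * ?u i) - (\<Sum>i<n. cnj (v i) * ?w i) - nsq n ?u + (\<Sum>i<n. cnj (?u i) * ?w i)"
      unfolding nsq_def by (simp add: algebra_simps sum.distrib sum_subtractf)
    also have "(\<Sum>i<n. cnj (v i) * ?w i) = nsq n ?u" using sa[of v ?u] unfolding nsq_def .
    finally show ?thesis by (simp add: algebra_simps)
  qed
  have e2: "(\<Sum>i<n. cnj (?u i) * ?w i) = qf n X ?u" unfolding l ..
  have "0 \<le> qf n X ?Y + (nsq n ?u - qf n X ?u)"
    using pos[of ?Y] le1[of ?u] by simp
  also have "\<dots> = qf n X v - nsq n ?u"
    unfolding e1 e2 l[of v] by (simp add: algebra_simps)
  finally have "nsq n ?u \<le> qf n X v" by simp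
  then show ?thesis using le1 order_trans by blast
qed

text \<open>Induction in steps of two: \<open>X^(k+2)\<close> is the congruence of
  \<open>X^k\<close> by the Hermitian kernel \<open>X\<close>, so positivity is inherited. The upper
  bound is inherited because \<open>X\<close> is a contraction
  (\<open>qf_kpow_2_le\<close>).\<close>

lemma qf_kpow_bounds:
  assumes herm: "\<And>i j. i < n \<Longrightarrow> j < n \<Longrightarrow> X j i = cnj (X i j)"
    and pos: "\<And>v. 0 \<le> qf n X v" and le1: "\<And>v. qf n X v \<le> nsq n v"
  shows "0 \<le> qf n (kpow n X k) v \<and> qf n (kpow n X k) v \<le> nsq n v"
proof (induction k arbitrary: v rule: induct_nat_012)
  case 0 show ?case by (simp add: qf_kpow_0 nsq_nonneg del: kpow.simps)
next
  case 1 show ?case using pos le1 by (simp add: qf_kpow_1 del: kpow.simps)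
next
  case (ge2 k)
  show ?case using ge2(1)[of "kact n X v"] qf_kpow_2_le[OF herm pos le1, of v]
    by (simp add: qf_kpow_Suc_Suc[OF herm] del: kpow.simps) (meson order_trans)
qed

text \<open>Over the complex numbers the form determines its kernel. This is the source of the entry
  bound \<open>norm_entry_le\<close> and of Hermitian symmetry in
  \<open>qf_hermitian\<close>.\<close>

lemma qf_polarization:
  assumes "a < n" "b < n"
  shows "4 * K a b = (\<Sum>z\<leftarrow>[1, -1, \<i>, -\<i>]. z * qf n K (\<lambda>i. z * (if i = a then 1 else 0) + (if i = b then 1 else 0)))"
proof -
  have dbl: "(\<Sum>i<n. \<Sum>j<n. K i j * ((if i = p then 1 else 0) * (if j = q then 1 else 0))) = K p q"
    if "p < n" "q < n" for p q
  proof -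
    have "(\<Sum>j<n. K i j * ((if i = p then 1 else 0) * (if j = q then 1 else 0)))
      = (if i = p then K i q else 0)" for i
      using that by (cases "i = p") (simp_all add: if_distrib cong: if_cong)
    then show ?thesis using that by simp
  qed
  have q: "qf n K (\<lambda>i. c * (if i = a then 1 else 0) + (if i = b then 1 else 0))
    = cnj c * c * K a a + cnj c * K a b + c * K b a + K b b" for c
  proof -
    have "qf n K (\<lambda>i. c * (if i = a then 1 else 0) + (if i = b then 1 else 0))
     = cnj c * c * (\<Sum>i<n. \<Sum>j<n. K i j * ((if i = a then 1 else 0) * (if j = a then 1 else 0)))
     + cnj c * (\<Sum>i<n. \<Sum>j<n. K i j * ((if i = a then 1 else 0) * (if j = b then 1 else 0)))
     + c * (\<Sum>i<n. \<Sum>j<n. K i j * ((if i = b then 1 else 0) * (if j = a then 1 else 0)))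
     + (\<Sum>i<n. \<Sum>j<n. K i j * ((if i = b then 1 else 0) * (if j = b then 1 else 0)))"
      unfolding qf_def sum_distrib_left sum.distrib[symmetric]
      by (intro sum.cong refl) (auto simp: algebra_simps)
    then show ?thesis using assms by (simp only: dbl)
  qed
  show ?thesis by (simp only: q list.map sum_list.Cons sum_list.Nil) (simp add: algebra_simps)
qed

text \<open>Four polarization terms, each at most the squared length 4 of its test vector, are
  divided by 4. For \<open>kpow\<close> the bound is uniform in the exponent, so the square root
  series has a summable majorant.\<close>

lemma norm_entry_le:
  assumes b: "\<And>v. 0 \<le> qf n K v \<and> qf n K v \<le> nsq n v" and "a < n" "c < n"
  shows "norm (K a c) \<le> 4"
proof -
  have nb: "norm (qf n K (\<lambda>i. z * (if i = a then 1 else 0) + (if i = c then 1 else 0))) \<le> 4" if "norm z = 1" for z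
  proof -
    let ?v = "\<lambda>i. z * (if i = a then 1 else 0) + (if i = c then 1 else 0)"
    have "norm (qf n K ?v) = Re (qf n K ?v)" 
      using b[of ?v] by (simp add: less_eq_complex_def cmod_eq_Re)
    also have "\<dots> \<le> Re (nsq n ?v)" using b[of ?v] by (simp add: less_eq_complex_def)
    also have "\<dots> = (\<Sum>i<n. (norm (?v i))\<^sup>2)"
    proof -
      have "Re (cnj w * w) = (norm w)\<^sup>2" for w unfolding cmod_power2 by (simp add: power2_eq_square)
      then show "Re (nsq n ?v) = (\<Sum>i<n. (norm (?v i))\<^sup>2)" unfolding nsq_def Re_sum by (simp only:)
    qed
    also have "\<dots> \<le> (\<Sum>i<n. 2 * ((if i = a then 1 else 0) + (if i = c then 1 else 0)))"
    proof (rule sum_mono)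
      fix i
      have "norm (z + 1) \<le> 2" using norm_triangle_ineq[of z 1] that by simp
      then have "(norm (z + 1))\<^sup>2 \<le> 4" using power_mono[of "norm (z+1)" 2 2] by simp
      then show "(norm (?v i))\<^sup>2 \<le> 2 * ((if i = a then 1 else 0) + (if i = c then 1 else 0))"
        using that by auto
    qed
    also have "\<dots> = 4" using assms by (simp add: sum.distrib sum_distrib_left[symmetric])
    finally show ?thesis .
  qed
  have "norm (4 * K a c) \<le> 16"
  proof -
    have n: "norm (z * qf n K (\<lambda>i. z * (if i = a then 1 else 0) + (if i = c then 1 else 0))) \<le> 4" if "norm z = 1" for z
      using nb[OF that] that by (simp only: norm_mult)
    have t: "norm (x + (y + (z + (w + 0)))) \<le> 16" if "norm x \<le> 4" "norm y \<le> 4" "norm z \<le> 4" "norm w \<le> 4" for x y z w :: complex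
      using that norm_triangle_ineq[of x "y + (z + w)"] norm_triangle_ineq[of y "z + w"] norm_triangle_ineq[of z w] by simp
    show ?thesis unfolding qf_polarization[OF assms(2,3), of K] list.map sum_list.Cons sum_list.Nil
      by (intro t n) auto
  qed
  then show ?thesis by (simp add: norm_mult)
qed

section \<open>The coefficients of \<open>sqrt (1 - x)\<close>, absolutely summable up to the
  endpoint \<open>x = 1\<close>\<close>

definition sqc :: "nat \<Rightarrow> real" where "sqc k = (1/2 gchoose k) * (- 1) ^ k"

lemma sqc_0: "sqc 0 = 1" by (simp add: sqc_def)

lemma gchoose_neg_half_sign: "(- 1) ^ m * ((- (1/2)) gchoose m) \<ge> (0::real)"
proof -
  have "(- 1) ^ m * ((- (1/2)) gchoose m) = (pochhammer (1/2) m / fact m :: real)"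
    by (simp add: gbinomial_pochhammer power_mult_distrib[symmetric])
  then show ?thesis by (simp add: pochhammer_nonneg)
qed

lemma sqc_nonpos: "sqc (Suc k) \<le> 0"
proof -
  have "sqc (Suc k) = - ((1/2) / real (Suc k)) * ((- 1) ^ k * ((- (1/2)) gchoose k))"
    unfolding sqc_def by (subst gbinomial_absorption'[of "Suc k"]) (auto simp: field_simps)
  then show ?thesis using gchoose_neg_half_sign[of k] by (simp add: mult_nonneg_nonneg)
qed

text \<open>The alternating partial sums of binomial coefficients telescope to a single coefficient
  with upper entry \<open>-1/2\<close>, whose sign is known from its Pochhammer form.\<close>

lemma sum_sqc: "(\<Sum>k\<le>m. sqc k) \<ge> 0"
  unfolding sqc_def gbinomial_sum_lower_neg using gchoose_neg_half_sign[of m] by simp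

lemma sqc_abs: "summable (\<lambda>k. \<bar>sqc k\<bar>)" 
proof (rule summableI_nonneg_bounded)
  fix n
  show "(\<Sum>k<n. \<bar>sqc k\<bar>) \<le> 2"
  proof (cases n)
    case (Suc m)
    have "(\<Sum>k\<le>m. \<bar>sqc k\<bar>) = (\<Sum>k\<le>m. (if k = 0 then 2 else 0) - sqc k)"
      by (intro sum.cong refl) (metis (full_types) abs_of_nonpos abs_one diff_0 not0_implies_Suc sqc_0 sqc_nonpos one_add_one add_diff_cancel_left')
    also have "\<dots> = 2 - (\<Sum>k\<le>m. sqc k)" by (simp add: sum_subtractf)
    finally show ?thesis using sum_sqc[of m] Suc by (simp add: lessThan_Suc_atMost)
  qed simp
qed simp

lemma sqc_suminf: "summable sqc" "(\<Sum>k. sqc k) \<ge> 0"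
proof -
  show s: "summable sqc" using sqc_abs summable_rabs_cancel by blast
  show "(\<Sum>k. sqc k) \<ge> 0"
    using LIMSEQ_le_const[OF summable_LIMSEQ'[OF s], of 0] sum_sqc by blast
qed

text \<open>The Vandermonde convolution: the Cauchy square of the series has the coefficients of
  \<open>1 - x\<close>.\<close>

lemma sqc_conv: "(\<Sum>i\<le>k. sqc i * sqc (k - i)) = (if k = 0 then 1 else if k = 1 then -1 else 0)"
proof -
  have "(\<Sum>i\<le>k. sqc i * sqc (k - i)) = (\<Sum>i=0..k. (1/2 gchoose i) * (1/2 gchoose (k - i)) * (- 1) ^ k)"
    unfolding sqc_def atLeast0AtMost
    by (intro sum.cong refl) (simp add: power_add[symmetric] algebra_simps)
  also have "\<dots> = (1 gchoose k) * (- 1) ^ k"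
    by (simp only: sum_distrib_right[symmetric] gbinomial_Vandermonde) simp
  also have "(1 gchoose k) = (of_nat (1 choose k) :: real)"
    using binomial_gbinomial[of 1 k, where 'a=real] by simp
  finally show ?thesis by (cases "k > 1") (auto simp: binomial_eq_0 le_Suc_eq not_less)
qed

text \<open>The square root of \<open>1 - X\<close> as the binomial series in \<open>X\<close>, which converges absolutely for \<open>0 \<le> X \<le> 1\<close>.\<close>

lemma sqrt_kernel_1:
  assumes herm: "\<And>i j. i < n \<Longrightarrow> j < n \<Longrightarrow> X j i = cnj (X i j)"
    and pos: "\<And>v. 0 \<le> qf n X v" and le1: "\<And>v. qf n X v \<le> nsq n v"
  shows "\<exists>B. (\<forall>v. 0 \<le> qf n B v) \<and>
     (\<forall>i<n. \<forall>j<n. (\<Sum>l<n. B i l * B l j) = (if i = j then 1 else 0) - X i j)"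
proof (intro exI conjI allI impI)
  define B where "B = (\<lambda>i j. \<Sum>k. complex_of_real (sqc k) * kpow n X k i j)"
  have bd: "norm (kpow n X k i j) \<le> 4" if "i < n" "j < n" for i j k
    by (rule norm_entry_le[OF qf_kpow_bounds[OF herm pos le1] that])
  have sn: "summable (\<lambda>k. norm (complex_of_real (sqc k) * kpow n X k i j))" if "i < n" "j < n" for i j
    by (rule summable_comparison_test'[OF summable_mult2[OF sqc_abs, of 4], of 0])
       (use bd[OF that] in \<open>auto simp: norm_mult intro: mult_left_mono\<close>)
  have sm: "(\<lambda>k. complex_of_real (sqc k) * kpow n X k i j) sums B i j" if "i < n" "j < n" for i j
    unfolding B_def using summable_norm_cancel[OF sn[OF that]] by (rule summable_sums)
  show "0 \<le> qf n B v" for v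
  proof -
    have "(\<lambda>k. \<Sum>i<n. \<Sum>j<n. cnj (v i) * (complex_of_real (sqc k) * kpow n X k i j) * v j) sums qf n B v"
      unfolding qf_def by (intro sums_sum sums_mult sums_mult2 sm) auto
    moreover have "(\<Sum>i<n. \<Sum>j<n. cnj (v i) * (complex_of_real (sqc k) * kpow n X k i j) * v j)
       = complex_of_real (sqc k) * qf n (kpow n X k) v" for k
      unfolding qf_def by (simp add: sum_distrib_left algebra_simps)
    ultimately have s: "(\<lambda>k. complex_of_real (sqc k) * qf n (kpow n X k) v) sums qf n B v" by simp
    have q: "0 \<le> qf n (kpow n X k) v" "qf n (kpow n X k) v \<le> nsq n v" for k
      using qf_kpow_bounds[OF herm pos le1, where k=k and v=v] by auto
    \<comment> \<open>For \<open>k > 0\<close> the coefficient is nonpositive, so replacing the form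
      of \<open>X^k\<close> by its upper bound \<open>nsq n v\<close> only lowers the term. The
      whole series is thus at least the coefficient sum times \<open>nsq n v\<close>, which is
      nonnegative.\<close>
    have le: "complex_of_real (sqc k) * nsq n v \<le> complex_of_real (sqc k) * qf n (kpow n X k) v" for k
    proof (cases k)
      case 0 then show ?thesis by (simp add: qf_kpow_0 del: kpow.simps)
    next
      case (Suc k')
      then have "0 \<le> - complex_of_real (sqc k)" using sqc_nonpos[of k'] by (simp add: less_eq_complex_def)
      from mult_left_mono[OF q(2)[of k] this] show ?thesis by simp
    qed
    have s2: "(\<lambda>k. complex_of_real (sqc k) * nsq n v) sums (complex_of_real (\<Sum>k. sqc k) * nsq n v)"
      by (intro sums_mult2 sums_of_real summable_sums sqc_suminf)
    have "Re (complex_of_real (\<Sum>k. sqc k) * nsq n v) \<le> Re (qf n B v)"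
      by (rule sums_le[OF _ sums_Re[OF s2] sums_Re[OF s]]) (use le in \<open>simp add: less_eq_complex_def\<close>)
    moreover have "0 \<le> Re (complex_of_real (\<Sum>k. sqc k) * nsq n v)"
      using nsq_nonneg[of n v] sqc_suminf(2) by (simp add: less_eq_complex_def)
    moreover have "Im (qf n B v) = 0"
    proof -
      have "(\<lambda>k. Im (complex_of_real (sqc k) * qf n (kpow n X k) v)) sums Im (qf n B v)" by (rule sums_Im[OF s])
      moreover have "Im (complex_of_real (sqc k) * qf n (kpow n X k) v) = 0" for k using q(1)[of k] by (simp add: less_eq_complex_def)
      ultimately have "(\<lambda>k. 0) sums Im (qf n B v)" by (simp only:)
      then show ?thesis using sums_unique2 sums_zero by blast
    qed
    ultimately show ?thesis by (simp add: less_eq_complex_def)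
  qed
  show "(\<Sum>l<n. B i l * B l j) = (if i = j then 1 else 0) - X i j" if ij: "i < n" "j < n" for i j
  proof -
    have "(\<lambda>k. \<Sum>l<n. \<Sum>a\<le>k. (complex_of_real (sqc a) * kpow n X a i l) * (complex_of_real (sqc (k - a)) * kpow n X (k - a) l j))
        sums (\<Sum>l<n. B i l * B l j)"
      unfolding B_def using sn ij by (intro sums_sum Cauchy_product_sums) auto
    moreover have "(\<Sum>l<n. \<Sum>a\<le>k. (complex_of_real (sqc a) * kpow n X a i l) * (complex_of_real (sqc (k - a)) * kpow n X (k - a) l j))
        = (if k = 0 then kpow n X 0 i j else if k = 1 then - kpow n X 1 i j else 0)" for k
    proof -
      have "(\<Sum>l<n. \<Sum>a\<le>k. (complex_of_real (sqc a) * kpow n X a i l) * (complex_of_real (sqc (k - a)) * kpow n X (k - a) l j))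
        = (\<Sum>a\<le>k. complex_of_real (sqc a * sqc (k - a)) * (\<Sum>l<n. kpow n X a i l * kpow n X (k - a) l j))"
        by (subst sum.swap) (simp add: sum_distrib_left algebra_simps del: kpow.simps)
      also have "\<dots> = (\<Sum>a\<le>k. complex_of_real (sqc a * sqc (k - a)) * kpow n X k i j)"
        using ij by (intro sum.cong refl) (simp add: kpow_add[symmetric] del: kpow.simps)
      also have "\<dots> = complex_of_real (if k = 0 then 1 else if k = 1 then -1 else 0) * kpow n X k i j"
        by (simp add: sum_distrib_right[symmetric] sqc_conv of_real_sum[symmetric] del: of_real_sum of_real_mult kpow.simps)
      finally show ?thesis by (simp del: kpow.simps)
    qed
    ultimately have "(\<lambda>k. if k = 0 then kpow n X 0 i j else if k = 1 then - kpow n X 1 i j else 0) sums (\<Sum>l<n. B i l * B l j)"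
      by (simp del: kpow.simps)
    moreover have "(\<lambda>k. if k = 0 then kpow n X 0 i j else if k = 1 then - kpow n X 1 i j else 0)
       sums (\<Sum>k\<in>{0::nat,1}. if k = 0 then kpow n X 0 i j else if k = 1 then - kpow n X 1 i j else 0)"
      by (rule sums_finite) auto
    ultimately have "(\<Sum>l<n. B i l * B l j) = kpow n X 0 i j - kpow n X 1 i j"
      using sums_unique2 by fastforce
    then show ?thesis using ij by (simp add: kpow_1 del: kpow.simps(2))
  qed
qed

section \<open>Existence and uniqueness of positive square roots\<close>

lemma qf_hermitian:
  assumes "\<And>v. 0 \<le> qf n K v" and ij: "i < n" "j < n"
  shows "K j i = cnj (K i j)"
proof -
  let ?L = "\<lambda>a b. K a b - cnj (K b a)"
  \<comment> \<open>The form takes real values, so the form of the anti-Hermitian part vanishes;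
    polarization then kills its entries.\<close>
  have "qf n ?L v = 0" for v
  proof -
    have "(\<Sum>i<n. \<Sum>j<n. cnj (v i) * cnj (K j i) * v j) = cnj (qf n K v)"
      unfolding qf_def cnj_sum by (subst sum.swap) (simp add: mult_ac)
    then have "qf n ?L v = qf n K v - cnj (qf n K v)"
      unfolding qf_def by (simp add: left_diff_distrib right_diff_distrib sum_subtractf)
    then show ?thesis using assms(1)[of v] by (simp add: less_eq_complex_def complex_eq_iff)
  qed
  then show ?thesis using qf_polarization[OF ij(2,1), of ?L] by simp
qed

lemma psd_iff_qf: "A \<in> carrier_mat n n \<Longrightarrow> psd A \<longleftrightarrow> (\<forall>v. 0 \<le> qf n (\<lambda>i j. A $$ (i,j)) v)"
proof
  assume A: "A \<in> carrier_mat n n"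
  show "psd A \<Longrightarrow> \<forall>v. 0 \<le> qf n (\<lambda>i j. A $$ (i,j)) v"
    using A unfolding psd_def qf_def Let_def by (simp add: less_eq_complex_def)
  assume q: "\<forall>v. 0 \<le> qf n (\<lambda>i j. A $$ (i,j)) v"
  have "cnj (A $$ (j,i)) = A $$ (i,j)" if "i < n" "j < n" for i j
    using qf_hermitian[of n "\<lambda>i j. A $$ (i,j)" j i] q that by simp
  then have "adj A = A"
    unfolding adj_def using A by (intro eq_matI) auto
  then show "psd A"
    using A q unfolding psd_def qf_def Let_def by (simp add: less_eq_complex_def)
qed

lemma Re_nsq: "Re (nsq n v) = (\<Sum>i<n. (norm (v i))\<^sup>2)"
proof -
  have "Re (cnj w * w) = (norm w)\<^sup>2" for w unfolding cmod_power2 by (simp add: power2_eq_square)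
  then show ?thesis unfolding nsq_def Re_sum by (simp only:)
qed

lemma nsq_of_real: "nsq n v = complex_of_real (\<Sum>i<n. (norm (v i))\<^sup>2)"
  using nsq_nonneg[of n v] Re_nsq[of n v] by (simp add: complex_eq_iff less_eq_complex_def)

lemma qf_le_nsq:
  assumes pos: "\<And>v. 0 \<le> qf n K v"
  shows "qf n K v \<le> complex_of_real (\<Sum>i<n. \<Sum>j<n. norm (K i j)) * nsq n v"
proof -
  have "Re (qf n K v) \<le> norm (qf n K v)" by (rule complex_Re_le_cmod)
  also have "\<dots> \<le> (\<Sum>i<n. \<Sum>j<n. norm (cnj (v i) * K i j * v j))"
    unfolding qf_def by (intro order_trans[OF norm_sum] sum_mono order_refl)
  also have "\<dots> \<le> (\<Sum>i<n. \<Sum>j<n. norm (K i j) * (\<Sum>i<n. (norm (v i))\<^sup>2))"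
  proof (intro sum_mono)
    fix i j assume ij: "i \<in> {..<n}" "j \<in> {..<n}"
    have m: "(norm (v k))\<^sup>2 \<le> (\<Sum>i<n. (norm (v i))\<^sup>2)" if "k \<in> {..<n}" for k
      by (rule member_le_sum) (use that in auto)
    have "norm (v i) * norm (v j) \<le> (\<Sum>i<n. (norm (v i))\<^sup>2)"
      using sum_squares_bound[of "norm (v i)" "norm (v j)"] m[OF ij(1)] m[OF ij(2)] by simp
    then show "norm (cnj (v i) * K i j * v j) \<le> norm (K i j) * (\<Sum>i<n. (norm (v i))\<^sup>2)"
      using mult_left_mono[OF _ norm_ge_zero[of "K i j"]] by (fastforce simp: norm_mult mult_ac)
  qed
  also have "\<dots> = (\<Sum>i<n. \<Sum>j<n. norm (K i j)) * Re (nsq n v)"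
    unfolding Re_nsq by (simp add: sum_distrib_right)
  finally show ?thesis using pos[of v] nsq_nonneg[of n v] by (simp add: less_eq_complex_def)
qed

lemma sqrt_kernel:
  assumes pos: "\<And>v. 0 \<le> qf n K v"
  shows "\<exists>B. (\<forall>v. 0 \<le> qf n B v) \<and> (\<forall>i<n. \<forall>j<n. (\<Sum>l<n. B i l * B l j) = K i j)"
proof -
  \<comment> \<open>Dividing by \<open>t\<close> brings \<open>K\<close> between 0 and 1, so that
    \<open>sqrt_kernel_1\<close> applies to \<open>X\<close>, which is the identity minus
    \<open>K / t\<close>. The summand 1 keeps \<open>t\<close> positive when \<open>K\<close>
    vanishes.\<close>
  define t where "t = 1 + (\<Sum>i<n. \<Sum>j<n. norm (K i j))"
  have t: "t > 0" "t \<ge> (\<Sum>i<n. \<Sum>j<n. norm (K i j))"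
    unfolding t_def by (auto intro!: add_pos_nonneg sum_nonneg)
  define X where "X = (\<lambda>i j. (if i = j then 1 else 0) - complex_of_real (1 / t) * K i j)"
  have qX: "qf n X v = nsq n v - complex_of_real (1 / t) * qf n K v" for v
  proof -
    have "qf n X v = qf n (kpow n X 0) v - complex_of_real (1 / t) * qf n K v"
      unfolding qf_def X_def
      by (simp add: left_diff_distrib right_diff_distrib sum_subtractf sum_distrib_left mult_ac)
    then show ?thesis by (simp only: qf_kpow_0)
  qed
  have le: "qf n X v \<le> nsq n v" for v
  proof -
    have "0 \<le> complex_of_real (1 / t) * qf n K v"
      using pos[of v] t by (intro mult_nonneg_nonneg) (auto simp: less_eq_complex_def)
    then show ?thesis unfolding qX by simp
  qed
  have ge: "0 \<le> qf n X v" for v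
  proof -
    have "qf n K v \<le> complex_of_real t * nsq n v"
      using qf_le_nsq[of n K v, OF pos] mult_right_mono[OF _ nsq_nonneg, of "complex_of_real (\<Sum>i<n. \<Sum>j<n. norm (K i j))" "complex_of_real t" n v] t(2)
      by (metis (no_types, lifting) less_eq_complex_def Re_complex_of_real Im_complex_of_real order_trans)
    then have "complex_of_real (1 / t) * qf n K v \<le> complex_of_real (1 / t) * (complex_of_real t * nsq n v)"
      using t by (intro mult_left_mono) (auto simp: less_eq_complex_def)
    also have "\<dots> = nsq n v" using t by simp
    finally show ?thesis unfolding qX by simp
  qed
  have h: "X j i = cnj (X i j)" if "i < n" "j < n" for i j
    by (rule qf_hermitian[OF ge that])
  from sqrt_kernel_1[OF h ge le] obtain B where B: "\<And>v. 0 \<le> qf n B v"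
    "\<And>i j. i < n \<Longrightarrow> j < n \<Longrightarrow> (\<Sum>l<n. B i l * B l j) = (if i = j then 1 else 0) - X i j" by blast
  let ?C = "\<lambda>i j. complex_of_real (sqrt t) * B i j"
  have "qf n ?C v = complex_of_real (sqrt t) * qf n B v" for v
    unfolding qf_def by (simp add: sum_distrib_left mult_ac)
  then have "0 \<le> qf n ?C v" for v using B(1)[of v] t by (simp add: less_eq_complex_def)
  moreover have "(\<Sum>l<n. ?C i l * ?C l j) = K i j" if "i < n" "j < n" for i j
  proof -
    have "(\<Sum>l<n. ?C i l * ?C l j) = (complex_of_real (sqrt t) * complex_of_real (sqrt t)) * (\<Sum>l<n. B i l * B l j)"
      by (simp add: sum_distrib_left mult_ac)
    also have "\<dots> = complex_of_real t * (complex_of_real (1 / t) * K i j)"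
      using t by (subst B(2)[OF that]) (simp add: X_def flip: of_real_mult)
    finally show ?thesis using t by simp
  qed
  ultimately show ?thesis by blast
qed

lemma qf_square:
  assumes "\<And>i j. i < n \<Longrightarrow> j < n \<Longrightarrow> S j i = cnj (S i j)"
    and "\<And>i j. i < n \<Longrightarrow> j < n \<Longrightarrow> (\<Sum>l<n. S i l * S l j) = K i j"
  shows "qf n K v = nsq n (kact n S v)"
proof -
  have "kpow n S (Suc (Suc 0)) i j = K i j" if "i < n" "j < n" for i j
    using assms(2)[OF that] that by (simp add: kpow_1 kpow.simps(2)[of n S "Suc 0"] del: kpow.simps)
  then have "qf n K v = qf n (kpow n S (Suc (Suc 0))) v"
    unfolding qf_def by (intro sum.cong refl) (simp del: kpow.simps)
  then show ?thesis using qf_kpow_Suc_Suc[of n S 0 v] assms(1) qf_kpow_0 by metis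
qed

lemma nsq_eq_0: "nsq n v = 0 \<longleftrightarrow> (\<forall>i<n. v i = 0)"
  unfolding nsq_of_real of_real_eq_0_iff by (subst sum_nonneg_eq_0_iff) auto

text \<open>With a positive root \<open>S\<close> of \<open>K\<close>, the form at \<open>w\<close>
  is the squared length of \<open>S w\<close>; if it vanishes, so do \<open>S w\<close> and
  \<open>K w\<close>.\<close>

lemma qf_eq_0_imp:
  assumes pos: "\<And>v. 0 \<le> qf n K v" and "qf n K w = 0" and i: "i < n"
  shows "kact n K w i = 0"
proof -
  obtain S where S: "\<And>v. 0 \<le> qf n S v" "\<And>i j. i < n \<Longrightarrow> j < n \<Longrightarrow> (\<Sum>l<n. S i l * S l j) = K i j"
    using sqrt_kernel[of n K, OF pos] by blast
  have "nsq n (kact n S w) = 0"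
  proof -
    have "qf n K w = nsq n (kact n S w)"
      by (rule qf_square) (rule qf_hermitian[OF S(1)], assumption+, rule S(2))
    then show ?thesis using assms(2) by simp
  qed
  then have z: "kact n S w l = 0" if "l < n" for l using that by (simp add: nsq_eq_0)
  have "kact n K w i = (\<Sum>j<n. (\<Sum>l<n. S i l * S l j) * w j)"
    unfolding kact_def using S(2) i by (intro sum.cong refl) auto
  also have "\<dots> = (\<Sum>l<n. \<Sum>j<n. S i l * S l j * w j)"
    unfolding sum_distrib_right by (rule sum.swap)
  also have "\<dots> = (\<Sum>l<n. S i l * kact n S w l)"
    unfolding kact_def by (simp add: sum_distrib_left mult.assoc)
  finally show ?thesis using z by simp
qed

text \<open>With \<open>D = B - C\<close>, equal squares mean \<open>B D + D C = 0\<close>.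
  Multiplying by \<open>D\<close> and taking the trace gives
  \<open>tr (D B D) + tr (D C D) = 0\<close> with both terms nonnegative. Hence
  \<open>B D = C D = 0\<close>, so \<open>D D = 0\<close>, and \<open>D\<close> vanishes because it
  is Hermitian.\<close>

lemma sqrt_kernel_unique:
  assumes B: "\<And>v. 0 \<le> qf n B v" and C: "\<And>v. 0 \<le> qf n C v"
    and eq: "\<And>i j. i < n \<Longrightarrow> j < n \<Longrightarrow> (\<Sum>l<n. B i l * B l j) = (\<Sum>l<n. C i l * C l j)"
    and ij: "i < n" "j < n"
  shows "B i j = C i j"
proof -
  define D where "D = (\<lambda>i j. B i j - C i j)"
  have hD: "cnj (D i k) = D k i" if "i < n" "k < n" for i k
    unfolding D_def using qf_hermitian[OF B that] qf_hermitian[OF C that] by simp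
  have z: "(\<Sum>j<n. B i j * D j k) + (\<Sum>j<n. D i j * C j k) = 0" if "i < n" "k < n" for i k
    using eq[OF that] unfolding D_def by (simp add: algebra_simps sum_subtractf sum.distrib)
  have "(\<Sum>k<n. qf n B (\<lambda>i. D i k)) + (\<Sum>k<n. qf n C (\<lambda>i. D i k)) = 0"
  proof -
    have 1: "(\<Sum>k<n. qf n B (\<lambda>i. D i k)) = (\<Sum>k<n. \<Sum>i<n. D k i * (\<Sum>j<n. B i j * D j k))"
      unfolding qf_def by (intro sum.cong refl) (simp add: hD sum_distrib_left mult.assoc)
    have "(\<Sum>k<n. qf n C (\<lambda>i. D i k)) = (\<Sum>k<n. \<Sum>i<n. \<Sum>j<n. D k i * C i j * D j k)"
      unfolding qf_def by (intro sum.cong refl) (simp add: hD)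
    also have "\<dots> = (\<Sum>k<n. \<Sum>j<n. \<Sum>i<n. D k i * C i j * D j k)"
      by (rule sum.cong[OF refl], rule sum.swap)
    also have "\<dots> = (\<Sum>j<n. \<Sum>k<n. \<Sum>i<n. D k i * C i j * D j k)" by (rule sum.swap)
    also have "\<dots> = (\<Sum>k<n. \<Sum>i<n. D k i * (\<Sum>j<n. D i j * C j k))"
      by (intro sum.cong refl) (simp add: sum_distrib_left mult_ac)
    finally have 2: "(\<Sum>k<n. qf n C (\<lambda>i. D i k)) = (\<Sum>k<n. \<Sum>i<n. D k i * (\<Sum>j<n. D i j * C j k))" .
    show ?thesis unfolding 1 2 sum.distrib[symmetric] distrib_left[symmetric]
      by (intro sum.neutral ballI) (simp only: z[unfolded sum.distrib[symmetric]] lessThan_iff mult_zero_right)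
  qed
  moreover have n1: "0 \<le> (\<Sum>k<n. qf n B (\<lambda>i. D i k))" "0 \<le> (\<Sum>k<n. qf n C (\<lambda>i. D i k))"
    by (rule sum_nonneg, rule B, rule sum_nonneg, rule C)
  ultimately have "(\<Sum>k<n. qf n B (\<lambda>i. D i k)) = 0" "(\<Sum>k<n. qf n C (\<lambda>i. D i k)) = 0"
    by (simp_all add: add_nonneg_eq_0_iff)
  then have q0: "qf n B (\<lambda>i. D i j) = 0" "qf n C (\<lambda>i. D i j) = 0"
    using sum_nonneg_0[of "{..<n}" "\<lambda>k. qf n B (\<lambda>i. D i k)" j]
      sum_nonneg_0[of "{..<n}" "\<lambda>k. qf n C (\<lambda>i. D i k)" j] B C ij(2) by auto
  have "kact n D (\<lambda>i. D i j) k = 0" if "k < n" for k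
    using qf_eq_0_imp[OF B q0(1) that] qf_eq_0_imp[OF C q0(2) that]
    unfolding kact_def D_def by (simp add: left_diff_distrib sum_subtractf)
  from this[OF ij(2)] have "nsq n (\<lambda>i. D i j) = 0"
    unfolding nsq_def kact_def using ij(2) by (simp add: hD)
  then show ?thesis using ij(1) unfolding nsq_eq_0 D_def by simp
qed

lemma mat_mult_entry:
  "A \<in> carrier_mat n m \<Longrightarrow> B \<in> carrier_mat m k \<Longrightarrow> i < n \<Longrightarrow> j < k \<Longrightarrow>
   (A * B) $$ (i,j) = (\<Sum>l<m. A $$ (i,l) * B $$ (l,j))"
  by (simp add: scalar_prod_def lessThan_atLeast0)

lemma psd_sqrt_exists:
  assumes "psd A" and A: "A \<in> carrier_mat n n"
  shows "\<exists>B \<in> carrier_mat n n. psd B \<and> B * B = A"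
proof -
  have "0 \<le> qf n (\<lambda>i j. A $$ (i,j)) v" for v using assms psd_iff_qf[OF A] by blast
  from sqrt_kernel[OF this] obtain S where S: "\<And>v. 0 \<le> qf n S v"
    "\<And>i j. i < n \<Longrightarrow> j < n \<Longrightarrow> (\<Sum>l<n. S i l * S l j) = A $$ (i,j)" by blast
  let ?B = "Matrix.mat n n (\<lambda>(i,j). S i j)"
  have "qf n (\<lambda>i j. ?B $$ (i,j)) v = qf n S v" for v
    unfolding qf_def by (intro sum.cong refl) auto
  then have "psd ?B" using S(1) by (subst psd_iff_qf[of _ n]) auto
  moreover have "?B * ?B = A"
    by (rule eq_matI) (use A S(2) in \<open>auto simp: mat_mult_entry[of _ n n _ n] simp del: index_mult_mat(1)\<close>)
  ultimately show ?thesis by (intro bexI[of _ ?B]) auto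
qed

lemma psd_carrier: "psd B \<Longrightarrow> B \<in> carrier_mat (dim_row B) (dim_row B)"
  unfolding psd_def by auto

text \<open>\<open>msqrt\<close> is a definite description; uniqueness lets any exhibited positive
  root stand for its value.\<close>

lemma msqrt_eqI:
  assumes "psd B" "B * B = A"
  shows "msqrt A = B"
  unfolding msqrt_def
proof (rule the_equality)
  show "psd B \<and> B * B = A" using assms by simp
  fix C assume C: "psd C \<and> C * C = A"
  define n where "n = dim_row B"
  have Bc: "B \<in> carrier_mat n n" unfolding n_def by (rule psd_carrier[OF assms(1)])
  have "dim_row C = n" using C assms(2) n_def by (metis index_mult_mat(2))
  then have Cc: "C \<in> carrier_mat n n" using psd_carrier[of C] C by metis
  show "C = B"
  proof (rule eq_matI)
    fix i j assume "i < dim_row B" "j < dim_col B"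
    then have ij: "i < n" "j < n" using Bc by auto
    show "C $$ (i,j) = B $$ (i,j)"
    proof (rule sqrt_kernel_unique[where n=n and B="\<lambda>i j. C $$ (i,j)" and C="\<lambda>i j. B $$ (i,j)"])
      show "0 \<le> qf n (\<lambda>i j. C $$ (i, j)) v" "0 \<le> qf n (\<lambda>i j. B $$ (i, j)) v" for v
        using C assms psd_iff_qf Bc Cc by blast+
      show "(\<Sum>l<n. C $$ (i,l) * C $$ (l,j)) = (\<Sum>l<n. B $$ (i,l) * B $$ (l,j))" if "i < n" "j < n" for i j
        using C assms(2) mat_mult_entry[OF Bc Bc that] mat_mult_entry[OF Cc Cc that] by simp
    qed (use ij in auto)
  qed (use Bc Cc in auto)
qed

section \<open>Rank-one matrices and the fidelity with a pure state\<close>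

lemma sum_double_prod: "(\<Sum>i\<in>A. \<Sum>j\<in>B. f i * g j) = (\<Sum>i\<in>A. f i) * (\<Sum>j\<in>B. g j :: 'a :: semiring_0)"
  by (simp add: sum_product)

lemma cmod_sq_nonneg: "0 \<le> z * cnj z" "0 \<le> cnj z * z"
  by (simp_all add: complex_mult_cnj less_eq_complex_def mult.commute[of "cnj z"])

lemma psd_rank1: 
  assumes "A = Matrix.mat n n (\<lambda>(i,j). c * (u i * cnj (u j)))" "0 \<le> c"
  shows "psd A"
proof -
  have "0 \<le> qf n (\<lambda>i j. A $$ (i,j)) v" for v
  proof -
    have "qf n (\<lambda>i j. A $$ (i,j)) v = c * (\<Sum>i<n. \<Sum>j<n. (cnj (v i) * u i) * (cnj (u j) * v j))"
      unfolding qf_def assms(1) sum_distrib_left by (intro sum.cong refl) (auto simp: algebra_simps)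
    also have "\<dots> = c * (cnj (\<Sum>j<n. cnj (u j) * v j) * (\<Sum>j<n. cnj (u j) * v j))"
      unfolding sum_double_prod by (simp add: mult.commute)
    finally show ?thesis using assms(2) cmod_sq_nonneg(2) by (metis mult_nonneg_nonneg)
  qed
  then show ?thesis using assms(1) by (subst psd_iff_qf[of _ n]) auto
qed

text \<open>A projection is its own root. With a root \<open>S\<close> of \<open>\<sigma>\<close>,
  the product \<open>\<tau> S\<close> has rank one: column \<open>\<phi>\<close> times row
  \<open>w\<close>, where \<open>w\<close> is the adjoint of \<open>\<phi>\<close> times
  \<open>S\<close>. Its trace norm is the length of \<open>w\<close>, and the squared length is the
  form of \<open>\<sigma>\<close> at \<open>\<phi>\<close>.\<close>

lemma fidelity_pure:
  assumes s: "psd \<sigma>" and sc: "\<sigma> \<in> carrier_mat d d"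
    and \<tau>: "\<tau> = Matrix.mat d d (\<lambda>(r,c). \<phi> r * cnj (\<phi> c))" and n1: "nsq d \<phi> = 1"
  shows "fidelity \<tau> \<sigma> = Re (qf d (\<lambda>r c. \<sigma> $$ (r,c)) \<phi>)"
proof -
  have \<tau>c: "\<tau> \<in> carrier_mat d d" using \<tau> by simp
  have "psd \<tau>" by (rule psd_rank1[where c=1 and u=\<phi> and n=d]) (simp_all add: \<tau> less_eq_complex_def)
  moreover have "\<tau> * \<tau> = \<tau>"
  proof (rule eq_matI)
    fix i j assume "i < dim_row \<tau>" "j < dim_col \<tau>"
    then have ij: "i < d" "j < d" using \<tau>c by auto
    have "(\<tau> * \<tau>) $$ (i,j) = (\<Sum>l<d. \<phi> i * cnj (\<phi> j) * (cnj (\<phi> l) * \<phi> l))"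
      using ij unfolding mat_mult_entry[OF \<tau>c \<tau>c ij] by (intro sum.cong refl) (auto simp: \<tau>)
    also have "\<dots> = \<phi> i * cnj (\<phi> j)" using n1 unfolding sum_distrib_left[symmetric] nsq_def by simp
    finally show "(\<tau> * \<tau>) $$ (i,j) = \<tau> $$ (i,j)" using ij by (simp add: \<tau>)
  qed (use \<tau>c in auto)
  ultimately have st: "msqrt \<tau> = \<tau>" by (rule msqrt_eqI)
  obtain S where S: "S \<in> carrier_mat d d" "psd S" "S * S = \<sigma>" using psd_sqrt_exists[OF s sc] by blast
  have ss: "msqrt \<sigma> = S" using S by (intro msqrt_eqI)
  define w where "w = (\<lambda>j. \<Sum>l<d. cnj (\<phi> l) * S $$ (l,j))"
  define TT where "TT = \<tau> * S"
  have Tc: "TT \<in> carrier_mat d d" using \<tau>c S unfolding TT_def by simp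
  have T: "TT $$ (k,j) = \<phi> k * w j" if "k < d" "j < d" for k j
    using that unfolding TT_def mat_mult_entry[OF \<tau>c S(1) that] w_def sum_distrib_left
    by (intro sum.cong refl) (auto simp: \<tau>)
  have aT: "adj TT * TT = Matrix.mat d d (\<lambda>(i,j). cnj (w i) * w j)"
  proof (rule eq_matI)
    fix i j assume "i < dim_row (Matrix.mat d d (\<lambda>(i,j). cnj (w i) * w j))" "j < dim_col (Matrix.mat d d (\<lambda>(i,j). cnj (w i) * w j))"
    then have ij: "i < d" "j < d" by auto
    have ac: "adj TT \<in> carrier_mat d d" using Tc \<tau>c S(1) unfolding adj_def by auto
    have "(adj TT * TT) $$ (i,j) = (\<Sum>l<d. (cnj (w i) * w j) * (cnj (\<phi> l) * \<phi> l))"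
      unfolding mat_mult_entry[OF ac Tc ij]
    proof (intro sum.cong refl)
      fix l assume l: "l \<in> {..<d}"
      have "adj TT $$ (i,l) = cnj (TT $$ (l,i))" unfolding adj_def using Tc ij l by auto
      then show "adj TT $$ (i,l) * TT $$ (l,j) = (cnj (w i) * w j) * (cnj (\<phi> l) * \<phi> l)"
        using T[of l i] T[of l j] ij l by simp
    qed
    also have "\<dots> = cnj (w i) * w j" using n1 unfolding sum_distrib_left[symmetric] nsq_def by simp
    finally show "(adj TT * TT) $$ (i,j) = Matrix.mat d d (\<lambda>(i,j). cnj (w i) * w j) $$ (i,j)" using ij by simp
  qed (use Tc in \<open>auto simp: adj_def\<close>)
  define N where "N = (\<Sum>i<d. (norm (w i))\<^sup>2)"
  have N0: "N \<ge> 0" unfolding N_def by (simp add: sum_nonneg)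
  have Nn: "nsq d w = complex_of_real N" unfolding nsq_of_real N_def ..
  \<comment> \<open>The positive root of a rank-one matrix is that matrix divided by its norm
    \<open>sqrt N\<close>. If \<open>N = 0\<close>, then \<open>w = 0\<close>, and
    \<open>1 / sqrt 0 = 0\<close> gives the correct zero matrix.\<close>
  let ?R = "Matrix.mat d d (\<lambda>(i,j). complex_of_real (1 / sqrt N) * (cnj (w i) * cnj (cnj (w j))))"
  have "psd ?R" by (rule psd_rank1[OF refl]) (use N0 in \<open>simp add: less_eq_complex_def\<close>)
  moreover have "?R * ?R = adj TT * TT"
    unfolding aT
  proof (rule eq_matI)
    fix i j assume "i < dim_row (Matrix.mat d d (\<lambda>(i,j). cnj (w i) * w j))" "j < dim_col (Matrix.mat d d (\<lambda>(i,j). cnj (w i) * w j))"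
    then have ij: "i < d" "j < d" by auto
    have "(?R * ?R) $$ (i,j) = (\<Sum>l<d. (complex_of_real (1 / sqrt N) * complex_of_real (1 / sqrt N) * (cnj (w i) * w j)) * (cnj (w l) * w l))"
      using ij by (subst mat_mult_entry[of _ d d _ d]) (auto intro!: sum.cong)
    also have "\<dots> = complex_of_real (1 / sqrt N) * complex_of_real (1 / sqrt N) * (cnj (w i) * w j) * complex_of_real N"
      unfolding sum_distrib_left[symmetric] nsq_def[symmetric] Nn ..
    also have "\<dots> = cnj (w i) * w j"
    proof (cases "N = 0")
      case True
      then have "w i = 0" using ij Nn nsq_eq_0[of d w] by simp
      then show ?thesis by simp
    next
      case False
      then have "1 / sqrt N * (1 / sqrt N) * N = 1" using N0 by (simp add: field_simps)
      then have "complex_of_real (1 / sqrt N) * complex_of_real (1 / sqrt N) * complex_of_real N = 1"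
        by (metis of_real_1 of_real_mult)
      then show ?thesis by (simp add: mult_ac)
    qed
    finally show "(?R * ?R) $$ (i,j) = Matrix.mat d d (\<lambda>(i,j). cnj (w i) * w j) $$ (i,j)" using ij by simp
  qed auto
  ultimately have "msqrt (adj TT * TT) = ?R" by (rule msqrt_eqI)
  then have "tnorm TT = Re (\<Sum>i<d. complex_of_real (1 / sqrt N) * (cnj (w i) * w i))"
    unfolding tnorm_def mtrace_def by (auto intro!: sum.cong arg_cong[where f=Re] simp del: Re_sum)
  also have "\<dots> = 1 / sqrt N * N"
    unfolding sum_distrib_left[symmetric] nsq_def[symmetric] Nn by simp
  also have "\<dots> = sqrt N" using N0 by (simp add: real_div_sqrt)
  finally have "fidelity \<tau> \<sigma> = N"
    unfolding fidelity_def st ss TT_def[symmetric] using N0 by simp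
  moreover have "qf d (\<lambda>r c. \<sigma> $$ (r,c)) \<phi> = nsq d w"
  proof -
    have hS: "S $$ (j,i) = cnj (S $$ (i,j))" if "i < d" "j < d" for i j
      using qf_hermitian[of d "\<lambda>i j. S $$ (i,j)" i j] S psd_iff_qf that by blast
    have "qf d (\<lambda>r c. \<sigma> $$ (r,c)) \<phi> = nsq d (kact d (\<lambda>i j. S $$ (i,j)) \<phi>)"
    proof (rule qf_square)
      show "S $$ (j,i) = cnj (S $$ (i,j))" if "i < d" "j < d" for i j by (rule hS[OF that])
      show "(\<Sum>l<d. S $$ (i,l) * S $$ (l,j)) = \<sigma> $$ (i,j)" if "i < d" "j < d" for i j
        using mat_mult_entry[OF S(1) S(1) that] S(3) by simp
    qed
    also have "\<dots> = nsq d (\<lambda>i. cnj (w i))"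
    proof -
      have "kact d (\<lambda>i j. S $$ (i,j)) \<phi> i = cnj (w i)" if "i < d" for i
        unfolding kact_def w_def cnj_sum
      proof (rule sum.cong[OF refl])
        fix l assume "l \<in> {..<d}"
        then show "S $$ (i,l) * \<phi> l = cnj (cnj (\<phi> l) * S $$ (l,i))" using hS[of l i] that by simp
      qed
      then show ?thesis unfolding nsq_def by (intro sum.cong refl) simp
    qed
    also have "\<dots> = nsq d w" unfolding nsq_def by (simp add: mult.commute)
    finally show ?thesis .
  qed
  ultimately show ?thesis using Nn by simp
qed

text \<open>Positive semidefiniteness of a kernel, in the form in which it passes to sums, products and pullbacks
  without effort.\<close>

definition gram :: "'a set \<Rightarrow> ('a \<Rightarrow> 'a \<Rightarrow> complex) \<Rightarrow> bool" where
  "gram A K \<longleftrightarrow> (\<exists>vs. \<forall>x\<in>A. \<forall>y\<in>A. K x y = (\<Sum>v\<leftarrow>vs. v x * cnj (v y)))"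

text \<open>The columns of the Hermitian square root serve as the vectors of the Gram
  representation.\<close>

lemma psd_gram:
  assumes "psd A" and A: "A \<in> carrier_mat n n"
  shows "gram {..<n} (\<lambda>i j. A $$ (i,j))"
proof -
  obtain S where S: "S \<in> carrier_mat n n" "psd S" "S * S = A" using psd_sqrt_exists[OF assms] by blast
  have hS: "S $$ (j,i) = cnj (S $$ (i,j))" if "i < n" "j < n" for i j
    using qf_hermitian[of n "\<lambda>i j. S $$ (i,j)" i j] S psd_iff_qf that by blast
  have "A $$ (i,j) = (\<Sum>v\<leftarrow>map (\<lambda>l i. S $$ (i,l)) [0..<n]. v i * cnj (v j))" if "i < n" "j < n" for i j
  proof -
    have "(\<Sum>l<n. S $$ (i,l) * S $$ (l,j)) = (\<Sum>l<n. S $$ (i,l) * cnj (S $$ (j,l)))"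
    proof (rule sum.cong[OF refl])
      fix l assume "l \<in> {..<n}"
      then show "S $$ (i,l) * S $$ (l,j) = S $$ (i,l) * cnj (S $$ (j,l))" using hS[of j l] that by simp
    qed
    then show ?thesis
      unfolding S(3)[symmetric] mat_mult_entry[OF S(1) S(1) that]
      by (simp add: interv_sum_list_conv_sum_set_nat o_def lessThan_atLeast0)
  qed
  then show ?thesis unfolding gram_def by (intro exI[of _ "map (\<lambda>l i. S $$ (i,l)) [0..<n]"]) auto
qed

lemma gram_vimage: "gram A K \<Longrightarrow> (\<And>x. x \<in> B \<Longrightarrow> f x \<in> A) \<Longrightarrow> gram B (\<lambda>x y. K (f x) (f y))"
  unfolding gram_def by (elim exE, rule_tac x="map (\<lambda>v x. v (f x)) vs" in exI) (simp add: o_def)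

lemma gram_cong: "gram A K \<Longrightarrow> (\<And>x y. x \<in> A \<Longrightarrow> y \<in> A \<Longrightarrow> L x y = K x y) \<Longrightarrow> gram A L"
  unfolding gram_def by auto

lemma gram_rank1: "gram A (\<lambda>x y. v x * cnj (v y))"
  unfolding gram_def by (rule exI[of _ "[v]"]) simp

lemma gram_0: "gram A (\<lambda>x y. 0)"
  unfolding gram_def by (rule exI[of _ "[]"]) simp

lemma gram_1: "gram A (\<lambda>x y. 1)"
  unfolding gram_def by (rule exI[of _ "[\<lambda>x. 1]"]) simp

lemma gram_add: "gram A K \<Longrightarrow> gram A L \<Longrightarrow> gram A (\<lambda>x y. K x y + L x y)"
  unfolding gram_def by (elim exE, rename_tac vs ws, rule_tac x="vs @ ws" in exI) simp

lemma gram_sum: "(\<And>i. i \<in> I \<Longrightarrow> gram A (K i)) \<Longrightarrow> gram A (\<lambda>x y. \<Sum>i\<in>I. K i x y)"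
  by (induction I rule: infinite_finite_induct) (auto intro: gram_0 gram_add)

lemma sum_list_product: "(\<Sum>p\<leftarrow>List.product xs ys. f (fst p) * g (snd p)) = (\<Sum>x\<leftarrow>xs. f x) * (\<Sum>y\<leftarrow>ys. g y :: 'a :: semiring_0)"
  by (induction xs) (simp_all add: o_def sum_list_const_mult distrib_right)

text \<open>The Schur product theorem: the pointwise products of the vectors of the two
  representations represent the product. With pullbacks, this yields positivity of tensor
  products.\<close>

lemma gram_mult: "gram A K \<Longrightarrow> gram A L \<Longrightarrow> gram A (\<lambda>x y. K x y * L x y)"
proof -
  assume "gram A K" "gram A L"
  then obtain vs ws where v: "\<And>x y. x \<in> A \<Longrightarrow> y \<in> A \<Longrightarrow> K x y = (\<Sum>v\<leftarrow>vs. v x * cnj (v y))"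
    and w: "\<And>x y. x \<in> A \<Longrightarrow> y \<in> A \<Longrightarrow> L x y = (\<Sum>v\<leftarrow>ws. v x * cnj (v y))" unfolding gram_def by blast
  have "K x y * L x y = (\<Sum>u\<leftarrow>map (\<lambda>p x. fst p x * snd p x) (List.product vs ws). u x * cnj (u y))"
    if "x \<in> A" "y \<in> A" for x y
    unfolding v[OF that] w[OF that] sum_list_product[symmetric]
    by (simp add: o_def mult_ac)
  then show ?thesis unfolding gram_def by blast
qed

lemma gram_prod: "(\<And>i. i \<in> I \<Longrightarrow> gram A (K i)) \<Longrightarrow> gram A (\<lambda>x y. \<Prod>i\<in>I. K i x y)"
  by (induction I rule: infinite_finite_induct) (auto intro: gram_1 gram_mult)

lemma gram_const: "0 \<le> c \<Longrightarrow> gram A (\<lambda>x y. complex_of_real c)"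
  by (rule gram_cong[OF gram_rank1[of A "\<lambda>x. complex_of_real (sqrt c)"]]) (simp flip: of_real_mult)

lemma gram_scale: "0 \<le> c \<Longrightarrow> gram A K \<Longrightarrow> gram A (\<lambda>x y. complex_of_real c * K x y)"
  by (intro gram_mult gram_const)

lemma gram_delta: "gram A (\<lambda>x y. if f x = f y \<and> P (f x) then 1 else 0)" if "finite (f ` A)"
proof (rule gram_cong)
  show "gram A (\<lambda>x y. \<Sum>z\<in>f ` A. (if f x = z \<and> P z then 1 else 0) * cnj (if f y = z \<and> P z then 1 else 0))"
    by (intro gram_sum gram_rank1)
  fix x y assume "x \<in> A" "y \<in> A"
  have "(\<Sum>z\<in>f ` A. (if f x = z \<and> P z then 1 else 0) * cnj (if f y = z \<and> P z then 1 else 0))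
     = (\<Sum>z\<in>f ` A. if z = f x then (if f x = f y \<and> P (f x) then 1 else 0) else (0::complex))"
    by (intro sum.cong refl) auto
  then show "(if f x = f y \<and> P (f x) then 1 else 0) = (\<Sum>z\<in>f ` A. (if f x = z \<and> P z then 1 else 0) * cnj (if f y = z \<and> P z then 1 else (0::complex)))"
    using \<open>x \<in> A\<close> that by simp
qed

lemma gram_cnj: "gram A K \<Longrightarrow> gram A (\<lambda>x y. cnj (K x y))"
proof -
  assume "gram A K"
  then obtain vs where v: "\<And>x y. x \<in> A \<Longrightarrow> y \<in> A \<Longrightarrow> K x y = (\<Sum>v\<leftarrow>vs. v x * cnj (v y))" unfolding gram_def by blast
  have "cnj (\<Sum>v\<leftarrow>vs. v x * cnj (v y)) = (\<Sum>u\<leftarrow>map (\<lambda>v x. cnj (v x)) vs. u x * cnj (u y))" for x y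
    by (induction vs) auto
  then show ?thesis unfolding gram_def using v by (intro exI[of _ "map (\<lambda>v x. cnj (v x)) vs"] ballI) (simp only:)
qed

lemma gram_form_nonneg:
  assumes "gram A K"
  shows "0 \<le> (\<Sum>x\<in>A. \<Sum>y\<in>A. cnj (v x) * K x y * v y)"
proof -
  obtain vs where k: "\<And>x y. x \<in> A \<Longrightarrow> y \<in> A \<Longrightarrow> K x y = (\<Sum>v\<leftarrow>vs. v x * cnj (v y))"
    using assms unfolding gram_def by blast
  have "(\<Sum>x\<in>A. \<Sum>y\<in>A. cnj (v x) * (\<Sum>u\<leftarrow>us. u x * cnj (u y)) * v y)
     = (\<Sum>u\<leftarrow>us. cnj (\<Sum>y\<in>A. cnj (u y) * v y) * (\<Sum>y\<in>A. cnj (u y) * v y))" for us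
  proof (induction us)
    case (Cons u us)
    have "(\<Sum>x\<in>A. \<Sum>y\<in>A. cnj (v x) * (\<Sum>u\<leftarrow>u#us. u x * cnj (u y)) * v y)
      = (\<Sum>x\<in>A. \<Sum>y\<in>A. (cnj (v x) * u x) * (cnj (u y) * v y)) + (\<Sum>x\<in>A. \<Sum>y\<in>A. cnj (v x) * (\<Sum>u\<leftarrow>us. u x * cnj (u y)) * v y)"
      unfolding sum.distrib[symmetric] by (intro sum.cong refl) (simp add: algebra_simps)
    then show ?case using Cons unfolding sum_double_prod by (simp add: mult.commute)
  qed simp
  note e = this
  have "(\<Sum>x\<in>A. \<Sum>y\<in>A. cnj (v x) * K x y * v y) = (\<Sum>x\<in>A. \<Sum>y\<in>A. cnj (v x) * (\<Sum>v\<leftarrow>vs. v x * cnj (v y)) * v y)"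
    using k by (intro sum.cong refl) simp
  also have "\<dots> \<ge> 0" unfolding e by (rule sum_list_nonneg) (auto simp: cmod_sq_nonneg simp del: cnj_sum)
  finally show ?thesis by simp
qed

lemma gram_sum_nonneg: "gram A K \<Longrightarrow> 0 \<le> (\<Sum>x\<in>A. \<Sum>y\<in>A. K x y)"
  using gram_form_nonneg[of A K "\<lambda>x. 1"] by simp

lemma gram_diag_nonneg: "gram A K \<Longrightarrow> x \<in> A \<Longrightarrow> 0 \<le> K x x"
  unfolding gram_def by (elim exE) (auto intro!: sum_list_nonneg simp: cmod_sq_nonneg)

lemma gram_psd:
  assumes "gram {..<n} (\<lambda>i j. A $$ (i,j))" "A \<in> carrier_mat n n"
  shows "psd A"
  using gram_form_nonneg[OF assms(1)] psd_iff_qf[OF assms(2)] unfolding qf_def by blast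

section \<open>Codes as kernels\<close>

text \<open>Positions may come from any set, so that codes can sit on a prefix, on sampled positions
  or on blocks. Extensional functions make two words equal as soon as their letters on
  \<open>T\<close> agree.\<close>

definition words :: "nat \<Rightarrow> 'p set \<Rightarrow> ('p \<Rightarrow> nat) set" where
  "words d T = PiE T (\<lambda>_. {..<d})"

lemma finite_words: "finite T \<Longrightarrow> finite (words d T)"
  unfolding words_def by (rule finite_PiE) auto

lemma restrict_words: "I \<in> words d T' \<Longrightarrow> T \<subseteq> T' \<Longrightarrow> restrict I T \<in> words d T"
  unfolding words_def by auto

lemma sum_PiE_Un:
  assumes "T1 \<inter> T2 = {}"
  shows "(\<Sum>I\<in>PiE (T1 \<union> T2) F. g (restrict I T1) (restrict I T2)) = (\<Sum>I1\<in>PiE T1 F. \<Sum>I2\<in>PiE T2 F. g I1 I2)"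
proof -
  let ?j = "\<lambda>(I1,I2) t. if t \<in> T1 then I1 t else if t \<in> T2 then I2 t else undefined"
  have "(\<Sum>I\<in>PiE (T1 \<union> T2) F. g (restrict I T1) (restrict I T2)) = (\<Sum>(I1,I2)\<in>PiE T1 F \<times> PiE T2 F. g I1 I2)"
    by (rule sum.reindex_bij_witness[where i="?j" and j="\<lambda>I. (restrict I T1, restrict I T2)"])
       (use assms in \<open>auto simp: PiE_iff extensional_def fun_eq_iff split: if_splits\<close>)
  then show ?thesis by (simp add: sum.cartesian_product)
qed

lemma sum_words_Un:
  "T1 \<inter> T2 = {} \<Longrightarrow>
   (\<Sum>I\<in>words d (T1 \<union> T2). g (restrict I T1) (restrict I T2)) = (\<Sum>I1\<in>words d T1. \<Sum>I2\<in>words d T2. g I1 I2)"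
  unfolding words_def by (rule sum_PiE_Un)

text \<open>A \<open>letter\<close> is a map on matrices, given by the entries \<open>(a,b)\<close> of the image of the matrix unit \<open>E\<^sub>i\<^sub>j\<close>
  at \<open>i j a b\<close>.\<close>

type_synonym letter = "nat \<Rightarrow> nat \<Rightarrow> nat \<Rightarrow> nat \<Rightarrow> complex"
type_synonym 'p wkern = "('p \<Rightarrow> nat) \<Rightarrow> ('p \<Rightarrow> nat) \<Rightarrow> complex"

text \<open>In word coordinates a tensor product of channels is a plain product of entries, free of
  index arithmetic.\<close>

definition chanW :: "'p set \<Rightarrow> ('p \<Rightarrow> letter) \<Rightarrow> ('p \<Rightarrow> nat) \<Rightarrow> ('p \<Rightarrow> nat) \<Rightarrow> ('p \<Rightarrow> nat) \<Rightarrow> ('p \<Rightarrow> nat) \<Rightarrow> complex" where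
  "chanW T \<nu> I J A B = (\<Prod>t\<in>T. \<nu> t (I t) (J t) (A t) (B t))"

text \<open>CPTP in kernel form: the Gram condition on pairs (input index, output index) is
  positivity of the Choi matrix, and the second condition is preservation of the trace on matrix
  units.\<close>

definition chk :: "nat \<Rightarrow> nat \<Rightarrow> letter \<Rightarrow> bool" where
  "chk dA dB n \<longleftrightarrow> gram ({..<dA} \<times> {..<dB}) (\<lambda>x y. n (fst x) (fst y) (snd x) (snd y)) \<and>
     (\<forall>i<dA. \<forall>j<dA. (\<Sum>a<dB. n i j a a) = (if i = j then 1 else 0))"

text \<open>The value, at the channel output for the input operator with entries \<open>P\<close>,
  of the linear functional that takes the value \<open>R A B\<close> on the matrix unit at
  \<open>(A, B)\<close>. Every success probability and fidelity below reduces to this bilinear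
  form.\<close>

definition pairing :: "nat \<Rightarrow> nat \<Rightarrow> 'p set \<Rightarrow> ('p \<Rightarrow> letter) \<Rightarrow> 'p wkern \<Rightarrow> 'p wkern \<Rightarrow> complex" where
  "pairing dA dB T \<nu> P R = (\<Sum>I\<in>words dA T. \<Sum>J\<in>words dA T. \<Sum>A\<in>words dB T. \<Sum>B\<in>words dB T.
     P I J * chanW T \<nu> I J A B * R A B)"

text \<open>Each representing vector is summed over \<open>y\<close>. The two copies of
  \<open>y\<close> are summed independently, not along the diagonal; this is the contraction of
  inner indices that occurs when maps are composed.\<close>

lemma gram_marg:
  assumes "gram (Y \<times> W) M"
  shows "gram W (\<lambda>w w'. \<Sum>y\<in>Y. \<Sum>y'\<in>Y. M (y,w) (y',w'))"
proof -
  obtain vs where v: "\<And>x y. x \<in> Y \<times> W \<Longrightarrow> y \<in> Y \<times> W \<Longrightarrow> M x y = (\<Sum>v\<leftarrow>vs. v x * cnj (v y))"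
    using assms unfolding gram_def by blast
  have e: "(\<Sum>y\<in>Y. \<Sum>y'\<in>Y. \<Sum>v\<leftarrow>us. v (y,w) * cnj (v (y',w'))) = (\<Sum>u\<leftarrow>map (\<lambda>v w. \<Sum>y\<in>Y. v (y,w)) us. u w * cnj (u w'))" for us w w'
  proof (induction us)
    case (Cons u us) then show ?case
      by (simp add: sum.distrib sum_product)
  qed simp
  have "(\<Sum>y\<in>Y. \<Sum>y'\<in>Y. M (y,w) (y',w')) = (\<Sum>u\<leftarrow>map (\<lambda>v w. \<Sum>y\<in>Y. v (y,w)) vs. u w * cnj (u w'))"
    if "w \<in> W" "w' \<in> W" for w w'
    unfolding e[symmetric] using v that by (intro sum.cong refl) auto
  then show ?thesis unfolding gram_def by (intro exI[of _ "map (\<lambda>v w. \<Sum>y\<in>Y. v (y,w)) vs"]) blast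
qed

lemma gram_truncate:
  assumes "gram A' K" and "\<And>x. x \<in> A \<Longrightarrow> Q x \<Longrightarrow> x \<in> A'"
  shows "gram A (\<lambda>x y. if Q x \<and> Q y then K x y else 0)"
proof -
  obtain vs where v: "\<And>x y. x \<in> A' \<Longrightarrow> y \<in> A' \<Longrightarrow> K x y = (\<Sum>v\<leftarrow>vs. v x * cnj (v y))"
    using assms(1) unfolding gram_def by blast
  let ?ws = "map (\<lambda>v x. if Q x then v x else 0) vs"
  have "(if Q x \<and> Q y then K x y else 0) = (\<Sum>v\<leftarrow>?ws. v x * cnj (v y))" if "x \<in> A" "y \<in> A" for x y
    using that assms(2) v by (auto simp: o_def)
  then show ?thesis unfolding gram_def by (intro exI[of _ ?ws]) blast
qed

lemma chanW_gram:
  assumes "\<forall>t\<in>T. chk dA dB (\<nu> t)"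
  shows "gram (words dA T \<times> words dB T) (\<lambda>x y. chanW T \<nu> (fst x) (fst y) (snd x) (snd y))"
  unfolding chanW_def
proof (rule gram_prod)
  fix t assume t: "t \<in> T"
  have "gram ({..<dA} \<times> {..<dB}) (\<lambda>x y. \<nu> t (fst x) (fst y) (snd x) (snd y))"
    using assms t unfolding chk_def by simp
  from gram_vimage[OF this, of "words dA T \<times> words dB T" "\<lambda>x. (fst x t, snd x t)"]
  show "gram (words dA T \<times> words dB T) (\<lambda>x y. \<nu> t (fst x t) (fst y t) (snd x t) (snd y t))"
    using t unfolding words_def by (auto simp: PiE_iff)
qed

lemma chanW_trace:
  assumes "\<forall>t\<in>T. chk dA dB (\<nu> t)" "finite T" and I: "I \<in> words dA T" "J \<in> words dA T"
  shows "(\<Sum>A\<in>words dB T. chanW T \<nu> I J A A) = (if I = J then 1 else 0)"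
proof -
  have "(\<Sum>A\<in>words dB T. chanW T \<nu> I J A A) = (\<Prod>t\<in>T. \<Sum>a<dB. \<nu> t (I t) (J t) a a)"
    unfolding words_def chanW_def using assms(2) by (subst prod_sum_PiE) auto
  also have "\<dots> = (\<Prod>t\<in>T. if I t = J t then 1 else 0)"
    using assms I unfolding chk_def words_def by (intro prod.cong refl) (auto simp: PiE_iff)
  also have "\<dots> = (if I = J then 1 else 0)"
  proof (cases "I = J")
    case False
    then obtain t where "t \<in> T" "I t \<noteq> J t"
      using I unfolding words_def by (metis PiE_ext)
    then show ?thesis using False assms(2) by auto
  qed simp
  finally show ?thesis .
qed

lemma pairing_cong:
  "(\<And>I J. I \<in> words dA T \<Longrightarrow> J \<in> words dA T \<Longrightarrow> P I J = P' I J) \<Longrightarrow>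
   (\<And>A B. A \<in> words dB T \<Longrightarrow> B \<in> words dB T \<Longrightarrow> R A B = R' A B) \<Longrightarrow>
   (\<And>t. t \<in> T \<Longrightarrow> \<nu> t = \<nu>' t) \<Longrightarrow>
   pairing dA dB T \<nu> P R = pairing dA dB T \<nu>' P' R'"
  unfolding pairing_def chanW_def by (intro sum.cong refl) (auto intro!: prod.cong)

lemma pairing_sum_left:
  "pairing dA dB T \<nu> (\<lambda>I J. \<Sum>k\<in>K. P k I J) R = (\<Sum>k\<in>K. pairing dA dB T \<nu> (P k) R)"
  by (induction K rule: infinite_finite_induct) (simp_all add: pairing_def sum.distrib distrib_right)

lemma pairing_sum_right:
  "pairing dA dB T \<nu> P (\<lambda>A B. \<Sum>k\<in>K. R k A B) = (\<Sum>k\<in>K. pairing dA dB T \<nu> P (R k))"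
  by (induction K rule: infinite_finite_induct) (simp_all add: pairing_def sum.distrib distrib_left)

lemma pairing_add_right:
  "pairing dA dB T \<nu> P (\<lambda>A B. R A B + R' A B) = pairing dA dB T \<nu> P R + pairing dA dB T \<nu> P R'"
  by (simp add: pairing_def sum.distrib distrib_left)

lemma pairing_scale_left: "pairing dA dB T \<nu> (\<lambda>I J. c * P I J) R = c * pairing dA dB T \<nu> P R"
  by (simp add: pairing_def sum_distrib_left mult.assoc)

lemma pairing_zero_right: "pairing dA dB T \<nu> P (\<lambda>A B. 0) = 0"
  by (simp add: pairing_def)

lemma chanW_Un:
  assumes "T1 \<inter> T2 = {}" "finite T1" "finite T2"
  shows "chanW (T1 \<union> T2) \<nu> I J A B =
     chanW T1 \<nu> (restrict I T1) (restrict J T1) (restrict A T1) (restrict B T1) *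
     chanW T2 \<nu> (restrict I T2) (restrict J T2) (restrict A T2) (restrict B T2)"
  unfolding chanW_def using assms by (simp add: prod.union_disjoint)

lemma pairing_tensor:
  assumes d: "T1 \<inter> T2 = {}" and f: "finite T1" "finite T2"
  shows "pairing dA dB (T1 \<union> T2) \<nu>
      (\<lambda>I J. P1 (restrict I T1) (restrict J T1) * P2 (restrict I T2) (restrict J T2))
      (\<lambda>A B. R1 (restrict A T1) (restrict B T1) * R2 (restrict A T2) (restrict B T2))
    = pairing dA dB T1 \<nu> P1 R1 * pairing dA dB T2 \<nu> P2 R2"
proof -
  let ?f = "\<lambda>I1 I2 J1 J2 A1 A2 B1 B2. (P1 I1 J1 * chanW T1 \<nu> I1 J1 A1 B1 * R1 A1 B1) * (P2 I2 J2 * chanW T2 \<nu> I2 J2 A2 B2 * R2 A2 B2)"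
  let ?W = "\<lambda>d. words d (T1 \<union> T2)"
  have "pairing dA dB (T1 \<union> T2) \<nu>
      (\<lambda>I J. P1 (restrict I T1) (restrict J T1) * P2 (restrict I T2) (restrict J T2))
      (\<lambda>A B. R1 (restrict A T1) (restrict B T1) * R2 (restrict A T2) (restrict B T2))
    = (\<Sum>I\<in>?W dA. \<Sum>J\<in>?W dA. \<Sum>A\<in>?W dB. \<Sum>B\<in>?W dB.
        ?f (restrict I T1) (restrict I T2) (restrict J T1) (restrict J T2) (restrict A T1) (restrict A T2) (restrict B T1) (restrict B T2))"
    unfolding pairing_def chanW_Un[OF d f] by (intro sum.cong refl) (simp add: mult_ac)
  also have "\<dots> = (\<Sum>I1\<in>words dA T1. \<Sum>I2\<in>words dA T2. \<Sum>J1\<in>words dA T1. \<Sum>J2\<in>words dA T2.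
      \<Sum>A1\<in>words dB T1. \<Sum>A2\<in>words dB T2. \<Sum>B1\<in>words dB T1. \<Sum>B2\<in>words dB T2. ?f I1 I2 J1 J2 A1 A2 B1 B2)"
    by (simp only: sum_words_Un[OF d, symmetric])
  also have "\<dots> = (\<Sum>(I1,I2,J1,J2,A1,A2,B1,B2)\<in>words dA T1 \<times> words dA T2 \<times> words dA T1 \<times> words dA T2
      \<times> words dB T1 \<times> words dB T2 \<times> words dB T1 \<times> words dB T2. ?f I1 I2 J1 J2 A1 A2 B1 B2)"
    by (simp add: sum.cartesian_product)
  also have "\<dots> = (\<Sum>((I1,J1,A1,B1),(I2,J2,A2,B2))\<in>(words dA T1 \<times> words dA T1 \<times> words dB T1 \<times> words dB T1) \<times>
      (words dA T2 \<times> words dA T2 \<times> words dB T2 \<times> words dB T2). ?f I1 I2 J1 J2 A1 A2 B1 B2)"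
    by (rule sum.reindex_bij_witness[where i="\<lambda>((I1,J1,A1,B1),(I2,J2,A2,B2)). (I1,I2,J1,J2,A1,A2,B1,B2)"
          and j="\<lambda>(I1,I2,J1,J2,A1,A2,B1,B2). ((I1,J1,A1,B1),(I2,J2,A2,B2))"]) auto
  also have "\<dots> = pairing dA dB T1 \<nu> P1 R1 * pairing dA dB T2 \<nu> P2 R2"
    unfolding pairing_def
    by (simp add: sum.cartesian_product sum_product split_def)
  finally show ?thesis .
qed

text \<open>Codes as kernels: \<open>p m i j I J\<close> is the entry \<open>(I,J)\<close> of the encoder applied to the matrix unit \<open>E\<^sub>i\<^sub>j\<close>,
  and \<open>r m A B a b\<close> the entry \<open>(a,b)\<close> of the decoder applied to \<open>E\<^sub>A\<^sub>B\<close>; the positions of the words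
  range over an arbitrary finite set \<open>T\<close>.\<close>

definition acode :: "nat \<Rightarrow> nat \<Rightarrow> 'p set \<Rightarrow> nat \<Rightarrow> nat \<Rightarrow> nat \<Rightarrow> (nat \<Rightarrow> nat \<Rightarrow> nat \<Rightarrow> 'p wkern) \<Rightarrow>
    (nat \<Rightarrow> ('p \<Rightarrow> nat) \<Rightarrow> ('p \<Rightarrow> nat) \<Rightarrow> nat \<Rightarrow> nat \<Rightarrow> complex) \<Rightarrow> bool" where
  "acode dA dB T M1 M2 D p r \<longleftrightarrow> 1 \<le> M1 \<and> 1 \<le> M2 \<and> M2 \<le> D \<and>
     (\<forall>m<M1. gram ({..<M2} \<times> words dA T) (\<lambda>x y. p m (fst x) (fst y) (snd x) (snd y))) \<and>
     (\<forall>m<M1. \<forall>i<M2. \<forall>j<M2. (\<Sum>I\<in>words dA T. p m i j I I) = (if i = j then 1 else 0)) \<and>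
     (\<forall>m<M1. gram (words dB T \<times> {..<D}) (\<lambda>x y. r m (fst x) (fst y) (snd x) (snd y))) \<and>
     (\<forall>A\<in>words dB T. \<forall>B\<in>words dB T. (\<Sum>m<M1. \<Sum>a<D. r m A B a a) = (if A = B then 1 else 0))"

lemma acodeD:
  assumes "acode dA dB T M1 M2 D p r"
  shows "1 \<le> M1" "1 \<le> M2" "M2 \<le> D"
    "m < M1 \<Longrightarrow> gram ({..<M2} \<times> words dA T) (\<lambda>x y. p m (fst x) (fst y) (snd x) (snd y))"
    "m < M1 \<Longrightarrow> i < M2 \<Longrightarrow> j < M2 \<Longrightarrow> (\<Sum>I\<in>words dA T. p m i j I I) = (if i = j then 1 else 0)"
    "m < M1 \<Longrightarrow> gram (words dB T \<times> {..<D}) (\<lambda>x y. r m (fst x) (fst y) (snd x) (snd y))"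
    "A \<in> words dB T \<Longrightarrow> B \<in> words dB T \<Longrightarrow> (\<Sum>m<M1. \<Sum>a<D. r m A B a a) = (if A = B then 1 else 0)"
  using assms unfolding acode_def by blast+

text \<open>The overlap of the transmitted state with the maximally entangled one: one factor
  \<open>1 / M2\<close> comes from the input state, the other from the target.\<close>

definition cfid :: "nat \<Rightarrow> nat \<Rightarrow> 'p set \<Rightarrow> ('p \<Rightarrow> letter) \<Rightarrow> nat \<Rightarrow> (nat \<Rightarrow> nat \<Rightarrow> 'p wkern) \<Rightarrow>
    (('p \<Rightarrow> nat) \<Rightarrow> ('p \<Rightarrow> nat) \<Rightarrow> nat \<Rightarrow> nat \<Rightarrow> complex) \<Rightarrow> complex" where
  "cfid dA dB T \<nu> M2 P R = complex_of_real (1 / (real M2)\<^sup>2) *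
     (\<Sum>i<M2. \<Sum>j<M2. pairing dA dB T \<nu> (P i j) (\<lambda>A B. R A B i j))"

definition afid where
  "afid dA dB T \<nu> M1 M2 p r = 1 / real M1 * (\<Sum>m<M1. Re (cfid dA dB T \<nu> M2 (p m) (r m)))"

text \<open>The composition of completely positive maps, on the level of Choi matrices: multiply the
  kernels of encoder, channel and decoder over the joint index set, then contract the inner
  indices.\<close>

lemma pairing_gram:
  assumes n: "\<forall>t\<in>T. chk dA dB (\<nu> t)"
    and P: "gram (X \<times> words dA T) (\<lambda>x y. P (fst x) (fst y) (snd x) (snd y))"
    and R: "gram (words dB T \<times> Z) (\<lambda>x y. R (fst x) (fst y) (snd x) (snd y))"
  shows "gram (X \<times> Z) (\<lambda>x y. pairing dA dB T \<nu> (P (fst x) (fst y)) (\<lambda>A B. R A B (snd x) (snd y)))"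
proof -
  let ?Y = "words dA T \<times> words dB T" and ?W = "X \<times> Z"
  let ?M = "\<lambda>u v. P (fst (snd u)) (fst (snd v)) (fst (fst u)) (fst (fst v)) *
     chanW T \<nu> (fst (fst u)) (fst (fst v)) (snd (fst u)) (snd (fst v)) * 
     R (snd (fst u)) (snd (fst v)) (snd (snd u)) (snd (snd v))"
  have "gram (?Y \<times> ?W) ?M"
  proof (intro gram_mult)
    show "gram (?Y \<times> ?W) (\<lambda>u v. P (fst (snd u)) (fst (snd v)) (fst (fst u)) (fst (fst v)))"
      using gram_vimage[OF P, of "?Y \<times> ?W" "\<lambda>u. (fst (snd u), fst (fst u))"] by auto
    show "gram (?Y \<times> ?W) (\<lambda>u v. chanW T \<nu> (fst (fst u)) (fst (fst v)) (snd (fst u)) (snd (fst v)))"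
      using gram_vimage[OF chanW_gram[OF n], where B="?Y \<times> ?W" and f=fst] by auto
    show "gram (?Y \<times> ?W) (\<lambda>u v. R (snd (fst u)) (snd (fst v)) (snd (snd u)) (snd (snd v)))"
      using gram_vimage[OF R, of "?Y \<times> ?W" "\<lambda>u. (snd (fst u), snd (snd u))"] by auto
  qed
  from gram_marg[OF this]
  have g: "gram ?W (\<lambda>w w'. \<Sum>y\<in>?Y. \<Sum>y'\<in>?Y. ?M (y,w) (y',w'))" .
  show ?thesis
  proof (rule gram_cong[OF g])
    fix x y :: "'b \<times> 'c"
    have "(\<Sum>u\<in>?Y. \<Sum>v\<in>?Y. ?M (u,x) (v,y)) = 
      (\<Sum>I\<in>words dA T. \<Sum>A\<in>words dB T. \<Sum>J\<in>words dA T. \<Sum>B\<in>words dB T. ?M ((I,A),x) ((J,B),y))"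
      by (simp only: sum.cartesian_product')
    also have "\<dots> = (\<Sum>I\<in>words dA T. \<Sum>J\<in>words dA T. \<Sum>A\<in>words dB T. \<Sum>B\<in>words dB T. ?M ((I,A),x) ((J,B),y))"
      by (rule sum.cong[OF refl], rule sum.swap)
    finally show "pairing dA dB T \<nu> (P (fst x) (fst y)) (\<lambda>A B. R A B (snd x) (snd y)) = (\<Sum>u\<in>?Y. \<Sum>v\<in>?Y. ?M (u,x) (v,y))"
      unfolding pairing_def by simp
  qed
qed

lemma gram_diag_fst: 
  assumes "gram (X \<times> X) (\<lambda>x y. K (fst x) (fst y) (snd x) (snd y))"
  shows "gram X (\<lambda>i j. K i j i j)"
  using gram_vimage[OF assms, of X "\<lambda>i. (i,i)"] by simp

lemma cfid_nonneg:
  assumes n: "\<forall>t\<in>T. chk dA dB (\<nu> t)"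
    and P: "gram ({..<M2} \<times> words dA T) (\<lambda>x y. P (fst x) (fst y) (snd x) (snd y))"
    and R: "gram (words dB T \<times> {..<M2}) (\<lambda>x y. R (fst x) (fst y) (snd x) (snd y))"
  shows "0 \<le> cfid dA dB T \<nu> M2 P R"
proof -
  have "gram {..<M2} (\<lambda>i j. pairing dA dB T \<nu> (P i j) (\<lambda>A B. R A B i j))"
    by (rule gram_diag_fst[OF pairing_gram[OF n P R]])
  from gram_sum_nonneg[OF this] show ?thesis unfolding cfid_def
    by (intro mult_nonneg_nonneg) (auto simp: less_eq_complex_def)
qed

lemma gram_Re_le:
  assumes "gram A K" "x \<in> A" "y \<in> A"
  shows "2 * Re (K x y) \<le> Re (K x x) + Re (K y y)"
proof -
  obtain vs where v: "\<And>x y. x \<in> A \<Longrightarrow> y \<in> A \<Longrightarrow> K x y = (\<Sum>v\<leftarrow>vs. v x * cnj (v y))"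
    using assms unfolding gram_def by blast
  have "2 * Re (\<Sum>v\<leftarrow>us. v x * cnj (v y)) \<le> Re (\<Sum>v\<leftarrow>us. v x * cnj (v x)) + Re (\<Sum>v\<leftarrow>us. v y * cnj (v y))" for us
  proof (induction us)
    case (Cons u us)
    have "2 * Re (u x * cnj (u y)) \<le> Re (u x * cnj (u x)) + Re (u y * cnj (u y))"
      using sum_squares_bound[of "Re (u x)" "Re (u y)"] sum_squares_bound[of "Im (u x)" "Im (u y)"]
      by (simp add: power2_eq_square)
    then show ?case using Cons by simp
  qed simp
  then show ?thesis using v assms by simp
qed

lemma gram_Re_sum_le:
  assumes "gram {..<n} K"
  shows "Re (\<Sum>i<n. \<Sum>j<n. K i j) \<le> real n * (\<Sum>i<n. Re (K i i))"
proof -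
  have "Re (\<Sum>i<n. \<Sum>j<n. K i j) = (\<Sum>i<n. \<Sum>j<n. Re (K i j))" by simp
  also have "\<dots> \<le> (\<Sum>i<n. \<Sum>j<n. (Re (K i i) + Re (K j j)) / 2)"
  proof (intro sum_mono)
    fix i j assume "i \<in> {..<n}" "j \<in> {..<n}"
    then show "Re (K i j) \<le> (Re (K i i) + Re (K j j)) / 2" using gram_Re_le[OF assms, of i j] by simp
  qed
  also have "\<dots> = real n * (\<Sum>i<n. Re (K i i))"
    by (simp add: sum.distrib add_divide_distrib sum_distrib_left[symmetric] sum_divide_distrib[symmetric])
  finally show ?thesis .
qed

text \<open>Off-diagonal entries of a Gram kernel are dominated by diagonal ones. Thus transmitting
  entanglement is at least as hard as transmitting the basis states, on average.\<close>

lemma cfid_le_diag: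
  assumes n: "\<forall>t\<in>T. chk dA dB (\<nu> t)" and "1 \<le> M2"
    and P: "gram ({..<M2} \<times> words dA T) (\<lambda>x y. P (fst x) (fst y) (snd x) (snd y))"
    and R: "gram (words dB T \<times> {..<M2}) (\<lambda>x y. R (fst x) (fst y) (snd x) (snd y))"
  shows "Re (cfid dA dB T \<nu> M2 P R) \<le> 1 / real M2 * (\<Sum>i<M2. Re (pairing dA dB T \<nu> (P i i) (\<lambda>A B. R A B i i)))"
proof -
  let ?K = "\<lambda>i j. pairing dA dB T \<nu> (P i j) (\<lambda>A B. R A B i j)"
  have "gram {..<M2} ?K"
    by (rule gram_diag_fst[OF pairing_gram[OF n P R]])
  note g = gram_Re_sum_le[OF this]
  have "Re (cfid dA dB T \<nu> M2 P R) = 1 / (real M2)\<^sup>2 * Re (\<Sum>i<M2. \<Sum>j<M2. ?K i j)"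
    unfolding cfid_def by (simp del: Re_sum)
  also have "\<dots> \<le> 1 / (real M2)\<^sup>2 * (real M2 * (\<Sum>i<M2. Re (?K i i)))"
    by (rule mult_left_mono[OF g]) simp
  also have "\<dots> = 1 / real M2 * (\<Sum>i<M2. Re (?K i i))"
    using assms(2) by (simp add: power2_eq_square)
  finally show ?thesis .
qed

text \<open>Paired with the trace functional, the channels disappear by trace preservation. This is
  what makes the outcome weights of a complete measurement sum to 1.\<close>

lemma pairing_ident:
  assumes n: "\<forall>t\<in>T. chk dA dB (\<nu> t)" and T: "finite T"
    and R: "\<And>A B. A \<in> words dB T \<Longrightarrow> B \<in> words dB T \<Longrightarrow> R A B = (if A = B then 1 else 0)"
  shows "pairing dA dB T \<nu> P R = (\<Sum>I\<in>words dA T. P I I)"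
proof -
  have "pairing dA dB T \<nu> P R = (\<Sum>I\<in>words dA T. \<Sum>J\<in>words dA T. P I J * (\<Sum>A\<in>words dB T. chanW T \<nu> I J A A))"
    unfolding pairing_def
  proof (intro sum.cong refl)
    fix I J
    have "(\<Sum>A\<in>words dB T. \<Sum>B\<in>words dB T. P I J * chanW T \<nu> I J A B * R A B)
      = (\<Sum>A\<in>words dB T. \<Sum>B\<in>words dB T. if B = A then P I J * chanW T \<nu> I J A A else 0)"
      using R by (intro sum.cong refl) auto
    then show "(\<Sum>A\<in>words dB T. \<Sum>B\<in>words dB T. P I J * chanW T \<nu> I J A B * R A B) = P I J * (\<Sum>A\<in>words dB T. chanW T \<nu> I J A A)"
      using finite_words[OF T] by (simp add: sum_distrib_left)
  qed
  also have "\<dots> = (\<Sum>I\<in>words dA T. \<Sum>J\<in>words dA T. if J = I then P I I else 0)"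
    using chanW_trace[OF n T] by (intro sum.cong refl) auto
  finally show ?thesis using finite_words[OF T] by simp
qed

lemma gram_section1: "gram (X \<times> Y) (\<lambda>x y. K (fst x) (fst y) (snd x) (snd y)) \<Longrightarrow> i \<in> X \<Longrightarrow> gram Y (\<lambda>I J. K i i I J)"
  using gram_vimage[of "X \<times> Y" _ Y "\<lambda>I. (i,I)"] by fastforce

lemma gram_section2: "gram (X \<times> Y) (\<lambda>x y. K (fst x) (fst y) (snd x) (snd y)) \<Longrightarrow> a \<in> Y \<Longrightarrow> gram X (\<lambda>A B. K A B a a)"
  using gram_vimage[of "X \<times> Y" _ X "\<lambda>A. (A,a)"] by fastforce

lemma gram_subset: "gram A K \<Longrightarrow> B \<subseteq> A \<Longrightarrow> gram B K"
  unfolding gram_def by blast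

lemma pairing_nonneg:
  assumes n: "\<forall>t\<in>T. chk dA dB (\<nu> t)" and P: "gram (words dA T) P" and R: "gram (words dB T) R"
  shows "0 \<le> pairing dA dB T \<nu> P R"
proof -
  have P': "gram ((UNIV :: unit set) \<times> words dA T) (\<lambda>x y. (\<lambda>_ _. P) (fst x) (fst y) (snd x) (snd y))"
    by (rule gram_vimage[OF P, of _ snd]) auto
  have R': "gram (words dB T \<times> (UNIV :: unit set)) (\<lambda>x y. (\<lambda>A B _ _. R A B) (fst x) (fst y) (snd x) (snd y))"
    by (rule gram_vimage[OF R, of _ fst]) auto
  from gram_diag_nonneg[OF pairing_gram[OF n P' R'], where x="((),())"] show ?thesis by auto
qed

lemma pairing_decode_le_1:
  assumes n: "\<forall>t\<in>T. chk dA dB (\<nu> t)" and T: "finite T"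
    and c: "acode dA dB T M1 M2 D p r" and "m < M1" "i < M2"
    and S: "S \<subseteq> {..<M1} \<times> {..<D}"
  shows "(\<Sum>(m',a)\<in>S. Re (pairing dA dB T \<nu> (p m i i) (\<lambda>A B. r m' A B a a))) \<le> 1"
proof -
  have nn: "0 \<le> pairing dA dB T \<nu> (p m i i) (\<lambda>A B. r m' A B a a)" if "m' < M1" "a < D" for m' a
    using acodeD[OF c] assms(4,5) that
    by (intro pairing_nonneg[OF n] gram_section1[of "{..<M2}" _ "p m"] gram_section2[of _ "{..<D}" "r m'"]) auto
  have "(\<Sum>(m',a)\<in>S. Re (pairing dA dB T \<nu> (p m i i) (\<lambda>A B. r m' A B a a)))
     \<le> (\<Sum>(m',a)\<in>{..<M1} \<times> {..<D}. Re (pairing dA dB T \<nu> (p m i i) (\<lambda>A B. r m' A B a a)))"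
    using S nn by (intro sum_mono2) (auto simp: less_eq_complex_def)
  also have "\<dots> = Re (\<Sum>m'<M1. \<Sum>a<D. pairing dA dB T \<nu> (p m i i) (\<lambda>A B. r m' A B a a))"
    by (simp add: sum.cartesian_product split_def)
  also have "(\<Sum>m'<M1. \<Sum>a<D. pairing dA dB T \<nu> (p m i i) (\<lambda>A B. r m' A B a a))
     = pairing dA dB T \<nu> (p m i i) (\<lambda>A B. \<Sum>m'<M1. \<Sum>a<D. r m' A B a a)"
    unfolding pairing_sum_right ..
  also have "\<dots> = 1"
    using acodeD[OF c] assms(4,5) by (subst pairing_ident[OF n T]) auto
  finally show ?thesis by simp
qed

lemma cfid_bounds:
  assumes n: "\<forall>t\<in>T. chk dA dB (\<nu> t)" and T: "finite T"
    and c: "acode dA dB T M1 M2 D p r" and m: "m < M1"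
  shows "0 \<le> Re (cfid dA dB T \<nu> M2 (p m) (r m))" "Re (cfid dA dB T \<nu> M2 (p m) (r m)) \<le> 1"
proof -
  have R: "gram (words dB T \<times> {..<M2}) (\<lambda>x y. r m (fst x) (fst y) (snd x) (snd y))"
    by (rule gram_subset[OF acodeD(6)[OF c m]]) (use acodeD(3)[OF c] in auto)
  show "0 \<le> Re (cfid dA dB T \<nu> M2 (p m) (r m))"
    using cfid_nonneg[OF n acodeD(4)[OF c m] R] by (simp add: less_eq_complex_def)
  have "Re (cfid dA dB T \<nu> M2 (p m) (r m)) \<le> 1 / real M2 * (\<Sum>i<M2. Re (pairing dA dB T \<nu> (p m i i) (\<lambda>A B. r m A B i i)))"
    by (rule cfid_le_diag[OF n acodeD(2)[OF c] acodeD(4)[OF c m] R])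
  also have "\<dots> \<le> 1 / real M2 * (\<Sum>i<M2. 1)"
  proof (intro mult_left_mono sum_mono)
    fix i assume "i \<in> {..<M2}"
    then show "Re (pairing dA dB T \<nu> (p m i i) (\<lambda>A B. r m A B i i)) \<le> 1"
      using pairing_decode_le_1[OF n T c m, of i "{(m,i)}"] acodeD(3)[OF c] m by auto
  qed simp
  also have "\<dots> = 1" using acodeD(2)[OF c] by simp
  finally show "Re (cfid dA dB T \<nu> M2 (p m) (r m)) \<le> 1" .
qed

lemma avg_bounds:
  assumes "1 \<le> M" "\<And>m. m < M \<Longrightarrow> 0 \<le> f m" "\<And>m. m < M \<Longrightarrow> f m \<le> (1::real)"
  shows "0 \<le> 1 / real M * (\<Sum>m<M. f m)" "1 / real M * (\<Sum>m<M. f m) \<le> 1"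
proof -
  show "0 \<le> 1 / real M * (\<Sum>m<M. f m)" using assms by (intro mult_nonneg_nonneg sum_nonneg) auto
  have "(\<Sum>m<M. f m) \<le> (\<Sum>m<M. 1)" using assms by (intro sum_mono) auto
  then show "1 / real M * (\<Sum>m<M. f m) \<le> 1" using assms(1) by (simp add: field_simps)
qed

lemma afid_bounds:
  assumes n: "\<forall>t\<in>T. chk dA dB (\<nu> t)" and T: "finite T"
    and c: "acode dA dB T M1 M2 D p r"
  shows "0 \<le> afid dA dB T \<nu> M1 M2 p r" "afid dA dB T \<nu> M1 M2 p r \<le> 1"
  unfolding afid_def using cfid_bounds[OF n T c] acodeD(1)[OF c] by (intro avg_bounds; simp)+

section \<open>Operations on codes: measuring, combining, padding, transporting, mixing\<close>

lemma div_mod_less: "u < M1 * M2 \<Longrightarrow> u div M2 < M1 \<and> u mod M2 < (M2::nat)"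
  by (metis less_mult_imp_div_less mod_less_divisor mult_0_right not_less_zero gr0I)

lemma sum_div_mod: "(\<Sum>u<M1 * M2. g (u div M2) (u mod M2)) = (\<Sum>m<M1. \<Sum>i<(M2::nat). g m i)"
proof (cases "M2 = 0")
  case False
  have "(\<Sum>u<M1 * M2. g (u div M2) (u mod M2)) = (\<Sum>m<M1. sum (\<lambda>u. g (u div M2) (u mod M2)) {m * M2 ..< m * M2 + M2})"
    by (rule sum.nat_group[symmetric])
  also have "\<dots> = (\<Sum>m<M1. \<Sum>i<M2. g m i)"
  proof (rule sum.cong[OF refl])
    fix m
    have "sum (\<lambda>u. g (u div M2) (u mod M2)) {0 + m * M2 ..< M2 + m * M2} = (\<Sum>i=0..<M2. g ((i + m * M2) div M2) ((i + m * M2) mod M2))"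
      by (subst sum.atLeastLessThan_shift_bounds) (simp add: add.commute)
    also have "\<dots> = (\<Sum>i=0..<M2. g m i)" using False by (intro sum.cong refl) simp
    finally show "sum (\<lambda>u. g (u div M2) (u mod M2)) {m * M2 ..< m * M2 + M2} = (\<Sum>i<M2. g m i)"
      by (simp add: add.commute lessThan_atLeast0)
  qed
  finally show ?thesis .
qed simp

text \<open>Measuring the transmitted half of the maximally entangled state in the computational basis
  turns a CET code into a purely classical code with \<open>M1 * M2\<close> messages. Outcomes outside the
  code space are attributed to one of the messages to keep the measurement complete.\<close>

lemma acode_classical:
  assumes c: "acode dA dB T M1 M2 D p r" and T: "finite T"
  shows "\<exists>p' r'. acode dA dB T (M1 * M2) 1 1 p' r' \<and>
     (\<forall>\<nu>. (\<forall>t\<in>T. chk dA dB (\<nu> t)) \<longrightarrow> afid dA dB T \<nu> M1 M2 p r \<le> afid dA dB T \<nu> (M1 * M2) 1 p' r')"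
proof -
  \<comment> \<open>Message \<open>u\<close> stands for the pair
    \<open>(u div M2, u mod M2)\<close>; the outcomes from \<open>M2\<close> on are credited to
    those \<open>u\<close> with second component 0.\<close>
  define p' where "p' = (\<lambda>u (i::nat) (j::nat). p (u div M2) (u mod M2) (u mod M2))"
  define r' where "r' = (\<lambda>u A B (a::nat) (b::nat). r (u div M2) A B (u mod M2) (u mod M2)
     + (\<Sum>e\<in>{M2..<D}. if u mod M2 = 0 then r (u div M2) A B e e else 0))"
  note cD = acodeD[OF c]
  have gr: "gram (words dB T \<times> {..<1}) (\<lambda>x y. r' u (fst x) (fst y) (snd x) (snd y))" if "u < M1 * M2" for u
  proof -
    have g: "gram (words dB T \<times> {..<1::nat}) (\<lambda>x y. r (u div M2) (fst x) (fst y) a a)" if "a < D" for a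
      using gram_vimage[OF gram_section2[OF cD(6), of "u div M2" a], of "words dB T \<times> {..<1::nat}" fst] that div_mod_less[OF \<open>u < M1 * M2\<close>] by auto
    show ?thesis unfolding r'_def
      using g div_mod_less[OF that] cD(3)
      by (intro gram_add gram_sum) (cases "u mod M2 = 0"; auto simp: gram_0)+
  qed
  have "acode dA dB T (M1 * M2) 1 1 p' r'"
    unfolding acode_def
  proof (intro conjI allI impI ballI)
    show "1 \<le> M1 * M2" using cD(1,2) by simp
    fix u assume u: "u < M1 * M2"
    note u' = div_mod_less[OF u]
    show "gram ({..<1} \<times> words dA T) (\<lambda>x y. p' u (fst x) (fst y) (snd x) (snd y))"
      unfolding p'_def using gram_vimage[OF gram_section1[OF cD(4), of "u div M2" "u mod M2"], of "{..<1::nat} \<times> words dA T" snd] u' by auto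
    show "gram (words dB T \<times> {..<1}) (\<lambda>x y. r' u (fst x) (fst y) (snd x) (snd y))" by (rule gr[OF u])
    fix i j :: nat assume "i < 1" "j < 1"
    then show "(\<Sum>I\<in>words dA T. p' u i j I I) = (if i = j then 1 else 0)"
      unfolding p'_def using u' cD(5) by auto
  next
    fix A B assume AB: "A \<in> words dB T" "B \<in> words dB T"
    have "(\<Sum>u<M1 * M2. \<Sum>a<1. r' u A B a a) = (\<Sum>m<M1. \<Sum>i<M2. r m A B i i + (\<Sum>e\<in>{M2..<D}. if i = 0 then r m A B e e else 0))"
      unfolding r'_def
      by (simp add: sum_div_mod[of "\<lambda>m i. r m A B i i + (\<Sum>e\<in>{M2..<D}. if i = 0 then r m A B e e else 0)"])
    also have "\<dots> = (\<Sum>m<M1. \<Sum>a<D. r m A B a a)"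
    proof (rule sum.cong[OF refl])
      fix m
      have "(\<Sum>i<M2. \<Sum>e\<in>{M2..<D}. if i = 0 then r m A B e e else 0) = (\<Sum>i<M2. if i = 0 then (\<Sum>e\<in>{M2..<D}. r m A B e e) else 0)"
        by (intro sum.cong refl) auto
      also have "\<dots> = (\<Sum>e\<in>{M2..<D}. r m A B e e)" using cD(2) by simp
      finally have "(\<Sum>i<M2. \<Sum>e\<in>{M2..<D}. if i = 0 then r m A B e e else 0) = (\<Sum>e\<in>{M2..<D}. r m A B e e)" .
      moreover have "(\<Sum>a<D. r m A B a a) = (\<Sum>a<M2. r m A B a a) + (\<Sum>e\<in>{M2..<D}. r m A B e e)"
        using cD(3) by (metis atLeast0LessThan le0 sum.atLeastLessThan_concat)
      ultimately show "(\<Sum>i<M2. r m A B i i + (\<Sum>e\<in>{M2..<D}. if i = 0 then r m A B e e else 0)) = (\<Sum>a<D. r m A B a a)"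
        by (simp add: sum.distrib)
    qed
    also have "\<dots> = (if A = B then 1 else 0)" by (rule cD(7)[OF AB])
    finally show "(\<Sum>u<M1 * M2. \<Sum>a<1. r' u A B a a) = (if A = B then 1 else 0)" .
  qed simp_all
  moreover have "afid dA dB T \<nu> M1 M2 p r \<le> afid dA dB T \<nu> (M1 * M2) 1 p' r'" if nu: "\<forall>t\<in>T. chk dA dB (\<nu> t)" for \<nu>
  proof -
    note n = nu
    let ?f = "\<lambda>m i. Re (pairing dA dB T \<nu> (p m i i) (\<lambda>A B. r m A B i i))"
    have "afid dA dB T \<nu> M1 M2 p r \<le> 1 / real M1 * (\<Sum>m<M1. 1 / real M2 * (\<Sum>i<M2. ?f m i))"
      unfolding afid_def
    proof (intro mult_left_mono sum_mono)
      fix m assume m: "m \<in> {..<M1}"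
      have R: "gram (words dB T \<times> {..<M2}) (\<lambda>x y. r m (fst x) (fst y) (snd x) (snd y))"
        by (rule gram_subset[OF cD(6)]) (use cD(3) m in auto)
      show "Re (cfid dA dB T \<nu> M2 (p m) (r m)) \<le> 1 / real M2 * (\<Sum>i<M2. ?f m i)"
        using cfid_le_diag[OF n cD(2) cD(4) R] m by simp
    qed simp
    also have "\<dots> = 1 / real (M1 * M2) * (\<Sum>u<M1 * M2. ?f (u div M2) (u mod M2))"
      by (subst sum_div_mod) (simp add: sum_distrib_left)
    also have "\<dots> \<le> afid dA dB T \<nu> (M1 * M2) 1 p' r'"
      unfolding afid_def
    proof (intro mult_left_mono sum_mono)
      fix u assume "u \<in> {..<M1 * M2}"
      then have u: "u < M1 * M2" and u': "u div M2 < M1" "u mod M2 < M2" using div_mod_less by auto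
      have gp: "gram (words dA T) (p (u div M2) (u mod M2) (u mod M2))"
        using gram_section1[OF cD(4)] u' by auto
      have "0 \<le> pairing dA dB T \<nu> (p (u div M2) (u mod M2) (u mod M2)) (\<lambda>A B. \<Sum>e\<in>{M2..<D}. if u mod M2 = 0 then r (u div M2) A B e e else 0)"
        using gram_section2[OF cD(6)[of "u div M2"]] u'
        by (intro pairing_nonneg[OF n gp] gram_sum) (cases "u mod M2 = 0"; auto simp: gram_0)
      then show "?f (u div M2) (u mod M2) \<le> Re (cfid dA dB T \<nu> 1 (p' u) (r' u))"
        unfolding cfid_def p'_def r'_def by (simp add: pairing_add_right less_eq_complex_def)
    qed simp
    finally show ?thesis .
  qed
  ultimately show ?thesis by blast
qed

lemma words_Un_eq_iff:
  assumes "A \<in> words d (T1 \<union> T2)" "B \<in> words d (T1 \<union> T2)"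
  shows "A = B \<longleftrightarrow> restrict A T1 = restrict B T1 \<and> restrict A T2 = restrict B T2"
proof
  assume r: "restrict A T1 = restrict B T1 \<and> restrict A T2 = restrict B T2"
  have "A t = B t" if "t \<in> T1 \<union> T2" for t
    using r that by (metis Un_iff restrict_apply')
  then show "A = B" using assms unfolding words_def by (metis PiE_ext)
qed simp

text \<open>A random code is derandomized by a classical prefix: the encoder itself draws the index \<open>k\<close>,
  sends it over the positions \<open>T1\<close> and uses the \<open>k\<close>-th code on the positions \<open>T2\<close>.\<close>

lemma acode_combine:
  assumes d: "T1 \<inter> T2 = {}" and f: "finite T1" "finite T2"
    and c1: "acode dA dB T1 K 1 1 \<delta> \<Lambda>"
    and c2: "\<And>k. k < K \<Longrightarrow> acode dA dB T2 M1 M2 (D k) (p k) (r k)"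
  shows "\<exists>D' p' r'. acode dA dB (T1 \<union> T2) M1 M2 D' p' r' \<and>
    (\<forall>\<nu>. (\<forall>t\<in>T1 \<union> T2. chk dA dB (\<nu> t)) \<longrightarrow>
      1 / real K * (\<Sum>k<K. Re (cfid dA dB T1 \<nu> 1 (\<delta> k) (\<Lambda> k)) * afid dA dB T2 \<nu> M1 M2 (p k) (r k))
      \<le> afid dA dB (T1 \<union> T2) \<nu> M1 M2 p' r')"
proof -
  let ?T = "T1 \<union> T2"
  \<comment> \<open>The sum is just a convenient common dimension containing every
    \<open>{..<D k}\<close>.\<close>
  define D' where "D' = (\<Sum>k<K. D k)"
  define p' where "p' = (\<lambda>m i j I J. \<Sum>k<K. complex_of_real (1 / real K) *
     (\<delta> k 0 0 (restrict I T1) (restrict J T1) * p k m i j (restrict I T2) (restrict J T2)))"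
  \<comment> \<open>The decoder with index \<open>k\<close> is embedded in the leading
    \<open>D k\<close> coordinates of the common output space and is weighted by the event that the
    prefix is decoded as \<open>k\<close>.\<close>
  define r' where "r' = (\<lambda>m A B a b. \<Sum>k<K. \<Lambda> k (restrict A T1) (restrict B T1) 0 0 *
     (if a < D k \<and> b < D k then r k m (restrict A T2) (restrict B T2) a b else 0))"
  note c1D = acodeD[OF c1] and c2D = acodeD[OF c2]
  have K: "1 \<le> K" by (rule c1D(1))
  have DD: "D k \<le> D'" if "k < K" for k unfolding D'_def using that by (intro member_le_sum) auto
  have M: "1 \<le> M1" "1 \<le> M2" "M2 \<le> D'" using c2D(1-3)[of 0] DD[of 0] K by auto
  have r1: "restrict I T1 \<in> words e T1" "restrict I T2 \<in> words e T2" if "I \<in> words e ?T" for I e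
    using that by (auto intro: restrict_words)
  have g\<delta>: "gram (words dA T1) (\<delta> k 0 0)" "gram (words dB T1) (\<lambda>A B. \<Lambda> k A B 0 0)" if "k < K" for k
    using gram_section1[OF c1D(4)[OF that], of 0] gram_section2[OF c1D(6)[OF that], of 0] by auto
  have gp: "gram ({..<M2} \<times> words dA ?T) (\<lambda>x y. p' m (fst x) (fst y) (snd x) (snd y))" if "m < M1" for m
    unfolding p'_def
  proof (intro gram_sum gram_scale gram_mult)
    fix k assume k: "k \<in> {..<K}"
    show "gram ({..<M2} \<times> words dA ?T) (\<lambda>x y. \<delta> k 0 0 (restrict (snd x) T1) (restrict (snd y) T1))"
      using k by (intro gram_vimage[OF g\<delta>(1), of _ _ "\<lambda>x. restrict (snd x) T1"]) (auto intro: r1)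
    have g: "gram ({..<M2} \<times> words dA T2) (\<lambda>x y. p k m (fst x) (fst y) (snd x) (snd y))"
      using c2D(4) k that by auto
    show "gram ({..<M2} \<times> words dA ?T) (\<lambda>x y. p k m (fst x) (fst y) (restrict (snd x) T2) (restrict (snd y) T2))"
      by (rule gram_vimage[OF g, of _ "\<lambda>x. (fst x, restrict (snd x) T2)", simplified]) (auto intro: r1)
  qed simp
  have grk: "gram (words dB ?T \<times> {..<D'}) (\<lambda>x y. \<Lambda> k (restrict (fst x) T1) (restrict (fst y) T1) 0 0 *
     (if snd x < D k \<and> snd y < D k then r k' m (restrict (fst x) T2) (restrict (fst y) T2) (snd x) (snd y) else 0))"
    if "m < M1" "k < K" "k' = k" for m k k'
  proof (rule gram_mult)
    show "gram (words dB ?T \<times> {..<D'}) (\<lambda>x y. \<Lambda> k (restrict (fst x) T1) (restrict (fst y) T1) 0 0)"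
      using that by (intro gram_vimage[OF g\<delta>(2), of _ _ "\<lambda>x. restrict (fst x) T1"]) (auto intro: r1)
    have g: "gram (words dB T2 \<times> {..<D k}) (\<lambda>x y. r k m (fst x) (fst y) (snd x) (snd y))"
      using c2D(6) that by auto
    have g': "gram (words dB ?T \<times> {..<D k}) (\<lambda>x y. r k m (restrict (fst x) T2) (restrict (fst y) T2) (snd x) (snd y))"
      by (rule gram_vimage[OF g, of _ "\<lambda>x. (restrict (fst x) T2, snd x)", simplified]) (auto intro: r1)
    show "gram (words dB ?T \<times> {..<D'}) (\<lambda>x y. if snd x < D k \<and> snd y < D k then r k' m (restrict (fst x) T2) (restrict (fst y) T2) (snd x) (snd y) else 0)"
      unfolding that(3) by (rule gram_truncate[OF g', of _ "\<lambda>x. snd x < D k"]) auto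
  qed
  have "acode dA dB ?T M1 M2 D' p' r'"
    unfolding acode_def
  proof (intro conjI allI impI ballI)
    show "1 \<le> M1" "1 \<le> M2" "M2 \<le> D'" by (fact M)+
    fix m assume m: "m < M1"
    show "gram ({..<M2} \<times> words dA ?T) (\<lambda>x y. p' m (fst x) (fst y) (snd x) (snd y))" by (rule gp[OF m])
    show "gram (words dB ?T \<times> {..<D'}) (\<lambda>x y. r' m (fst x) (fst y) (snd x) (snd y))"
      unfolding r'_def using grk m by (intro gram_sum) auto
    fix i j assume ij: "i < M2" "j < M2"
    have "(\<Sum>I\<in>words dA ?T. p' m i j I I) = (\<Sum>k<K. complex_of_real (1 / real K) *
        (\<Sum>I\<in>words dA ?T. \<delta> k 0 0 (restrict I T1) (restrict I T1) * p k m i j (restrict I T2) (restrict I T2)))"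
      unfolding p'_def by (subst sum.swap) (simp add: sum_distrib_left)
    also have "\<dots> = (\<Sum>k<K. complex_of_real (1 / real K) * (if i = j then 1 else 0))"
    proof (rule sum.cong[OF refl])
      fix k assume k: "k \<in> {..<K}"
      have "(\<Sum>I\<in>words dA ?T. \<delta> k 0 0 (restrict I T1) (restrict I T1) * p k m i j (restrict I T2) (restrict I T2))
        = (\<Sum>I1\<in>words dA T1. \<Sum>I2\<in>words dA T2. \<delta> k 0 0 I1 I1 * p k m i j I2 I2)"
        by (rule sum_words_Un[OF d])
      also have "\<dots> = (\<Sum>I1\<in>words dA T1. \<delta> k 0 0 I1 I1) * (\<Sum>I2\<in>words dA T2. p k m i j I2 I2)"
        by (simp add: sum_product)
      also have "\<dots> = (if i = j then 1 else 0)" using c1D(5)[of k 0 0] c2D(5)[of k m i j] k m ij by simp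
      finally show "complex_of_real (1 / real K) * (\<Sum>I\<in>words dA ?T. \<delta> k 0 0 (restrict I T1) (restrict I T1) * p k m i j (restrict I T2) (restrict I T2))
         = complex_of_real (1 / real K) * (if i = j then 1 else 0)" by (simp only:)
    qed
    also have "\<dots> = (if i = j then 1 else 0)" using K by simp
    finally show "(\<Sum>I\<in>words dA ?T. p' m i j I I) = (if i = j then 1 else 0)" .
  next
    fix A B assume AB: "A \<in> words dB ?T" "B \<in> words dB ?T"
    note A = r1[OF AB(1)] and B = r1[OF AB(2)]
    have "(\<Sum>m<M1. \<Sum>a<D'. r' m A B a a) = (\<Sum>m<M1. \<Sum>k<K. \<Sum>a<D'. \<Lambda> k (restrict A T1) (restrict B T1) 0 0 *
       (if a < D k then r k m (restrict A T2) (restrict B T2) a a else 0))"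
      unfolding r'_def by (rule sum.cong[OF refl], subst sum.swap) simp
    also have "\<dots> = (\<Sum>k<K. \<Sum>m<M1. \<Sum>a<D'. \<Lambda> k (restrict A T1) (restrict B T1) 0 0 *
       (if a < D k then r k m (restrict A T2) (restrict B T2) a a else 0))" by (rule sum.swap)
    also have "\<dots> = (\<Sum>k<K. \<Lambda> k (restrict A T1) (restrict B T1) 0 0 * (if restrict A T2 = restrict B T2 then 1 else 0))"
    proof (rule sum.cong[OF refl])
      fix k assume k: "k \<in> {..<K}"
      have "(\<Sum>a<D'. if a < D k then r k m (restrict A T2) (restrict B T2) a a else 0) = (\<Sum>a<D k. r k m (restrict A T2) (restrict B T2) a a)" for m
        using DD[of k] k by (intro sum.mono_neutral_cong_right) auto
      then show "(\<Sum>m<M1. \<Sum>a<D'. \<Lambda> k (restrict A T1) (restrict B T1) 0 0 * (if a < D k then r k m (restrict A T2) (restrict B T2) a a else 0))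
        = \<Lambda> k (restrict A T1) (restrict B T1) 0 0 * (if restrict A T2 = restrict B T2 then 1 else 0)"
        using c2D(7)[OF _ A(2) B(2), of k] k by (simp add: sum_distrib_left[symmetric])
    qed
    also have "\<dots> = (if restrict A T1 = restrict B T1 then 1 else 0) * (if restrict A T2 = restrict B T2 then 1 else 0)"
      using c1D(7)[OF A(1) B(1)] by (simp add: sum_distrib_right[symmetric])
    also have "\<dots> = (if A = B then 1 else 0)" using words_Un_eq_iff[OF AB] by auto
    finally show "(\<Sum>m<M1. \<Sum>a<D'. r' m A B a a) = (if A = B then 1 else 0)" .
  qed
  moreover have "1 / real K * (\<Sum>k<K. Re (cfid dA dB T1 \<nu> 1 (\<delta> k) (\<Lambda> k)) * afid dA dB T2 \<nu> M1 M2 (p k) (r k))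
      \<le> afid dA dB (T1 \<union> T2) \<nu> M1 M2 p' r'" if nu: "\<forall>t\<in>T1 \<union> T2. chk dA dB (\<nu> t)" for \<nu>
  proof -
    have n: "\<forall>t\<in>T1. chk dA dB (\<nu> t)" "\<forall>t\<in>T2. chk dA dB (\<nu> t)" using nu by auto
    let ?e = "\<lambda>k k'. pairing dA dB T1 \<nu> (\<delta> k 0 0) (\<lambda>A B. \<Lambda> k' A B 0 0)"
    have e: "cfid dA dB T1 \<nu> 1 (\<delta> k) (\<Lambda> k) = ?e k k" for k unfolding cfid_def by simp
    have e0: "0 \<le> ?e k k'" if "k < K" "k' < K" for k k'
      by (rule pairing_nonneg[OF n(1) g\<delta>(1)[OF that(1)] g\<delta>(2)[OF that(2)]])
    have f0: "0 \<le> cfid dA dB T2 \<nu> M2 (p k m) (r k' m)" if "k < K" "k' < K" "m < M1" for k k' m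
      by (rule cfid_nonneg[OF n(2) c2D(4)[OF that(1,3)] gram_subset[OF c2D(6)[OF that(2,3)]]]) (use c2D(3)[OF that(2)] in auto)
    have main: "(\<Sum>k<K. Re (?e k k) * Re (cfid dA dB T2 \<nu> M2 (p k m) (r k m))) \<le> real K * Re (cfid dA dB ?T \<nu> M2 (p' m) (r' m))" if m: "m < M1" for m
    proof -
      have pr: "pairing dA dB ?T \<nu> (p' m i j) (\<lambda>A B. r' m A B i j)
          = complex_of_real (1 / real K) * (\<Sum>k<K. \<Sum>k'<K. ?e k k' * pairing dA dB T2 \<nu> (p k m i j) (\<lambda>A B. r k' m A B i j))"
        if ij: "i < M2" "j < M2" for i j
      proof -
        have "pairing dA dB ?T \<nu> (p' m i j) (\<lambda>A B. r' m A B i j)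
          = (\<Sum>k<K. \<Sum>k'<K. complex_of_real (1 / real K) * pairing dA dB ?T \<nu>
             (\<lambda>I J. \<delta> k 0 0 (restrict I T1) (restrict J T1) * p k m i j (restrict I T2) (restrict J T2))
             (\<lambda>A B. \<Lambda> k' (restrict A T1) (restrict B T1) 0 0 * (if i < D k' \<and> j < D k' then r k' m (restrict A T2) (restrict B T2) i j else 0)))"
          unfolding p'_def r'_def pairing_sum_left pairing_scale_left pairing_sum_right by (simp add: sum_distrib_left)
        also have "\<dots> = (\<Sum>k<K. \<Sum>k'<K. complex_of_real (1 / real K) * (?e k k' * pairing dA dB T2 \<nu> (p k m i j) (\<lambda>A B. r k' m A B i j)))"
        proof (intro sum.cong refl)
          fix k k' assume k: "k \<in> {..<K}" "k' \<in> {..<K}"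
          have "i < D k'" "j < D k'" using c2D(3)[of k'] k ij by auto
          then show "complex_of_real (1 / real K) * pairing dA dB ?T \<nu>
             (\<lambda>I J. \<delta> k 0 0 (restrict I T1) (restrict J T1) * p k m i j (restrict I T2) (restrict J T2))
             (\<lambda>A B. \<Lambda> k' (restrict A T1) (restrict B T1) 0 0 * (if i < D k' \<and> j < D k' then r k' m (restrict A T2) (restrict B T2) i j else 0))
             = complex_of_real (1 / real K) * (?e k k' * pairing dA dB T2 \<nu> (p k m i j) (\<lambda>A B. r k' m A B i j))"
            using pairing_tensor[OF d f, of dA dB \<nu> "\<delta> k 0 0" "p k m i j" "\<lambda>A B. \<Lambda> k' A B 0 0" "\<lambda>A B. r k' m A B i j"] by simp
        qed
        finally show ?thesis by (simp only: sum_distrib_left)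
      qed
      have "cfid dA dB ?T \<nu> M2 (p' m) (r' m) = complex_of_real (1 / (real M2)\<^sup>2) *
         (\<Sum>i<M2. \<Sum>j<M2. complex_of_real (1 / real K) * (\<Sum>k<K. \<Sum>k'<K. ?e k k' * pairing dA dB T2 \<nu> (p k m i j) (\<lambda>A B. r k' m A B i j)))"
        unfolding cfid_def using pr by simp
      also have "(\<Sum>i<M2. \<Sum>j<M2. complex_of_real (1 / real K) * (\<Sum>k<K. \<Sum>k'<K. ?e k k' * pairing dA dB T2 \<nu> (p k m i j) (\<lambda>A B. r k' m A B i j)))
         = complex_of_real (1 / real K) * (\<Sum>k<K. \<Sum>k'<K. ?e k k' * (\<Sum>i<M2. \<Sum>j<M2. pairing dA dB T2 \<nu> (p k m i j) (\<lambda>A B. r k' m A B i j)))"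
      proof -
        let ?h = "\<lambda>i j k k'. ?e k k' * pairing dA dB T2 \<nu> (p k m i j) (\<lambda>A B. r k' m A B i j)"
        have "(\<Sum>i<M2. \<Sum>j<M2. \<Sum>k<K. \<Sum>k'<K. ?h i j k k') = (\<Sum>(i,j,k,k')\<in>{..<M2}\<times>{..<M2}\<times>{..<K}\<times>{..<K}. ?h i j k k')"
          by (simp add: sum.cartesian_product)
        also have "\<dots> = (\<Sum>(k,k',i,j)\<in>{..<K}\<times>{..<K}\<times>{..<M2}\<times>{..<M2}. ?h i j k k')"
          by (rule sum.reindex_bij_witness[where i="\<lambda>(k,k',i,j). (i,j,k,k')" and j="\<lambda>(i,j,k,k'). (k,k',i,j)"]) auto
        also have "\<dots> = (\<Sum>k<K. \<Sum>k'<K. \<Sum>i<M2. \<Sum>j<M2. ?h i j k k')"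
          by (simp add: sum.cartesian_product)
        finally show ?thesis by (simp only: sum_distrib_left[symmetric])
      qed
      finally have c: "cfid dA dB ?T \<nu> M2 (p' m) (r' m) = complex_of_real (1 / real K) * (\<Sum>k<K. \<Sum>k'<K. ?e k k' * cfid dA dB T2 \<nu> M2 (p k m) (r k' m))"
        unfolding cfid_def by (simp add: sum_distrib_left mult_ac)
      have nn: "0 \<le> ?e k k' * cfid dA dB T2 \<nu> M2 (p k m) (r k' m)" if "k < K" "k' < K" for k k'
        by (rule mult_nonneg_nonneg[OF e0[OF that] f0[OF that m]])
      have "(\<Sum>k<K. Re (?e k k) * Re (cfid dA dB T2 \<nu> M2 (p k m) (r k m))) = (\<Sum>k<K. Re (?e k k * cfid dA dB T2 \<nu> M2 (p k m) (r k m)))"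
        using e0 by (intro sum.cong refl) (simp add: less_eq_complex_def)
      \<comment> \<open>The terms with \<open>k' = k\<close> describe a correctly decoded prefix;
        all other terms are nonnegative and only help.\<close>
      also have "\<dots> \<le> (\<Sum>k<K. \<Sum>k'<K. Re (?e k k' * cfid dA dB T2 \<nu> M2 (p k m) (r k' m)))"
      proof (rule sum_mono)
        fix k assume k: "k \<in> {..<K}"
        show "Re (?e k k * cfid dA dB T2 \<nu> M2 (p k m) (r k m)) \<le> (\<Sum>k'<K. Re (?e k k' * cfid dA dB T2 \<nu> M2 (p k m) (r k' m)))"
          by (rule member_le_sum[of k "{..<K}" "\<lambda>k'. Re (?e k k' * cfid dA dB T2 \<nu> M2 (p k m) (r k' m))"])
             (use k nn[of k] in \<open>simp_all add: less_eq_complex_def\<close>)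
      qed
      also have "\<dots> = real K * Re (cfid dA dB ?T \<nu> M2 (p' m) (r' m))"
        unfolding c using K by (simp del: times_complex.simps)
      finally show ?thesis .
    qed
    have "1 / real K * (\<Sum>k<K. Re (cfid dA dB T1 \<nu> 1 (\<delta> k) (\<Lambda> k)) * afid dA dB T2 \<nu> M1 M2 (p k) (r k))
      = 1 / real K * (1 / real M1 * (\<Sum>m<M1. \<Sum>k<K. Re (?e k k) * Re (cfid dA dB T2 \<nu> M2 (p k m) (r k m))))"
      unfolding afid_def e sum.swap[of _ "{..<K}" "{..<M1}"] by (simp add: sum_distrib_left mult_ac)
    also have "\<dots> \<le> 1 / real K * (1 / real M1 * (\<Sum>m<M1. real K * Re (cfid dA dB ?T \<nu> M2 (p' m) (r' m))))"
      using main by (intro mult_left_mono sum_mono) auto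
    also have "\<dots> = afid dA dB ?T \<nu> M1 M2 p' r'"
      unfolding afid_def sum_distrib_left[symmetric] using K by simp
    finally show ?thesis .
  qed
  ultimately show ?thesis by blast
qed

text \<open>The neutral element of \<open>acode_combine\<close>: the one message is sent as a
  constant word and decoded by the trace, without error. It fills idle positions.\<close>

lemma acode_trivial:
  assumes "1 \<le> dA" and T: "finite T"
  shows "\<exists>p r. acode dA dB T 1 1 1 p r \<and> (\<forall>\<nu>. (\<forall>t\<in>T. chk dA dB (\<nu> t)) \<longrightarrow> cfid dA dB T \<nu> 1 (p 0) (r 0) = 1)"
proof -
  let ?z = "\<lambda>t\<in>T. 0::nat"
  have z: "?z \<in> words dA T" using assms unfolding words_def by auto
  define p where "p = (\<lambda>(m::nat) (i::nat) (j::nat) I J. if I = J \<and> I = ?z then 1 else (0::complex))"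
  define r where "r = (\<lambda>(m::nat) A B (a::nat) (b::nat). if A = (B :: 'a \<Rightarrow> nat) then 1 else (0::complex))"
  have fw: "finite (words d T)" for d using finite_words[OF T] .
  have "acode dA dB T 1 1 1 p r"
    unfolding acode_def
  proof (intro conjI allI impI ballI)
    fix m
    show "gram ({..<1} \<times> words dA T) (\<lambda>x y. p m (fst x) (fst y) (snd x) (snd y))"
      unfolding p_def using fw by (intro gram_delta[of snd _ "\<lambda>I. I = ?z"]) auto
    show "gram (words dB T \<times> {..<1}) (\<lambda>x y. r m (fst x) (fst y) (snd x) (snd y))"
      unfolding r_def using fw gram_delta[of fst "words dB T \<times> {..<1::nat}" "\<lambda>I. True"] by auto
    fix i j :: nat assume "i < 1" "j < 1"
    have "(\<Sum>I\<in>words dA T. p m i j I I) = (\<Sum>I\<in>words dA T. if I = ?z then 1 else 0)"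
      unfolding p_def by (intro sum.cong refl) auto
    then show "(\<Sum>I\<in>words dA T. p m i j I I) = (if i = j then 1 else 0)"
      using z fw \<open>i < 1\<close> \<open>j < 1\<close> by simp
  qed (simp_all add: r_def)
  moreover have "cfid dA dB T \<nu> 1 (p 0) (r 0) = 1" if n: "\<forall>t\<in>T. chk dA dB (\<nu> t)" for \<nu>
  proof -
    have "pairing dA dB T \<nu> (p 0 0 0) (\<lambda>A B. r 0 A B 0 0) = (\<Sum>I\<in>words dA T. p 0 0 0 I I)"
      by (rule pairing_ident[OF n T]) (simp add: r_def)
    also have "\<dots> = 1" using acodeD(5)[OF \<open>acode dA dB T 1 1 1 p r\<close>, of 0 0 0] by simp
    finally show ?thesis unfolding cfid_def by simp
  qed
  ultimately show ?thesis by blast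
qed

text \<open>A prefix with a single message is decoded with certainty, so
  \<open>acode_combine\<close> merely enlarges the position set without loss.\<close>

lemma acode_pad:
  assumes d: "T1 \<inter> T2 = {}" and f: "finite T1" "finite T2" and "1 \<le> dA"
    and c: "acode dA dB T2 M1 M2 D p r"
  shows "\<exists>D' p' r'. acode dA dB (T1 \<union> T2) M1 M2 D' p' r' \<and>
    (\<forall>\<nu>. (\<forall>t\<in>T1 \<union> T2. chk dA dB (\<nu> t)) \<longrightarrow> afid dA dB T2 \<nu> M1 M2 p r \<le> afid dA dB (T1 \<union> T2) \<nu> M1 M2 p' r')"
proof -
  obtain \<delta> \<Lambda> where t: "acode dA dB T1 1 1 1 \<delta> \<Lambda>" 
    "\<And>\<nu>. \<forall>t\<in>T1. chk dA dB (\<nu> t) \<Longrightarrow> cfid dA dB T1 \<nu> 1 (\<delta> 0) (\<Lambda> 0) = 1"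
    using acode_trivial[OF assms(4) f(1)] by metis
  from acode_combine[OF d f t(1), of M1 M2 "\<lambda>_. D" "\<lambda>_. p" "\<lambda>_. r"] c
  obtain D' p' r' where c': "acode dA dB (T1 \<union> T2) M1 M2 D' p' r'"
    and i: "\<And>\<nu>. \<forall>t\<in>T1 \<union> T2. chk dA dB (\<nu> t) \<Longrightarrow>
      1 / real 1 * (\<Sum>k<1. Re (cfid dA dB T1 \<nu> 1 (\<delta> k) (\<Lambda> k)) * afid dA dB T2 \<nu> M1 M2 p r)
      \<le> afid dA dB (T1 \<union> T2) \<nu> M1 M2 p' r'" by blast
  have "afid dA dB T2 \<nu> M1 M2 p r \<le> afid dA dB (T1 \<union> T2) \<nu> M1 M2 p' r'" if n: "\<forall>t\<in>T1 \<union> T2. chk dA dB (\<nu> t)" for \<nu>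
    using i[OF n] t(2)[of \<nu>] n by simp
  then show ?thesis using c' by blast
qed

lemma words_bij:
  assumes "bij_betw g T T'"
  shows "bij_betw (\<lambda>I. \<lambda>t\<in>T. I (g t)) (words d T') (words d T)"
proof (rule bij_betwI[where g="\<lambda>I. \<lambda>t\<in>T'. I (inv_into T g t)"])
  show "(\<lambda>I. \<lambda>t\<in>T. I (g t)) \<in> words d T' \<rightarrow> words d T"
    using assms unfolding words_def by (auto simp: bij_betw_def)
  show "(\<lambda>I. \<lambda>t\<in>T'. I (inv_into T g t)) \<in> words d T \<rightarrow> words d T'"
    using assms unfolding words_def by (auto simp: bij_betw_def inv_into_into PiE_iff)
  show "(\<lambda>t\<in>T'. (\<lambda>t\<in>T. I (g t)) (inv_into T g t)) = I" if "I \<in> words d T'" for I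
    using assms that unfolding words_def
    by (auto simp: bij_betw_def inv_into_into f_inv_into_f PiE_iff extensional_def fun_eq_iff)
  show "(\<lambda>t\<in>T. (\<lambda>t\<in>T'. I (inv_into T g t)) (g t)) = I" if "I \<in> words d T" for I
    using assms that unfolding words_def
    by (auto simp: bij_betw_def PiE_iff extensional_def fun_eq_iff)
qed

text \<open>A bijection of positions reindexes all word sums at once; the letters are pulled back
  along it. Shifted, sampled and blockwise codes all come from here.\<close>

lemma acode_transport:
  assumes g: "bij_betw g T T'" and T: "finite T"
    and c: "acode dA dB T M1 M2 D p r"
  shows "\<exists>p' r'. acode dA dB T' M1 M2 D p' r' \<and>
    (\<forall>\<nu>. afid dA dB T' \<nu> M1 M2 p' r' = afid dA dB T (\<lambda>t. \<nu> (g t)) M1 M2 p r)"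
proof -
  let ?h = "\<lambda>I. \<lambda>t\<in>T. I (g t)"
  define p' where "p' = (\<lambda>m i j I J. p m i j (?h I) (?h J))"
  define r' where "r' = (\<lambda>m A B. r m (?h A) (?h B))"
  note cD = acodeD[OF c] and b = words_bij[OF g]
  have h: "?h I \<in> words d T" if "I \<in> words d T'" for I d
    using bij_betwE[OF b] that by blast
  have "acode dA dB T' M1 M2 D p' r'"
    unfolding acode_def
  proof (intro conjI allI impI ballI)
    fix m assume m: "m < M1"
    show "gram ({..<M2} \<times> words dA T') (\<lambda>x y. p' m (fst x) (fst y) (snd x) (snd y))"
      unfolding p'_def using h by (intro gram_vimage[OF cD(4)[OF m], of _ "\<lambda>x. (fst x, ?h (snd x))", simplified]) auto
    show "gram (words dB T' \<times> {..<D}) (\<lambda>x y. r' m (fst x) (fst y) (snd x) (snd y))"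
      unfolding r'_def using h by (intro gram_vimage[OF cD(6)[OF m], of _ "\<lambda>x. (?h (fst x), snd x)", simplified]) auto
    fix i j assume "i < M2" "j < M2"
    then show "(\<Sum>I\<in>words dA T'. p' m i j I I) = (if i = j then 1 else 0)"
      unfolding p'_def using sum.reindex_bij_betw[OF b, of "\<lambda>I. p m i j I I" dA] cD(5)[OF m] by simp
  next
    fix A B assume AB: "A \<in> words dB T'" "B \<in> words dB T'"
    have "?h A = ?h B \<longleftrightarrow> A = B" using AB b[of dB] unfolding bij_betw_def inj_on_def by blast
    then show "(\<Sum>m<M1. \<Sum>a<D. r' m A B a a) = (if A = B then 1 else 0)"
      unfolding r'_def using cD(7)[OF h[OF AB(1)] h[OF AB(2)]] by simp
  qed (use cD in auto)
  moreover have "afid dA dB T' \<nu> M1 M2 p' r' = afid dA dB T (\<lambda>t. \<nu> (g t)) M1 M2 p r" for \<nu>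
  proof -
    have ch: "chanW T' \<nu> I J A B = chanW T (\<lambda>t. \<nu> (g t)) (?h I) (?h J) (?h A) (?h B)" for I J A B
      unfolding chanW_def using prod.reindex_bij_betw[OF g, of "\<lambda>t. \<nu> t (I t) (J t) (A t) (B t)"] by simp
    have "pairing dA dB T' \<nu> (\<lambda>I J. P (?h I) (?h J)) (\<lambda>A B. R (?h A) (?h B)) = pairing dA dB T (\<lambda>t. \<nu> (g t)) P R" for P R
    proof -
      let ?w = "\<lambda>I J A B. P I J * chanW T (\<lambda>t. \<nu> (g t)) I J A B * R A B"
      have "pairing dA dB T' \<nu> (\<lambda>I J. P (?h I) (?h J)) (\<lambda>A B. R (?h A) (?h B))
        = (\<Sum>I\<in>words dA T'. \<Sum>J\<in>words dA T'. \<Sum>A\<in>words dB T'. \<Sum>B\<in>words dB T'. ?w (?h I) (?h J) (?h A) (?h B))"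
        unfolding pairing_def ch ..
      also have "\<dots> = pairing dA dB T (\<lambda>t. \<nu> (g t)) P R"
        unfolding pairing_def
        by (subst (4) sum.reindex_bij_betw[OF b], subst (3) sum.reindex_bij_betw[OF b], subst (2) sum.reindex_bij_betw[OF b], subst sum.reindex_bij_betw[OF b]) (rule refl)
      finally show ?thesis .
    qed
    then have "pairing dA dB T' \<nu> (p' m i j) (\<lambda>A B. r' m A B i j) = pairing dA dB T (\<lambda>t. \<nu> (g t)) (p m i j) (\<lambda>A B. r m A B i j)" for m i j
      unfolding p'_def r'_def .
    then show ?thesis unfolding afid_def cfid_def by simp
  qed
  ultimately show ?thesis by blast
qed

lemma chanW_mix:
  assumes "finite T" "finite S"
  shows "chanW T (\<lambda>t i j a b. \<Sum>s\<in>S. complex_of_real (q s) * n s i j a b) I J A B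
    = (\<Sum>z\<in>PiE T (\<lambda>_. S). complex_of_real (\<Prod>t\<in>T. q (z t)) * chanW T (\<lambda>t. n (z t)) I J A B)"
  unfolding chanW_def using assms by (subst prod_sum_PiE) (simp_all add: prod.distrib)

lemma pairing_mix:
  assumes "finite T" "finite S"
  shows "pairing dA dB T (\<lambda>t i j a b. \<Sum>s\<in>S. complex_of_real (q s) * n s i j a b) P R
    = (\<Sum>z\<in>PiE T (\<lambda>_. S). complex_of_real (\<Prod>t\<in>T. q (z t)) * pairing dA dB T (\<lambda>t. n (z t)) P R)"
proof -
  let ?Z = "PiE T (\<lambda>_. S)"
  let ?h = "\<lambda>I J A B z. complex_of_real (\<Prod>t\<in>T. q (z t)) * (P I J * chanW T (\<lambda>t. n (z t)) I J A B * R A B)"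
  have "pairing dA dB T (\<lambda>t i j a b. \<Sum>s\<in>S. complex_of_real (q s) * n s i j a b) P R
    = (\<Sum>I\<in>words dA T. \<Sum>J\<in>words dA T. \<Sum>A\<in>words dB T. \<Sum>B\<in>words dB T. \<Sum>z\<in>?Z. ?h I J A B z)"
    unfolding pairing_def chanW_mix[OF assms]
    by (intro sum.cong refl) (simp add: sum_distrib_left sum_distrib_right mult_ac)
  also have "\<dots> = (\<Sum>I\<in>words dA T. \<Sum>J\<in>words dA T. \<Sum>A\<in>words dB T. \<Sum>z\<in>?Z. \<Sum>B\<in>words dB T. ?h I J A B z)"
    by (intro sum.cong[OF refl]) (rule sum.swap)
  also have "\<dots> = (\<Sum>I\<in>words dA T. \<Sum>J\<in>words dA T. \<Sum>z\<in>?Z. \<Sum>A\<in>words dB T. \<Sum>B\<in>words dB T. ?h I J A B z)"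
    by (intro sum.cong[OF refl]) (rule sum.swap)
  also have "\<dots> = (\<Sum>I\<in>words dA T. \<Sum>z\<in>?Z. \<Sum>J\<in>words dA T. \<Sum>A\<in>words dB T. \<Sum>B\<in>words dB T. ?h I J A B z)"
    by (intro sum.cong[OF refl]) (rule sum.swap)
  also have "\<dots> = (\<Sum>z\<in>?Z. \<Sum>I\<in>words dA T. \<Sum>J\<in>words dA T. \<Sum>A\<in>words dB T. \<Sum>B\<in>words dB T. ?h I J A B z)"
    by (rule sum.swap)
  finally show ?thesis unfolding pairing_def by (simp only: sum_distrib_left)
qed

lemma cfid_mix:
  assumes "finite T" "finite S"
  shows "cfid dA dB T (\<lambda>t i j a b. \<Sum>s\<in>S. complex_of_real (q s) * n s i j a b) M2 P R
    = (\<Sum>z\<in>PiE T (\<lambda>_. S). complex_of_real (\<Prod>t\<in>T. q (z t)) * cfid dA dB T (\<lambda>t. n (z t)) M2 P R)"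
proof -
  let ?Z = "PiE T (\<lambda>_. S)"
  let ?h = "\<lambda>i j z. complex_of_real (\<Prod>t\<in>T. q (z t)) * pairing dA dB T (\<lambda>t. n (z t)) (P i j) (\<lambda>A B. R A B i j)"
  have "(\<Sum>i<M2. \<Sum>j<M2. \<Sum>z\<in>?Z. ?h i j z) = (\<Sum>i<M2. \<Sum>z\<in>?Z. \<Sum>j<M2. ?h i j z)"
    by (intro sum.cong[OF refl]) (rule sum.swap)
  also have "\<dots> = (\<Sum>z\<in>?Z. \<Sum>i<M2. \<Sum>j<M2. ?h i j z)" by (rule sum.swap)
  finally show ?thesis unfolding cfid_def pairing_mix[OF assms]
    by (simp only: sum_distrib_left mult.left_commute)
qed

text \<open>A product of mixed letters expands into a mixture of product channels over all state
  words, with product weights, and the fidelity is linear in the channel. This is what links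
  \<open>conv_chan\<close> to the arbitrarily varying channel.\<close>

lemma afid_mix:
  assumes "finite T" "finite S"
  shows "afid dA dB T (\<lambda>t i j a b. \<Sum>s\<in>S. complex_of_real (q s) * n s i j a b) M1 M2 p r
    = (\<Sum>z\<in>PiE T (\<lambda>_. S). (\<Prod>t\<in>T. q (z t)) * afid dA dB T (\<lambda>t. n (z t)) M1 M2 p r)"
proof -
  let ?Z = "PiE T (\<lambda>_. S)"
  have "Re (complex_of_real x * c) = x * Re c" for x c by simp
  then show ?thesis unfolding afid_def cfid_mix[OF assms] Re_sum
    by (simp only: sum_distrib_left mult.left_commute sum.swap[of _ "{..<M1}" ?Z])
qed

section \<open>Tensor powers in word coordinates\<close>

text \<open>Base-\<open>d\<close> digits with the most significant one first, as
  \<open>tensor2\<close> gives the high-order part of an index to its first factor.\<close>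

definition dg :: "nat \<Rightarrow> nat \<Rightarrow> nat \<Rightarrow> nat \<Rightarrow> nat" where
  "dg d l x = (\<lambda>t\<in>{..<l}. (x div d ^ (l - 1 - t)) mod d)"

lemma dg_0: "x < d * d ^ l \<Longrightarrow> dg d (Suc l) x 0 = x div d ^ l"
  unfolding dg_def by (simp add: less_mult_imp_div_less)

lemma dg_Suc: "t < l \<Longrightarrow> dg d (Suc l) x (Suc t) = dg d l (x mod d ^ l) t"
proof -
  assume t: "t < l"
  define e where "e = l - 1 - t"
  have l: "l = e + Suc t" using t unfolding e_def by simp
  have "(x mod d ^ l) div d ^ e = (x div d ^ e) mod d ^ Suc t"
  proof (cases "d = 0")
    case False
    then show ?thesis unfolding l power_add mod_mult2_eq[of x "d ^ e" "d ^ Suc t"]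
      by (simp del: power_Suc)
  qed (simp add: l power_0_left)
  then have "(x mod d ^ l) div d ^ e mod d = (x div d ^ e) mod d"
    by (simp add: mod_mod_cancel)
  then show ?thesis using t unfolding dg_def e_def by simp
qed

lemma dg_inj: "inj_on (dg d l) {..<d ^ l}"
proof (induction l)
  case 0 show ?case by (simp add: inj_on_def)
next
  case (Suc l)
  show ?case
  proof (rule inj_onI)
    fix x y assume xy: "x \<in> {..<d ^ Suc l}" "y \<in> {..<d ^ Suc l}" and e: "dg d (Suc l) x = dg d (Suc l) y"
    have pos: "0 < d ^ l" using xy(1) by (cases "d ^ l = 0") auto
    have "x div d ^ l = y div d ^ l" using dg_0[of x d l] dg_0[of y d l] e xy by simp
    moreover have "dg d l (x mod d ^ l) = dg d l (y mod d ^ l)"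
    proof
      fix t show "dg d l (x mod d ^ l) t = dg d l (y mod d ^ l) t"
        by (cases "t < l") (metis dg_Suc e, simp add: dg_def)
    qed
    then have "x mod d ^ l = y mod d ^ l" using inj_onD[OF Suc.IH] pos by simp
    ultimately show "x = y" by (metis div_mult_mod_eq)
  qed
qed

lemma dg_words: "1 \<le> d \<Longrightarrow> dg d l x \<in> words d {..<l}"
  unfolding dg_def words_def by auto

lemma dg_bij: "1 \<le> d \<Longrightarrow> bij_betw (dg d l) {..<d ^ l} (words d {..<l})"
proof -
  assume d: "1 \<le> d"
  have "dg d l ` {..<d ^ l} = words d {..<l}"
  proof (rule card_subset_eq)
    show "finite (words d {..<l})" by (rule finite_words) simp
    show "dg d l ` {..<d ^ l} \<subseteq> words d {..<l}" using dg_words[OF d] by auto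
    show "card (dg d l ` {..<d ^ l}) = card (words d {..<l})"
      unfolding words_def by (simp add: card_image[OF dg_inj] card_PiE)
  qed
  with dg_inj show ?thesis unfolding bij_betw_def by blast
qed

definition ud :: "nat \<Rightarrow> nat \<Rightarrow> (nat \<Rightarrow> nat) \<Rightarrow> nat" where
  "ud d l = inv_into {..<d ^ l} (dg d l)"

lemma dg_ud: "1 \<le> d \<Longrightarrow> I \<in> words d {..<l} \<Longrightarrow> dg d l (ud d l I) = I"
  unfolding ud_def using dg_bij[of d l] by (simp add: bij_betw_def f_inv_into_f)

lemma ud_dg: "x < d ^ l \<Longrightarrow> ud d l (dg d l x) = x"
  unfolding ud_def using dg_inj by simp

lemma ud_less: "1 \<le> d \<Longrightarrow> I \<in> words d {..<l} \<Longrightarrow> ud d l I < d ^ l"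
  unfolding ud_def using dg_bij[of d l] by (metis bij_betw_def inv_into_into lessThan_iff)

lemma sum_dg: "1 \<le> d \<Longrightarrow> (\<Sum>x<d ^ l. f (dg d l x)) = (\<Sum>I\<in>words d {..<l}. f I)"
  by (rule sum.reindex_bij_betw[OF dg_bij])

definition ker :: "nat \<Rightarrow> cmap \<Rightarrow> letter" where
  "ker d N i j a b = N (munit d i j) $$ (a,b)"

lemma munit_carrier [simp]: "munit d i j \<in> carrier_mat d d"
  unfolding munit_def by simp

lemma lin_map_entry:
  assumes lin: "lin_map d d' N" and X: "X \<in> carrier_mat d d" and ab: "a < d'" "b < d'"
  shows "N X $$ (a,b) = (\<Sum>i<d. \<Sum>j<d. X $$ (i,j) * ker d N i j a b)"
proof -
  have car: "\<And>Y. Y \<in> carrier_mat d d \<Longrightarrow> N Y \<in> carrier_mat d' d'"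
    and add: "\<And>Y Z. Y \<in> carrier_mat d d \<Longrightarrow> Z \<in> carrier_mat d d \<Longrightarrow> N (Y + Z) = N Y + N Z"
    and sc: "\<And>Y c. Y \<in> carrier_mat d d \<Longrightarrow> N (c \<cdot>\<^sub>m Y) = c \<cdot>\<^sub>m N Y"
    using lin unfolding lin_map_def by blast+
  let ?X = "\<lambda>S. Matrix.mat d d (\<lambda>(i,j). if (i,j) \<in> S then X $$ (i,j) else 0)"
  have "N (?X S) $$ (a,b) = (\<Sum>(i,j)\<in>S. X $$ (i,j) * ker d N i j a b)" if "finite S" "S \<subseteq> {..<d} \<times> {..<d}" for S
    using that
  proof (induction S rule: finite_induct)
    case empty
    have "?X {} = 0 \<cdot>\<^sub>m ?X {}" by (rule eq_matI) auto
    then have "N (?X {}) = 0 \<cdot>\<^sub>m N (?X {})" using sc[of "?X {}" 0] by simp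
    then have "N (?X {}) $$ (a,b) = (0 \<cdot>\<^sub>m N (?X {})) $$ (a,b)" by (rule arg_cong)
    also have "\<dots> = 0" using car[of "?X {}"] ab by simp
    finally show ?case by (simp only: sum.empty)
  next
    case (insert s S)
    obtain i j where s: "s = (i,j)" by (cases s)
    have "?X (insert s S) = ?X S + X $$ (i,j) \<cdot>\<^sub>m munit d i j"
      by (rule eq_matI) (use insert.hyps s in \<open>auto simp: munit_def\<close>)
    then have "N (?X (insert s S)) = N (?X S) + X $$ (i,j) \<cdot>\<^sub>m N (munit d i j)"
      using add[of "?X S" "X $$ (i,j) \<cdot>\<^sub>m munit d i j"] sc[of "munit d i j" "X $$ (i,j)"] by simp
    moreover have "(N (?X S) + X $$ (i,j) \<cdot>\<^sub>m N (munit d i j)) $$ (a,b) = N (?X S) $$ (a,b) + X $$ (i,j) * ker d N i j a b"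
      using car[of "munit d i j"] car[of "?X S"] ab unfolding ker_def by simp
    moreover have "N (?X S) $$ (a,b) = (\<Sum>(i,j)\<in>S. X $$ (i,j) * ker d N i j a b)"
      using insert by blast
    ultimately have "N (?X (insert s S)) $$ (a,b) = X $$ (i,j) * ker d N i j a b + (\<Sum>(i,j)\<in>S. X $$ (i,j) * ker d N i j a b)"
      by (simp only: add.commute)
    then show ?case unfolding sum.insert[OF insert.hyps] by (simp only: s prod.case)
  qed
  from this[of "{..<d} \<times> {..<d}"] have "N (?X ({..<d} \<times> {..<d})) $$ (a,b) = (\<Sum>(i,j)\<in>{..<d} \<times> {..<d}. X $$ (i,j) * ker d N i j a b)" by simp
  moreover have "?X ({..<d} \<times> {..<d}) = X" by (rule eq_matI) (use X in auto)
  ultimately show ?thesis by (simp add: sum.cartesian_product)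
qed

lemma tensor2_carrier: "tensor2 d1 d1' d2 d2' N1 N2 X \<in> carrier_mat (d1' * d2') (d1' * d2')"
  unfolding tensor2_def msum_def by simp

lemma tensor2_entry:
  assumes N1: "\<And>i j. N1 (munit d1 i j) \<in> carrier_mat d1' d1'"
    and N2: "\<And>i j. N2 (munit d2 i j) \<in> carrier_mat d2' d2'"
    and rc: "r < d1' * d2'" "c < d1' * d2'"
  shows "tensor2 d1 d1' d2 d2' N1 N2 X $$ (r,c) = (\<Sum>i<d1. \<Sum>j<d1. \<Sum>k<d2. \<Sum>l<d2.
     X $$ (i * d2 + k, j * d2 + l) * (ker d1 N1 i j (r div d2') (c div d2') * ker d2 N2 k l (r mod d2') (c mod d2')))"
proof -
  have e: "(x \<cdot>\<^sub>m kron (N1 (munit d1 i j)) (N2 (munit d2 k l))) $$ (r,c)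
     = x * (ker d1 N1 i j (r div d2') (c div d2') * ker d2 N2 k l (r mod d2') (c mod d2'))" for x i j k l
    using N1[of i j] N2[of k l] rc unfolding kron_def ker_def by simp
  show ?thesis
    unfolding tensor2_def msum_def using rc
    by (simp add: split_def e sum.cartesian_product)
qed

lemma ker_ident: "a < n \<Longrightarrow> b < n \<Longrightarrow> ker n (\<lambda>Y. Y) i j a b = (if a = i \<and> b = j then 1 else 0)"
  unfolding ker_def munit_def by simp

lemma tensor2_ident_entry:
  assumes N: "\<And>i j. N (munit d i j) \<in> carrier_mat d' d'"
    and rc: "r < n * d'" "c < n * d'"
  shows "tensor2 n n d d' (\<lambda>Y. Y) N X $$ (r,c) = (\<Sum>k<d. \<Sum>l<d.
     X $$ ((r div d') * d + k, (c div d') * d + l) * ker d N k l (r mod d') (c mod d'))"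
proof -
  have rd: "r div d' < n" "c div d' < n" using rc by (auto intro: less_mult_imp_div_less)
  have "tensor2 n n d d' (\<lambda>Y. Y) N X $$ (r,c) = (\<Sum>i<n. \<Sum>j<n. \<Sum>k<d. \<Sum>l<d.
     X $$ (i * d + k, j * d + l) * (ker n (\<lambda>Y. Y) i j (r div d') (c div d') * ker d N k l (r mod d') (c mod d')))"
    by (rule tensor2_entry) (use N rc in simp_all)
  also have "\<dots> = (\<Sum>i<n. \<Sum>j<n. if i = r div d' then if j = c div d' then 
      (\<Sum>k<d. \<Sum>l<d. X $$ ((r div d') * d + k, (c div d') * d + l) * ker d N k l (r mod d') (c mod d')) else 0 else 0)"
    using rd by (intro sum.cong[OF refl]) (auto simp: ker_ident)
  also have "\<dots> = (\<Sum>k<d. \<Sum>l<d. X $$ ((r div d') * d + k, (c div d') * d + l) * ker d N k l (r mod d') (c mod d'))"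
  proof -
    have "(\<Sum>j<n. if i = r div d' then if j = c div d' then z else 0 else 0) = (if i = r div d' then z else (0::complex))" for i z
      using rd by auto
    then show ?thesis using rd by simp
  qed
  finally show ?thesis .
qed

lemma mult_add_less: "a < n \<Longrightarrow> k < d \<Longrightarrow> a * d + k < n * (d::nat)"
  by (metis (no_types, lifting) Suc_leI add.commute add_less_cancel_right less_le_trans mult_Suc mult_le_mono1)

text \<open>Complete positivity with an ancilla of dimension \<open>d\<close>, applied to the
  unnormalized maximally entangled state \<open>?X\<close>: the output is the Choi matrix, and its
  index pairs are read off by \<open>fst x * d' + snd x\<close>.\<close>

lemma cp_map_gram:
  assumes cp: "cp_map d d' N"
  shows "gram ({..<d} \<times> {..<d'}) (\<lambda>x y. ker d N (fst x) (fst y) (snd x) (snd y))"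
proof -
  let ?u = "\<lambda>r. if r div d = r mod d then 1 else (0::complex)"
  let ?X = "Matrix.mat (d * d) (d * d) (\<lambda>(r,c). 1 * (?u r * cnj (?u c)))"
  have lin: "lin_map d d' N" using cp unfolding cp_map_def by blast
  have N: "N (munit d i j) \<in> carrier_mat d' d'" for i j using lin unfolding lin_map_def by simp
  have "psd ?X" by (rule psd_rank1[OF refl]) (simp add: less_eq_complex_def)
  then have "psd (tensor2 d d d d' (\<lambda>Y. Y) N ?X)" using cp unfolding cp_map_def by simp
  from psd_gram[OF this tensor2_carrier]
  have g: "gram {..<d * d'} (\<lambda>i j. tensor2 d d d d' (\<lambda>Y. Y) N ?X $$ (i,j))" .
  have lt: "fst x * d' + snd x < d * d'" if "x \<in> {..<d} \<times> {..<d'}" for x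
    using that by (metis (no_types) lessThan_iff mem_Times_iff mult_add_less)
  show ?thesis
  proof (rule gram_cong)
    show "gram ({..<d} \<times> {..<d'}) (\<lambda>x y. tensor2 d d d d' (\<lambda>Y. Y) N ?X $$ (fst x * d' + snd x, fst y * d' + snd y))"
      by (rule gram_vimage[OF g, of _ "\<lambda>x. fst x * d' + snd x"]) (use lt in auto)
    fix x y assume xy: "x \<in> {..<d} \<times> {..<d'}" "y \<in> {..<d} \<times> {..<d'}"
    then have b: "fst x < d" "snd x < d'" "fst y < d" "snd y < d'" by auto
    have lt': "a * d + k < d * d" if "a < d" "k < d" for a k using mult_add_less[OF that] .
    have "tensor2 d d d d' (\<lambda>Y. Y) N ?X $$ (fst x * d' + snd x, fst y * d' + snd y) = (\<Sum>k<d. \<Sum>l<d.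
       ?X $$ (fst x * d + k, fst y * d + l) * ker d N k l (snd x) (snd y))"
      using b N lt[OF xy(1)] lt[OF xy(2)] by (subst tensor2_ident_entry) simp_all
    also have "\<dots> = (\<Sum>k<d. \<Sum>l<d. if k = fst x then if l = fst y then ker d N (fst x) (fst y) (snd x) (snd y) else 0 else 0)"
      using b lt' by (intro sum.cong refl) auto
    also have "\<dots> = ker d N (fst x) (fst y) (snd x) (snd y)"
    proof -
      have "(\<Sum>l<d. if k = fst x then if l = fst y then z else 0 else 0) = (if k = fst x then z else (0::complex))" for k z
        using b by auto
      then show ?thesis using b by simp
    qed
    finally show "ker d N (fst x) (fst y) (snd x) (snd y) = tensor2 d d d d' (\<lambda>Y. Y) N ?X $$ (fst x * d' + snd x, fst y * d' + snd y)" ..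
  qed
qed

lemma cptp_chk:
  assumes "cptp d d' N"
  shows "chk d d' (ker d N)"
proof -
  have cp: "cp_map d d' N" and tr: "\<And>X. X \<in> carrier_mat d d \<Longrightarrow> mtrace (N X) = mtrace X"
    using assms unfolding cptp_def by auto
  have N: "N (munit d i j) \<in> carrier_mat d' d'" for i j
    using cp unfolding cp_map_def lin_map_def by simp
  have "(\<Sum>a<d'. ker d N i j a a) = (if i = j then 1 else 0)" if "i < d" "j < d" for i j
  proof -
    have "(\<Sum>a<d'. ker d N i j a a) = mtrace (N (munit d i j))"
      using N[of i j] unfolding mtrace_def ker_def by simp
    also have "\<dots> = mtrace (munit d i j)" by (rule tr[OF munit_carrier])
    also have "\<dots> = (\<Sum>k<d. if k = i \<and> k = j then 1 else 0)" unfolding mtrace_def munit_def by simp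
    also have "\<dots> = (\<Sum>k<d. if k = i then (if i = j then 1 else 0) else 0)" by (intro sum.cong refl) auto
    finally show ?thesis using that by simp
  qed
  then show ?thesis unfolding chk_def using cp_map_gram[OF cp] by blast
qed

text \<open>The inverse of \<open>ker\<close> on indices within range: extension of a kernel by
  linearity.\<close>

definition kmap :: "nat \<Rightarrow> nat \<Rightarrow> letter \<Rightarrow> cmap" where
  "kmap d d' K X = Matrix.mat d' d' (\<lambda>(a,b). \<Sum>i<d. \<Sum>j<d. X $$ (i,j) * K i j a b)"

lemma ker_kmap: "i < d \<Longrightarrow> j < d \<Longrightarrow> a < d' \<Longrightarrow> b < d' \<Longrightarrow> ker d (kmap d d' K) i j a b = K i j a b"
proof -
  assume ij: "i < d" "j < d" and ab: "a < d'" "b < d'"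
  have "(\<Sum>x<d. \<Sum>y<d. munit d i j $$ (x,y) * K x y a b) = (\<Sum>x<d. \<Sum>y<d. if x = i then if y = j then K i j a b else 0 else 0)"
    by (intro sum.cong refl) (auto simp: munit_def)
  also have "\<dots> = (\<Sum>x<d. if x = i then K i j a b else 0)"
    using ij by (intro sum.cong refl) auto
  finally show ?thesis using ij ab unfolding ker_def kmap_def by simp
qed

lemma kmap_lin: "lin_map d d' (kmap d d' K)"
  unfolding lin_map_def
proof (intro conjI ballI allI)
  fix X Y :: "complex mat" assume X: "X \<in> carrier_mat d d" 
  show "kmap d d' K X \<in> carrier_mat d' d'" unfolding kmap_def by simp
  show "kmap d d' K (c \<cdot>\<^sub>m X) = c \<cdot>\<^sub>m kmap d d' K X" for c
    by (rule eq_matI) (use X in \<open>auto simp: kmap_def sum_distrib_left mult.assoc intro!: sum.cong\<close>)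
  assume Y: "Y \<in> carrier_mat d d"
  show "kmap d d' K (X + Y) = kmap d d' K X + kmap d d' K Y"
    by (rule eq_matI) (use X Y in \<open>auto simp: kmap_def sum.distrib[symmetric] distrib_right intro!: sum.cong\<close>)
qed

lemma gram_form_diag:
  assumes "gram (X \<times> Y) (\<lambda>x y. K (fst x) (fst y) (snd x) (snd y))" "gram X Z" "a \<in> Y"
  shows "0 \<le> (\<Sum>i\<in>X. \<Sum>j\<in>X. Z i j * K i j a a)"
  by (rule gram_sum_nonneg, rule gram_mult[OF assms(2) gram_section2[OF assms(1,3)]])

text \<open>The converse direction of Choi's theorem: the output of the extended map is a
  contraction of the Schur product of the input matrix with the Choi matrix.\<close>

lemma kmap_cp:
  assumes K: "gram ({..<d} \<times> {..<d'}) (\<lambda>x y. K (fst x) (fst y) (snd x) (snd y))"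
  shows "cp_map d d' (kmap d d' K)"
  unfolding cp_map_def
proof (intro conjI kmap_lin allI impI)
  fix n X assume X: "X \<in> carrier_mat (n * d) (n * d) \<and> psd X"
  let ?S = "tensor2 n n d d' (\<lambda>Y. Y) (kmap d d' K) X"
  have gX: "gram {..<n * d} (\<lambda>i j. X $$ (i,j))" using psd_gram X by blast
  have lt: "(r div d') * d + k < n * d" if "r < n * d'" "k < d" for r k
    using mult_add_less[of "r div d'" n k d] that less_mult_imp_div_less by blast
  have md: "r mod d' < d'" if "r < n * d'" for r using that by (cases "d' = 0") auto
  have "gram ({..<d} \<times> {..<n * d'}) (\<lambda>u v. X $$ ((snd u div d') * d + fst u, (snd v div d') * d + fst v) * K (fst u) (fst v) (snd u mod d') (snd v mod d'))"
  proof (rule gram_mult)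
    show "gram ({..<d} \<times> {..<n * d'}) (\<lambda>u v. X $$ ((snd u div d') * d + fst u, (snd v div d') * d + fst v))"
      by (rule gram_vimage[OF gX, of _ "\<lambda>u. (snd u div d') * d + fst u"]) (use lt in auto)
    show "gram ({..<d} \<times> {..<n * d'}) (\<lambda>u v. K (fst u) (fst v) (snd u mod d') (snd v mod d'))"
      by (rule gram_vimage[OF K, of _ "\<lambda>u. (fst u, snd u mod d')", simplified]) (use md in auto)
  qed
  from gram_marg[OF this]
  have g: "gram {..<n * d'} (\<lambda>r c. \<Sum>k<d. \<Sum>l<d. X $$ ((r div d') * d + k, (c div d') * d + l) * K k l (r mod d') (c mod d'))" by simp
  have "gram {..<n * d'} (\<lambda>r c. ?S $$ (r,c))"
  proof (rule gram_cong[OF g])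
    fix r c assume rc: "r \<in> {..<n * d'}" "c \<in> {..<n * d'}"
    have N: "kmap d d' K (munit d i j) \<in> carrier_mat d' d'" for i j unfolding kmap_def by simp
    show "?S $$ (r,c) = (\<Sum>k<d. \<Sum>l<d. X $$ ((r div d') * d + k, (c div d') * d + l) * K k l (r mod d') (c mod d'))"
      using rc md N by (subst tensor2_ident_entry) (auto simp: ker_kmap intro!: sum.cong)
  qed
  then show "psd ?S" by (rule gram_psd[OF _ tensor2_carrier])
qed

lemma mtrace_kmap: "mtrace (kmap d d' K X) = (\<Sum>i<d. \<Sum>j<d. X $$ (i,j) * (\<Sum>a<d'. K i j a a))"
proof -
  have "mtrace (kmap d d' K X) = (\<Sum>a<d'. \<Sum>i<d. \<Sum>j<d. X $$ (i,j) * K i j a a)"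
    unfolding mtrace_def kmap_def by simp
  also have "\<dots> = (\<Sum>i<d. \<Sum>a<d'. \<Sum>j<d. X $$ (i,j) * K i j a a)" by (rule sum.swap)
  also have "\<dots> = (\<Sum>i<d. \<Sum>j<d. \<Sum>a<d'. X $$ (i,j) * K i j a a)" by (intro sum.cong[OF refl]) (rule sum.swap)
  finally show ?thesis by (simp add: sum_distrib_left)
qed

lemma sum_delta_trace: "X \<in> carrier_mat d d \<Longrightarrow> (\<Sum>i<d. \<Sum>j<d. X $$ (i,j) * (if i = j then 1 else 0)) = mtrace X"
  unfolding mtrace_def by (simp add: if_distrib cong: if_cong)

lemma kmap_cptp:
  assumes "chk d d' K"
  shows "cptp d d' (kmap d d' K)"
  unfolding cptp_def
proof (intro conjI ballI)
  show "cp_map d d' (kmap d d' K)" using assms kmap_cp unfolding chk_def by blast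
  fix X :: "complex mat" assume X: "X \<in> carrier_mat d d"
  have "mtrace (kmap d d' K X) = (\<Sum>i<d. \<Sum>j<d. X $$ (i,j) * (if i = j then 1 else 0))"
    using assms unfolding mtrace_kmap chk_def by (intro sum.cong refl) auto
  then show "mtrace (kmap d d' K X) = mtrace X" using sum_delta_trace[OF X] by simp
qed

text \<open>The recursion of \<open>tensor_list\<close> splits off the first factor just as
  \<open>dg\<close> splits off the leading digit, so the index arithmetic of iterated Kronecker
  products collapses to \<open>chanW\<close>.\<close>

lemma tensor_list_entry:
  assumes "\<forall>N\<in>set Ns. \<forall>X\<in>carrier_mat dA dA. N X \<in> carrier_mat dB dB" and "1 \<le> dA" "1 \<le> dB"
  shows "X \<in> carrier_mat (dA ^ length Ns) (dA ^ length Ns) \<Longrightarrow>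
    tensor_list dA dB Ns X \<in> carrier_mat (dB ^ length Ns) (dB ^ length Ns) \<and>
    (\<forall>a<dB ^ length Ns. \<forall>b<dB ^ length Ns. tensor_list dA dB Ns X $$ (a,b) =
     (\<Sum>i<dA ^ length Ns. \<Sum>j<dA ^ length Ns. X $$ (i,j) *
       chanW {..<length Ns} (\<lambda>t. ker dA (Ns ! t)) (dg dA (length Ns) i) (dg dA (length Ns) j) (dg dB (length Ns) a) (dg dB (length Ns) b)))"
  using assms(1)
proof (induction Ns arbitrary: X)
  case Nil
  then show ?case by (simp add: chanW_def)
next
  case (Cons N Ns)
  let ?l = "length Ns"
  let ?D = "dA ^ ?l" and ?D' = "dB ^ ?l"
  let ?c = "\<lambda>i j a b. chanW {..<?l} (\<lambda>t. ker dA (Ns ! t)) (dg dA ?l i) (dg dA ?l j) (dg dB ?l a) (dg dB ?l b)"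
  have N1: "N (munit dA i j) \<in> carrier_mat dB dB" for i j using Cons.prems(2) by simp
  have IH: "tensor_list dA dB Ns X \<in> carrier_mat ?D' ?D'"
    "\<And>a b. a < ?D' \<Longrightarrow> b < ?D' \<Longrightarrow> tensor_list dA dB Ns X $$ (a,b) = (\<Sum>i<?D. \<Sum>j<?D. X $$ (i,j) * ?c i j a b)"
    if "X \<in> carrier_mat ?D ?D" for X
    using Cons.IH[OF that] Cons.prems(2) by auto
  have kt: "ker ?D (tensor_list dA dB Ns) k l a b = ?c k l a b" if kl: "k < ?D" "l < ?D" and "a < ?D'" "b < ?D'" for k l a b
  proof -
    have "(\<Sum>i<?D. \<Sum>j<?D. munit ?D k l $$ (i,j) * ?c i j a b) = (\<Sum>i<?D. \<Sum>j<?D. if i = k then if j = l then ?c k l a b else 0 else 0)"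
      by (intro sum.cong refl) (auto simp: munit_def)
    also have "\<dots> = (\<Sum>i<?D. if i = k then ?c k l a b else 0)"
      using kl by (intro sum.cong refl) auto
    finally show ?thesis unfolding ker_def[of ?D] using IH(2)[of "munit ?D k l" a b] that by simp
  qed
  have ch: "chanW {..<Suc ?l} (\<lambda>t. ker dA ((N # Ns) ! t)) (dg dA (Suc ?l) i) (dg dA (Suc ?l) j) (dg dB (Suc ?l) a) (dg dB (Suc ?l) b)
     = ker dA N (i div ?D) (j div ?D) (a div ?D') (b div ?D') * ?c (i mod ?D) (j mod ?D) (a mod ?D') (b mod ?D')"
    if "i < dA * ?D" "j < dA * ?D" "a < dB * ?D'" "b < dB * ?D'" for i j a b
    unfolding chanW_def prod.lessThan_Suc_shift using that by (simp add: dg_0 dg_Suc)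
  have D0: "0 < ?D" "0 < ?D'" using assms by auto
  show ?case
  proof (intro conjI allI impI)
    show "tensor_list dA dB (N # Ns) X \<in> carrier_mat (dB ^ length (N # Ns)) (dB ^ length (N # Ns))"
      using tensor2_carrier[of dA dB ?D ?D' N "tensor_list dA dB Ns" X] by simp
    fix a b assume "a < dB ^ length (N # Ns)" "b < dB ^ length (N # Ns)"
    then have ab: "a < dB * ?D'" "b < dB * ?D'" by auto
    have ab': "a mod ?D' < ?D'" "b mod ?D' < ?D'" using D0 by auto
    have "tensor_list dA dB (N # Ns) X $$ (a,b) = (\<Sum>i<dA. \<Sum>j<dA. \<Sum>k<?D. \<Sum>l<?D. X $$ (i * ?D + k, j * ?D + l) *
       (ker dA N i j (a div ?D') (b div ?D') * ker ?D (tensor_list dA dB Ns) k l (a mod ?D') (b mod ?D')))"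
      unfolding tensor_list.simps by (rule tensor2_entry) (use N1 IH(1) ab in simp_all)
    also have "\<dots> = (\<Sum>i<dA. \<Sum>j<dA. \<Sum>k<?D. \<Sum>l<?D. X $$ (i * ?D + k, j * ?D + l) *
       (ker dA N i j (a div ?D') (b div ?D') * ?c k l (a mod ?D') (b mod ?D')))"
      using kt ab' by (intro sum.cong refl) simp
    also have "\<dots> = (\<Sum>i<dA. \<Sum>k<?D. \<Sum>j<dA. \<Sum>l<?D. X $$ (i * ?D + k, j * ?D + l) *
       (ker dA N i j (a div ?D') (b div ?D') * ?c k l (a mod ?D') (b mod ?D')))"
      by (intro sum.cong[OF refl]) (rule sum.swap)
    also have "\<dots> = (\<Sum>x<dA * ?D. \<Sum>y<dA * ?D. X $$ ((x div ?D) * ?D + x mod ?D, (y div ?D) * ?D + y mod ?D) *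
       (ker dA N (x div ?D) (y div ?D) (a div ?D') (b div ?D') * ?c (x mod ?D) (y mod ?D) (a mod ?D') (b mod ?D')))"
      by (subst (1 2) sum_div_mod[symmetric]) (rule refl)
    also have "\<dots> = (\<Sum>x<dA * ?D. \<Sum>y<dA * ?D. X $$ (x, y) *
       chanW {..<Suc ?l} (\<lambda>t. ker dA ((N # Ns) ! t)) (dg dA (Suc ?l) x) (dg dA (Suc ?l) y) (dg dB (Suc ?l) a) (dg dB (Suc ?l) b))"
      using ab by (intro sum.cong refl) (simp only: ch div_mult_mod_eq lessThan_iff)
    finally show "tensor_list dA dB (N # Ns) X $$ (a,b) =
     (\<Sum>i<dA ^ length (N # Ns). \<Sum>j<dA ^ length (N # Ns). X $$ (i,j) *
       chanW {..<length (N # Ns)} (\<lambda>t. ker dA ((N # Ns) ! t)) (dg dA (length (N # Ns)) i) (dg dA (length (N # Ns)) j) (dg dB (length (N # Ns)) a) (dg dB (length (N # Ns)) b))"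
      by simp
  qed
qed

definition enc_kern :: "nat \<Rightarrow> nat \<Rightarrow> nat \<Rightarrow> cmap \<Rightarrow> nat \<Rightarrow> nat \<Rightarrow> nat wkern" where
  "enc_kern dA l M2 P i j I J = ker M2 P i j (ud dA l I) (ud dA l J)"

definition dec_kern :: "nat \<Rightarrow> nat \<Rightarrow> cmap \<Rightarrow> (nat \<Rightarrow> nat) \<Rightarrow> (nat \<Rightarrow> nat) \<Rightarrow> nat \<Rightarrow> nat \<Rightarrow> complex" where
  "dec_kern dB l R A B a b = ker (dB ^ l) R (ud dB l A) (ud dB l B) a b"

lemma cptp_cp: "cptp d d' N \<Longrightarrow> cp_map d d' N"
  unfolding cptp_def by blast

lemma cptni_cp: "cptni d d' N \<Longrightarrow> cp_map d d' N"
  unfolding cptni_def by blast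

lemma cp_lin: "cp_map d d' N \<Longrightarrow> lin_map d d' N"
  unfolding cp_map_def by blast

lemma lin_carrier: "lin_map d d' N \<Longrightarrow> X \<in> carrier_mat d d \<Longrightarrow> N X \<in> carrier_mat d' d'"
  unfolding lin_map_def by blast

lemma is_codeD:
  assumes "is_code dA dB l M1 M2 (D, P, R)"
  shows "1 \<le> M1" "1 \<le> M2" "M2 \<le> D"
    "m < M1 \<Longrightarrow> cptp M2 (dA ^ l) (P m)" "m < M1 \<Longrightarrow> cptni (dB ^ l) D (R m)"
    "X \<in> carrier_mat (dB ^ l) (dB ^ l) \<Longrightarrow> (\<Sum>m<M1. mtrace (R m X)) = mtrace X"
  using assms unfolding is_code_def by auto

lemma code_acode:
  assumes c: "is_code dA dB l M1 M2 (D, P, R)" and d: "1 \<le> dA" "1 \<le> dB"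
  shows "acode dA dB {..<l} M1 M2 D (\<lambda>m. enc_kern dA l M2 (P m)) (\<lambda>m. dec_kern dB l (R m))"
  unfolding acode_def
proof (intro conjI allI impI ballI)
  note cD = is_codeD[OF c]
  show "1 \<le> M1" "1 \<le> M2" "M2 \<le> D" by (fact cD)+
  fix m assume m: "m < M1"
  show "gram ({..<M2} \<times> words dA {..<l}) (\<lambda>x y. enc_kern dA l M2 (P m) (fst x) (fst y) (snd x) (snd y))"
    unfolding enc_kern_def
    by (rule gram_vimage[OF cp_map_gram[OF cptp_cp[OF cD(4)[OF m]]], of _ "\<lambda>x. (fst x, ud dA l (snd x))", simplified])
       (use ud_less[OF d(1)] in auto)
  show "gram (words dB {..<l} \<times> {..<D}) (\<lambda>x y. dec_kern dB l (R m) (fst x) (fst y) (snd x) (snd y))"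
    unfolding dec_kern_def
    by (rule gram_vimage[OF cp_map_gram[OF cptni_cp[OF cD(5)[OF m]]], of _ "\<lambda>x. (ud dB l (fst x), snd x)", simplified])
       (use ud_less[OF d(2)] in auto)
  fix i j assume ij: "i < M2" "j < M2"
  have "(\<Sum>I\<in>words dA {..<l}. enc_kern dA l M2 (P m) i j I I) = (\<Sum>x<dA ^ l. ker M2 (P m) i j x x)"
    unfolding enc_kern_def sum_dg[OF d(1), symmetric] by (intro sum.cong refl) (simp add: ud_dg)
  also have "\<dots> = (if i = j then 1 else 0)"
    using cptp_chk[OF cD(4)[OF m]] ij unfolding chk_def by blast
  finally show "(\<Sum>I\<in>words dA {..<l}. enc_kern dA l M2 (P m) i j I I) = (if i = j then 1 else 0)" .
next
  note cD = is_codeD[OF c]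
  fix A B assume AB: "A \<in> words dB {..<l}" "B \<in> words dB {..<l}"
  let ?X = "munit (dB ^ l) (ud dB l A) (ud dB l B)"
  have "(\<Sum>m<M1. \<Sum>a<D. dec_kern dB l (R m) A B a a) = (\<Sum>m<M1. mtrace (R m ?X))"
  proof (rule sum.cong[OF refl])
    fix m assume "m \<in> {..<M1}"
    then have "R m ?X \<in> carrier_mat D D" 
      using lin_carrier[OF cp_lin[OF cptni_cp[OF cD(5)]], of m ?X] by simp
    then show "(\<Sum>a<D. dec_kern dB l (R m) A B a a) = mtrace (R m ?X)"
      unfolding dec_kern_def ker_def mtrace_def by simp
  qed
  also have "\<dots> = mtrace ?X" by (rule cD(6)) simp
  also have "\<dots> = (\<Sum>x<dB ^ l. if x = ud dB l A then (if ud dB l A = ud dB l B then 1 else 0) else 0)"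
    unfolding mtrace_def munit_def by (intro sum.cong) auto
  also have "\<dots> = (if ud dB l A = ud dB l B then 1 else 0)" using ud_less[OF d(2) AB(1)] by simp
  also have "ud dB l A = ud dB l B \<longleftrightarrow> A = B" using dg_ud[OF d(2)] AB by metis
  finally show "(\<Sum>m<M1. \<Sum>a<D. dec_kern dB l (R m) A B a a) = (if A = B then 1 else 0)" .
qed

text \<open>Encoding, transmission and decoding are expanded over matrix units; the resulting sum
  over numeric indices is then reindexed by words through \<open>sum_dg\<close>.\<close>

lemma transmit_entry:
  assumes P: "lin_map M2 (dA ^ l) P" and R: "lin_map (dB ^ l) D R"
    and Ns: "length Ns = l" "\<forall>N\<in>set Ns. \<forall>X\<in>carrier_mat dA dA. N X \<in> carrier_mat dB dB"
    and d: "1 \<le> dA" "1 \<le> dB" and ab: "a < D" "b < D"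
  shows "R (tensor_list dA dB Ns (P (munit M2 i j))) $$ (a,b) =
     pairing dA dB {..<l} (\<lambda>t. ker dA (Ns ! t)) (enc_kern dA l M2 P i j) (\<lambda>A B. dec_kern dB l R A B a b)"
proof -
  let ?\<nu> = "\<lambda>t. ker dA (Ns ! t)"
  let ?X = "P (munit M2 i j)" 
  let ?W = "tensor_list dA dB Ns"
  have X: "?X \<in> carrier_mat (dA ^ l) (dA ^ l)" by (rule lin_carrier[OF P munit_carrier])
  have W: "?W ?X \<in> carrier_mat (dB ^ l) (dB ^ l)"
    and We: "\<And>a b. a < dB ^ l \<Longrightarrow> b < dB ^ l \<Longrightarrow> ?W ?X $$ (a,b) = (\<Sum>x<dA ^ l. \<Sum>y<dA ^ l. ?X $$ (x,y) *
       chanW {..<l} ?\<nu> (dg dA l x) (dg dA l y) (dg dB l a) (dg dB l b))"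
    using tensor_list_entry[OF Ns(2) d, of ?X] X Ns(1) by auto
  let ?F = "\<lambda>I J A B. enc_kern dA l M2 P i j I J * chanW {..<l} ?\<nu> I J A B * dec_kern dB l R A B a b"
  have "R (?W ?X) $$ (a,b) = (\<Sum>u<dB ^ l. \<Sum>v<dB ^ l. ?W ?X $$ (u,v) * ker (dB ^ l) R u v a b)"
    by (rule lin_map_entry[OF R W ab])
  also have "\<dots> = (\<Sum>u<dB ^ l. \<Sum>v<dB ^ l. \<Sum>x<dA ^ l. \<Sum>y<dA ^ l. ?F (dg dA l x) (dg dA l y) (dg dB l u) (dg dB l v))"
  proof (intro sum.cong[OF refl])
    fix u v assume uv: "u \<in> {..<dB ^ l}" "v \<in> {..<dB ^ l}"
    have eF: "?F (dg dA l x) (dg dA l y) (dg dB l u) (dg dB l v) = (?X $$ (x,y) *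
       chanW {..<l} ?\<nu> (dg dA l x) (dg dA l y) (dg dB l u) (dg dB l v)) * ker (dB ^ l) R u v a b"
      if "x < dA ^ l" "y < dA ^ l" for x y
      using uv that unfolding enc_kern_def dec_kern_def by (simp only: ud_dg lessThan_iff) (simp add: ker_def[of M2])
    show "?W ?X $$ (u,v) * ker (dB ^ l) R u v a b = (\<Sum>x<dA ^ l. \<Sum>y<dA ^ l. ?F (dg dA l x) (dg dA l y) (dg dB l u) (dg dB l v))"
      using uv by (simp only: We lessThan_iff sum_distrib_right) (intro sum.cong refl, simp only: eF lessThan_iff)
  qed
  also have "\<dots> = (\<Sum>A\<in>words dB {..<l}. \<Sum>B\<in>words dB {..<l}. \<Sum>I\<in>words dA {..<l}. \<Sum>J\<in>words dA {..<l}. ?F I J A B)"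
    by (simp only: sum_dg[OF d(1), of "\<lambda>J. ?F _ J _ _"] sum_dg[OF d(1), of "\<lambda>I. \<Sum>J\<in>words dA {..<l}. ?F I J _ _"]
       sum_dg[OF d(2), of "\<lambda>B. \<Sum>I\<in>words dA {..<l}. \<Sum>J\<in>words dA {..<l}. ?F I J _ B"]
       sum_dg[OF d(2), of "\<lambda>A. \<Sum>B\<in>words dB {..<l}. \<Sum>I\<in>words dA {..<l}. \<Sum>J\<in>words dA {..<l}. ?F I J A B"])
  also have "\<dots> = (\<Sum>(A,B,I,J)\<in>words dB {..<l} \<times> words dB {..<l} \<times> words dA {..<l} \<times> words dA {..<l}. ?F I J A B)"
    by (simp add: sum.cartesian_product)
  also have "\<dots> = (\<Sum>(I,J,A,B)\<in>words dA {..<l} \<times> words dA {..<l} \<times> words dB {..<l} \<times> words dB {..<l}. ?F I J A B)"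
    by (rule sum.reindex_bij_witness[where i="\<lambda>(I,J,A,B). (A,B,I,J)" and j="\<lambda>(A,B,I,J). (I,J,A,B)"]) auto
  also have "\<dots> = pairing dA dB {..<l} ?\<nu> (enc_kern dA l M2 P i j) (\<lambda>A B. dec_kern dB l R A B a b)"
    unfolding pairing_def by (simp add: sum.cartesian_product)
  finally show ?thesis .
qed

lemma mult_add_div_mod: "x < (e::nat) \<Longrightarrow> (k * e + x) div e = k \<and> (k * e + x) mod e = x"
  by simp

text \<open>In the ordering used by \<open>target\<close>, the vector with reference index
  \<open>k\<close>, message \<open>m\<close> and output index \<open>k\<close> has the number
  \<open>k * (M1 * D) + (m * D + k)\<close>; these numbers form the support of the target
  state.\<close>

lemma sum_target:
  fixes f :: "nat \<Rightarrow> complex"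
  assumes m: "m < M1" and M: "M2 \<le> D"
  shows "(\<Sum>r<M2 * (M1 * D). if (r mod (M1 * D)) div D = m \<and> (r mod (M1 * D)) mod D = r div (M1 * D) \<and> r div (M1 * D) < M2 then f r else 0)
    = (\<Sum>k<M2. f (k * (M1 * D) + (m * D + k)))"
proof -
  have lt: "m * D + k < M1 * D" if "k < M2" for k using mult_add_less[OF m, of k D] that M by simp
  show ?thesis
  proof (rule sum.mono_neutral_cong_right[of _ "(\<lambda>k. k * (M1 * D) + (m * D + k)) ` {..<M2}", THEN trans])
    show "(\<lambda>k. k * (M1 * D) + (m * D + k)) ` {..<M2} \<subseteq> {..<M2 * (M1 * D)}"
      using mult_add_less[OF _ lt] by auto
    show "\<forall>r\<in>{..<M2 * (M1 * D)} - (\<lambda>k. k * (M1 * D) + (m * D + k)) ` {..<M2}.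
       (if (r mod (M1 * D)) div D = m \<and> (r mod (M1 * D)) mod D = r div (M1 * D) \<and> r div (M1 * D) < M2 then f r else 0) = 0"
    proof (intro ballI)
      fix r assume r: "r \<in> {..<M2 * (M1 * D)} - (\<lambda>k. k * (M1 * D) + (m * D + k)) ` {..<M2}"
      have False if h: "(r mod (M1 * D)) div D = m" "(r mod (M1 * D)) mod D = r div (M1 * D)" "r div (M1 * D) < M2"
      proof -
        let ?k = "r div (M1 * D)"
        have "r mod (M1 * D) = m * D + ?k" using h div_mult_mod_eq[of "r mod (M1 * D)" D] by metis
        then have "r = ?k * (M1 * D) + (m * D + ?k)" using div_mult_mod_eq[of r "M1 * D"] by metis
        then show False using r h(3) by blast
      qed
      then show "(if (r mod (M1 * D)) div D = m \<and> (r mod (M1 * D)) mod D = r div (M1 * D) \<and> r div (M1 * D) < M2 then f r else 0) = 0" by auto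
    qed
    fix r assume "r \<in> (\<lambda>k. k * (M1 * D) + (m * D + k)) ` {..<M2}"
    then obtain k where k: "k < M2" "r = k * (M1 * D) + (m * D + k)" by auto
    have "r div (M1 * D) = k" "r mod (M1 * D) = m * D + k" using mult_add_div_mod[OF lt[OF k(1)], of k] unfolding k(2) by auto
    then show "(if (r mod (M1 * D)) div D = m \<and> (r mod (M1 * D)) mod D = r div (M1 * D) \<and> r div (M1 * D) < M2 then f r else 0) = f r"
      using k M by simp
  next
    have inj: "inj_on (\<lambda>k. k * (M1 * D) + (m * D + k)) {..<M2}"
    proof (rule inj_onI)
      fix k k' assume "k \<in> {..<M2}" "k' \<in> {..<M2}" "k * (M1 * D) + (m * D + k) = k' * (M1 * D) + (m * D + k')"
      then have "(k * (M1 * D) + (m * D + k)) div (M1 * D) = (k' * (M1 * D) + (m * D + k')) div (M1 * D)" by (simp only:)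
      then show "k = k'" using mult_add_div_mod[OF lt, of k k] mult_add_div_mod[OF lt, of k' k'] \<open>k \<in> {..<M2}\<close> \<open>k' \<in> {..<M2}\<close> by (metis lessThan_iff)
    qed
    show "sum f ((\<lambda>k. k * (M1 * D) + (m * D + k)) ` {..<M2}) = (\<Sum>k<M2. f (k * (M1 * D) + (m * D + k)))"
      by (simp add: sum.reindex[OF inj])
  qed simp
qed

text \<open>The target state of \<open>gfid\<close> is pure, so the fidelity is linear in the channel output.\<close>

lemma gfid_eq:
  assumes c: "is_code dA dB l M1 M2 (D, P, R)" and m: "m < M1"
    and Ns: "length Ns = l" "\<forall>N\<in>set Ns. cptp dA dB N" and d: "1 \<le> dA" "1 \<le> dB"
  shows "gfid dA dB l M1 M2 (tensor_list dA dB Ns) (D, P, R) m =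
    Re (cfid dA dB {..<l} (\<lambda>t. ker dA (Ns ! t)) M2 (enc_kern dA l M2 (P m)) (dec_kern dB l (R m)))"
proof -
  note cD = is_codeD[OF c] and aD = acodeD[OF code_acode[OF c d]]
  let ?\<nu> = "\<lambda>t. ker dA (Ns ! t)"
  let ?W = "tensor_list dA dB Ns"
  let ?E = "M1 * D"
  let ?q = "\<lambda>m' i j a b. pairing dA dB {..<l} ?\<nu> (enc_kern dA l M2 (P m) i j) (\<lambda>A B. dec_kern dB l (R m') A B a b)"
  have D: "0 < D" using cD(2,3) by simp
  have chk: "\<forall>t\<in>{..<l}. chk dA dB (?\<nu> t)" using Ns cptp_chk by (metis lessThan_iff nth_mem)
  have Nc: "\<forall>N\<in>set Ns. \<forall>X\<in>carrier_mat dA dA. N X \<in> carrier_mat dB dB"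
    using Ns(2) lin_carrier[OF cp_lin[OF cptp_cp]] by blast
  have T: "R m' (?W (P m (munit M2 i j))) $$ (a,b) = ?q m' i j a b" if "m' < M1" "a < D" "b < D" for m' i j a b
    by (rule transmit_entry[OF cp_lin[OF cptp_cp[OF cD(4)[OF m]]] cp_lin[OF cptni_cp[OF cD(5)[OF that(1)]]] Ns(1) Nc d that(2,3)])
  have Rc: "R m' (?W (P m (munit M2 i j))) \<in> carrier_mat D D" if "m' < M1" for m' i j
  proof -
    have "P m (munit M2 i j) \<in> carrier_mat (dA ^ l) (dA ^ l)" by (rule lin_carrier[OF cp_lin[OF cptp_cp[OF cD(4)[OF m]]] munit_carrier])
    then have "?W (P m (munit M2 i j)) \<in> carrier_mat (dB ^ l) (dB ^ l)"
      using tensor_list_entry[OF Nc d] Ns(1) by blast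
    then show ?thesis by (rule lin_carrier[OF cp_lin[OF cptni_cp[OF cD(5)[OF that]]]])
  qed
  let ?f = "dec_map M1 D R \<circ> ?W \<circ> P m"
  have fc: "?f (munit M2 i j) \<in> carrier_mat ?E ?E" for i j unfolding dec_map_def msum_def by simp
  have kf: "ker M2 ?f i j x y = (\<Sum>m'<M1. if x div D = m' \<and> y div D = m' then ?q m' i j (x mod D) (y mod D) else 0)"
    if xy: "x < ?E" "y < ?E" for i j x y
  proof -
    have "ker M2 ?f i j x y = (\<Sum>m'<M1. kron (munit M1 m' m') (R m' (?W (P m (munit M2 i j)))) $$ (x,y))"
      unfolding ker_def dec_map_def msum_def using xy by simp
    also have "\<dots> = (\<Sum>m'<M1. if x div D = m' \<and> y div D = m' then ?q m' i j (x mod D) (y mod D) else 0)"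
    proof (rule sum.cong[OF refl])
      fix m' assume m': "m' \<in> {..<M1}"
      have md: "x mod D < D" "y mod D < D" "x div D < M1" "y div D < M1" using D xy less_mult_imp_div_less by auto
      show "kron (munit M1 m' m') (R m' (?W (P m (munit M2 i j)))) $$ (x,y) = (if x div D = m' \<and> y div D = m' then ?q m' i j (x mod D) (y mod D) else 0)"
        using Rc[of m' i j] T[of m' "x mod D" "y mod D" i j] m' md xy by (simp add: kron_def munit_def)
    qed
    finally show ?thesis .
  qed
  define \<sigma> where "\<sigma> = tensor2 M2 M2 M2 ?E (\<lambda>Y. Y) ?f (maxent M2)"
  have \<sigma>c: "\<sigma> \<in> carrier_mat (M2 * ?E) (M2 * ?E)" unfolding \<sigma>_def by (rule tensor2_carrier)
  have \<sigma>e: "\<sigma> $$ (r,c) = complex_of_real (1 / real M2) * ker M2 ?f (r div ?E) (c div ?E) (r mod ?E) (c mod ?E)"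
    if rc: "r < M2 * ?E" "c < M2 * ?E" for r c
  proof -
    have rd: "r div ?E < M2" "c div ?E < M2" using rc less_mult_imp_div_less by auto
    have "\<sigma> $$ (r,c) = (\<Sum>k<M2. \<Sum>l<M2. maxent M2 $$ ((r div ?E) * M2 + k, (c div ?E) * M2 + l) * ker M2 ?f k l (r mod ?E) (c mod ?E))"
      unfolding \<sigma>_def by (rule tensor2_ident_entry) (use fc rc in simp_all)
    also have "\<dots> = (\<Sum>k<M2. \<Sum>l<M2. if k = r div ?E then if l = c div ?E then complex_of_real (1 / real M2) * ker M2 ?f (r div ?E) (c div ?E) (r mod ?E) (c mod ?E) else 0 else 0)"
      using rd mult_add_less[of _ M2 _ M2] by (intro sum.cong refl) (auto simp: maxent_def)
    also have "\<dots> = (\<Sum>k<M2. if k = r div ?E then complex_of_real (1 / real M2) * ker M2 ?f (r div ?E) (c div ?E) (r mod ?E) (c mod ?E) else 0)"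
      using rd by (intro sum.cong refl) auto
    finally show ?thesis using rd by simp
  qed
  \<comment> \<open>The output is block diagonal in the message register, and each block is a Gram
    kernel supplied by \<open>pairing_gram\<close>.\<close>
  have "psd \<sigma>"
  proof (rule gram_psd[OF gram_cong \<sigma>c])
    let ?Z = "{..<M2} \<times> {..<D}"
    let ?K = "\<lambda>r c. complex_of_real (1 / real M2) * (\<Sum>m'<M1. if ((r mod ?E) div D = m') \<and> ((c mod ?E) div D = m') then
       ?q m' (r div ?E) (c div ?E) ((r mod ?E) mod D) ((c mod ?E) mod D) else 0)"
    have md: "r div ?E < M2" "(r mod ?E) mod D < D" if "r < M2 * ?E" for r using D that less_mult_imp_div_less by auto
    show "gram {..<M2 * ?E} ?K"
    proof (intro gram_scale gram_sum)
      fix m' assume m': "m' \<in> {..<M1}"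
      have "gram ?Z (\<lambda>x y. ?q m' (fst x) (fst y) (snd x) (snd y))"
        using m' by (intro pairing_gram[OF chk aD(4)[OF m] aD(6)]) auto
      from gram_vimage[OF this, of "{..<M2 * ?E}" "\<lambda>r. (r div ?E, (r mod ?E) mod D)"] md
      have "gram {..<M2 * ?E} (\<lambda>r c. ?q m' (r div ?E) (c div ?E) ((r mod ?E) mod D) ((c mod ?E) mod D))" by auto
      from gram_truncate[OF this, of "{..<M2 * ?E}" "\<lambda>r. (r mod ?E) div D = m'"]
      show "gram {..<M2 * ?E} (\<lambda>r c. if ((r mod ?E) div D = m') \<and> ((c mod ?E) div D = m') then
       ?q m' (r div ?E) (c div ?E) ((r mod ?E) mod D) ((c mod ?E) mod D) else 0)" by auto
    qed simp
    fix r c assume rc: "r \<in> {..<M2 * ?E}" "c \<in> {..<M2 * ?E}"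
    have "0 < ?E" using cD(1) D by simp
    then have "r mod ?E < ?E" "c mod ?E < ?E" by auto
    then show "\<sigma> $$ (r,c) = ?K r c" using rc by (simp only: \<sigma>e kf lessThan_iff)
  qed
  define ok where "ok = (\<lambda>r. (r mod ?E) div D = m \<and> (r mod ?E) mod D = r div ?E \<and> r div ?E < M2)"
  define \<phi> where "\<phi> = (\<lambda>r. if ok r then complex_of_real (1 / sqrt (real M2)) else 0)"
  have sq: "complex_of_real (1 / sqrt (real M2)) * complex_of_real (1 / sqrt (real M2)) = complex_of_real (1 / real M2)"
    unfolding of_real_mult[symmetric] by (simp add: real_sqrt_mult_self)
  have tgt: "target M1 M2 D m = Matrix.mat (M2 * ?E) (M2 * ?E) (\<lambda>(r,c). \<phi> r * cnj (\<phi> c))"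
    unfolding target_def Let_def ok_def[symmetric]
    by (rule eq_matI) (use sq in \<open>auto simp: \<phi>_def ok_def\<close>)
  have sum_ok: "(\<Sum>r<M2 * ?E. if ok r then g r else 0) = (\<Sum>k<M2. g (k * ?E + (m * D + k)))" for g :: "nat \<Rightarrow> complex"
    unfolding ok_def by (rule sum_target[OF m cD(3)])
  have "nsq (M2 * ?E) \<phi> = (\<Sum>r<M2 * ?E. if ok r then complex_of_real (1 / real M2) else 0)"
    unfolding nsq_def \<phi>_def using sq by (intro sum.cong refl) auto
  also have "\<dots> = 1" unfolding sum_ok using cD(2) by simp
  finally have n1: "nsq (M2 * ?E) \<phi> = 1" .
  have lt: "m * D + k < ?E" if "k < M2" for k using mult_add_less[OF m, of k D] that cD(3) by simp
  have "qf (M2 * ?E) (\<lambda>r c. \<sigma> $$ (r,c)) \<phi> = (\<Sum>r<M2 * ?E. if ok r then (\<Sum>c<M2 * ?E. if ok c then complex_of_real (1 / real M2) * \<sigma> $$ (r,c) else 0) else 0)"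
    unfolding qf_def \<phi>_def sq[symmetric] by (intro sum.cong refl) (auto intro!: sum.cong)
  also have "\<dots> = (\<Sum>k<M2. \<Sum>k'<M2. complex_of_real (1 / real M2) * \<sigma> $$ (k * ?E + (m * D + k), k' * ?E + (m * D + k')))"
    unfolding sum_ok ..
  also have "\<dots> = (\<Sum>k<M2. \<Sum>k'<M2. complex_of_real (1 / real M2) * (complex_of_real (1 / real M2) * ?q m k k' k k'))"
  proof (intro sum.cong refl)
    fix k k' assume "k \<in> {..<M2}" "k' \<in> {..<M2}"
    then have k: "k < M2" "k' < M2" by auto
    have dm: "(k * ?E + (m * D + k)) div ?E = k" "(k * ?E + (m * D + k)) mod ?E = m * D + k" "(m * D + k) div D = m" "(m * D + k) mod D = k" 
      if "k < M2" for k
      using mult_add_div_mod[OF lt[OF that], of k] mult_add_div_mod[of k D m] that cD(3) by auto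
    have "\<sigma> $$ (k * ?E + (m * D + k), k' * ?E + (m * D + k')) = complex_of_real (1 / real M2) * ker M2 ?f k k' (m * D + k) (m * D + k')"
      unfolding \<sigma>e[OF mult_add_less[OF k(1) lt[OF k(1)]] mult_add_less[OF k(2) lt[OF k(2)]]] dm[OF k(1)] dm[OF k(2)] ..
    also have "ker M2 ?f k k' (m * D + k) (m * D + k') = (\<Sum>m'<M1. if m = m' then ?q m k k' k k' else 0)"
      unfolding kf[OF lt[OF k(1)] lt[OF k(2)]] dm[OF k(1)] dm[OF k(2)] by (intro sum.cong refl) auto
    also have "\<dots> = ?q m k k' k k'" using m by simp
    finally show "complex_of_real (1 / real M2) * \<sigma> $$ (k * ?E + (m * D + k), k' * ?E + (m * D + k')) 
      = complex_of_real (1 / real M2) * (complex_of_real (1 / real M2) * ?q m k k' k k')" by (simp only:)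
  qed
  also have "\<dots> = cfid dA dB {..<l} ?\<nu> M2 (enc_kern dA l M2 (P m)) (dec_kern dB l (R m))"
    unfolding cfid_def sum_distrib_left by (intro sum.cong refl) (simp add: power2_eq_square)
  finally have q: "qf (M2 * ?E) (\<lambda>r c. \<sigma> $$ (r,c)) \<phi> = cfid dA dB {..<l} ?\<nu> M2 (enc_kern dA l M2 (P m)) (dec_kern dB l (R m))" .
  have "gfid dA dB l M1 M2 ?W (D, P, R) m = fidelity (target M1 M2 D m) \<sigma>"
    unfolding gfid_def \<sigma>_def by simp
  also have "\<dots> = Re (qf (M2 * ?E) (\<lambda>r c. \<sigma> $$ (r,c)) \<phi>)"
    by (rule fidelity_pure[OF \<open>psd \<sigma>\<close> \<sigma>c tgt n1])
  finally show ?thesis unfolding q .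
qed

lemma avg_fid_eq:
  assumes c: "is_code dA dB l M1 M2 (D, P, R)"
    and Ns: "length Ns = l" "\<forall>N\<in>set Ns. cptp dA dB N" and d: "1 \<le> dA" "1 \<le> dB"
  shows "avg_fid dA dB l M1 M2 (tensor_list dA dB Ns) (D, P, R) =
    afid dA dB {..<l} (\<lambda>t. ker dA (Ns ! t)) M1 M2 (\<lambda>m. enc_kern dA l M2 (P m)) (\<lambda>m. dec_kern dB l (R m))"
  unfolding avg_fid_def afid_def using gfid_eq[OF c _ Ns d] by simp

lemma code_to_acode:
  assumes c: "is_code dA dB l M1 M2 c" and d: "1 \<le> dA" "1 \<le> dB"
  shows "\<exists>D p r. acode dA dB {..<l} M1 M2 D p r \<and> (\<forall>Ns. length Ns = l \<longrightarrow> (\<forall>N\<in>set Ns. cptp dA dB N) \<longrightarrow>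
    avg_fid dA dB l M1 M2 (tensor_list dA dB Ns) c = afid dA dB {..<l} (\<lambda>t. ker dA (Ns ! t)) M1 M2 p r)"
proof -
  obtain D P R where c': "c = (D, P, R)" by (cases c)
  show ?thesis using code_acode[OF c[unfolded c'] d] avg_fid_eq[OF c[unfolded c'] _ _ d] unfolding c' by blast
qed

text \<open>Together with \<open>code_to_acode\<close> this makes codes and kernel codes
  interchangeable, with the same average fidelity for all channel lists at once. The rebuilt kernels
  agree with the given ones on words and on indices below \<open>M2\<close>, which is all that the
  fidelity sees.\<close>

lemma acode_to_code:
  assumes a: "acode dA dB {..<l} M1 M2 D p r" and d: "1 \<le> dA" "1 \<le> dB"
  shows "\<exists>c. is_code dA dB l M1 M2 c \<and> (\<forall>Ns. length Ns = l \<longrightarrow> (\<forall>N\<in>set Ns. cptp dA dB N) \<longrightarrow>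
    avg_fid dA dB l M1 M2 (tensor_list dA dB Ns) c = afid dA dB {..<l} (\<lambda>t. ker dA (Ns ! t)) M1 M2 p r)"
proof -
  note aD = acodeD[OF a]
  define P where "P = (\<lambda>m. kmap M2 (dA ^ l) (\<lambda>i j x y. p m i j (dg dA l x) (dg dA l y)))"
  define R where "R = (\<lambda>m. kmap (dB ^ l) D (\<lambda>x y a b. r m (dg dB l x) (dg dB l y) a b))"
  have gR: "gram ({..<dB ^ l} \<times> {..<D}) (\<lambda>u v. r m (dg dB l (fst u)) (dg dB l (fst v)) (snd u) (snd v))" if "m < M1" for m
    by (rule gram_vimage[OF aD(6)[OF that], of _ "\<lambda>u. (dg dB l (fst u), snd u)", simplified]) (use dg_words[OF d(2)] in auto)
  have code: "is_code dA dB l M1 M2 (D, P, R)"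
    unfolding is_code_def prod.case
  proof (intro conjI allI impI ballI)
    show "1 \<le> M1" "1 \<le> M2" "M2 \<le> D" by (fact aD)+
    have trR: "mtrace (R m X) = (\<Sum>i<dB ^ l. \<Sum>j<dB ^ l. X $$ (i,j) * (\<Sum>a<D. r m (dg dB l i) (dg dB l j) a a))" for m X
      unfolding R_def by (rule mtrace_kmap)
    have tr: "(\<Sum>m<M1. mtrace (R m X)) = mtrace X" if X: "X \<in> carrier_mat (dB ^ l) (dB ^ l)" for X
    proof -
      have "(\<Sum>m<M1. mtrace (R m X)) = (\<Sum>i<dB ^ l. \<Sum>m<M1. \<Sum>j<dB ^ l. X $$ (i,j) * (\<Sum>a<D. r m (dg dB l i) (dg dB l j) a a))"
        unfolding trR by (rule sum.swap)
      also have "\<dots> = (\<Sum>i<dB ^ l. \<Sum>j<dB ^ l. \<Sum>m<M1. X $$ (i,j) * (\<Sum>a<D. r m (dg dB l i) (dg dB l j) a a))"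
        by (rule sum.cong[OF refl], rule sum.swap)
      also have "\<dots> = (\<Sum>i<dB ^ l. \<Sum>j<dB ^ l. X $$ (i,j) * (if i = j then 1 else 0))"
      proof (intro sum.cong refl)
        fix i j assume "i \<in> {..<dB ^ l}" "j \<in> {..<dB ^ l}"
        then have "dg dB l i = dg dB l j \<longleftrightarrow> i = j" using dg_inj[of dB l] by (auto simp: inj_on_def)
        then show "(\<Sum>m<M1. X $$ (i,j) * (\<Sum>a<D. r m (dg dB l i) (dg dB l j) a a)) = X $$ (i,j) * (if i = j then 1 else 0)"
          using aD(7)[OF dg_words[OF d(2), of l i] dg_words[OF d(2), of l j]] unfolding sum_distrib_left[symmetric] by simp
      qed
      also have "\<dots> = mtrace X" by (rule sum_delta_trace[OF X])
      finally show ?thesis .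
    qed
    then show "\<And>X. X \<in> carrier_mat (dB ^ l) (dB ^ l) \<Longrightarrow> (\<Sum>m<M1. mtrace (R m X)) = mtrace X" .
    fix m assume m: "m < M1"
    show "cptp M2 (dA ^ l) (P m)"
      unfolding P_def
    proof (rule kmap_cptp, unfold chk_def, intro conjI allI impI)
      show "gram ({..<M2} \<times> {..<dA ^ l}) (\<lambda>x y. p m (fst x) (fst y) (dg dA l (snd x)) (dg dA l (snd y)))"
        by (rule gram_vimage[OF aD(4)[OF m], of _ "\<lambda>u. (fst u, dg dA l (snd u))", simplified]) (use dg_words[OF d(1)] in auto)
      fix i j assume ij: "i < M2" "j < M2"
      show "(\<Sum>a<dA ^ l. p m i j (dg dA l a) (dg dA l a)) = (if i = j then 1 else 0)"
        using sum_dg[OF d(1), of "\<lambda>I. p m i j I I" l] aD(5)[OF m ij] by simp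
    qed
    show "cptni (dB ^ l) D (R m)"
      unfolding cptni_def
    proof (intro conjI ballI impI)
      show "cp_map (dB ^ l) D (R m)" unfolding R_def by (rule kmap_cp[OF gR[OF m]])
      fix X assume X: "X \<in> carrier_mat (dB ^ l) (dB ^ l)" "psd X"
      have nn: "0 \<le> Re (mtrace (R m' X))" if "m' < M1" for m'
      proof -
        have "mtrace (R m' X) = (\<Sum>a<D. \<Sum>i<dB ^ l. \<Sum>j<dB ^ l. X $$ (i,j) * r m' (dg dB l i) (dg dB l j) a a)"
          unfolding R_def mtrace_def kmap_def by simp
        also have "\<dots> \<ge> 0"
          by (intro sum_nonneg gram_form_diag[OF gR[OF that] psd_gram[OF X(2,1)]]) auto
        finally show ?thesis by (simp add: less_eq_complex_def)
      qed
      \<comment> \<open>No single decoder branch raises the trace, since it is one of the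
        nonnegative summands whose total is the trace of \<open>X\<close>.\<close>
      have "Re (mtrace (R m X)) \<le> (\<Sum>m'<M1. Re (mtrace (R m' X)))"
        by (rule member_le_sum[of m "{..<M1}" "\<lambda>m'. Re (mtrace (R m' X))"]) (use m nn in auto)
      also have "\<dots> = Re (mtrace X)" using tr[OF X(1)] by (metis Re_sum)
      finally show "Re (mtrace (R m X)) \<le> Re (mtrace X)" .
    qed
  qed
  have "avg_fid dA dB l M1 M2 (tensor_list dA dB Ns) (D, P, R) = afid dA dB {..<l} (\<lambda>t. ker dA (Ns ! t)) M1 M2 p r"
    if Ns: "length Ns = l" "\<forall>N\<in>set Ns. cptp dA dB N" for Ns
  proof -
    have p: "enc_kern dA l M2 (P m) i j I J = p m i j I J" if "i < M2" "j < M2" "I \<in> words dA {..<l}" "J \<in> words dA {..<l}" for m i j I J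
      unfolding enc_kern_def P_def using that by (simp add: ker_kmap ud_less[OF d(1)] dg_ud[OF d(1)])
    have r: "dec_kern dB l (R m) A B a b = r m A B a b" if "a < M2" "b < M2" "A \<in> words dB {..<l}" "B \<in> words dB {..<l}" for m a b A B
      unfolding dec_kern_def R_def using that aD(3) by (simp add: ker_kmap ud_less[OF d(2)] dg_ud[OF d(2)])
    have "pairing dA dB {..<l} (\<lambda>t. ker dA (Ns ! t)) (enc_kern dA l M2 (P m) i j) (\<lambda>A B. dec_kern dB l (R m) A B i j)
       = pairing dA dB {..<l} (\<lambda>t. ker dA (Ns ! t)) (p m i j) (\<lambda>A B. r m A B i j)" if "i < M2" "j < M2" for m i j
      by (rule pairing_cong) (use p r that in auto)
    then show ?thesis
      unfolding avg_fid_eq[OF code Ns d] afid_def cfid_def by simp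
  qed
  then show ?thesis using code by blast
qed

section \<open>Rate regions in terms of kernels\<close>

text \<open>\<open>tensor2\<close> evaluates a map on matrix units only, so \<open>W\<close> can be
  exchanged for the map rebuilt from its kernel, to which \<open>kmap_cptp\<close> applies. It is
  needed for the convex combinations in \<open>conv_chan\<close>.\<close>

lemma chk_cptp:
  assumes lin: "lin_map d d' W" and chk: "chk d d' (ker d W)"
  shows "cptp d d' W"
  unfolding cptp_def cp_map_def
proof (intro conjI lin allI impI ballI)
  fix X :: "complex mat" assume X: "X \<in> carrier_mat d d"
  have "mtrace (W X) = (\<Sum>a<d'. \<Sum>i<d. \<Sum>j<d. X $$ (i,j) * ker d W i j a a)"
    unfolding mtrace_def using lin_carrier[OF lin X] lin_map_entry[OF lin X] by simp
  also have "\<dots> = mtrace (kmap d d' (ker d W) X)" unfolding mtrace_def kmap_def by simp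
  also have "\<dots> = mtrace X" using kmap_cptp[OF chk] X unfolding cptp_def by blast
  finally show "mtrace (W X) = mtrace X" .
next
  fix n and X :: "complex mat" assume X: "X \<in> carrier_mat (n * d) (n * d) \<and> psd X"
  have "tensor2 n n d d' (\<lambda>Y. Y) W X = tensor2 n n d d' (\<lambda>Y. Y) (kmap d d' (ker d W)) X" (is "?L = ?R")
  proof (rule eq_matI)
    have c: "?L \<in> carrier_mat (n * d') (n * d')" "?R \<in> carrier_mat (n * d') (n * d')" by (rule tensor2_carrier)+
    then show "dim_row ?L = dim_row ?R" "dim_col ?L = dim_col ?R" by auto
    fix r c assume "r < dim_row ?R" "c < dim_col ?R"
    then have rc: "r < n * d'" "c < n * d'" using c by auto
    have md: "r mod d' < d'" "c mod d' < d'" using rc by (cases "d' = 0"; simp)+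
    have "?L $$ (r,c) = (\<Sum>k<d. \<Sum>l<d. X $$ ((r div d') * d + k, (c div d') * d + l) * ker d W k l (r mod d') (c mod d'))"
      by (rule tensor2_ident_entry) (use lin_carrier[OF lin] rc in simp_all)
    moreover have "?R $$ (r,c) = (\<Sum>k<d. \<Sum>l<d. X $$ ((r div d') * d + k, (c div d') * d + l) * ker d (kmap d d' (ker d W)) k l (r mod d') (c mod d'))"
      by (rule tensor2_ident_entry) (use rc in \<open>simp_all add: kmap_def\<close>)
    ultimately show "?L $$ (r,c) = ?R $$ (r,c)" using md by (simp add: ker_kmap)
  qed
  then show "psd ?L" using kmap_cptp[OF chk] X unfolding cptp_def cp_map_def by simp
qed

definition wstate :: "nat \<Rightarrow> ('s \<Rightarrow> cmap) \<Rightarrow> (nat \<Rightarrow> 's) \<Rightarrow> nat \<Rightarrow> letter" where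
  "wstate dA N s t = ker dA (N (s t))"

text \<open>Achievability at one block length. State sequences are functions on all of
  \<open>nat\<close>, so that they can be shifted, sampled or regrouped without keeping track of
  lengths.\<close>

definition detgood :: "nat \<Rightarrow> nat \<Rightarrow> ('s \<Rightarrow> cmap) \<Rightarrow> nat \<Rightarrow> real \<Rightarrow> real \<Rightarrow> real \<Rightarrow> bool" where
  "detgood dA dB N l r1 r2 \<eta> \<longleftrightarrow> (\<exists>M1 M2 D p r. acode dA dB {..<l} M1 M2 D p r \<and>
     r1 \<le> log 2 (real M1) / real l \<and> r2 \<le> log 2 (real M2) / real l \<and>
     (\<forall>s. 1 - \<eta> \<le> afid dA dB {..<l} (wstate dA N s) M1 M2 p r))"

lemma afid_cong:
  assumes "\<And>t. t \<in> T \<Longrightarrow> \<nu> t = \<nu>' t"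
  shows "afid dA dB T \<nu> M1 M2 p r = afid dA dB T \<nu>' M1 M2 p r"
proof -
  have "pairing dA dB T \<nu> P R = pairing dA dB T \<nu>' P R" for P R
    by (rule pairing_cong) (use assms in auto)
  then show ?thesis unfolding afid_def cfid_def by simp
qed

text \<open>Achievability asks for one sequence of codes, whereas constructions deliver one
  tolerance at a time. At each \<open>l\<close> the best tolerance of the form
  \<open>1 / (k + 1)\<close> with \<open>k \<le> l\<close> is taken, and it tends to 0.\<close>

lemma diagonal_seq:
  fixes Q :: "nat \<Rightarrow> real \<Rightarrow> bool"
  assumes "\<And>\<eta>. 0 < \<eta> \<Longrightarrow> eventually (\<lambda>l. Q l \<eta>) sequentially"
  shows "\<exists>e. e \<longlonglongrightarrow> 0 \<and> eventually (\<lambda>l. Q l (e l)) sequentially"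
proof -
  let ?A = "\<lambda>l. {k. k \<le> l \<and> Q l (1 / real (Suc k))}"
  \<comment> \<open>The inserted 0 makes the maximum exist at every \<open>l\<close>; tolerance 1 is
    eventually available, and from then on the chosen value is genuine.\<close>
  define kk where "kk = (\<lambda>l. Max (insert 0 (?A l)))"
  define e where "e = (\<lambda>l. 1 / real (Suc (kk l)))"
  have fin: "finite (insert 0 (?A l))" for l by simp
  have ge: "eventually (\<lambda>l. k \<le> kk l) sequentially" for k
  proof -
    have "eventually (\<lambda>l. Q l (1 / real (Suc k))) sequentially" by (rule assms) simp
    with eventually_ge_at_top[of k] show ?thesis
      by eventually_elim (auto simp: kk_def intro!: Max_ge)
  qed
  have "filterlim kk at_top sequentially" using ge by (simp add: filterlim_at_top)
  then have "filterlim (\<lambda>l. real (Suc (kk l))) at_top sequentially"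
    by (intro filterlim_compose[OF filterlim_real_sequentially] filterlim_compose[OF filterlim_Suc])
  then have "e \<longlonglongrightarrow> 0" unfolding e_def
    by (intro tendsto_divide_0[OF tendsto_const] filterlim_at_top_imp_at_infinity)
  moreover have "eventually (\<lambda>l. Q l (e l)) sequentially"
  proof -
    have "eventually (\<lambda>l. Q l 1) sequentially" by (rule assms) simp
    then show ?thesis
    proof eventually_elim
      case (elim l)
      have "kk l \<in> insert 0 (?A l)" unfolding kk_def by (rule Max_in[OF fin]) simp
      then show ?case unfolding e_def using elim by auto
    qed
  qed
  ultimately show ?thesis by blast
qed

context
  fixes N :: "'s::finite \<Rightarrow> cmap" and dA dB :: nat
  assumes dA: "1 \<le> dA" and dB: "1 \<le> dB" and N: "\<forall>s. cptp dA dB (N s)"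
begin

lemma chk_N: "chk dA dB (ker dA (N s))"
  using N cptp_chk by blast

lemma chk_wstate: "\<forall>t\<in>T. chk dA dB (wstate dA N s t)"
  unfolding wstate_def using chk_N by blast

lemma code_of_acode:
  assumes "acode dA dB {..<l} M1 M2 D p r"
  shows "\<exists>c. is_code dA dB l M1 M2 c \<and>
    (\<forall>ss. length ss = l \<longrightarrow> avg_fid dA dB l M1 M2 (chan_seq dA dB N ss) c = afid dA dB {..<l} (wstate dA N (\<lambda>t. ss ! t)) M1 M2 p r)"
proof -
  obtain c where c: "is_code dA dB l M1 M2 c"
    and e: "\<And>Ns. length Ns = l \<Longrightarrow> (\<forall>N\<in>set Ns. cptp dA dB N) \<Longrightarrow>
    avg_fid dA dB l M1 M2 (tensor_list dA dB Ns) c = afid dA dB {..<l} (\<lambda>t. ker dA (Ns ! t)) M1 M2 p r"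
    using acode_to_code[OF assms dA dB] by blast
  have "avg_fid dA dB l M1 M2 (chan_seq dA dB N ss) c = afid dA dB {..<l} (wstate dA N (\<lambda>t. ss ! t)) M1 M2 p r"
    if "length ss = l" for ss
    unfolding chan_seq_def using e[of "map N ss"] that N
    by (auto simp: wstate_def intro!: afid_cong)
  with c show ?thesis by blast
qed

lemma acode_of_code:
  assumes "is_code dA dB l M1 M2 c"
  shows "\<exists>D p r. acode dA dB {..<l} M1 M2 D p r \<and>
    (\<forall>ss. length ss = l \<longrightarrow> avg_fid dA dB l M1 M2 (chan_seq dA dB N ss) c = afid dA dB {..<l} (wstate dA N (\<lambda>t. ss ! t)) M1 M2 p r)"
proof -
  obtain D p r where c: "acode dA dB {..<l} M1 M2 D p r"
    and e: "\<And>Ns. length Ns = l \<Longrightarrow> (\<forall>N\<in>set Ns. cptp dA dB N) \<Longrightarrow>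
    avg_fid dA dB l M1 M2 (tensor_list dA dB Ns) c = afid dA dB {..<l} (\<lambda>t. ker dA (Ns ! t)) M1 M2 p r"
    using code_to_acode[OF assms dA dB] by blast
  have "avg_fid dA dB l M1 M2 (chan_seq dA dB N ss) c = afid dA dB {..<l} (wstate dA N (\<lambda>t. ss ! t)) M1 M2 p r"
    if "length ss = l" for ss
    unfolding chan_seq_def using e[of "map N ss"] that N
    by (auto simp: wstate_def intro!: afid_cong)
  with c show ?thesis by blast
qed

lemma afid_wstate_bounds:
  assumes "acode dA dB {..<l} M1 M2 D p r"
  shows "0 \<le> afid dA dB {..<l} (wstate dA N s) M1 M2 p r" "afid dA dB {..<l} (wstate dA N s) M1 M2 p r \<le> 1"
  using afid_bounds[OF chk_wstate _ assms] by auto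

lemma avg_fid_bounds:
  assumes "is_code dA dB l M1 M2 c" "length ss = l"
  shows "0 \<le> avg_fid dA dB l M1 M2 (chan_seq dA dB N ss) c" "avg_fid dA dB l M1 M2 (chan_seq dA dB N ss) c \<le> 1"
  using acode_of_code[OF assms(1)] afid_wstate_bounds assms(2) by metis+

lemma finite_lists: "finite {ss :: 's list. length ss = l}"
  using finite_lists_length_eq[of "UNIV :: 's set" l] by simp

lemma lists_ne: "{ss :: 's list. length ss = l} \<noteq> {}"
proof -
  have "replicate l undefined \<in> {ss :: 's list. length ss = l}" by simp
  then show ?thesis by blast
qed

lemma wstate_list: "afid dA dB {..<l} (wstate dA N s) M1 M2 p r = afid dA dB {..<l} (wstate dA N (\<lambda>t. map s [0..<l] ! t)) M1 M2 p r"
  by (rule afid_cong) (simp add: wstate_def)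

text \<open>Provides codes at the finitely many lengths where no good one is promised, and shows
  that the zero rate pair is always achievable.\<close>

lemma detgood_trivial: "detgood dA dB N l 0 0 0"
proof -
  obtain p r where "acode dA dB {..<l} 1 1 1 p r" 
    and e: "\<And>\<nu>. \<forall>t\<in>{..<l}. chk dA dB (\<nu> t) \<Longrightarrow> cfid dA dB {..<l} \<nu> 1 (p 0) (r 0) = 1"
    using acode_trivial[OF dA, of "{..<l}" dB] by auto
  moreover have "afid dA dB {..<l} (wstate dA N s) 1 1 p r = 1" for s
    unfolding afid_def using e[OF chk_wstate] by simp
  ultimately show ?thesis unfolding detgood_def
    by (intro exI[of _ 1] exI[of _ p] exI[of _ r]) auto
qed

text \<open>Limits inferior, limit and infimum are traded for a condition at each block length and
  tolerance. As the state alphabet is finite, only finitely many lists enter each infimum.\<close>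

lemma A_d_iff:
  "(R1, R2) \<in> A_d dA dB N \<longleftrightarrow> R1 \<ge> 0 \<and> R2 \<ge> 0 \<and>
    (\<forall>\<eta>>0. eventually (\<lambda>l. detgood dA dB N l (R1 - \<eta>) (R2 - \<eta>) \<eta>) sequentially)"
proof
  assume "(R1, R2) \<in> A_d dA dB N"
  then obtain M1 M2 c where R: "R1 \<ge> 0" "R2 \<ge> 0" and c: "\<And>l. is_code dA dB l (M1 l) (M2 l) (c l)"
    and l1: "ereal R1 \<le> liminf (\<lambda>l. ereal (log 2 (real (M1 l)) / real l))"
    and l2: "ereal R2 \<le> liminf (\<lambda>l. ereal (log 2 (real (M2 l)) / real l))"
    and lim: "(\<lambda>l. INF ss \<in> {ss. length ss = l}. avg_fid dA dB l (M1 l) (M2 l) (chan_seq dA dB N ss) (c l)) \<longlonglongrightarrow> 1"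
    unfolding A_d_def by auto
  have "eventually (\<lambda>l. detgood dA dB N l (R1 - \<eta>) (R2 - \<eta>) \<eta>) sequentially" if \<eta>: "\<eta> > 0" for \<eta>
  proof -
    have "ereal (R1 - \<eta>) < ereal R1" using \<eta> by simp
    from less_LiminfD[OF less_le_trans[OF this l1]]
    have e1: "eventually (\<lambda>l. R1 - \<eta> < log 2 (real (M1 l)) / real l) sequentially" by simp
    have "ereal (R2 - \<eta>) < ereal R2" using \<eta> by simp
    from less_LiminfD[OF less_le_trans[OF this l2]]
    have e2: "eventually (\<lambda>l. R2 - \<eta> < log 2 (real (M2 l)) / real l) sequentially" by simp
    have e3: "eventually (\<lambda>l. 1 - \<eta> < (INF ss \<in> {ss. length ss = l}. avg_fid dA dB l (M1 l) (M2 l) (chan_seq dA dB N ss) (c l))) sequentially"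
      using order_tendstoD(1)[OF lim] \<eta> by simp
    from e1 e2 e3 show ?thesis
    proof eventually_elim
      case (elim l)
      obtain D p r where a: "acode dA dB {..<l} (M1 l) (M2 l) D p r"
        and e: "\<And>ss. length ss = l \<Longrightarrow> avg_fid dA dB l (M1 l) (M2 l) (chan_seq dA dB N ss) (c l) = afid dA dB {..<l} (wstate dA N (\<lambda>t. ss ! t)) (M1 l) (M2 l) p r"
        using acode_of_code[OF c] by blast
      have "1 - \<eta> \<le> afid dA dB {..<l} (wstate dA N s) (M1 l) (M2 l) p r" for s
      proof -
        have "(INF ss \<in> {ss. length ss = l}. avg_fid dA dB l (M1 l) (M2 l) (chan_seq dA dB N ss) (c l))
           \<le> avg_fid dA dB l (M1 l) (M2 l) (chan_seq dA dB N (map s [0..<l])) (c l)"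
          by (rule cINF_lower) (use finite_lists in auto)
        then show ?thesis using elim(3) e[of "map s [0..<l]"] wstate_list[of l s "M1 l" "M2 l" p r] by simp
      qed
      then show ?case unfolding detgood_def using a elim by (meson less_imp_le)
    qed
  qed
  then show "R1 \<ge> 0 \<and> R2 \<ge> 0 \<and> (\<forall>\<eta>>0. eventually (\<lambda>l. detgood dA dB N l (R1 - \<eta>) (R2 - \<eta>) \<eta>) sequentially)"
    using R by blast
next
  assume asm: "R1 \<ge> 0 \<and> R2 \<ge> 0 \<and> (\<forall>\<eta>>0. eventually (\<lambda>l. detgood dA dB N l (R1 - \<eta>) (R2 - \<eta>) \<eta>) sequentially)"
  obtain e where e: "e \<longlonglongrightarrow> 0" and ev: "eventually (\<lambda>l. detgood dA dB N l (R1 - e l) (R2 - e l) (e l)) sequentially"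
    using diagonal_seq[of "\<lambda>l \<eta>. detgood dA dB N l (R1 - \<eta>) (R2 - \<eta>) \<eta>"] asm by blast
  let ?P = "\<lambda>l M. is_code dA dB l (fst M) (fst (snd M)) (snd (snd M)) \<and> (detgood dA dB N l (R1 - e l) (R2 - e l) (e l) \<longrightarrow>
      R1 - e l \<le> log 2 (real (fst M)) / real l \<and> R2 - e l \<le> log 2 (real (fst (snd M))) / real l \<and>
      (\<forall>ss. length ss = l \<longrightarrow> 1 - e l \<le> avg_fid dA dB l (fst M) (fst (snd M)) (chan_seq dA dB N ss) (snd (snd M))))"
  have "\<exists>M. ?P l M" for l
  proof (cases "detgood dA dB N l (R1 - e l) (R2 - e l) (e l)")
    case True
    then obtain M1 M2 D p r where a: "acode dA dB {..<l} M1 M2 D p r"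
      and b: "R1 - e l \<le> log 2 (real M1) / real l" "R2 - e l \<le> log 2 (real M2) / real l"
     "\<And>s. 1 - e l \<le> afid dA dB {..<l} (wstate dA N s) M1 M2 p r" unfolding detgood_def by blast
    from code_of_acode[OF a] obtain c where "is_code dA dB l M1 M2 c"
      "\<And>ss. length ss = l \<Longrightarrow> avg_fid dA dB l M1 M2 (chan_seq dA dB N ss) c = afid dA dB {..<l} (wstate dA N (\<lambda>t. ss ! t)) M1 M2 p r" by blast
    then show ?thesis using b by (intro exI[of _ "(M1, M2, c)"]) auto
  next
    case False
    obtain M1 M2 D p r where a: "acode dA dB {..<l} M1 M2 D p r"
      using detgood_trivial[of l] unfolding detgood_def by blast
    from code_of_acode[OF a] obtain c where "is_code dA dB l M1 M2 c" by blast
    then show ?thesis using False by (intro exI[of _ "(M1, M2, c)"]) auto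
  qed
  then obtain C where C: "\<And>l. ?P l (C l)" by metis
  define M1 where "M1 = (\<lambda>l. fst (C l))"
  define M2 where "M2 = (\<lambda>l. fst (snd (C l)))"
  define c where "c = (\<lambda>l. snd (snd (C l)))"
  have code: "\<And>l. is_code dA dB l (M1 l) (M2 l) (c l)" unfolding M1_def M2_def c_def using C by blast
  have g: "eventually (\<lambda>l. R1 - e l \<le> log 2 (real (M1 l)) / real l \<and> R2 - e l \<le> log 2 (real (M2 l)) / real l \<and>
      (\<forall>ss. length ss = l \<longrightarrow> 1 - e l \<le> avg_fid dA dB l (M1 l) (M2 l) (chan_seq dA dB N ss) (c l))) sequentially"
    using ev by eventually_elim (use C in \<open>auto simp: M1_def M2_def c_def\<close>)
  have li: "ereal R \<le> liminf (\<lambda>l. ereal (f l))" if "eventually (\<lambda>l. R - e l \<le> f l) sequentially" for R f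
  proof -
    have "(\<lambda>l. ereal (R - e l)) \<longlonglongrightarrow> ereal (R - 0)" by (intro tendsto_intros e)
    then have "liminf (\<lambda>l. ereal (R - e l)) = ereal R" using lim_imp_Liminf[of sequentially "\<lambda>l. ereal (R - e l)"] by simp
    moreover have "liminf (\<lambda>l. ereal (R - e l)) \<le> liminf (\<lambda>l. ereal (f l))"
      by (rule Liminf_mono) (use that in simp)
    ultimately show ?thesis by simp
  qed
  have "(\<lambda>l. INF ss \<in> {ss. length ss = l}. avg_fid dA dB l (M1 l) (M2 l) (chan_seq dA dB N ss) (c l)) \<longlonglongrightarrow> 1"
  proof (rule tendsto_sandwich[of "\<lambda>l. 1 - e l" _ sequentially "\<lambda>_. 1"])
    show "eventually (\<lambda>l. 1 - e l \<le> (INF ss \<in> {ss. length ss = l}. avg_fid dA dB l (M1 l) (M2 l) (chan_seq dA dB N ss) (c l))) sequentially"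
      using g by eventually_elim (rule cINF_greatest[OF lists_ne], auto)
    show "eventually (\<lambda>l. (INF ss \<in> {ss. length ss = l}. avg_fid dA dB l (M1 l) (M2 l) (chan_seq dA dB N ss) (c l)) \<le> 1) sequentially"
    proof (intro always_eventually allI)
      fix l
      have "(INF ss \<in> {ss. length ss = l}. avg_fid dA dB l (M1 l) (M2 l) (chan_seq dA dB N ss) (c l))
           \<le> avg_fid dA dB l (M1 l) (M2 l) (chan_seq dA dB N (replicate l undefined)) (c l)"
        by (rule cINF_lower) (use finite_lists in auto)
      then show "(INF ss \<in> {ss. length ss = l}. avg_fid dA dB l (M1 l) (M2 l) (chan_seq dA dB N ss) (c l)) \<le> 1"
        using avg_fid_bounds(2)[OF code, of "replicate l undefined" l] by simp
    qed
    have "(\<lambda>l. 1 - e l) \<longlonglongrightarrow> 1 - 0" by (intro tendsto_intros e)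
    then show "(\<lambda>l. 1 - e l) \<longlonglongrightarrow> 1" by simp
  qed simp
  moreover have "ereal R1 \<le> liminf (\<lambda>l. ereal (log 2 (real (M1 l)) / real l))"
    by (rule li) (use g in \<open>auto elim: eventually_mono\<close>)
  moreover have "ereal R2 \<le> liminf (\<lambda>l. ereal (log 2 (real (M2 l)) / real l))"
    by (rule li) (use g in \<open>auto elim: eventually_mono\<close>)
  ultimately show "(R1, R2) \<in> A_d dA dB N"
    unfolding A_d_def using asm code by blast
qed

lemma detgood_mono:
  assumes "detgood dA dB N l r1 r2 \<eta>" "r1' \<le> r1" "r2' \<le> r2" "\<eta> \<le> \<eta>'"
  shows "detgood dA dB N l r1' r2' \<eta>'"
proof -
  obtain M1 M2 D p r where a: "acode dA dB {..<l} M1 M2 D p r"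
    and b: "r1 \<le> log 2 (real M1) / real l" "r2 \<le> log 2 (real M2) / real l"
    and f: "\<And>s. 1 - \<eta> \<le> afid dA dB {..<l} (wstate dA N s) M1 M2 p r"
    using assms(1) unfolding detgood_def by blast
  show ?thesis unfolding detgood_def
  proof (intro exI conjI allI)
    show "acode dA dB {..<l} M1 M2 D p r" by (fact a)
    show "r1' \<le> log 2 (real M1) / real l" "r2' \<le> log 2 (real M2) / real l"
      using b assms(2,3) by linarith+
    show "1 - \<eta>' \<le> afid dA dB {..<l} (wstate dA N s) M1 M2 p r" for s
      using f[of s] assms(4) by linarith
  qed
qed

lemma zero_in_A_d: "(0, 0) \<in> A_d dA dB N"
proof -
  have "detgood dA dB N l (0 - \<eta>) (0 - \<eta>) \<eta>" if "\<eta> > 0" for l \<eta>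
    by (rule detgood_mono[OF detgood_trivial]) (use that in auto)
  then show ?thesis unfolding A_d_iff by simp
qed

text \<open>Point masses; on the counting space of codes all singletons and all fidelities are
  measurable.\<close>

lemma A_d_subset_A_r: "A_d dA dB N \<subseteq> A_r dA dB N"
proof
  fix R assume R0: "R \<in> A_d dA dB N"
  obtain R1 R2 where R1: "R = (R1, R2)" by (cases R)
  from R0[unfolded R1] obtain M1 M2 c where R': "R1 \<ge> 0" "R2 \<ge> 0" and c: "\<And>l. is_code dA dB l (M1 l) (M2 l) (c l)"
    and l: "ereal R1 \<le> liminf (\<lambda>l. ereal (log 2 (real (M1 l)) / real l))"
      "ereal R2 \<le> liminf (\<lambda>l. ereal (log 2 (real (M2 l)) / real l))"
    and lim: "(\<lambda>l. INF ss \<in> {ss. length ss = l}. avg_fid dA dB l (M1 l) (M2 l) (chan_seq dA dB N ss) (c l)) \<longlonglongrightarrow> 1"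
    unfolding A_d_def by auto
  note R = R1 R'
  define \<mu> where "\<mu> = (\<lambda>l. return (count_space {c. is_code dA dB l (M1 l) (M2 l) c}) (c l))"
  have "is_rcode dA dB N l (M1 l) (M2 l) (\<mu> l)" for l
    unfolding is_rcode_def \<mu>_def using c[of l]
    by (auto intro!: prob_space_return simp: measurable_def)
  moreover have "(LINT c|\<mu> l. avg_fid dA dB l (M1 l) (M2 l) (chan_seq dA dB N ss) c) = avg_fid dA dB l (M1 l) (M2 l) (chan_seq dA dB N ss) (c l)" for l ss
    unfolding \<mu>_def using c[of l] by (subst integral_return) auto
  ultimately show "R \<in> A_r dA dB N"
    unfolding A_r_def R(1) mem_Collect_eq prod.case using R l lim
    by (intro conjI, simp, simp, rule_tac x=M1 in exI, rule_tac x=M2 in exI, rule_tac x=\<mu> in exI) (simp only: simp_thms)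
qed

lemma conv_chan_elem:
  assumes "W \<in> conv_chan dB N"
  obtains q where "\<forall>s. q s \<ge> 0" "sum q UNIV = 1" "cptp dA dB W"
    "\<And>i j a b. a < dB \<Longrightarrow> b < dB \<Longrightarrow> ker dA W i j a b = (\<Sum>s\<in>UNIV. complex_of_real (q s) * ker dA (N s) i j a b)"
proof -
  obtain q where W: "W = (\<lambda>X. msum dB (\<lambda>s. complex_of_real (q s) \<cdot>\<^sub>m N s X) UNIV)"
    and q: "\<forall>s. q s \<ge> 0" "sum q UNIV = 1" using assms unfolding conv_chan_def by blast
  have lN: "lin_map dA dB (N s)" for s using N cp_lin cptp_cp by blast
  have Nc: "N s X \<in> carrier_mat dB dB" if "X \<in> carrier_mat dA dA" for s X using lin_carrier[OF lN that] .
  have We: "W X $$ (a,b) = (\<Sum>s\<in>UNIV. complex_of_real (q s) * N s X $$ (a,b))"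
    if "X \<in> carrier_mat dA dA" "a < dB" "b < dB" for X a b
  proof -
    have "(complex_of_real (q s) \<cdot>\<^sub>m N s X) $$ (a,b) = complex_of_real (q s) * N s X $$ (a,b)" for s
      using Nc[OF that(1), of s] that by (subst index_smult_mat) auto
    then show ?thesis unfolding W msum_def using that by simp
  qed
  have Wc: "W X \<in> carrier_mat dB dB" for X unfolding W msum_def by simp
  have lin: "lin_map dA dB W"
    unfolding lin_map_def
  proof (intro conjI ballI allI)
    fix X :: "complex mat" assume X: "X \<in> carrier_mat dA dA"
    show "W X \<in> carrier_mat dB dB" by (rule Wc)
    show "W (c \<cdot>\<^sub>m X) = c \<cdot>\<^sub>m W X" for c
    proof (rule eq_matI)
      fix a b assume "a < dim_row (c \<cdot>\<^sub>m W X)" "b < dim_col (c \<cdot>\<^sub>m W X)"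
      then have ab: "a < dB" "b < dB" using Wc[of X] by auto
      have "N s (c \<cdot>\<^sub>m X) = c \<cdot>\<^sub>m N s X" for s using lN[of s] X unfolding lin_map_def by blast
      moreover have "(c \<cdot>\<^sub>m N s X) $$ (a,b) = c * N s X $$ (a,b)" for s
        using Nc[OF X, of s] ab by (subst index_smult_mat) auto
      ultimately show "W (c \<cdot>\<^sub>m X) $$ (a,b) = (c \<cdot>\<^sub>m W X) $$ (a,b)"
        using We[of "c \<cdot>\<^sub>m X" a b] We[of X a b] X ab Nc[OF X] Wc[of X] by (simp add: sum_distrib_left mult.left_commute)
    qed (use Wc[of X] Wc[of "c \<cdot>\<^sub>m X"] in auto)
    fix Y :: "complex mat" assume Y: "Y \<in> carrier_mat dA dA"
    show "W (X + Y) = W X + W Y"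
    proof (rule eq_matI)
      fix a b assume "a < dim_row (W X + W Y)" "b < dim_col (W X + W Y)"
      then have ab: "a < dB" "b < dB" using Wc[of X] Wc[of Y] by auto
      have "N s (X + Y) = N s X + N s Y" for s using lN[of s] X Y unfolding lin_map_def by blast
      moreover have "(N s X + N s Y) $$ (a,b) = N s X $$ (a,b) + N s Y $$ (a,b)" for s
        using Nc[OF X, of s] Nc[OF Y, of s] ab by (subst index_add_mat) auto
      ultimately show "W (X + Y) $$ (a,b) = (W X + W Y) $$ (a,b)"
        using We[of "X + Y" a b] We[of X a b] We[of Y a b] X Y ab Nc[OF X] Nc[OF Y] Wc[of X] Wc[of Y] by (simp add: sum.distrib distrib_left)
    qed (use Wc[of X] Wc[of Y] Wc[of "X + Y"] in auto)
  qed
  have k: "ker dA W i j a b = (\<Sum>s\<in>UNIV. complex_of_real (q s) * ker dA (N s) i j a b)" if "a < dB" "b < dB" for i j a b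
    unfolding ker_def using We[OF munit_carrier that] .
  have "chk dA dB (ker dA W)"
    unfolding chk_def
  proof (intro conjI allI impI)
    have "gram ({..<dA} \<times> {..<dB}) (\<lambda>x y. \<Sum>s\<in>UNIV. complex_of_real (q s) * ker dA (N s) (fst x) (fst y) (snd x) (snd y))"
      using q chk_N unfolding chk_def by (intro gram_sum gram_scale) auto
    then show "gram ({..<dA} \<times> {..<dB}) (\<lambda>x y. ker dA W (fst x) (fst y) (snd x) (snd y))"
      by (rule gram_cong) (use k in auto)
    fix i j assume ij: "i < dA" "j < dA"
    have "(\<Sum>a<dB. ker dA W i j a a) = (\<Sum>a<dB. \<Sum>s\<in>UNIV. complex_of_real (q s) * ker dA (N s) i j a a)" using k by simp
    also have "\<dots> = (\<Sum>s\<in>UNIV. complex_of_real (q s) * (\<Sum>a<dB. ker dA (N s) i j a a))"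
      by (subst sum.swap) (simp add: sum_distrib_left)
    also have "\<dots> = (\<Sum>s\<in>UNIV. complex_of_real (q s)) * (if i = j then 1 else 0)"
      using chk_N ij unfolding chk_def by (simp add: sum_distrib_right)
    also have "(\<Sum>s\<in>UNIV. complex_of_real (q s)) = 1" using q(2) by (metis of_real_sum of_real_1)
    finally show "(\<Sum>a<dB. ker dA W i j a a) = (if i = j then 1 else 0)" by simp
  qed
  with q k chk_cptp[OF lin] show ?thesis using that by blast
qed

lemma afid_cong_lt:
  assumes a: "acode dA dB T M1 M2 D p r" 
    and e: "\<And>t i j a b. t \<in> T \<Longrightarrow> i < dA \<Longrightarrow> j < dA \<Longrightarrow> a < dB \<Longrightarrow> b < dB \<Longrightarrow> \<nu> t i j a b = \<nu>' t i j a b"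
  shows "afid dA dB T \<nu> M1 M2 p r = afid dA dB T \<nu>' M1 M2 p r"
proof -
  have "chanW T \<nu> I J A B = chanW T \<nu>' I J A B"
    if "I \<in> words dA T" "J \<in> words dA T" "A \<in> words dB T" "B \<in> words dB T" for I J A B
    unfolding chanW_def using that e by (intro prod.cong refl) (auto simp: words_def PiE_iff)
  then have "pairing dA dB T \<nu> P R = pairing dA dB T \<nu>' P R" for P R
    unfolding pairing_def by (intro sum.cong refl) auto
  then show ?thesis unfolding afid_def cfid_def by simp
qed

text \<open>A member of \<open>conv_chan\<close> acts like a jammer who draws states independently
  from \<open>q\<close>, so the fidelity is the mean over state words with product weights.\<close>

lemma compound_fid:
  assumes a: "acode dA dB {..<l} M1 M2 D p r"
    and k: "\<And>i j a b. a < dB \<Longrightarrow> b < dB \<Longrightarrow> ker dA W i j a b = (\<Sum>s\<in>UNIV. complex_of_real (q s) * ker dA (N s) i j a b)"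
  shows "afid dA dB {..<l} (\<lambda>t. ker dA (replicate l W ! t)) M1 M2 p r
    = (\<Sum>z\<in>PiE {..<l} (\<lambda>_. UNIV). (\<Prod>t<l. q (z t)) * afid dA dB {..<l} (wstate dA N z) M1 M2 p r)"
proof -
  have "afid dA dB {..<l} (\<lambda>t. ker dA (replicate l W ! t)) M1 M2 p r
    = afid dA dB {..<l} (\<lambda>t i j a b. \<Sum>s\<in>UNIV. complex_of_real (q s) * ker dA (N s) i j a b) M1 M2 p r"
    by (rule afid_cong_lt[OF a]) (use k in auto)
  also have "\<dots> = (\<Sum>z\<in>PiE {..<l} (\<lambda>_. UNIV). (\<Prod>t<l. q (z t)) * afid dA dB {..<l} (\<lambda>t. ker dA (N (z t))) M1 M2 p r)"
    by (rule afid_mix) auto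
  finally show ?thesis unfolding wstate_def .
qed

lemma sum_prod_q: 
  assumes "sum q UNIV = (1::real)"
  shows "(\<Sum>z\<in>PiE {..<l::nat} (\<lambda>_. UNIV :: 's set). \<Prod>t<l. q (z t)) = 1"
  using prod_sum_PiE[of "{..<l}" "\<lambda>_. UNIV :: 's set" "\<lambda>_. q"] assms by simp

text \<open>Fidelity at least \<open>1 - \<eta>\<close> for every state word passes to every
  independent mixture of state words.\<close>

lemma A_d_subset_C_CET: "A_d dA dB N \<subseteq> C_CET dA dB (conv_chan dB N)"
proof
  fix R assume R: "R \<in> A_d dA dB N"
  obtain R1 R2 where Re: "R = (R1, R2)" by (cases R)
  have nn: "R1 \<ge> 0" "R2 \<ge> 0" and ev: "\<And>\<eta>. \<eta> > 0 \<Longrightarrow> eventually (\<lambda>l. detgood dA dB N l (R1 - \<eta>) (R2 - \<eta>) \<eta>) sequentially"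
    using R A_d_iff[of R1 R2] unfolding Re by auto
  have "\<exists>n0. \<forall>n\<ge>n0. \<exists>M1 M2 c. is_code dA dB n M1 M2 c \<and>
        log 2 (real M1) / real n \<ge> R1 - \<delta> \<and> log 2 (real M2) / real n \<ge> R2 - \<delta> \<and>
        (INF W \<in> conv_chan dB N. avg_fid dA dB n M1 M2 (tensor_list dA dB (replicate n W)) c) \<ge> 1 - \<epsilon>"
    if "\<epsilon> > 0" "\<delta> > 0" for \<epsilon> \<delta>
  proof -
    define \<eta> where "\<eta> = min \<epsilon> \<delta>"
    have \<eta>: "\<eta> > 0" "\<eta> \<le> \<epsilon>" "\<eta> \<le> \<delta>" unfolding \<eta>_def using that by auto
    from ev[OF \<eta>(1)] obtain n0 where n0: "\<And>n. n \<ge> n0 \<Longrightarrow> detgood dA dB N n (R1 - \<eta>) (R2 - \<eta>) \<eta>"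
      unfolding eventually_sequentially by blast
    show ?thesis
    proof (rule exI[of _ n0], intro allI impI)
      fix n assume "n \<ge> n0"
      from n0[OF this] obtain M1 M2 D p r where a: "acode dA dB {..<n} M1 M2 D p r"
        and b: "R1 - \<eta> \<le> log 2 (real M1) / real n" "R2 - \<eta> \<le> log 2 (real M2) / real n"
        and f: "\<And>s. 1 - \<eta> \<le> afid dA dB {..<n} (wstate dA N s) M1 M2 p r" unfolding detgood_def by blast
      from acode_to_code[OF a dA dB] obtain c where c: "is_code dA dB n M1 M2 c"
        and e: "\<And>Ns. length Ns = n \<Longrightarrow> (\<forall>N\<in>set Ns. cptp dA dB N) \<Longrightarrow>
          avg_fid dA dB n M1 M2 (tensor_list dA dB Ns) c = afid dA dB {..<n} (\<lambda>t. ker dA (Ns ! t)) M1 M2 p r" by blast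
      have "1 - \<epsilon> \<le> (INF W \<in> conv_chan dB N. avg_fid dA dB n M1 M2 (tensor_list dA dB (replicate n W)) c)"
      proof (rule cINF_greatest)
        have "(\<lambda>X. msum dB (\<lambda>s. complex_of_real (1 / real CARD('s)) \<cdot>\<^sub>m N s X) UNIV) \<in> conv_chan dB N"
          unfolding conv_chan_def by (auto intro!: exI[of _ "\<lambda>_. 1 / real CARD('s)"])
        then show "conv_chan dB N \<noteq> {}" by blast
        fix W assume W: "W \<in> conv_chan dB N"
        obtain q where q: "\<forall>s. q s \<ge> 0" "sum q UNIV = 1" "cptp dA dB W"
          and k: "\<And>i j a b. a < dB \<Longrightarrow> b < dB \<Longrightarrow> ker dA W i j a b = (\<Sum>s\<in>UNIV. complex_of_real (q s) * ker dA (N s) i j a b)"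
          using conv_chan_elem[OF W] by blast
        have "avg_fid dA dB n M1 M2 (tensor_list dA dB (replicate n W)) c = 
          (\<Sum>z\<in>PiE {..<n} (\<lambda>_. UNIV). (\<Prod>t<n. q (z t)) * afid dA dB {..<n} (wstate dA N z) M1 M2 p r)"
          using e[of "replicate n W"] q(3) compound_fid[OF a k] by simp
        also have "\<dots> \<ge> (\<Sum>z\<in>PiE {..<n} (\<lambda>_. UNIV :: 's set). (\<Prod>t<n. q (z t)) * (1 - \<eta>))"
          using f q(1) by (intro sum_mono mult_left_mono prod_nonneg) auto
        finally show "1 - \<epsilon> \<le> avg_fid dA dB n M1 M2 (tensor_list dA dB (replicate n W)) c"
          using sum_prod_q[OF q(2), of n] \<eta> by (simp add: sum_distrib_right[symmetric])
      qed
      then show "\<exists>M1 M2 c. is_code dA dB n M1 M2 c \<and>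
        log 2 (real M1) / real n \<ge> R1 - \<delta> \<and> log 2 (real M2) / real n \<ge> R2 - \<delta> \<and>
        (INF W \<in> conv_chan dB N. avg_fid dA dB n M1 M2 (tensor_list dA dB (replicate n W)) c) \<ge> 1 - \<epsilon>"
        using c b \<eta> by (rule_tac x=M1 in exI, rule_tac x=M2 in exI, rule_tac x=c in exI) auto
    qed
  qed
  then show "R \<in> C_CET dA dB (conv_chan dB N)" unfolding C_CET_def Re using nn by blast
qed

end

section \<open>Derandomization\<close>

text \<open>A random code of average error \<open>\<eta>\<close> has this property because \<open>e\<^sup>x \<le> 1 + 2 x\<close> on \<open>[0, 1]\<close>; the weighted
  form makes no reference to a measure on the set of codes.\<close>

definition rangood :: "nat \<Rightarrow> nat \<Rightarrow> ('s \<Rightarrow> cmap) \<Rightarrow> nat \<Rightarrow> nat \<Rightarrow> nat \<Rightarrow> real \<Rightarrow> bool" where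
  "rangood dA dB N l M1 M2 \<eta> \<longleftrightarrow> (\<forall>w. (\<forall>s. 0 \<le> w s) \<longrightarrow> (\<exists>D p r. acode dA dB {..<l} M1 M2 D p r \<and>
     (\<Sum>s\<in>PiE {..<l} (\<lambda>_. UNIV). w s * exp (1 - afid dA dB {..<l} (wstate dA N s) M1 M2 p r))
     \<le> exp (2 * \<eta>) * (\<Sum>s\<in>PiE {..<l} (\<lambda>_. UNIV). w s)))"

lemma exp_le_linear: "0 \<le> x \<Longrightarrow> x \<le> 1 \<Longrightarrow> exp x \<le> 1 + 2 * (x::real)"
proof -
  assume x: "0 \<le> x" "x \<le> 1"
  have "exp x \<le> 1 + x + x\<^sup>2" by (rule exp_bound[OF x])
  also have "\<dots> \<le> 1 + 2 * x" using x by (simp add: power2_eq_square mult_left_le)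
  finally show ?thesis .
qed

context
  fixes N :: "'s::finite \<Rightarrow> cmap" and dA dB :: nat
  assumes dA: "1 \<le> dA" and dB: "1 \<le> dB" and N: "\<forall>s. cptp dA dB (N s)"
begin

text \<open>Derandomization by the method of conditional expectations: the \<open>K\<close> codes are chosen one after the other,
  keeping the potential \<open>\<Sum>s exp (accumulated error on s)\<close> small.\<close>

lemma derandomize:
  assumes "rangood dA dB N l M1 M2 \<eta>"
  shows "\<exists>D p r. (\<forall>k<K. acode dA dB {..<l} M1 M2 (D k) (p k) (r k)) \<and>
    (\<Sum>s\<in>PiE {..<l} (\<lambda>_. UNIV). exp (\<Sum>k<K. 1 - afid dA dB {..<l} (wstate dA N s) M1 M2 (p k) (r k)))
      \<le> exp (2 * \<eta> * real K) * real (CARD('s) ^ l)"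
proof (induction K)
  case 0
  show ?case by (simp add: card_PiE)
next
  case (Suc K)
  let ?f = "\<lambda>s p r. 1 - afid dA dB {..<l} (wstate dA N s) M1 M2 p r"
  from Suc obtain D p r where c: "\<And>k. k < K \<Longrightarrow> acode dA dB {..<l} M1 M2 (D k) (p k) (r k)"
    and b: "(\<Sum>s\<in>PiE {..<l} (\<lambda>_. UNIV). exp (\<Sum>k<K. ?f s (p k) (r k))) \<le> exp (2 * \<eta> * real K) * real (CARD('s) ^ l)"
    by blast
  obtain D' p' r' where c': "acode dA dB {..<l} M1 M2 D' p' r'"
    and b': "(\<Sum>s\<in>PiE {..<l} (\<lambda>_. UNIV). exp (\<Sum>k<K. ?f s (p k) (r k)) * exp (?f s p' r')) 
      \<le> exp (2 * \<eta>) * (\<Sum>s\<in>PiE {..<l} (\<lambda>_. UNIV). exp (\<Sum>k<K. ?f s (p k) (r k)))"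
    using assms[unfolded rangood_def, rule_format, of "\<lambda>s. exp (\<Sum>k<K. ?f s (p k) (r k))"] by auto
  have "(\<Sum>s\<in>PiE {..<l} (\<lambda>_. UNIV). exp (\<Sum>k<Suc K. ?f s ((p(K := p')) k) ((r(K := r')) k)))
     = (\<Sum>s\<in>PiE {..<l} (\<lambda>_. UNIV). exp (\<Sum>k<K. ?f s (p k) (r k)) * exp (?f s p' r'))"
    by (intro sum.cong refl) (simp add: exp_add)
  also have "\<dots> \<le> exp (2 * \<eta>) * (exp (2 * \<eta> * real K) * real (CARD('s) ^ l))"
    by (rule order_trans[OF b' mult_left_mono[OF b]]) simp
  also have "\<dots> = exp (2 * \<eta> * real (Suc K)) * real (CARD('s) ^ l)"
    by (simp add: exp_add[symmetric] distrib_left add.commute)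
  finally show ?case using c c'
    by (intro exI[of _ "D(K := D')"] exI[of _ "p(K := p')"] exI[of _ "r(K := r')"]) (auto simp: less_Suc_eq)
qed

text \<open>Each summand of the potential is at most the whole potential; its logarithm costs
  \<open>ln\<close> of the number of state words, which is linear in \<open>l\<close>. Per code this
  excess vanishes once \<open>K\<close> grows faster than \<open>l\<close>.\<close>

lemma derandomize_uniform:
  assumes "rangood dA dB N l M1 M2 \<eta>"
  shows "\<exists>D p r. (\<forall>k<K. acode dA dB {..<l} M1 M2 (D k) (p k) (r k)) \<and>
    (\<forall>s. (\<Sum>k<K. 1 - afid dA dB {..<l} (wstate dA N s) M1 M2 (p k) (r k)) \<le> 2 * \<eta> * real K + real l * ln (real CARD('s)))"
proof -
  let ?f = "\<lambda>s p r. 1 - afid dA dB {..<l} (wstate dA N s) M1 M2 p r"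
  from derandomize[OF assms, of K] obtain D p r where c: "\<forall>k<K. acode dA dB {..<l} M1 M2 (D k) (p k) (r k)"
    and b: "(\<Sum>s\<in>PiE {..<l} (\<lambda>_. UNIV). exp (\<Sum>k<K. ?f s (p k) (r k))) \<le> exp (2 * \<eta> * real K) * real (CARD('s) ^ l)"
    by blast
  have "(\<Sum>k<K. ?f s (p k) (r k)) \<le> 2 * \<eta> * real K + real l * ln (real CARD('s))" for s
  proof -
    \<comment> \<open>The potential sums over extensional words, so \<open>s\<close> is cut down to
      the first \<open>l\<close> positions, the only ones that the fidelity sees.\<close>
    define sr where "sr = restrict s {..<l}"
    have "sr \<in> PiE {..<l} (\<lambda>_. UNIV)" unfolding sr_def by simp
    then have "exp (\<Sum>k<K. ?f sr (p k) (r k)) \<le> (\<Sum>s\<in>PiE {..<l} (\<lambda>_. UNIV). exp (\<Sum>k<K. ?f s (p k) (r k)))"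
      by (intro member_le_sum finite_PiE) simp_all
    also note b
    finally have "(\<Sum>k<K. ?f sr (p k) (r k)) \<le> ln (exp (2 * \<eta> * real K) * real (CARD('s) ^ l))"
      by (subst ln_ge_iff) auto
    also have "\<dots> = 2 * \<eta> * real K + real l * ln (real CARD('s))"
      by (simp add: ln_mult ln_realpow)
    also have "(\<Sum>k<K. ?f sr (p k) (r k)) = (\<Sum>k<K. ?f s (p k) (r k))"
      by (intro sum.cong refl arg_cong[where f="\<lambda>x. 1 - x"] afid_cong) (simp add: wstate_def sr_def)
    finally show ?thesis .
  qed
  with c show ?thesis by blast
qed

text \<open>The prefix, measured into \<open>K1 * K2\<close> classical messages, names one of
  equally many derandomized codes. The two failure sources add because
  \<open>e * f \<ge> e - (1 - f)\<close> for numbers in the unit interval; the last error term is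
  the price of uniformity over state words, spread over all codes.\<close>

lemma prefix_code:
  assumes pre: "acode dA dB {..<j} K1 K2 D0 p0 r0" and e: "\<And>s. 1 - \<epsilon> \<le> afid dA dB {..<j} (wstate dA N s) K1 K2 p0 r0"
    and ran: "rangood dA dB N l M1 M2 \<eta>"
  shows "\<exists>D p r. acode dA dB {..<j + l} M1 M2 D p r \<and>
    (\<forall>s. 1 - (\<epsilon> + 2 * \<eta> + real l * ln (real CARD('s)) / real (K1 * K2)) \<le> afid dA dB {..<j + l} (wstate dA N s) M1 M2 p r)"
proof -
  define K where "K = K1 * K2"
  have K: "1 \<le> K" unfolding K_def using acodeD(1,2)[OF pre] by simp
  obtain \<delta> \<Lambda> where cl: "acode dA dB {..<j} K 1 1 \<delta> \<Lambda>"
    and cle: "\<And>\<nu>. \<forall>t\<in>{..<j}. chk dA dB (\<nu> t) \<Longrightarrow> afid dA dB {..<j} \<nu> K1 K2 p0 r0 \<le> afid dA dB {..<j} \<nu> K 1 \<delta> \<Lambda>"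
    using acode_classical[OF pre] unfolding K_def by blast
  obtain D p r where c: "\<And>k. k < K \<Longrightarrow> acode dA dB {..<l} M1 M2 (D k) (p k) (r k)"
    and b: "\<And>s. (\<Sum>k<K. 1 - afid dA dB {..<l} (wstate dA N s) M1 M2 (p k) (r k)) \<le> 2 * \<eta> * real K + real l * ln (real CARD('s))"
    using derandomize_uniform[OF ran, of K] by blast
  have bij: "bij_betw (\<lambda>t. t + j) {..<l} {j..<j + l}"
    by (rule bij_betwI[where g="\<lambda>t. t - j"]) auto
  have "\<exists>q. k < K \<longrightarrow> acode dA dB {j..<j + l} M1 M2 (D k) (fst q) (snd q) \<and>
    (\<forall>\<nu>. afid dA dB {j..<j + l} \<nu> M1 M2 (fst q) (snd q) = afid dA dB {..<l} (\<lambda>t. \<nu> (t + j)) M1 M2 (p k) (r k))" for k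
    using acode_transport[OF bij _ c[of k]] by fastforce
  then obtain q where q: "\<And>k. k < K \<Longrightarrow> acode dA dB {j..<j + l} M1 M2 (D k) (fst (q k)) (snd (q k))"
    and qe: "\<And>k \<nu>. k < K \<Longrightarrow> afid dA dB {j..<j + l} \<nu> M1 M2 (fst (q k)) (snd (q k)) = afid dA dB {..<l} (\<lambda>t. \<nu> (t + j)) M1 M2 (p k) (r k)"
    by metis
  have dis: "{..<j} \<inter> {j..<j + l} = {}" and un: "{..<j} \<union> {j..<j + l} = {..<j + l}" by auto
  obtain D' p' r' where c': "acode dA dB {..<j + l} M1 M2 D' p' r'"
    and fid: "\<And>\<nu>. \<forall>t\<in>{..<j + l}. chk dA dB (\<nu> t) \<Longrightarrow>
      1 / real K * (\<Sum>k<K. Re (cfid dA dB {..<j} \<nu> 1 (\<delta> k) (\<Lambda> k)) * afid dA dB {j..<j + l} \<nu> M1 M2 (fst (q k)) (snd (q k)))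
      \<le> afid dA dB {..<j + l} \<nu> M1 M2 p' r'"
    using acode_combine[OF dis _ _ cl, of M1 M2 D "\<lambda>k. fst (q k)" "\<lambda>k. snd (q k)"] q unfolding un by auto
  have "1 - (\<epsilon> + 2 * \<eta> + real l * ln (real CARD('s)) / real K) \<le> afid dA dB {..<j + l} (wstate dA N s) M1 M2 p' r'" for s
  proof -
    let ?\<nu> = "wstate dA N s"
    let ?e = "\<lambda>k. Re (cfid dA dB {..<j} ?\<nu> 1 (\<delta> k) (\<Lambda> k))"
    let ?f = "\<lambda>k. afid dA dB {j..<j + l} ?\<nu> M1 M2 (fst (q k)) (snd (q k))"
    have chk: "\<forall>t\<in>T. chk dA dB (?\<nu> t)" for T by (rule chk_wstate[OF dA dB N])
    have e1: "0 \<le> ?e k \<and> ?e k \<le> 1" if "k < K" for k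
      using cfid_bounds[OF chk _ cl that] by simp
    have f1: "0 \<le> ?f k \<and> ?f k \<le> 1" if "k < K" for k
      using afid_bounds[OF chk _ q[OF that]] by simp
    have se: "real K * (1 - \<epsilon>) \<le> (\<Sum>k<K. ?e k)"
    proof -
      have "1 - \<epsilon> \<le> 1 / real K * (\<Sum>k<K. ?e k)"
        using e[of s] cle[OF chk] unfolding afid_def[of dA dB "{..<j}" ?\<nu> K 1] by (rule order_trans)
      then show ?thesis using K by (simp add: field_simps)
    qed
    have sf: "(\<Sum>k<K. 1 - ?f k) \<le> 2 * \<eta> * real K + real l * ln (real CARD('s))"
    proof -
      have "(\<Sum>k<K. 1 - ?f k) = (\<Sum>k<K. 1 - afid dA dB {..<l} (wstate dA N (\<lambda>t. s (t + j))) M1 M2 (p k) (r k))"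
        by (intro sum.cong refl) (simp add: qe wstate_def[abs_def])
      then show ?thesis using b[of "\<lambda>t. s (t + j)"] by simp
    qed
    have "real K * (1 - (\<epsilon> + 2 * \<eta> + real l * ln (real CARD('s)) / real K)) 
       = real K * (1 - \<epsilon>) - (2 * \<eta> * real K + real l * ln (real CARD('s)))"
      using K by (simp add: field_simps)
    also have "\<dots> \<le> (\<Sum>k<K. ?e k) - (\<Sum>k<K. 1 - ?f k)" using se sf by linarith
    also have "\<dots> = (\<Sum>k<K. ?e k - (1 - ?f k))" by (simp only: sum_subtractf)
    also have "\<dots> \<le> (\<Sum>k<K. ?e k * ?f k)"
    proof (rule sum_mono)
      fix k assume "k \<in> {..<K}"
      then have "0 \<le> (1 - ?e k) * (1 - ?f k)" using e1 f1 by (intro mult_nonneg_nonneg) auto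
      then show "?e k - (1 - ?f k) \<le> ?e k * ?f k" by (simp add: algebra_simps)
    qed
    finally have "1 - (\<epsilon> + 2 * \<eta> + real l * ln (real CARD('s)) / real K) \<le> 1 / real K * (\<Sum>k<K. ?e k * ?f k)"
      using K by (simp add: field_simps)
    also have "\<dots> \<le> afid dA dB {..<j + l} ?\<nu> M1 M2 p' r'" by (rule fid[OF chk])
    finally show ?thesis .
  qed
  then show ?thesis using c' unfolding K_def by blast
qed

text \<open>The payload occupies a fraction of at least \<open>1 - \<kappa>\<close> of the
  positions, which lowers the rate \<open>R\<close> by at most \<open>\<kappa> * R\<close>; half of
  the tolerance pays for this, the other half for \<open>\<eta>1\<close>. The case distinction is
  there because a negative rate bound would not shrink under the factor
  \<open>1 - \<kappa>\<close>.\<close>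

lemma rate_shrink:
  assumes "0 \<le> \<kappa>" "\<kappa> \<le> 1" "0 \<le> R" "\<kappa> * R \<le> \<eta> / 2" "0 \<le> \<eta>1" "\<eta>1 \<le> \<eta> / 2"
    and "(1 - \<kappa>) * real n \<le> real l" "l \<le> n" "0 < n" and r: "R - \<eta>1 \<le> x / real l" and l: "0 < l" and x: "0 \<le> x"
  shows "R - \<eta> \<le> x / real n"
proof (cases "R - \<eta>1 \<le> 0")
  case True
  then have "R - \<eta> \<le> 0" using assms by linarith
  also have "0 \<le> x / real n" using x by simp
  finally show ?thesis .
next
  case False
  have "R - \<eta> \<le> R - \<eta>1 - \<kappa> * R" using assms by linarith
  also have "\<dots> \<le> R - \<eta>1 - \<kappa> * R + \<kappa> * \<eta>1" using assms by simp
  also have "\<dots> = (R - \<eta>1) * (1 - \<kappa>)" by (simp add: algebra_simps)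
  also have "\<dots> \<le> x / real n"
  proof -
    have "(R - \<eta>1) * ((1 - \<kappa>) * real n) \<le> (R - \<eta>1) * real l" using False assms by (intro mult_left_mono) auto
    also have "\<dots> \<le> x" using r l by (simp add: pos_le_divide_eq)
    finally show ?thesis using \<open>0 < n\<close> by (simp add: pos_le_divide_eq mult.assoc)
  qed
  finally show ?thesis .
qed

text \<open>Elimination: a vanishing fraction of the channel uses carries the classical prefix.\<close>

lemma elimination:
  assumes R: "0 \<le> R1" "0 \<le> R2"
    and ran: "\<And>\<eta>. 0 < \<eta> \<Longrightarrow> eventually (\<lambda>l. \<exists>M1 M2. rangood dA dB N l M1 M2 \<eta> \<and> 1 \<le> M1 \<and> 1 \<le> M2 \<and>
        R1 - \<eta> \<le> log 2 (real M1) / real l \<and> R2 - \<eta> \<le> log 2 (real M2) / real l) sequentially"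
    and pre: "(P1, P2) \<in> A_d dA dB N" "(P1, P2) \<noteq> (0, 0)"
  shows "(R1, R2) \<in> A_d dA dB N"
proof -
  define \<rho> where "\<rho> = P1 + P2"
  have P: "0 \<le> P1" "0 \<le> P2" and pd: "\<And>\<eta>. 0 < \<eta> \<Longrightarrow> eventually (\<lambda>l. detgood dA dB N l (P1 - \<eta>) (P2 - \<eta>) \<eta>) sequentially"
    using pre(1) unfolding A_d_iff[OF dA dB N] by auto
  have \<rho>: "0 < \<rho>" unfolding \<rho>_def using P pre(2) by (auto simp: add_nonneg_eq_0_iff less_le)
  have "eventually (\<lambda>n. detgood dA dB N n (R1 - \<eta>) (R2 - \<eta>) \<eta>) sequentially" if \<eta>: "0 < \<eta>" for \<eta>
  proof -
    \<comment> \<open>Error budget: \<open>\<eta>2\<close>, \<open>2 * \<eta>1\<close> and the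
      uniformity term each get a quarter of \<open>\<eta>\<close>. In addition,
      \<open>\<eta>2 \<le> \<rho> / 4\<close> leaves the prefix a total rate of at least
      \<open>\<rho> / 2\<close>, and \<open>\<kappa>\<close> is small enough that both rates lose at
      most \<open>\<eta> / 2\<close>.\<close>
    define \<eta>1 where "\<eta>1 = \<eta> / 8"
    define \<eta>2 where "\<eta>2 = min (\<eta> / 4) (\<rho> / 4)"
    define \<kappa> where "\<kappa> = min (1/2) (\<eta> / (2 * (1 + R1 + R2)))"
    have h: "0 < \<eta>1" "0 < \<eta>2" "\<eta>2 \<le> \<eta> / 4" "\<eta>2 \<le> \<rho> / 4" unfolding \<eta>1_def \<eta>2_def using \<eta> \<rho> by auto
    have k: "0 < \<kappa>" unfolding \<kappa>_def using \<eta> R by auto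
    have k2: "\<kappa> \<le> 1/2" unfolding \<kappa>_def by (rule min.cobounded1)
    note k = k k2
    have "\<kappa> \<le> \<eta> / (2 * (1 + R1 + R2))" unfolding \<kappa>_def by simp
    then have "\<kappa> * (1 + R1 + R2) \<le> \<eta> / 2" using R by (simp add: pos_le_divide_eq mult_ac)
    moreover have "\<kappa> * R1 \<le> \<kappa> * (1 + R1 + R2)" "\<kappa> * R2 \<le> \<kappa> * (1 + R1 + R2)" using R k by (auto intro: mult_left_mono)
    ultimately have kR: "\<kappa> * R1 \<le> \<eta> / 2" "\<kappa> * R2 \<le> \<eta> / 2" by auto
    define j where "j = (\<lambda>n. nat \<lfloor>\<kappa> * real n\<rfloor>)"
    have j1: "real (j n) \<le> \<kappa> * real n" "\<kappa> * real n - 1 \<le> real (j n)" for n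
    proof -
      have "0 \<le> \<kappa> * real n" using k by simp
      then show "real (j n) \<le> \<kappa> * real n" "\<kappa> * real n - 1 \<le> real (j n)" unfolding j_def by linarith+
    qed
    have jn: "j n \<le> n" for n
    proof -
      have "\<kappa> * real n \<le> 1 * real n" using k by (intro mult_right_mono) auto
      then show ?thesis using j1(1)[of n] by linarith
    qed
    define l where "l = (\<lambda>n. n - j n)"
    have ln: "real (l n) = real n - real (j n)" "j n + l n = n" "l n \<le> n" for n unfolding l_def using jn[of n] by auto
    have ll: "(1 - \<kappa>) * real n \<le> real (l n)" for n using j1(1)[of n] ln(1)[of n] by (simp add: algebra_simps)
    have "filterlim (\<lambda>n. \<kappa> * real n - 1) at_top sequentially" using k(1) by real_asymp
    then have "filterlim (\<lambda>n. real (j n)) at_top sequentially"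
      by (rule filterlim_at_top_mono) (use j1 in auto)
    then have jt: "filterlim j at_top sequentially" by (simp add: filterlim_sequentially_iff_filterlim_real)
    have "filterlim (\<lambda>n. (1 - \<kappa>) * real n) at_top sequentially" using k by real_asymp
    then have "filterlim (\<lambda>n. real (l n)) at_top sequentially"
      by (rule filterlim_at_top_mono) (use ll in auto)
    then have lt: "filterlim l at_top sequentially" by (simp add: filterlim_sequentially_iff_filterlim_real)
    have e1: "eventually (\<lambda>n. \<exists>M1 M2. rangood dA dB N (l n) M1 M2 \<eta>1 \<and> 1 \<le> M1 \<and> 1 \<le> M2 \<and>
        R1 - \<eta>1 \<le> log 2 (real M1) / real (l n) \<and> R2 - \<eta>1 \<le> log 2 (real M2) / real (l n)) sequentially"
      by (rule eventually_compose_filterlim[OF ran[OF h(1)] lt])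
    have e2: "eventually (\<lambda>n. detgood dA dB N (j n) (P1 - \<eta>2) (P2 - \<eta>2) \<eta>2) sequentially"
      by (rule eventually_compose_filterlim[OF pd[OF h(2)] jt])
    \<comment> \<open>A prefix of length about \<open>\<kappa> * n\<close> names exponentially many
      codes, which outweighs the linear numerator.\<close>
    have "(\<lambda>n. real n * ln (real CARD('s)) / 2 powr ((\<kappa> * real n - 1) * (\<rho> / 2))) \<longlonglongrightarrow> 0"
      using k(1) \<rho> by real_asymp
    then have e3: "eventually (\<lambda>n. real n * ln (real CARD('s)) / 2 powr ((\<kappa> * real n - 1) * (\<rho> / 2)) < \<eta> / 4) sequentially"
      using \<eta> by (intro order_tendstoD(2)[of _ 0]) auto
    have e4: "eventually (\<lambda>n. 1 \<le> l n) sequentially" using lt by (simp add: filterlim_at_top)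
    have e5: "eventually (\<lambda>n. 1 \<le> j n) sequentially" using jt by (simp add: filterlim_at_top)
    from e1 e2 e3 e4 e5 show ?thesis
    proof eventually_elim
      case (elim n)
      from elim(1) obtain M1 M2 where rg: "rangood dA dB N (l n) M1 M2 \<eta>1" and M: "1 \<le> M1" "1 \<le> M2"
        and r: "R1 - \<eta>1 \<le> log 2 (real M1) / real (l n)" "R2 - \<eta>1 \<le> log 2 (real M2) / real (l n)" by blast
      from elim(2) obtain K1 K2 D0 p0 r0 where a: "acode dA dB {..<j n} K1 K2 D0 p0 r0"
        and kr: "P1 - \<eta>2 \<le> log 2 (real K1) / real (j n)" "P2 - \<eta>2 \<le> log 2 (real K2) / real (j n)"
        and ka: "\<And>s. 1 - \<eta>2 \<le> afid dA dB {..<j n} (wstate dA N s) K1 K2 p0 r0" unfolding detgood_def by blast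
      from prefix_code[OF a ka rg] obtain D p r' where c: "acode dA dB {..<n} M1 M2 D p r'"
        and f: "\<And>s. 1 - (\<eta>2 + 2 * \<eta>1 + real (l n) * ln (real CARD('s)) / real (K1 * K2)) \<le> afid dA dB {..<n} (wstate dA N s) M1 M2 p r'"
        unfolding ln(2) by blast
      have K0: "0 < real K1" "0 < real K2" using acodeD(1,2)[OF a] by auto
      have jp: "0 < real (j n)" using elim(5) by simp
      have "(\<kappa> * real n - 1) * (\<rho> / 2) \<le> real (j n) * (\<rho> / 2)"
        using j1(2)[of n] \<rho> by (intro mult_right_mono) auto
      also have "\<dots> \<le> real (j n) * ((P1 - \<eta>2) + (P2 - \<eta>2))"
        using h(4) jp unfolding \<rho>_def by (intro mult_left_mono) auto
      also have "\<dots> \<le> log 2 (real K1) + log 2 (real K2)"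
      proof -
        have "(P1 - \<eta>2) * real (j n) \<le> log 2 (real K1)" "(P2 - \<eta>2) * real (j n) \<le> log 2 (real K2)"
          using kr jp by (simp_all only: pos_le_divide_eq)
        then show ?thesis by (simp add: algebra_simps)
      qed
      also have "\<dots> = log 2 (real (K1 * K2))" using K0 by (simp add: log_mult)
      finally have "2 powr ((\<kappa> * real n - 1) * (\<rho> / 2)) \<le> 2 powr (log 2 (real (K1 * K2)))" by simp
      also have "\<dots> = real (K1 * K2)" using K0 by (intro powr_log_cancel) auto
      finally have KK: "2 powr ((\<kappa> * real n - 1) * (\<rho> / 2)) \<le> real (K1 * K2)" .
      have "real (l n) * ln (real CARD('s)) / real (K1 * K2) \<le> real n * ln (real CARD('s)) / 2 powr ((\<kappa> * real n - 1) * (\<rho> / 2))"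
        using KK ln(3)[of n] K0 by (intro frac_le mult_right_mono mult_nonneg_nonneg) auto
      then have er: "\<eta>2 + 2 * \<eta>1 + real (l n) * ln (real CARD('s)) / real (K1 * K2) \<le> \<eta>"
        using elim(3) h(3) \<eta> unfolding \<eta>1_def by linarith
      have x: "0 \<le> log 2 (real M1)" "0 \<le> log 2 (real M2)" using M by auto
      have n0: "0 < n" "0 < l n" using elim(4) ln(3)[of n] by auto
      have "\<eta>1 \<le> \<eta> / 2" "0 \<le> \<eta>1" "0 \<le> \<kappa>" "\<kappa> \<le> 1" using h \<eta> k unfolding \<eta>1_def by auto
      then have rr: "R1 - \<eta> \<le> log 2 (real M1) / real n" "R2 - \<eta> \<le> log 2 (real M2) / real n"
        using rate_shrink[OF _ _ R(1) kR(1) _ _ ll ln(3) n0(1) r(1) n0(2) x(1)]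
          rate_shrink[OF _ _ R(2) kR(2) _ _ ll ln(3) n0(1) r(2) n0(2) x(2)] by auto
      show ?case unfolding detgood_def
      proof (intro exI conjI allI)
        show "acode dA dB {..<n} M1 M2 D p r'" by (fact c)
        show "R1 - \<eta> \<le> log 2 (real M1) / real n" "R2 - \<eta> \<le> log 2 (real M2) / real n" by (fact rr)+
        show "1 - \<eta> \<le> afid dA dB {..<n} (wstate dA N s) M1 M2 p r'" for s using f[of s] er by linarith
      qed
    qed
  qed
  then show ?thesis using R unfolding A_d_iff[OF dA dB N] by blast
qed

text \<open>The weighted exponential error is integrated over the random code; linearizing
  \<open>exp\<close> reduces the mean to the average error, and some code in the sample space does
  not exceed the mean.\<close>

lemma rangood_of_A_r:
  assumes "is_rcode dA dB N l M1 M2 \<mu>" 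
    and f: "1 - \<eta> \<le> (INF ss \<in> {ss. length ss = l}. (LINT c|\<mu>. avg_fid dA dB l M1 M2 (chan_seq dA dB N ss) c))"
  shows "rangood dA dB N l M1 M2 \<eta>"
  unfolding rangood_def
proof (intro allI impI)
  interpret prob_space \<mu> using assms unfolding is_rcode_def by blast
  have sp: "space \<mu> = {c. is_code dA dB l M1 M2 c}"
    and me: "\<And>ss m. length ss = l \<Longrightarrow> m < M1 \<Longrightarrow> (\<lambda>c. gfid dA dB l M1 M2 (chan_seq dA dB N ss) c m) \<in> borel_measurable \<mu>"
    using assms unfolding is_rcode_def by blast+
  fix w :: "(nat \<Rightarrow> 's) \<Rightarrow> real" assume w: "\<forall>s. 0 \<le> w s"
  let ?S = "PiE {..<l} (\<lambda>_. UNIV :: 's set)"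
  let ?F = "\<lambda>s c. avg_fid dA dB l M1 M2 (chan_seq dA dB N (map s [0..<l])) c"
  have mF: "?F s \<in> borel_measurable \<mu>" for s
    unfolding avg_fid_def using me by (intro borel_measurable_times borel_measurable_sum) auto
  have bF: "0 \<le> ?F s c \<and> ?F s c \<le> 1" if "c \<in> space \<mu>" for s c
    using avg_fid_bounds[OF dA dB N, of l M1 M2 c "map s [0..<l]"] that unfolding sp by simp
  have iF: "integrable \<mu> (?F s)" for s
    by (rule integrable_const_bound[of _ 1]) (use bF mF in auto)
  have iE: "integrable \<mu> (\<lambda>c. exp (1 - ?F s c))" for s
    by (rule integrable_const_bound[of _ "exp 1"]) (use bF mF in auto)
  have lF: "1 - \<eta> \<le> (LINT c|\<mu>. ?F s c)" for s
  proof -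
    have "(INF ss \<in> {ss. length ss = l}. (LINT c|\<mu>. avg_fid dA dB l M1 M2 (chan_seq dA dB N ss) c)) \<le> (LINT c|\<mu>. ?F s c)"
      by (rule cINF_lower) (use finite_lists[OF dA dB N, of l] in auto)
    then show ?thesis using f by simp
  qed
  let ?g = "\<lambda>c. \<Sum>s\<in>?S. w s * exp (1 - ?F s c)"
  have ig: "integrable \<mu> ?g" using iE by auto
  have "(LINT c|\<mu>. ?g c) = (\<Sum>s\<in>?S. w s * (LINT c|\<mu>. exp (1 - ?F s c)))"
    using iE by (subst Bochner_Integration.integral_sum) auto
  also have "\<dots> \<le> (\<Sum>s\<in>?S. w s * exp (2 * \<eta>))"
  proof (intro sum_mono mult_left_mono)
    fix s
    have "(LINT c|\<mu>. exp (1 - ?F s c)) \<le> (LINT c|\<mu>. 1 + 2 * (1 - ?F s c))"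
      using iE iF bF by (intro integral_mono exp_le_linear) auto
    also have "\<dots> = 1 + 2 * (1 - (LINT c|\<mu>. ?F s c))" using iF by (simp add: prob_space)
    also have "\<dots> \<le> 1 + 2 * \<eta>" using lF[of s] by simp
    also have "\<dots> \<le> exp (2 * \<eta>)" by (rule exp_ge_add_one_self)
    finally show "(LINT c|\<mu>. exp (1 - ?F s c)) \<le> exp (2 * \<eta>)" .
  qed (use w in auto)
  finally have le: "(LINT c|\<mu>. ?g c) \<le> exp (2 * \<eta>) * (\<Sum>s\<in>?S. w s)"
    by (simp add: sum_distrib_left mult.commute)
  have "\<exists>c\<in>space \<mu>. ?g c \<le> (LINT c|\<mu>. ?g c)"
  proof (rule ccontr)
    assume "\<not> ?thesis"
    then have "(LINT c|\<mu>. (LINT c|\<mu>. ?g c)) < (LINT c|\<mu>. ?g c)"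
      using ig by (intro integral_less_AE_space) (auto simp: not_le emeasure_space_1)
    then show False by (simp add: prob_space)
  qed
  then obtain c where c: "is_code dA dB l M1 M2 c" and gc: "?g c \<le> exp (2 * \<eta>) * (\<Sum>s\<in>?S. w s)"
    using le unfolding sp by force
  obtain D p r where a: "acode dA dB {..<l} M1 M2 D p r"
    and e: "\<And>ss. length ss = l \<Longrightarrow> avg_fid dA dB l M1 M2 (chan_seq dA dB N ss) c = afid dA dB {..<l} (wstate dA N (\<lambda>t. ss ! t)) M1 M2 p r"
    using acode_of_code[OF dA dB N c] by blast
  have "?F s c = afid dA dB {..<l} (wstate dA N s) M1 M2 p r" for s
    using e[of "map s [0..<l]"] wstate_list[OF dA dB N, of l s M1 M2 p r] by simp
  then show "\<exists>D p r. acode dA dB {..<l} M1 M2 D p r \<and>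
     (\<Sum>s\<in>?S. w s * exp (1 - afid dA dB {..<l} (wstate dA N s) M1 M2 p r)) \<le> exp (2 * \<eta>) * (\<Sum>s\<in>?S. w s)"
    using a gc by auto
qed

lemma A_r_subset_A_d:
  assumes "(P1, P2) \<in> A_d dA dB N" "(P1, P2) \<noteq> (0, 0)"
  shows "A_r dA dB N \<subseteq> A_d dA dB N"
proof
  fix R assume R0: "R \<in> A_r dA dB N"
  obtain R1 R2 where Re: "R = (R1, R2)" by (cases R)
  from R0[unfolded Re] obtain M1 M2 \<mu> where R: "R1 \<ge> 0" "R2 \<ge> 0" and c: "\<And>l. is_rcode dA dB N l (M1 l) (M2 l) (\<mu> l)"
    and l1: "ereal R1 \<le> liminf (\<lambda>l. ereal (log 2 (real (M1 l)) / real l))"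
    and l2: "ereal R2 \<le> liminf (\<lambda>l. ereal (log 2 (real (M2 l)) / real l))"
    and lim: "(\<lambda>l. INF ss \<in> {ss. length ss = l}. (LINT c|\<mu> l. avg_fid dA dB l (M1 l) (M2 l) (chan_seq dA dB N ss) c)) \<longlonglongrightarrow> 1"
    unfolding A_r_def by auto
  have M: "1 \<le> M1 l \<and> 1 \<le> M2 l" for l
  proof -
    have "prob_space (\<mu> l)" "space (\<mu> l) = {c. is_code dA dB l (M1 l) (M2 l) c}" using c[of l] unfolding is_rcode_def by auto
    then obtain c where "is_code dA dB l (M1 l) (M2 l) c" using prob_space.not_empty by blast
    then show ?thesis using is_codeD(1,2) by (metis prod_cases3)
  qed
  have "eventually (\<lambda>l. \<exists>M1 M2. rangood dA dB N l M1 M2 \<eta> \<and> 1 \<le> M1 \<and> 1 \<le> M2 \<and>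
        R1 - \<eta> \<le> log 2 (real M1) / real l \<and> R2 - \<eta> \<le> log 2 (real M2) / real l) sequentially" if \<eta>: "0 < \<eta>" for \<eta>
  proof -
    have "ereal (R1 - \<eta>) < ereal R1" using \<eta> by simp
    from less_LiminfD[OF less_le_trans[OF this l1]]
    have e1: "eventually (\<lambda>l. R1 - \<eta> < log 2 (real (M1 l)) / real l) sequentially" by simp
    have "ereal (R2 - \<eta>) < ereal R2" using \<eta> by simp
    from less_LiminfD[OF less_le_trans[OF this l2]]
    have e2: "eventually (\<lambda>l. R2 - \<eta> < log 2 (real (M2 l)) / real l) sequentially" by simp
    have e3: "eventually (\<lambda>l. 1 - \<eta> < (INF ss \<in> {ss. length ss = l}. (LINT c|\<mu> l. avg_fid dA dB l (M1 l) (M2 l) (chan_seq dA dB N ss) c))) sequentially"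
      using order_tendstoD(1)[OF lim] \<eta> by simp
    from e1 e2 e3 show ?thesis
    proof eventually_elim
      case (elim l)
      then show ?case using M[of l] rangood_of_A_r[OF c[of l], of \<eta>] by (intro exI[of _ "M1 l"] exI[of _ "M2 l"]) auto
    qed
  qed
  from elimination[OF R this assms] show "R \<in> A_d dA dB N" unfolding Re .
qed

end

section \<open>Sampling without replacement\<close>

text \<open>The logarithm of the ratio between \<open>fact n\<close> and the Stirling expression
  \<open>sqrt n * (n / e)^n\<close>.\<close>

definition stirling_defect :: "nat \<Rightarrow> real" where
  "stirling_defect n = ln (fact n) - (real n + 1/2) * ln (real n) + real n"

lemma stirling_defect_Suc:
  assumes "1 \<le> n"
  shows "stirling_defect (Suc n) - stirling_defect n = 1 - (real n + 1/2) * (ln (real n + 1) - ln (real n))"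
proof -
  have "ln (fact (Suc n) :: real) = ln (real n + 1) + ln (fact n)"
    by (simp add: ln_mult add.commute)
  then show ?thesis unfolding stirling_defect_def by (simp add: algebra_simps)
qed

text \<open>The midpoint bound for the logarithm makes the defect decreasing from its value 1 at
  \<open>n = 1\<close>. The trapezoid bound limits each decrease to
  \<open>1 / (4 n) - 1 / (4 (n + 1))\<close>, which telescopes; the extra term in the lower bound is
  the reserve for all later decreases.\<close>

lemma stirling_defect_bounds:
  assumes "1 \<le> n"
  shows "stirling_defect n \<le> 1" "3/4 + 1 / (4 * real n) \<le> stirling_defect n"
  using assms
proof (induction n rule: dec_induct)
  case base
  show "stirling_defect 1 \<le> 1" "3/4 + 1 / (4 * real 1) \<le> stirling_defect 1" by (simp_all add: stirling_defect_def)
next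
  case (step n)
  then have n: "0 < real n" by simp
  have d: "stirling_defect (Suc n) = stirling_defect n + 1 - (real n + 1/2) * (ln (real n + 1) - ln (real n))"
    using stirling_defect_Suc[of n] step by simp
  have "2 * (real n + 1 - real n) / (real n + (real n + 1)) \<le> ln (real n + 1) - ln (real n)"
    by (rule ln_inverse_approx_ge) (use n in auto)
  then have "(real n + 1/2) * (2 / (2 * real n + 1)) \<le> (real n + 1/2) * (ln (real n + 1) - ln (real n))"
    using n by (intro mult_left_mono) auto
  moreover have "(real n + 1/2) * (2 / (2 * real n + 1)) = 1" using n by (simp add: field_simps)
  ultimately show "stirling_defect (Suc n) \<le> 1" using d step by linarith
  have "ln (real n + 1) - ln (real n) \<le> 1 * (inverse (real n) + inverse (real n + 1)) / 2"
    by (rule ln_inverse_approx_le) (use n in auto)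
  then have "(real n + 1/2) * (ln (real n + 1) - ln (real n)) \<le> (real n + 1/2) * ((inverse (real n) + inverse (real n + 1)) / 2)"
    using n by (intro mult_left_mono) auto
  also have "\<dots> = 1 + 1 / (4 * real n) - 1 / (4 * (real n + 1))" using n by (simp add: divide_simps) (simp add: algebra_simps power2_eq_square)
  finally have "3/4 + 1 / (4 * (real n + 1)) \<le> stirling_defect (Suc n)" using d step by linarith
  then show "3/4 + 1 / (4 * real (Suc n)) \<le> stirling_defect (Suc n)" by (simp add: add.commute)
qed

lemma fact_stirling:
  assumes "1 \<le> n"
  shows "fact n \<le> exp 1 * sqrt (real n) * real n ^ n * exp (- real n)"
    "sqrt (real n) * real n ^ n * exp (- real n) \<le> (fact n :: real)"
proof -
  have n: "0 < real n" using assms by simp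
  have e: "sqrt (real n) * real n ^ n = exp ((real n + 1/2) * ln (real n))"
  proof -
    have "sqrt (real n) = exp (1/2 * ln (real n))" using n by (simp add: ln_sqrt[symmetric])
    moreover have "real n ^ n = exp (real n * ln (real n))" using n by (simp add: exp_of_nat_mult)
    ultimately show ?thesis by (simp add: exp_add[symmetric] algebra_simps)
  qed
  have f: "(fact n :: real) = exp (stirling_defect n) * (sqrt (real n) * real n ^ n) * exp (- real n)"
    unfolding e stirling_defect_def exp_add[symmetric] by simp
  have p: "0 \<le> (sqrt (real n) * real n ^ n) * exp (- real n)" by simp
  have "exp (stirling_defect n) \<le> exp 1" using stirling_defect_bounds(1)[OF assms] by simp
  from mult_right_mono[OF this p] show "fact n \<le> exp 1 * sqrt (real n) * real n ^ n * exp (- real n)"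
    unfolding f by (simp add: mult.assoc)
  have "0 \<le> 1 / (4 * real n)" using n by simp
  then have "0 \<le> stirling_defect n" using stirling_defect_bounds(2)[OF assms] by linarith
  then have "1 \<le> exp (stirling_defect n)" by simp
  from mult_right_mono[OF this p] show "sqrt (real n) * real n ^ n * exp (- real n) \<le> (fact n :: real)"
    unfolding f by (simp add: mult.assoc)
qed

text \<open>Poisson weights of mean \<open>x\<close> are of order at most \<open>1 / sqrt x\<close>,
  uniformly in \<open>m\<close>. For \<open>m \<ge> x / 4\<close> this follows from Stirling and
  \<open>ln y \<le> y - 1\<close>; for smaller \<open>m\<close> the weight is exponentially
  small.\<close>

lemma poisson_max:
  assumes x: "0 < x"
  shows "x ^ m / fact m \<le> 2 * exp x / sqrt x"
proof (cases "x / 4 \<le> real m")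
  case True
  then have m: "0 < real m" using x by simp
  have "x ^ m / fact m \<le> x ^ m / (sqrt (real m) * real m ^ m * exp (- real m))"
    using fact_stirling(2)[of m] m x by (intro divide_left_mono) auto
  also have "\<dots> = (x / real m) ^ m * exp (real m) / sqrt (real m)"
    by (simp add: power_divide exp_minus field_simps)
  also have "\<dots> \<le> exp x / sqrt (real m)"
  proof (intro divide_right_mono)
    have "real m * ln (x / real m) \<le> real m * (x / real m - 1)"
      using m x by (intro mult_left_mono ln_le_minus_one) auto
    then have "real m * ln (x / real m) + real m \<le> x" using m by (simp add: algebra_simps)
    then have "exp (real m * ln (x / real m) + real m) \<le> exp x" by simp
    then show "(x / real m) ^ m * exp (real m) \<le> exp x"
      using m x by (simp add: exp_add exp_of_nat_mult)
  qed simp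
  also have "\<dots> \<le> exp x / (sqrt x / 2)"
  proof (intro divide_left_mono)
    have "sqrt (x / 4) \<le> sqrt (real m)" using True by simp
    then show "sqrt x / 2 \<le> sqrt (real m)" by (simp add: real_sqrt_divide)
  qed (use x m in auto)
  finally show ?thesis by (simp add: mult.commute)
next
  case False
  \<comment> \<open>At half the mean, one term is bounded by the exponential series. Restoring the
    factor \<open>2 ^ m\<close> costs at most \<open>exp (x / 4)\<close> because
    \<open>m < x / 4\<close>; the remaining quarter of the exponent beats
    \<open>sqrt x\<close>.\<close>
  have "(x / 2) ^ m / fact m \<le> exp (x / 2)"
  proof -
    have "a / b = a /\<^sub>R b" for a b :: real by (simp only: real_scaleR_def divide_inverse mult.commute)
    then have "(x / 2) ^ m / fact m = (\<Sum>n\<in>{m}. (x / 2) ^ n /\<^sub>R fact n)"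
      by (simp only: sum.insert sum.empty finite.emptyI empty_iff not_False_eq_True add_0_right)
    also have "\<dots> \<le> (\<Sum>n. (x / 2) ^ n /\<^sub>R fact n)"
      by (rule sum_le_suminf[OF summable_exp_generic]) (use x in auto)
    finally show ?thesis by (simp add: exp_def)
  qed
  moreover have "(2::real) ^ m \<le> exp (x / 4)"
  proof -
    have "(2::real) ^ m \<le> exp 1 ^ m" using exp_ge_add_one_self[of 1] by (intro power_mono) auto
    also have "\<dots> = exp (real m)" by (simp add: exp_of_nat_mult[symmetric])
    also have "\<dots> \<le> exp (x / 4)" using False by simp
    finally show ?thesis .
  qed
  ultimately have "2 ^ m * ((x / 2) ^ m / fact m) \<le> exp (x / 4) * exp (x / 2)"
    using x by (intro mult_mono) auto
  then have "x ^ m / fact m \<le> exp (3 * x / 4)"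
    by (simp add: power_divide exp_add[symmetric])
  also have "exp (3 * x / 4) \<le> 2 * exp x / sqrt x"
  proof -
    have "x \<le> 4 * exp (x / 2)" using exp_ge_add_one_self[of "x / 2"] x by linarith
    also have "\<dots> = (2 * exp (x / 4))\<^sup>2" by (simp add: power_mult_distrib exp_double[symmetric])
    finally have "sqrt x \<le> 2 * exp (x / 4)" by (intro real_le_lsqrt) auto
    then have "exp (3 * x / 4) * sqrt x \<le> exp (3 * x / 4) * (2 * exp (x / 4))" by simp
    also have "\<dots> = 2 * exp x" by (simp add: exp_add[symmetric])
    finally show ?thesis using x by (simp add: pos_le_divide_eq)
  qed
  finally show ?thesis .
qed

text \<open>Falling factorials over the reals: they vanish for \<open>j > n\<close>, so the pattern
  count below also covers species that are asked for too often.\<close>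

definition ffact :: "nat \<Rightarrow> nat \<Rightarrow> real" where
  "ffact n j = (\<Prod>i<j. real n - real i)"

lemma ffact_fact: "j \<le> n \<Longrightarrow> ffact n j = fact n / fact (n - j)"
proof (induction j)
  case 0 then show ?case by (simp add: ffact_def)
next
  case (Suc j)
  then have "fact (n - j) = real (n - j) * fact (n - Suc j)"
    by (metis Suc_diff_Suc Suc_le_lessD diff_is_0_eq fact_Suc nat_less_le not_less_eq_eq of_nat_mult of_nat_fact)
  moreover have "ffact n (Suc j) = ffact n j * real (n - j)" using Suc.prems by (simp add: ffact_def of_nat_diff)
  moreover have "real (n - j) \<noteq> 0" using Suc.prems by simp
  ultimately show ?case using Suc by simp
qed

lemma ffact_0: "n < j \<Longrightarrow> ffact n j = 0"
  unfolding ffact_def by (rule prod_zero) auto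

text \<open>After Stirling for \<open>fact n\<close>, the remaining factor is a Poisson weight of
  mean \<open>\<delta> * n\<close>; the factor \<open>sqrt n\<close> cancels against the bound of
  \<open>poisson_max\<close>, so only a constant is lost. The parameter \<open>\<delta>\<close> is
  free: using the same value for all species makes their exponential and power factors multiply to
  those of the whole population.\<close>

lemma ffact_upper:
  assumes j: "j \<le> n" and d: "0 < \<delta>" "\<delta> \<le> 1"
  shows "ffact n j \<le> 2 * exp 1 / sqrt \<delta> * exp (- ((1 - \<delta>) * real n)) / \<delta> ^ (n - j) * real n ^ j"
proof (cases "n = 0")
  case True
  have "1 \<le> 2 * exp 1 / sqrt \<delta>"
  proof -
    have "sqrt \<delta> \<le> 1" using d by simp
    also have "1 \<le> 2 * exp (1::real)" using exp_ge_add_one_self[of 1] by linarith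
    finally show ?thesis using d by (simp add: pos_le_divide_eq)
  qed
  then show ?thesis using True j by (simp add: ffact_def)
next
  case False
  define m where "m = n - j"
  have nm: "n = m + j" unfolding m_def using j by simp
  have n: "0 < real n" using False by simp
  have x: "0 < \<delta> * real n" using n d by simp
  have "ffact n j = fact n / fact m" using ffact_fact[OF j] unfolding m_def .
  also have "\<dots> \<le> (exp 1 * sqrt (real n) * real n ^ n * exp (- real n)) / fact m"
    using fact_stirling(1)[of n] False by (intro divide_right_mono) auto
  also have "\<dots> = exp 1 * sqrt (real n) * exp (- real n) * real n ^ j * (real n ^ m / fact m)"
    unfolding nm by (simp add: power_add)
  also have "real n ^ m / fact m = ((\<delta> * real n) ^ m / fact m) / \<delta> ^ m" using d by (simp add: power_mult_distrib)
  also have "exp 1 * sqrt (real n) * exp (- real n) * real n ^ j * (((\<delta> * real n) ^ m / fact m) / \<delta> ^ m)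
     \<le> exp 1 * sqrt (real n) * exp (- real n) * real n ^ j * ((2 * exp (\<delta> * real n) / sqrt (\<delta> * real n)) / \<delta> ^ m)"
    using poisson_max[OF x, of m] d by (intro mult_left_mono divide_right_mono) auto
  also have "\<dots> = 2 * exp 1 / sqrt \<delta> * (exp (- real n) * exp (\<delta> * real n)) / \<delta> ^ m * real n ^ j"
    using n d by (simp add: real_sqrt_mult field_simps)
  also have "exp (- real n) * exp (\<delta> * real n) = exp (- ((1 - \<delta>) * real n))"
    by (simp add: exp_add[symmetric] algebra_simps)
  finally show ?thesis unfolding m_def .
qed

text \<open>The counterpart for the whole population. With \<open>\<delta>\<close> equal to the
  unsampled fraction, Stirling for both factorials reproduces the exponential and power factors of
  \<open>ffact_upper\<close>.\<close>

lemma ffact_lower: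
  assumes k: "k < l" and d: "\<delta> = real (l - k) / real l"
  shows "exp (- 1) / sqrt \<delta> * exp (- ((1 - \<delta>) * real l)) / \<delta> ^ (l - k) * real l ^ k \<le> ffact l k"
proof -
  define m where "m = l - k"
  have lm: "l = m + k" and m: "0 < real m" "1 \<le> m" unfolding m_def using k by auto
  have l: "0 < real l" using k by simp
  have dm: "\<delta> * real l = real m" "0 < \<delta>" unfolding d m_def[symmetric] using l m by auto
  have "exp (- 1) / sqrt \<delta> * exp (- ((1 - \<delta>) * real l)) / \<delta> ^ m * real l ^ k
     = (sqrt (real l) * real l ^ l * exp (- real l)) / (exp 1 * sqrt (real m) * real m ^ m * exp (- real m))"
  proof -
    have "exp (- ((1 - \<delta>) * real l)) = exp (- real l) * exp (real m)"
      unfolding exp_add[symmetric] dm(1)[symmetric] by (simp add: algebra_simps)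
    moreover have "sqrt (real m) = sqrt \<delta> * sqrt (real l)" unfolding dm(1)[symmetric] by (rule real_sqrt_mult)
    moreover have "real m ^ m = \<delta> ^ m * real l ^ m" unfolding dm(1)[symmetric] by (rule power_mult_distrib)
    moreover have "real l ^ l = real l ^ m * real l ^ k" by (subst (2) lm) (rule power_add)
    ultimately show ?thesis using l dm(2) by (simp add: exp_minus field_simps)
  qed
  also have "\<dots> \<le> fact l / fact m"
    using fact_stirling(2)[of l] fact_stirling(1)[of m] k m by (intro frac_le) auto
  also have "\<dots> = ffact l k" using ffact_fact[of k l] k unfolding m_def by simp
  finally show ?thesis unfolding m_def .
qed

section \<open>Counting ordered samples by their state pattern\<close>

definition samples :: "nat \<Rightarrow> nat \<Rightarrow> nat list set" where
  "samples l k = {xs. length xs = k \<and> distinct xs \<and> set xs \<subseteq> {..<l}}"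

lemma finite_samples: "finite (samples l k)"
  unfolding samples_def by (rule finite_subset[OF _ finite_lists_length_eq[of "{..<l}" k]]) auto

lemma card_samples_pattern:
  fixes s :: "nat \<Rightarrow> 's::finite"
  shows "real (card {xs \<in> samples l (length zs). map s xs = zs})
     = (\<Prod>\<sigma>\<in>UNIV. ffact (card {t. t < l \<and> s t = \<sigma>}) (count_list zs \<sigma>))"
proof (induction zs)
  case Nil
  have "{xs \<in> samples l (length ([] :: 's list)). map s xs = []} = {[]}" unfolding samples_def by auto
  then show ?case by (simp add: ffact_def)
next
  case (Cons z zs)
  let ?n = "\<lambda>\<sigma>. card {t. t < l \<and> s t = \<sigma>}"
  let ?X = "{xs \<in> samples l (length zs). map s xs = zs}"
  let ?A = "\<lambda>xs. {x. x < l \<and> s x = z} - set xs"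
  have fin: "finite ?X" using finite_samples by simp
  have "{xs \<in> samples l (length (z # zs)). map s xs = z # zs} = (\<lambda>(xs, x). x # xs) ` (SIGMA xs:?X. ?A xs)"
  proof (rule equalityI; rule subsetI)
    fix ys assume "ys \<in> {xs \<in> samples l (length (z # zs)). map s xs = z # zs}"
    then show "ys \<in> (\<lambda>(xs, x). x # xs) ` (SIGMA xs:?X. ?A xs)"
      by (cases ys) (auto simp: samples_def image_iff)
  next
    fix ys assume "ys \<in> (\<lambda>(xs, x). x # xs) ` (SIGMA xs:?X. ?A xs)"
    then show "ys \<in> {xs \<in> samples l (length (z # zs)). map s xs = z # zs}"
      by (auto simp: samples_def)
  qed
  moreover have "inj_on (\<lambda>(xs, x). x # xs) (SIGMA xs:?X. ?A xs)" by (auto simp: inj_on_def)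
  ultimately have "card {xs \<in> samples l (length (z # zs)). map s xs = z # zs} = (\<Sum>xs\<in>?X. card (?A xs))"
    using fin by (simp add: card_image)
  moreover have "real (card (?A xs)) = real (?n z) - real (count_list zs z)" if "xs \<in> ?X" for xs
  proof -
    have d: "distinct xs" "set xs \<subseteq> {..<l}" "map s xs = zs" using that unfolding samples_def by auto
    have "{x. x < l \<and> s x = z} \<inter> set xs = set (filter (\<lambda>x. s x = z) xs)" using d(2) by auto
    moreover have "card (set (filter (\<lambda>x. s x = z) xs)) = length (filter (\<lambda>x. s x = z) xs)"
      by (rule distinct_card) (use d(1) in simp)
    moreover have "length (filter (\<lambda>x. s x = z) xs) = count_list zs z"
      unfolding d(3)[symmetric] by (simp add: count_list_eq_length_filter filter_map o_def eq_commute[of z])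
    ultimately have i: "card ({x. x < l \<and> s x = z} \<inter> set xs) = count_list zs z" by simp
    have "card ({x. x < l \<and> s x = z} \<inter> set xs) \<le> ?n z" by (intro card_mono) auto
    moreover have "card (?A xs) = ?n z - card ({x. x < l \<and> s x = z} \<inter> set xs)"
      by (rule card_Diff_subset_Int) simp
    ultimately show ?thesis using i by (simp add: of_nat_diff)
  qed
  ultimately have "real (card {xs \<in> samples l (length (z # zs)). map s xs = z # zs}) = (real (?n z) - real (count_list zs z)) * real (card ?X)"
    by simp
  also have "\<dots> = (real (?n z) - real (count_list zs z)) * (\<Prod>\<sigma>\<in>UNIV. ffact (?n \<sigma>) (count_list zs \<sigma>))"
    unfolding Cons.IH ..
  also have "\<dots> = (\<Prod>\<sigma>\<in>UNIV. ffact (?n \<sigma>) (count_list (z # zs) \<sigma>))"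
  proof -
    have "(\<Prod>\<sigma>\<in>UNIV. ffact (?n \<sigma>) (count_list (z # zs) \<sigma>)) = ffact (?n z) (Suc (count_list zs z)) * (\<Prod>\<sigma>\<in>UNIV - {z}. ffact (?n \<sigma>) (count_list zs \<sigma>))"
      by (subst prod.remove[of UNIV z]) (auto intro!: prod.cong)
    moreover have "(\<Prod>\<sigma>\<in>UNIV. ffact (?n \<sigma>) (count_list zs \<sigma>)) = ffact (?n z) (count_list zs z) * (\<Prod>\<sigma>\<in>UNIV - {z}. ffact (?n \<sigma>) (count_list zs \<sigma>))"
      by (rule prod.remove) auto
    ultimately show ?thesis by (simp add: ffact_def mult_ac)
  qed
  finally show ?case .
qed

text \<open>The pattern count over the one-element alphabet \<open>unit\<close>.\<close>

lemma card_samples: "real (card (samples l k)) = ffact l k"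
proof -
  have "{xs \<in> samples l (length (replicate k ())). map (\<lambda>_. ()) xs = replicate k ()} = samples l k"
    unfolding samples_def by (auto simp: map_replicate_const)
  moreover have "count_list (replicate k ()) () = k" by (induction k) auto
  ultimately show ?thesis using card_samples_pattern[of l "replicate k ()" "\<lambda>_. ()"] by (simp add: UNIV_unit)
qed

lemma prod_list_count:
  "(\<Prod>z\<leftarrow>zs. q z) = (\<Prod>\<sigma>\<in>(UNIV :: 's::finite set). (q \<sigma> :: real) ^ count_list zs \<sigma>)"
proof (induction zs)
  case (Cons z zs)
  have "(\<Prod>\<sigma>\<in>(UNIV :: 's set). q \<sigma> ^ count_list (z # zs) \<sigma>) = (\<Prod>\<sigma>\<in>UNIV. (if \<sigma> = z then q \<sigma> else 1) * q \<sigma> ^ count_list zs \<sigma>)"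
    by (intro prod.cong) auto
  then show ?case using Cons by (simp add: prod.distrib)
qed simp

lemma sum_count_list: "(\<Sum>\<sigma>\<in>(UNIV :: 's::finite set). count_list zs \<sigma>) = length zs"
proof (induction zs)
  case (Cons z zs)
  have "(\<Sum>\<sigma>\<in>(UNIV :: 's set). count_list (z # zs) \<sigma>) = (\<Sum>\<sigma>\<in>(UNIV :: 's set). (if \<sigma> = z then 1 else 0) + count_list zs \<sigma>)"
    by (intro sum.cong) auto
  then show ?case using Cons by (simp add: sum.distrib)
qed simp

lemma sum_type: "(\<Sum>\<sigma>\<in>(UNIV :: 's::finite set). card {t. t < l \<and> s t = \<sigma>}) = l"
proof -
  have "(\<Sum>\<sigma>\<in>(UNIV :: 's set). card {t. t < l \<and> s t = \<sigma>}) = card (\<Union>\<sigma>\<in>(UNIV :: 's set). {t. t < l \<and> s t = \<sigma>})"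
    by (rule card_UN_disjoint[symmetric]) auto
  also have "(\<Union>\<sigma>\<in>(UNIV :: 's set). {t. t < l \<and> s t = \<sigma>}) = {..<l}" by auto
  finally show ?thesis by simp
qed

text \<open>Sampling a proportion \<open>1 - \<delta>\<close> of a population without replacement is dominated, up to a constant
  depending only on \<open>\<delta>\<close> and the number of species, by sampling with replacement.\<close>

lemma sampling_domination:
  fixes s :: "nat \<Rightarrow> 's::finite"
  assumes k: "k < l" "length zs = k" and d: "0 < \<delta>0" "\<delta>0 \<le> real (l - k) / real l"
  shows "real (card {xs \<in> samples l k. map s xs = zs}) \<le> exp 1 * (2 * exp 1 / sqrt \<delta>0) ^ CARD('s)
     * real (card (samples l k)) * (\<Prod>z\<leftarrow>zs. real (card {t. t < l \<and> s t = z}) / real l)"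
proof -
  let ?n = "\<lambda>\<sigma>. card {t. t < l \<and> s t = \<sigma>}"
  let ?j = "count_list zs"
  define \<delta> where "\<delta> = real (l - k) / real l"
  have l: "0 < real l" using k by simp
  have \<delta>: "0 < \<delta>" "\<delta> \<le> 1" "\<delta>0 \<le> \<delta>" unfolding \<delta>_def using k d by auto
  show ?thesis
  proof (cases "\<forall>\<sigma>. ?j \<sigma> \<le> ?n \<sigma>")
    case False
    then obtain \<sigma> where "?n \<sigma> < ?j \<sigma>" by (auto simp: not_le)
    then have "ffact (?n \<sigma>) (?j \<sigma>) = 0" by (rule ffact_0)
    then have "(\<Prod>\<sigma>\<in>UNIV. ffact (?n \<sigma>) (?j \<sigma>)) = 0"
      by (intro prod_zero[OF finite] bexI[of _ \<sigma>]) auto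
    then have "real (card {xs \<in> samples l k. map s xs = zs}) = 0" using card_samples_pattern[of l zs s] k by simp
    moreover have "0 \<le> (\<Prod>z\<leftarrow>zs. real (?n z) / real l)" unfolding prod_list_count by (intro prod_nonneg) auto
    ultimately show ?thesis using d by simp
  next
    case True
    define m where "m = (\<lambda>\<sigma>. ?n \<sigma> - ?j \<sigma>)"
    have "(\<Sum>\<sigma>\<in>UNIV. m \<sigma>) = (\<Sum>\<sigma>\<in>UNIV. ?n \<sigma>) - (\<Sum>\<sigma>\<in>UNIV. ?j \<sigma>)"
      unfolding m_def by (rule sum_subtractf_nat) (use True in auto)
    then have sm: "(\<Sum>\<sigma>\<in>UNIV. m \<sigma>) = l - k" unfolding sum_type sum_count_list k .
    let ?c = "2 * exp 1 / sqrt \<delta>"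
    have "real (card {xs \<in> samples l k. map s xs = zs}) = (\<Prod>\<sigma>\<in>UNIV. ffact (?n \<sigma>) (?j \<sigma>))"
      using card_samples_pattern[of l zs s] k by simp
    \<comment> \<open>Each species contributes one constant \<open>?c\<close>. The numbers of
      unsampled positions add up to \<open>l - k\<close>, so the other factors combine to those of
      \<open>ffact_lower\<close>.\<close>
    also have "\<dots> \<le> (\<Prod>\<sigma>\<in>UNIV. ?c * exp (- ((1 - \<delta>) * real (?n \<sigma>))) / \<delta> ^ m \<sigma> * real (?n \<sigma>) ^ ?j \<sigma>)"
    proof (rule prod_mono, intro conjI)
      fix \<sigma>
      show "0 \<le> ffact (?n \<sigma>) (?j \<sigma>)" using True by (simp add: ffact_fact)
      show "ffact (?n \<sigma>) (?j \<sigma>) \<le> ?c * exp (- ((1 - \<delta>) * real (?n \<sigma>))) / \<delta> ^ m \<sigma> * real (?n \<sigma>) ^ ?j \<sigma>"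
        unfolding m_def by (rule ffact_upper) (use True \<delta> in auto)
    qed
    also have "\<dots> = ?c ^ CARD('s) * exp (- ((1 - \<delta>) * real l)) / \<delta> ^ (l - k) * (\<Prod>\<sigma>\<in>UNIV. real (?n \<sigma>) ^ ?j \<sigma>)"
    proof -
      have "(\<Prod>\<sigma>\<in>UNIV. exp (- ((1 - \<delta>) * real (?n \<sigma>)))) = exp (\<Sum>\<sigma>\<in>(UNIV :: 's set). - ((1 - \<delta>) * real (?n \<sigma>)))"
        by (rule exp_sum[symmetric]) simp
      also have "(\<Sum>\<sigma>\<in>(UNIV :: 's set). - ((1 - \<delta>) * real (?n \<sigma>))) = - ((1 - \<delta>) * real (\<Sum>\<sigma>\<in>(UNIV :: 's set). ?n \<sigma>))"
        by (simp add: sum_negf sum_distrib_left)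
      finally have e: "(\<Prod>\<sigma>\<in>UNIV. exp (- ((1 - \<delta>) * real (?n \<sigma>)))) = exp (- ((1 - \<delta>) * real l))" unfolding sum_type .
      have f: "(\<Prod>\<sigma>\<in>UNIV. \<delta> ^ m \<sigma>) = \<delta> ^ (l - k)" unfolding sm[symmetric] by (rule power_sum[symmetric])
      show ?thesis unfolding prod.distrib prod_dividef e f by (simp add: power_mult_distrib power_divide)
    qed
    finally have up: "real (card {xs \<in> samples l k. map s xs = zs}) \<le>
      ?c ^ CARD('s) * exp (- ((1 - \<delta>) * real l)) / \<delta> ^ (l - k) * (\<Prod>\<sigma>\<in>UNIV. real (?n \<sigma>) ^ ?j \<sigma>)" .
    have low: "exp (- 1) / sqrt \<delta> * exp (- ((1 - \<delta>) * real l)) / \<delta> ^ (l - k) * real l ^ k \<le> real (card (samples l k))"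
      unfolding card_samples by (rule ffact_lower[OF k(1) \<delta>_def])
    have q: "(\<Prod>z\<leftarrow>zs. real (?n z) / real l) * real l ^ k = (\<Prod>\<sigma>\<in>UNIV. real (?n \<sigma>) ^ ?j \<sigma>)"
    proof -
      have "real l ^ k = (\<Prod>\<sigma>\<in>(UNIV :: 's set). real l ^ ?j \<sigma>)"
        unfolding k(2)[symmetric] sum_count_list[of zs, symmetric] by (rule power_sum)
      then show ?thesis unfolding prod_list_count using l by (simp add: prod.distrib[symmetric] power_divide)
    qed
    let ?Q = "(\<Prod>z\<leftarrow>zs. real (?n z) / real l)"
    have Q0: "0 \<le> ?Q" unfolding prod_list_count by (intro prod_nonneg) auto
    have s1: "sqrt \<delta> \<le> 1" using \<delta> by simp
    have cc: "?c \<le> 2 * exp 1 / sqrt \<delta>0" using \<delta> d by (intro divide_left_mono) auto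
    note up
    also have "?c ^ CARD('s) * exp (- ((1 - \<delta>) * real l)) / \<delta> ^ (l - k) * (\<Prod>\<sigma>\<in>UNIV. real (?n \<sigma>) ^ ?j \<sigma>)
      = ?c ^ CARD('s) * (exp 1 * sqrt \<delta>) * (exp (- 1) / sqrt \<delta> * exp (- ((1 - \<delta>) * real l)) / \<delta> ^ (l - k) * real l ^ k) * ?Q"
      unfolding q[symmetric] using \<delta> by (simp add: exp_minus field_simps)
    also have "\<dots> \<le> ?c ^ CARD('s) * (exp 1 * sqrt \<delta>) * real (card (samples l k)) * ?Q"
      using low Q0 \<delta> by (intro mult_right_mono mult_left_mono) auto
    also have "\<dots> \<le> (2 * exp 1 / sqrt \<delta>0) ^ CARD('s) * (exp 1 * 1) * real (card (samples l k)) * ?Q"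
      using cc s1 Q0 \<delta> d by (intro mult_right_mono mult_mono power_mono) auto
    finally show ?thesis by (simp add: mult_ac)
  qed
qed

lemma sampling_average:
  fixes s :: "nat \<Rightarrow> 's::finite"
  assumes k: "k < l" and d: "0 < \<delta>0" "\<delta>0 \<le> real (l - k) / real l" and F: "\<And>zs. 0 \<le> F zs"
  shows "(\<Sum>xs\<in>samples l k. F (map s xs)) \<le> exp 1 * (2 * exp 1 / sqrt \<delta>0) ^ CARD('s) * real (card (samples l k)) *
     (\<Sum>zs\<in>{zs. length zs = k}. (\<Prod>z\<leftarrow>zs. real (card {t. t < l \<and> s t = z}) / real l) * F zs)"
proof -
  let ?Z = "{zs :: 's list. length zs = k}"
  have fZ: "finite ?Z" using finite_lists_length_eq[of "UNIV :: 's set" k] by simp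
  have "(\<Sum>xs\<in>samples l k. F (map s xs)) = (\<Sum>zs\<in>?Z. \<Sum>xs\<in>{xs \<in> samples l k. map s xs = zs}. F (map s xs))"
    by (rule sum.group[symmetric, OF finite_samples fZ]) (auto simp: samples_def)
  also have "\<dots> = (\<Sum>zs\<in>?Z. real (card {xs \<in> samples l k. map s xs = zs}) * F zs)"
    by (intro sum.cong refl) simp
  also have "\<dots> \<le> (\<Sum>zs\<in>?Z. (exp 1 * (2 * exp 1 / sqrt \<delta>0) ^ CARD('s)
     * real (card (samples l k)) * (\<Prod>z\<leftarrow>zs. real (card {t. t < l \<and> s t = z}) / real l)) * F zs)"
    using sampling_domination[OF k _ d] F by (intro sum_mono mult_right_mono) auto
  finally show ?thesis by (simp add: sum_distrib_left mult.assoc)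
qed

section \<open>Codes for the compound channel\<close>

lemma sum_lists_PiE:
  "(\<Sum>zs\<in>{zs. length zs = k}. G zs) = (\<Sum>z\<in>PiE {..<k} (\<lambda>_. UNIV :: 's set). G (map z [0..<k]))"
  by (rule sum.reindex_bij_witness[where i="\<lambda>z. map z [0..<k]" and j="\<lambda>zs. restrict ((!) zs) {..<k}"])
     (auto simp: PiE_iff extensional_def fun_eq_iff intro!: nth_equalityI arg_cong[where f=G])

lemma prod_list_map_upt: "(\<Prod>x\<leftarrow>map z [0..<k]. q x) = (\<Prod>t<k. q (z t))" for q :: "'a \<Rightarrow> real"
  by (induction k) (auto simp: mult.commute)

lemma samples_nonempty: "k \<le> l \<Longrightarrow> samples l k \<noteq> {}"
proof -
  assume "k \<le> l"
  then have "[0..<k] \<in> samples l k" unfolding samples_def by auto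
  then show ?thesis by blast
qed

context
  fixes N :: "'s::finite \<Rightarrow> cmap" and dA dB :: nat
  assumes dA: "1 \<le> dA" and dB: "1 \<le> dB" and N: "\<forall>s. cptp dA dB (N s)"
begin

text \<open>The code is transported to the sampled positions and the rest is padded with idle
  letters; the states that it meets are then \<open>map s xs\<close>.\<close>

lemma scatter_code:
  assumes a: "acode dA dB {..<k} M1 M2 D p r" and xs: "xs \<in> samples l k"
  shows "\<exists>D' p' r'. acode dA dB {..<l} M1 M2 D' p' r' \<and>
    (\<forall>s. afid dA dB {..<k} (wstate dA N (\<lambda>t. map s xs ! t)) M1 M2 p r \<le> afid dA dB {..<l} (wstate dA N s) M1 M2 p' r')"
proof -
  have x: "length xs = k" "distinct xs" "set xs \<subseteq> {..<l}" using xs unfolding samples_def by auto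
  have bij: "bij_betw ((!) xs) {..<k} (set xs)" using bij_betw_nth[OF x(2), of "{..<k}" "set xs"] x(1) by simp
  obtain p1 r1 where a1: "acode dA dB (set xs) M1 M2 D p1 r1"
    and e1: "\<And>\<nu>. afid dA dB (set xs) \<nu> M1 M2 p1 r1 = afid dA dB {..<k} (\<lambda>t. \<nu> (xs ! t)) M1 M2 p r"
    using acode_transport[OF bij _ a] by auto
  have un: "({..<l} - set xs) \<union> set xs = {..<l}" using x(3) by auto
  obtain D2 p2 r2 where a2: "acode dA dB {..<l} M1 M2 D2 p2 r2"
    and e2: "\<And>\<nu>. \<forall>t\<in>{..<l}. chk dA dB (\<nu> t) \<Longrightarrow> afid dA dB (set xs) \<nu> M1 M2 p1 r1 \<le> afid dA dB {..<l} \<nu> M1 M2 p2 r2"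
    using acode_pad[of "{..<l} - set xs" "set xs", OF _ _ _ dA a1] unfolding un by auto
  have "afid dA dB {..<k} (wstate dA N (\<lambda>t. map s xs ! t)) M1 M2 p r \<le> afid dA dB {..<l} (wstate dA N s) M1 M2 p2 r2" for s
  proof -
    have "afid dA dB {..<k} (wstate dA N (\<lambda>t. map s xs ! t)) M1 M2 p r = afid dA dB {..<k} (\<lambda>t. wstate dA N s (xs ! t)) M1 M2 p r"
      by (rule afid_cong) (simp add: wstate_def x(1))
    also have "\<dots> = afid dA dB (set xs) (wstate dA N s) M1 M2 p1 r1" by (rule e1[symmetric])
    also have "\<dots> \<le> afid dA dB {..<l} (wstate dA N s) M1 M2 p2 r2" by (rule e2[OF chk_wstate[OF dA dB N]])
    finally show ?thesis .
  qed
  with a2 show ?thesis by blast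
qed

text \<open>The random code uses a uniformly drawn sample of positions. For a fixed state word the
  sampled states are dominated by independent draws from its empirical distribution, against which
  the compound code has error at most \<open>\<epsilon>\<close>; domination multiplies this error by
  a constant.\<close>

lemma rangood_of_compound:
  assumes a: "acode dA dB {..<k} M1 M2 D p r"
    and cmp: "\<And>q. \<forall>s. 0 \<le> q s \<Longrightarrow> sum q UNIV = 1 \<Longrightarrow>
       1 - \<epsilon> \<le> (\<Sum>z\<in>PiE {..<k} (\<lambda>_. UNIV). (\<Prod>t<k. q (z t)) * afid dA dB {..<k} (wstate dA N z) M1 M2 p r)"
    and k: "k < l" and d: "0 < \<delta>0" "\<delta>0 \<le> real (l - k) / real l"
    and \<eta>: "exp 1 * (2 * exp 1 / sqrt \<delta>0) ^ CARD('s) * \<epsilon> \<le> \<eta>"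
  shows "rangood dA dB N l M1 M2 \<eta>"
  unfolding rangood_def
proof (intro allI impI)
  fix w :: "(nat \<Rightarrow> 's) \<Rightarrow> real" assume w: "\<forall>s. 0 \<le> w s"
  let ?C = "exp 1 * (2 * exp 1 / sqrt \<delta>0) ^ CARD('s)"
  let ?X = "samples l k"
  let ?in = "\<lambda>zs. afid dA dB {..<k} (wstate dA N (\<lambda>t. zs ! t)) M1 M2 p r"
  have "\<forall>xs\<in>?X. \<exists>c. acode dA dB {..<l} M1 M2 (fst c) (fst (snd c)) (snd (snd c)) \<and>
    (\<forall>s. ?in (map s xs) \<le> afid dA dB {..<l} (wstate dA N s) M1 M2 (fst (snd c)) (snd (snd c)))"
    using scatter_code[OF a] by fastforce
  then obtain c where c: "\<And>xs. xs \<in> ?X \<Longrightarrow> acode dA dB {..<l} M1 M2 (fst (c xs)) (fst (snd (c xs))) (snd (snd (c xs)))"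
    and ce: "\<And>xs s. xs \<in> ?X \<Longrightarrow> ?in (map s xs) \<le> afid dA dB {..<l} (wstate dA N s) M1 M2 (fst (snd (c xs))) (snd (snd (c xs)))"
    by (metis (no_types, lifting))
  let ?f = "\<lambda>xs s. afid dA dB {..<l} (wstate dA N s) M1 M2 (fst (snd (c xs))) (snd (snd (c xs)))"
  have X0: "0 < real (card ?X)" using samples_nonempty[of k l] finite_samples[of l k] k by (simp add: card_gt_0_iff)
  have avg: "(\<Sum>xs\<in>?X. 1 - ?f xs s) \<le> real (card ?X) * \<eta>" for s
  proof -
    \<comment> \<open>The empirical distribution of \<open>s\<close>: it depends on the state word,
      which is why the code must be good for all of \<open>conv_chan\<close> at once.\<close>
    let ?q = "\<lambda>z. real (card {t. t < l \<and> s t = z}) / real l"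
    have q0: "\<forall>s. 0 \<le> ?q s" by simp
    have q1: "sum ?q UNIV = 1" using sum_type[of l s] k
      by (simp add: sum_divide_distrib[symmetric] of_nat_sum[symmetric] del: of_nat_sum)
    have in1: "?in zs \<le> 1" for zs using afid_wstate_bounds(2)[OF dA dB N a] .
    have "(\<Sum>xs\<in>?X. 1 - ?f xs s) \<le> (\<Sum>xs\<in>?X. 1 - ?in (map s xs))"
      using ce by (intro sum_mono) auto
    also have "\<dots> \<le> ?C * real (card ?X) * (\<Sum>zs\<in>{zs. length zs = k}. (\<Prod>z\<leftarrow>zs. ?q z) * (1 - ?in zs))"
      by (rule sampling_average[OF k d, of "\<lambda>zs. 1 - ?in zs"]) (use in1 in auto)
    also have "(\<Sum>zs\<in>{zs. length zs = k}. (\<Prod>z\<leftarrow>zs. ?q z) * (1 - ?in zs))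
      = (\<Sum>z\<in>PiE {..<k} (\<lambda>_. UNIV). (\<Prod>t<k. ?q (z t)) * (1 - afid dA dB {..<k} (wstate dA N z) M1 M2 p r))"
      unfolding sum_lists_PiE prod_list_map_upt wstate_list[OF dA dB N, symmetric] ..
    also have "\<dots> = 1 - (\<Sum>z\<in>PiE {..<k} (\<lambda>_. UNIV). (\<Prod>t<k. ?q (z t)) * afid dA dB {..<k} (wstate dA N z) M1 M2 p r)"
      unfolding right_diff_distrib sum_subtractf mult_1_right sum_prod_q[OF dA dB N q1] ..
    also have "?C * real (card ?X) * \<dots> \<le> ?C * real (card ?X) * \<epsilon>"
      using cmp[OF q0 q1] d by (intro mult_left_mono) auto
    also have "\<dots> = real (card ?X) * (?C * \<epsilon>)" by (simp only: mult_ac)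
    also have "\<dots> \<le> real (card ?X) * \<eta>" using \<eta> by (intro mult_left_mono) auto
    finally show ?thesis .
  qed
  let ?S = "PiE {..<l} (\<lambda>_. UNIV :: 's set)"
  let ?W = "\<Sum>s\<in>?S. w s"
  have "(\<Sum>xs\<in>?X. \<Sum>s\<in>?S. w s * exp (1 - ?f xs s)) = (\<Sum>s\<in>?S. w s * (\<Sum>xs\<in>?X. exp (1 - ?f xs s)))"
    by (subst sum.swap) (simp add: sum_distrib_left)
  also have "\<dots> \<le> (\<Sum>s\<in>?S. w s * (real (card ?X) * exp (2 * \<eta>)))"
  proof (intro sum_mono mult_left_mono)
    fix s
    have "(\<Sum>xs\<in>?X. exp (1 - ?f xs s)) \<le> (\<Sum>xs\<in>?X. 1 + 2 * (1 - ?f xs s))"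
      using afid_wstate_bounds[OF dA dB N c] by (intro sum_mono exp_le_linear) auto
    also have "\<dots> = real (card ?X) + 2 * (\<Sum>xs\<in>?X. 1 - ?f xs s)"
      by (simp only: sum.distrib sum_constant sum_distrib_left mult_1_right)
    also have "\<dots> \<le> real (card ?X) + 2 * (real (card ?X) * \<eta>)" using avg[of s] by simp
    also have "\<dots> = real (card ?X) * (1 + 2 * \<eta>)" by (simp add: algebra_simps)
    also have "\<dots> \<le> real (card ?X) * exp (2 * \<eta>)" using exp_ge_add_one_self[of "2 * \<eta>"] by (intro mult_left_mono) auto
    finally show "(\<Sum>xs\<in>?X. exp (1 - ?f xs s)) \<le> real (card ?X) * exp (2 * \<eta>)" .
  qed (use w in auto)
  also have "\<dots> = real (card ?X) * (exp (2 * \<eta>) * ?W)"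
    by (simp only: sum_distrib_left mult_ac)
  finally have tot: "(\<Sum>xs\<in>?X. \<Sum>s\<in>?S. w s * exp (1 - ?f xs s)) \<le> real (card ?X) * (exp (2 * \<eta>) * ?W)" .
  have "\<exists>xs\<in>?X. (\<Sum>s\<in>?S. w s * exp (1 - ?f xs s)) \<le> exp (2 * \<eta>) * ?W"
  proof (rule ccontr)
    assume "\<not> ?thesis"
    then have "(\<Sum>xs\<in>?X. exp (2 * \<eta>) * ?W) < (\<Sum>xs\<in>?X. \<Sum>s\<in>?S. w s * exp (1 - ?f xs s))"
      using samples_nonempty[of k l] finite_samples[of l k] k by (intro sum_strict_mono) (auto simp: not_le)
    then show False using tot by simp
  qed
  then obtain xs where "xs \<in> ?X" "(\<Sum>s\<in>?S. w s * exp (1 - ?f xs s)) \<le> exp (2 * \<eta>) * ?W" by blast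
  then show "\<exists>D p r. acode dA dB {..<l} M1 M2 D p r \<and>
     (\<Sum>s\<in>?S. w s * exp (1 - afid dA dB {..<l} (wstate dA N s) M1 M2 p r)) \<le> exp (2 * \<eta>) * ?W"
    using c[of xs] by blast
qed

lemma C_CET_subset_A_d:
  assumes "(P1, P2) \<in> A_d dA dB N" "(P1, P2) \<noteq> (0, 0)"
  shows "C_CET dA dB (conv_chan dB N) \<subseteq> A_d dA dB N"
proof
  fix Rr assume R0: "Rr \<in> C_CET dA dB (conv_chan dB N)"
  obtain R1 R2 where Re: "Rr = (R1, R2)" by (cases Rr)
  have R: "R1 \<ge> 0" "R2 \<ge> 0" and cc: "\<And>\<epsilon> \<delta>. \<epsilon> > 0 \<Longrightarrow> \<delta> > 0 \<Longrightarrow> \<exists>n0. \<forall>n \<ge> n0. \<exists>M1 M2 c.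
        is_code dA dB n M1 M2 c \<and> log 2 (real M1) / real n \<ge> R1 - \<delta> \<and> log 2 (real M2) / real n \<ge> R2 - \<delta> \<and>
        (INF W \<in> conv_chan dB N. avg_fid dA dB n M1 M2 (tensor_list dA dB (replicate n W)) c) \<ge> 1 - \<epsilon>"
    using R0 unfolding C_CET_def Re by auto
  have "eventually (\<lambda>l. \<exists>M1 M2. rangood dA dB N l M1 M2 \<eta> \<and> 1 \<le> M1 \<and> 1 \<le> M2 \<and>
        R1 - \<eta> \<le> log 2 (real M1) / real l \<and> R2 - \<eta> \<le> log 2 (real M2) / real l) sequentially" if \<eta>: "0 < \<eta>" for \<eta>
  proof -
    define \<kappa> where "\<kappa> = min (1/2) (\<eta> / (2 * (1 + R1 + R2)))"
    have k: "0 < \<kappa>" unfolding \<kappa>_def using \<eta> R by auto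
    have k2: "\<kappa> \<le> 1/2" unfolding \<kappa>_def by (rule min.cobounded1)
    have "\<kappa> \<le> \<eta> / (2 * (1 + R1 + R2))" unfolding \<kappa>_def by simp
    then have "\<kappa> * (1 + R1 + R2) \<le> \<eta> / 2" using R by (simp add: pos_le_divide_eq mult_ac)
    moreover have "\<kappa> * R1 \<le> \<kappa> * (1 + R1 + R2)" "\<kappa> * R2 \<le> \<kappa> * (1 + R1 + R2)" using R k by (auto intro: mult_left_mono)
    ultimately have kR: "\<kappa> * R1 \<le> \<eta> / 2" "\<kappa> * R2 \<le> \<eta> / 2" by auto
    \<comment> \<open>The domination constant blows up as the unsampled fraction tends to 0, so a
      positive fraction stays idle: at least \<open>\<delta>0\<close>, and at most
      \<open>\<kappa> = 2 * \<delta>0\<close> after rounding up once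
      \<open>\<delta>0 * l \<ge> 1\<close>.\<close>
    define \<delta>0 where "\<delta>0 = \<kappa> / 2"
    have d0: "0 < \<delta>0" "\<delta>0 \<le> 1/4" using k k2 unfolding \<delta>0_def by auto
    define C where "C = exp 1 * (2 * exp 1 / sqrt \<delta>0) ^ CARD('s)"
    have C: "0 < C" unfolding C_def using d0 by simp
    \<comment> \<open>\<open>C\<close> depends only on \<open>\<delta>0\<close> and the number of
      states, so the accuracy demanded from the compound code can be fixed before the code is
      chosen.\<close>
    define \<epsilon> where "\<epsilon> = \<eta> / C"
    have \<epsilon>: "0 < \<epsilon>" "C * \<epsilon> \<le> \<eta>" unfolding \<epsilon>_def using C \<eta> by auto
    obtain n0 where n0: "\<And>n. n \<ge> n0 \<Longrightarrow> \<exists>M1 M2 c.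
        is_code dA dB n M1 M2 c \<and> log 2 (real M1) / real n \<ge> R1 - \<eta>/2 \<and> log 2 (real M2) / real n \<ge> R2 - \<eta>/2 \<and>
        (INF W \<in> conv_chan dB N. avg_fid dA dB n M1 M2 (tensor_list dA dB (replicate n W)) c) \<ge> 1 - \<epsilon>"
      using cc[OF \<epsilon>(1), of "\<eta>/2"] \<eta> by auto
    define m where "m = (\<lambda>l. nat \<lceil>\<delta>0 * real l\<rceil>)"
    define kk where "kk = (\<lambda>l. l - m l)"
    have m1: "\<delta>0 * real l \<le> real (m l)" "real (m l) \<le> \<delta>0 * real l + 1" for l
    proof -
      have "0 \<le> \<delta>0 * real l" using d0 by simp
      then show "\<delta>0 * real l \<le> real (m l)" "real (m l) \<le> \<delta>0 * real l + 1" unfolding m_def by linarith+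
    qed
    have "filterlim (\<lambda>l. (1 - \<kappa>) * real l) at_top sequentially" using k k2 by real_asymp
    then have f1: "eventually (\<lambda>l. real n0 + 1 \<le> (1 - \<kappa>) * real l) sequentially" by (simp add: filterlim_at_top)
    have "filterlim (\<lambda>l. \<delta>0 * real l) at_top sequentially" using d0 by real_asymp
    then have f2: "eventually (\<lambda>l. 1 \<le> \<delta>0 * real l) sequentially" by (simp add: filterlim_at_top)
    from f1 f2 eventually_ge_at_top[of 1] show ?thesis
    proof eventually_elim
      case (elim l)
      have l0: "0 < l" using elim(3) by simp
      have ml: "real (m l) \<le> \<kappa> * real l" using m1(2)[of l] elim(2) unfolding \<delta>0_def by linarith
      also have "\<dots> \<le> 1 * real l" using k2 by (intro mult_right_mono) auto
      finally have mle: "m l \<le> l" by simp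
      have mpos: "0 < m l" using m1(1)[of l] elim(2) by (cases "m l") auto
      have kkr: "real (kk l) = real l - real (m l)" unfolding kk_def using mle by simp
      have kl: "(1 - \<kappa>) * real l \<le> real (kk l)" unfolding kkr using ml by (simp add: algebra_simps)
      have kn: "n0 \<le> kk l" "0 < kk l" using kl elim(1) by linarith+
      have klt: "kk l < l" unfolding kk_def using mpos l0 by simp
      have lk: "real (l - kk l) = real (m l)" unfolding kk_def using mle by simp
      have dl: "\<delta>0 \<le> real (l - kk l) / real l" unfolding lk using m1(1)[of l] l0 by (simp add: pos_le_divide_eq)
      from n0[OF kn(1)] obtain M1 M2 c where c: "is_code dA dB (kk l) M1 M2 c"
        and r: "R1 - \<eta>/2 \<le> log 2 (real M1) / real (kk l)" "R2 - \<eta>/2 \<le> log 2 (real M2) / real (kk l)"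
        and inf: "1 - \<epsilon> \<le> (INF W \<in> conv_chan dB N. avg_fid dA dB (kk l) M1 M2 (tensor_list dA dB (replicate (kk l) W)) c)"
        by blast
      from code_to_acode[OF c dA dB] obtain D p r' where a: "acode dA dB {..<kk l} M1 M2 D p r'"
        and e: "\<And>Ns. length Ns = kk l \<Longrightarrow> (\<forall>N\<in>set Ns. cptp dA dB N) \<Longrightarrow>
           avg_fid dA dB (kk l) M1 M2 (tensor_list dA dB Ns) c = afid dA dB {..<kk l} (\<lambda>t. ker dA (Ns ! t)) M1 M2 p r'" by blast
      have cmp: "1 - \<epsilon> \<le> (\<Sum>z\<in>PiE {..<kk l} (\<lambda>_. UNIV). (\<Prod>t<kk l. q (z t)) * afid dA dB {..<kk l} (wstate dA N z) M1 M2 p r')"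
        if q: "\<forall>s. 0 \<le> q s" "sum q UNIV = 1" for q
      proof -
        have fid: "avg_fid dA dB (kk l) M1 M2 (tensor_list dA dB (replicate (kk l) W)) c =
          afid dA dB {..<kk l} (\<lambda>t. ker dA (replicate (kk l) W ! t)) M1 M2 p r'" if "W \<in> conv_chan dB N" for W
          using conv_chan_elem[OF dA dB N that] e[of "replicate (kk l) W"] by (metis in_set_replicate length_replicate)
        \<comment> \<open>The family \<open>conv_chan\<close> may be infinite; a lower bound is
          needed to compare the infimum with a single member.\<close>
        have bdd: "bdd_below ((\<lambda>W. avg_fid dA dB (kk l) M1 M2 (tensor_list dA dB (replicate (kk l) W)) c) ` conv_chan dB N)"
        proof (rule bdd_belowI2)
          fix W assume W: "W \<in> conv_chan dB N"
          obtain q where "cptp dA dB W" using conv_chan_elem[OF dA dB N W] by metis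
          then have "\<forall>t\<in>{..<kk l}. chk dA dB (ker dA (replicate (kk l) W ! t))" using cptp_chk by auto
          from afid_bounds(1)[OF this _ a] show "0 \<le> avg_fid dA dB (kk l) M1 M2 (tensor_list dA dB (replicate (kk l) W)) c"
            unfolding fid[OF W] by simp
        qed
        define W where "W = (\<lambda>X. msum dB (\<lambda>s. complex_of_real (q s) \<cdot>\<^sub>m N s X) UNIV)"
        have W: "W \<in> conv_chan dB N" unfolding W_def conv_chan_def using q by blast
        have kW: "ker dA W i j a b = (\<Sum>s\<in>UNIV. complex_of_real (q s) * ker dA (N s) i j a b)" if "a < dB" "b < dB" for i j a b
        proof -
          have "(complex_of_real (q s) \<cdot>\<^sub>m N s (munit dA i j)) $$ (a,b) = complex_of_real (q s) * N s (munit dA i j) $$ (a,b)" for s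
          proof -
            have "N s (munit dA i j) \<in> carrier_mat dB dB" using N lin_carrier[OF cp_lin[OF cptp_cp]] by (metis munit_carrier)
            then show ?thesis using that by (subst index_smult_mat) auto
          qed
          then show ?thesis unfolding ker_def W_def msum_def using that by simp
        qed
        have "1 - \<epsilon> \<le> avg_fid dA dB (kk l) M1 M2 (tensor_list dA dB (replicate (kk l) W)) c"
          by (rule order_trans[OF inf cINF_lower[OF bdd W]])
        moreover have "afid dA dB {..<kk l} (\<lambda>t. ker dA (replicate (kk l) W ! t)) M1 M2 p r'
          = (\<Sum>z\<in>PiE {..<kk l} (\<lambda>_. UNIV). (\<Prod>t<kk l. q (z t)) * afid dA dB {..<kk l} (wstate dA N z) M1 M2 p r')"
          by (rule compound_fid[OF dA dB N a]) (rule kW)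
        ultimately show ?thesis unfolding fid[OF W] by simp
      qed
      have rg: "rangood dA dB N l M1 M2 \<eta>"
        by (rule rangood_of_compound[OF a cmp klt d0(1) dl]) (use \<epsilon>(2) in \<open>auto simp: C_def\<close>)
      have M: "1 \<le> M1" "1 \<le> M2" using acodeD(1,2)[OF a] by auto
      have x: "0 \<le> log 2 (real M1)" "0 \<le> log 2 (real M2)" using M by auto
      have kk1: "0 \<le> \<kappa>" "\<kappa> \<le> 1" "0 \<le> \<eta>/2" "kk l \<le> l" using k k2 \<eta> klt by auto
      have "R1 - \<eta> \<le> log 2 (real M1) / real l" "R2 - \<eta> \<le> log 2 (real M2) / real l"
        using rate_shrink[OF dA dB N kk1(1,2) R(1) kR(1) kk1(3) _ kl kk1(4) l0 r(1) kn(2) x(1)]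
          rate_shrink[OF dA dB N kk1(1,2) R(2) kR(2) kk1(3) _ kl kk1(4) l0 r(2) kn(2) x(2)] by auto
      then show ?case using rg M by blast
    qed
  qed
  from elimination[OF dA dB N R this assms] show "Rr \<in> A_d dA dB N" unfolding Re .
qed

end

section \<open>Symmetrizable channels\<close>

context
  fixes N :: "'s::finite \<Rightarrow> cmap" and dA dB :: nat
  assumes dA: "1 \<le> dA" and dB: "1 \<le> dB" and N: "\<forall>s. cptp dA dB (N s)"
begin

lemma N_carrier: "\<forall>M\<in>set (map N ss). \<forall>X\<in>carrier_mat dA dA. M X \<in> carrier_mat dB dB"
proof (intro ballI)
  fix M and X :: "complex mat" assume "M \<in> set (map N ss)" and X: "X \<in> carrier_mat dA dA"
  then obtain s where M: "M = N s" by auto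
  have "cptp dA dB (N s)" using N by blast
  from lin_carrier[OF cp_lin[OF cptp_cp[OF this]] X] show "M X \<in> carrier_mat dB dB" unfolding M .
qed

text \<open>Symmetrizability speaks about output matrices, codes about pairings; this identity
  carries equations between the former over to the latter.\<close>

lemma pairing_chan_seq:
  assumes X: "X = Matrix.mat (dA ^ l) (dA ^ l) (\<lambda>(x,y). P (dg dA l x) (dg dA l y))" and ss: "length ss = l"
  shows "pairing dA dB {..<l} (wstate dA N (\<lambda>t. ss ! t)) P R =
    (\<Sum>a<dB ^ l. \<Sum>b<dB ^ l. chan_seq dA dB N ss X $$ (a,b) * R (dg dB l a) (dg dB l b))"
proof -
  let ?\<nu> = "wstate dA N (\<lambda>t. ss ! t)"
  let ?F = "\<lambda>I J A B. P I J * chanW {..<l} ?\<nu> I J A B * R A B"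
  note Nc = N_carrier[of ss]
  have ch: "chan_seq dA dB N ss X $$ (a,b) = (\<Sum>x<dA ^ l. \<Sum>y<dA ^ l. P (dg dA l x) (dg dA l y) *
       chanW {..<l} ?\<nu> (dg dA l x) (dg dA l y) (dg dB l a) (dg dB l b))" if "a < dB ^ l" "b < dB ^ l" for a b
  proof -
    have "chan_seq dA dB N ss X $$ (a,b) = (\<Sum>x<dA ^ l. \<Sum>y<dA ^ l. X $$ (x,y) *
       chanW {..<l} (\<lambda>t. ker dA (map N ss ! t)) (dg dA l x) (dg dA l y) (dg dB l a) (dg dB l b))"
      unfolding chan_seq_def using tensor_list_entry[OF Nc dA dB, of X] ss that X by simp
    also have "\<dots> = (\<Sum>x<dA ^ l. \<Sum>y<dA ^ l. P (dg dA l x) (dg dA l y) *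
       chanW {..<l} ?\<nu> (dg dA l x) (dg dA l y) (dg dB l a) (dg dB l b))"
      unfolding X chanW_def using ss by (intro sum.cong refl) (auto simp: wstate_def)
    finally show ?thesis .
  qed
  have "(\<Sum>a<dB ^ l. \<Sum>b<dB ^ l. chan_seq dA dB N ss X $$ (a,b) * R (dg dB l a) (dg dB l b))
    = (\<Sum>a<dB ^ l. \<Sum>b<dB ^ l. \<Sum>x<dA ^ l. \<Sum>y<dA ^ l. ?F (dg dA l x) (dg dA l y) (dg dB l a) (dg dB l b))"
    by (intro sum.cong[OF refl]) (simp add: ch sum_distrib_right)
  also have "\<dots> = (\<Sum>A\<in>words dB {..<l}. \<Sum>B\<in>words dB {..<l}. \<Sum>I\<in>words dA {..<l}. \<Sum>J\<in>words dA {..<l}. ?F I J A B)"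
    by (simp only: sum_dg[OF dA, of "\<lambda>J. ?F _ J _ _"] sum_dg[OF dA, of "\<lambda>I. \<Sum>J\<in>words dA {..<l}. ?F I J _ _"]
       sum_dg[OF dB, of "\<lambda>B. \<Sum>I\<in>words dA {..<l}. \<Sum>J\<in>words dA {..<l}. ?F I J _ B"]
       sum_dg[OF dB, of "\<lambda>A. \<Sum>B\<in>words dB {..<l}. \<Sum>I\<in>words dA {..<l}. \<Sum>J\<in>words dA {..<l}. ?F I J A B"])
  also have "\<dots> = (\<Sum>(A,B,I,J)\<in>words dB {..<l} \<times> words dB {..<l} \<times> words dA {..<l} \<times> words dA {..<l}. ?F I J A B)"
    by (simp add: sum.cartesian_product)
  also have "\<dots> = (\<Sum>(I,J,A,B)\<in>words dA {..<l} \<times> words dA {..<l} \<times> words dB {..<l} \<times> words dB {..<l}. ?F I J A B)"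
    by (rule sum.reindex_bij_witness[where i="\<lambda>(I,J,A,B). (A,B,I,J)" and j="\<lambda>(A,B,I,J). (I,J,A,B)"]) auto
  also have "\<dots> = pairing dA dB {..<l} ?\<nu> P R"
    unfolding pairing_def by (simp add: sum.cartesian_product)
  finally show ?thesis by simp
qed

lemma chan_seq_carrier:
  assumes "X \<in> carrier_mat (dA ^ l) (dA ^ l)" "length ss = l"
  shows "chan_seq dA dB N ss X \<in> carrier_mat (dB ^ l) (dB ^ l)"
proof -
  note Nc = N_carrier[of ss]
  show ?thesis unfolding chan_seq_def using tensor_list_entry[OF Nc dA dB, of X] assms by simp
qed

text \<open>A jammer who applies the symmetrizing strategy to a uniformly drawn message makes two messages
  indistinguishable: the success probabilities satisfy \<open>2 K\<^sup>2 (1 - \<eta>) \<le> K\<^sup>2 + K\<close>.\<close>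

lemma symmetrizable_bound:
  assumes sym: "l_symmetrizable dA dB N l"
    and c: "acode dA dB {..<l} K 1 1 p r" and f: "\<And>s. 1 - \<eta> \<le> afid dA dB {..<l} (wstate dA N s) K 1 p r"
  shows "2 * (real K)\<^sup>2 * (1 - \<eta>) \<le> (real K)\<^sup>2 + real K"
proof -
  note cD = acodeD[OF c]
  let ?SS = "{ss :: 's list. length ss = l}"
  define X where "X = (\<lambda>u. Matrix.mat (dA ^ l) (dA ^ l) (\<lambda>(x,y). p u 0 0 (dg dA l x) (dg dA l y)))"
  have Xu: "X u = Matrix.mat (dA ^ l) (dA ^ l) (\<lambda>(x,y). p u 0 0 (dg dA l x) (dg dA l y))" for u
    unfolding X_def ..
  have Xc: "X u \<in> carrier_mat (dA ^ l) (dA ^ l)" for u unfolding X_def by simp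
  have gp: "gram (words dA {..<l}) (p u 0 0)" if "u < K" for u
    using gram_section1[OF cD(4)[OF that], of 0] by simp
  have gr: "gram (words dB {..<l}) (\<lambda>A B. r u A B 0 0)" if "u < K" for u
    using gram_section2[OF cD(6)[OF that], of 0] by simp
  have dens: "dens_op (dA ^ l) (X u)" if u: "u < K" for u
    unfolding dens_op_def
  proof (intro conjI Xc)
    have "gram {..<dA ^ l} (\<lambda>i j. X u $$ (i,j))"
      by (rule gram_cong[OF gram_vimage[OF gp[OF u], of _ "dg dA l"]]) (use dg_words[OF dA] in \<open>auto simp: X_def\<close>)
    then show "psd (X u)" by (rule gram_psd[OF _ Xc])
    have "mtrace (X u) = (\<Sum>x<dA ^ l. p u 0 0 (dg dA l x) (dg dA l x))" unfolding mtrace_def X_def by simp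
    also have "\<dots> = 1" unfolding sum_dg[OF dA, of "\<lambda>I. p u 0 0 I I"] using cD(5)[OF u, of 0 0] by simp
    finally show "mtrace (X u) = 1" .
  qed
  \<comment> \<open>Symmetrizability is applied to the finite set of encoded states. Messages with
    the same encoding share a jamming strategy, which is harmless because \<open>q\<close> is
    indexed by states.\<close>
  obtain q where q0: "\<And>u ss. u < K \<Longrightarrow> 0 \<le> q (X u) ss" and q1: "\<And>u. u < K \<Longrightarrow> (\<Sum>ss\<in>?SS. q (X u) ss) = 1"
    and qs: "\<And>u v. u < K \<Longrightarrow> v < K \<Longrightarrow>
      msum (dB ^ l) (\<lambda>ss. complex_of_real (q (X v) ss) \<cdot>\<^sub>m chan_seq dA dB N ss (X u)) ?SS
      = msum (dB ^ l) (\<lambda>ss. complex_of_real (q (X u) ss) \<cdot>\<^sub>m chan_seq dA dB N ss (X v)) ?SS"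
  proof -
    have "finite (X ` {..<K}) \<and> X ` {..<K} \<subseteq> {\<rho>. dens_op (dA ^ l) \<rho>}" using dens by auto
    from sym[unfolded l_symmetrizable_def, rule_format, OF this] obtain q where
      qa: "(\<forall>\<rho>\<in>X ` {..<K}. (\<forall>ss. 0 \<le> q \<rho> ss) \<and> (\<Sum>ss\<in>?SS. q \<rho> ss) = 1)"
      and qb: "\<forall>\<rho>\<in>X ` {..<K}. \<forall>\<sigma>\<in>X ` {..<K}.
              msum (dB ^ l) (\<lambda>ss. complex_of_real (q \<rho> ss) \<cdot>\<^sub>m chan_seq dA dB N ss \<sigma>) ?SS
            = msum (dB ^ l) (\<lambda>ss. complex_of_real (q \<sigma> ss) \<cdot>\<^sub>m chan_seq dA dB N ss \<rho>) ?SS" by blast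
    show ?thesis by (rule that[of q]) (use qa qb in blast)+
  qed
  define pr where "pr = (\<lambda>w ss u. pairing dA dB {..<l} (wstate dA N (\<lambda>t. ss ! t)) (p u 0 0) (\<lambda>A B. r w A B 0 0))"
  \<comment> \<open>\<open>e w v u\<close> is the probability of decoding \<open>w\<close> when
    \<open>u\<close> is sent while the jammer imitates \<open>v\<close>; by symmetrizability it is
    symmetric in \<open>u\<close> and \<open>v\<close>.\<close>
  define e where "e = (\<lambda>w v u. \<Sum>ss\<in>?SS. q (X v) ss * Re (pr w ss u))"
  have chk: "\<forall>t\<in>T. chk dA dB (wstate dA N s t)" for T s by (rule chk_wstate[OF dA dB N])
  have pr0: "0 \<le> Re (pr w ss u)" if "w < K" "u < K" for w ss u
    unfolding pr_def using pairing_nonneg[OF chk gp[OF that(2)] gr[OF that(1)]] by (simp add: less_eq_complex_def)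
  have e0: "0 \<le> e w v u" if "w < K" "v < K" "u < K" for w v u
    unfolding e_def using q0 pr0 that by (intro sum_nonneg mult_nonneg_nonneg) auto
  have esym: "e w v u = e w u v" if "u < K" "v < K" for w u v
  proof -
    have m: "(\<Sum>ss\<in>?SS. complex_of_real (q (X v) ss) * pr w ss u) = (\<Sum>a<dB ^ l. \<Sum>b<dB ^ l.
       msum (dB ^ l) (\<lambda>ss. complex_of_real (q (X v) ss) \<cdot>\<^sub>m chan_seq dA dB N ss (X u)) ?SS $$ (a,b) * r w (dg dB l a) (dg dB l b) 0 0)"
      (is "_ = ?R") for v u
    proof -
      have "(complex_of_real (q (X v) ss) \<cdot>\<^sub>m chan_seq dA dB N ss (X u)) $$ (a,b) = complex_of_real (q (X v) ss) * chan_seq dA dB N ss (X u) $$ (a,b)"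
        if "length ss = l" "a < dB ^ l" "b < dB ^ l" for ss a b
        using chan_seq_carrier[OF Xc that(1), of u] that by (subst index_smult_mat) auto
      then have "?R = (\<Sum>a<dB ^ l. \<Sum>b<dB ^ l. \<Sum>ss\<in>?SS. complex_of_real (q (X v) ss) * (chan_seq dA dB N ss (X u) $$ (a,b) * r w (dg dB l a) (dg dB l b) 0 0))"
        unfolding msum_def by (intro sum.cong[OF refl]) (simp add: sum_distrib_right mult.assoc)
      also have "\<dots> = (\<Sum>a<dB ^ l. \<Sum>ss\<in>?SS. \<Sum>b<dB ^ l. complex_of_real (q (X v) ss) * (chan_seq dA dB N ss (X u) $$ (a,b) * r w (dg dB l a) (dg dB l b) 0 0))"
        by (rule sum.cong[OF refl], rule sum.swap)
      also have "\<dots> = (\<Sum>ss\<in>?SS. \<Sum>a<dB ^ l. \<Sum>b<dB ^ l. complex_of_real (q (X v) ss) * (chan_seq dA dB N ss (X u) $$ (a,b) * r w (dg dB l a) (dg dB l b) 0 0))"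
        by (rule sum.swap)
      also have "\<dots> = (\<Sum>ss\<in>?SS. complex_of_real (q (X v) ss) * pr w ss u)"
        unfolding pr_def sum_distrib_left[symmetric]
        by (intro sum.cong refl) (simp add: pairing_chan_seq[OF Xu])
      finally show ?thesis by simp
    qed
    have "(\<Sum>ss\<in>?SS. complex_of_real (q (X v) ss) * pr w ss u) = (\<Sum>ss\<in>?SS. complex_of_real (q (X u) ss) * pr w ss v)"
      unfolding m qs[OF that] ..
    then have "Re (\<Sum>ss\<in>?SS. complex_of_real (q (X v) ss) * pr w ss u) = Re (\<Sum>ss\<in>?SS. complex_of_real (q (X u) ss) * pr w ss v)" by simp
    then show ?thesis unfolding e_def by simp
  qed
  have two: "e w v u + e w' v u \<le> 1" if "w < K" "w' < K" "w \<noteq> w'" "v < K" "u < K" for w w' v u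
  proof -
    have "Re (pr w ss u) + Re (pr w' ss u) \<le> 1" if "length ss = l" for ss
      using pairing_decode_le_1[OF chk _ c \<open>u < K\<close>, of 0 "{(w,0),(w',0)}"] \<open>w < K\<close> \<open>w' < K\<close> \<open>w \<noteq> w'\<close> unfolding pr_def by simp
    then have "(\<Sum>ss\<in>?SS. q (X v) ss * (Re (pr w ss u) + Re (pr w' ss u))) \<le> (\<Sum>ss\<in>?SS. q (X v) ss * 1)"
      using q0[OF \<open>v < K\<close>] by (intro sum_mono mult_left_mono) auto
    then show ?thesis unfolding e_def using q1[OF \<open>v < K\<close>] by (simp add: distrib_left sum.distrib)
  qed
  have one: "e w v u \<le> 1" if "w < K" "v < K" "u < K" for w v u
  proof -
    have "Re (pr w ss u) \<le> 1" if "length ss = l" for ss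
      using pairing_decode_le_1[OF chk _ c \<open>u < K\<close>, of 0 "{(w,0)}"] \<open>w < K\<close> unfolding pr_def by simp
    then have "(\<Sum>ss\<in>?SS. q (X v) ss * Re (pr w ss u)) \<le> (\<Sum>ss\<in>?SS. q (X v) ss * 1)"
      using q0[OF \<open>v < K\<close>] by (intro sum_mono mult_left_mono) auto
    then show ?thesis unfolding e_def using q1[OF \<open>v < K\<close>] by simp
  qed
  have K: "1 \<le> K" by (rule cD(1))
  have low: "real K * (1 - \<eta>) \<le> (\<Sum>u<K. e u v u)" if v: "v < K" for v
  proof -
    have "(\<Sum>ss\<in>?SS. q (X v) ss * (real K * (1 - \<eta>))) \<le> (\<Sum>ss\<in>?SS. q (X v) ss * (\<Sum>u<K. Re (pr u ss u)))"
    proof (intro sum_mono mult_left_mono)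
      fix ss assume "ss \<in> ?SS"
      have "afid dA dB {..<l} (wstate dA N (\<lambda>t. ss ! t)) K 1 p r = 1 / real K * (\<Sum>u<K. Re (pr u ss u))"
        unfolding afid_def cfid_def pr_def by simp
      then have "1 - \<eta> \<le> 1 / real K * (\<Sum>u<K. Re (pr u ss u))" using f[of "\<lambda>t. ss ! t"] by simp
      then show "real K * (1 - \<eta>) \<le> (\<Sum>u<K. Re (pr u ss u))" using K by (simp add: field_simps)
    qed (use q0[OF v] in auto)
    also have "(\<Sum>ss\<in>?SS. q (X v) ss * (\<Sum>u<K. Re (pr u ss u))) = (\<Sum>u<K. e u v u)"
      unfolding e_def by (subst sum.swap) (simp add: sum_distrib_left)
    finally show ?thesis using q1[OF v] by (simp add: sum_distrib_right[symmetric])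
  qed
  have "real K * (real K * (1 - \<eta>)) \<le> (\<Sum>v<K. \<Sum>u<K. e u v u)"
  proof -
    have "(\<Sum>v<K. real K * (1 - \<eta>)) \<le> (\<Sum>v<K. \<Sum>u<K. e u v u)" using low by (intro sum_mono) auto
    then show ?thesis by simp
  qed
  \<comment> \<open>Exchanging sender and jammer turns the success of the sent message into the
    decoding of the imitated one, so both events have the same total weight, although they exclude
    each other when the messages differ.\<close>
  moreover have "(\<Sum>v<K. \<Sum>u<K. e u v u) = (\<Sum>v<K. \<Sum>u<K. e v v u)"
  proof -
    have "(\<Sum>v<K. \<Sum>u<K. e u v u) = (\<Sum>u<K. \<Sum>v<K. e u v u)" by (rule sum.swap)
    also have "\<dots> = (\<Sum>u<K. \<Sum>v<K. e u u v)" by (intro sum.cong refl) (use esym in auto)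
    finally show ?thesis .
  qed
  ultimately have "2 * (real K * (real K * (1 - \<eta>))) \<le> (\<Sum>v<K. \<Sum>u<K. e u v u + e v v u)"
    by (simp add: sum.distrib)
  also have "\<dots> \<le> (\<Sum>v<K. \<Sum>u<K. 1 + (if u = v then 1 else 0))"
  proof (intro sum_mono)
    fix v u assume "v \<in> {..<K}" "u \<in> {..<K}"
    then show "e u v u + e v v u \<le> 1 + (if u = v then 1 else 0)"
      using two[of u v v u] one[of u v u] by (cases "u = v") auto
  qed
  also have "\<dots> = (real K)\<^sup>2 + real K" by (simp add: sum.distrib power2_eq_square algebra_simps)
  finally show ?thesis by (simp add: power2_eq_square mult.assoc)
qed

text \<open>A nonzero rate pair gives, after measuring in the code basis, a classical code with at
  least two messages and error at most 1/8, while \<open>symmetrizable_bound\<close> forces error at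
  least 1/4 for two or more messages.\<close>

lemma symmetrizable_imp_A_d_trivial:
  assumes sym: "symmetrizable dA dB N"
  shows "A_d dA dB N = {(0, 0)}"
proof -
  have "R = (0, 0)" if R0: "R \<in> A_d dA dB N" for R
  proof (rule ccontr)
    assume ne: "R \<noteq> (0, 0)"
    obtain R1 R2 where Re: "R = (R1, R2)" by (cases R)
    have R: "0 \<le> R1" "0 \<le> R2" and ev: "\<And>\<eta>. 0 < \<eta> \<Longrightarrow> eventually (\<lambda>l. detgood dA dB N l (R1 - \<eta>) (R2 - \<eta>) \<eta>) sequentially"
      using R0 A_d_iff[OF dA dB N, of R1 R2] unfolding Re by auto
    \<comment> \<open>The second bound keeps \<open>(R1 - \<eta>) + (R2 - \<eta>)\<close> positive,
      hence \<open>M1 * M2 > 1\<close>; the first one stays below the forced error 1/4.\<close>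
    define \<eta> where "\<eta> = min (1/8) ((R1 + R2) / 4)"
    have pos: "0 < R1 + R2" using R ne unfolding Re by (auto simp: less_le add_nonneg_eq_0_iff)
    have h: "0 < \<eta>" "\<eta> \<le> 1/8" "\<eta> \<le> (R1 + R2) / 4"
      unfolding \<eta>_def using pos min.cobounded2[of "1/8" "(R1 + R2) / 4"] by simp_all
    have "eventually (\<lambda>l. detgood dA dB N l (R1 - \<eta>) (R2 - \<eta>) \<eta> \<and> 1 \<le> l) sequentially"
      using ev[OF h(1)] eventually_ge_at_top[of 1] by eventually_elim auto
    then obtain l where l: "1 \<le> l" and dg: "detgood dA dB N l (R1 - \<eta>) (R2 - \<eta>) \<eta>"
      using eventually_happens'[OF sequentially_bot] by blast
    obtain M1 M2 D p r where a: "acode dA dB {..<l} M1 M2 D p r"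
      and b: "R1 - \<eta> \<le> log 2 (real M1) / real l" "R2 - \<eta> \<le> log 2 (real M2) / real l"
      and f: "\<And>s. 1 - \<eta> \<le> afid dA dB {..<l} (wstate dA N s) M1 M2 p r" using dg unfolding detgood_def by blast
    have M: "0 < real M1" "0 < real M2" using acodeD(1,2)[OF a] by auto
    have "0 < (R1 - \<eta>) + (R2 - \<eta>)" using h(3) pos by (simp add: field_simps)
    also have "\<dots> \<le> log 2 (real M1) / real l + log 2 (real M2) / real l" using b by linarith
    also have "\<dots> = log 2 (real (M1 * M2)) / real l" using M by (simp add: log_mult add_divide_distrib)
    finally have "0 < log 2 (real (M1 * M2))" using l by (simp add: zero_less_divide_iff)
    then have "1 < real (M1 * M2)" using M by (subst (asm) zero_less_log_cancel_iff) auto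
    then have K: "2 \<le> real (M1 * M2)" by (metis Suc_1 Suc_leI of_nat_1 of_nat_less_iff of_nat_le_iff of_nat_numeral)
    obtain p' r' where c: "acode dA dB {..<l} (M1 * M2) 1 1 p' r'"
      and cf: "\<And>\<nu>. \<forall>t\<in>{..<l}. chk dA dB (\<nu> t) \<Longrightarrow> afid dA dB {..<l} \<nu> M1 M2 p r \<le> afid dA dB {..<l} \<nu> (M1 * M2) 1 p' r'"
      using acode_classical[OF a] by blast
    have "1 - \<eta> \<le> afid dA dB {..<l} (wstate dA N s) (M1 * M2) 1 p' r'" for s
      using f[of s] cf[OF chk_wstate[OF dA dB N, of "{..<l}" s]] by linarith
    from symmetrizable_bound[OF _ c this] have "2 * (real (M1 * M2))\<^sup>2 * (1 - \<eta>) \<le> (real (M1 * M2))\<^sup>2 + real (M1 * M2)"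
      using sym l unfolding symmetrizable_def by blast
    moreover have "2 * (real (M1 * M2))\<^sup>2 * (7/8) \<le> 2 * (real (M1 * M2))\<^sup>2 * (1 - \<eta>)"
      using h by (intro mult_left_mono) auto
    moreover have "2 * real (M1 * M2) \<le> (real (M1 * M2))\<^sup>2"
      using K mult_right_mono[of 2 "real (M1 * M2)" "real (M1 * M2)"] by (simp add: power2_eq_square)
    moreover have "0 < (real (M1 * M2))\<^sup>2" using M by simp
    ultimately show False by linarith
  qed
  then show ?thesis using zero_in_A_d[OF dA dB N] by blast
qed

end

section \<open>Classical codes from an antisymmetric score\<close>

lemma exp_minus_le: "\<bar>u\<bar> \<le> 1 \<Longrightarrow> exp (- u) \<le> 1 - u + (u::real)\<^sup>2"
proof -
  assume u: "\<bar>u\<bar> \<le> 1"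
  show ?thesis
  proof (cases "0 \<le> u")
    case True
    have "1 \<le> (1 - u + u\<^sup>2) * (1 + u + u\<^sup>2 / 2)"
    proof -
      have "(1 - u + u\<^sup>2) * (1 + u + u\<^sup>2 / 2) = 1 + (u\<^sup>2 + u^3 + u^4) / 2"
        by (simp add: field_simps power2_eq_square power3_eq_cube power4_eq_xxxx)
      also have "\<dots> \<ge> 1" using True by simp
      finally show ?thesis .
    qed
    also have "\<dots> \<le> (1 - u + u\<^sup>2) * exp u"
      using exp_lower_Taylor_quadratic[OF True] u True by (intro mult_left_mono) auto
    finally show ?thesis by (simp add: exp_minus pos_divide_le_eq[symmetric] inverse_eq_divide)
  next
    case False
    then show ?thesis using exp_bound[of "- u"] u by simp
  qed
qed

text \<open>The tilted pair error exponent: averaged over a uniform true input, it is below \<open>1\<close> whatever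
  the competing input and the state.\<close>

lemma tilted_average:
  fixes W :: "nat \<Rightarrow> 't \<Rightarrow> 'y \<Rightarrow> real" and G :: "nat \<Rightarrow> nat \<Rightarrow> 'y \<Rightarrow> real"
  assumes Y: "finite Y" and K: "1 \<le> K"
    and W0: "\<And>a s y. a < K \<Longrightarrow> s \<in> S \<Longrightarrow> y \<in> Y \<Longrightarrow> 0 \<le> W a s y"
    and W1: "\<And>a s. a < K \<Longrightarrow> s \<in> S \<Longrightarrow> (\<Sum>y\<in>Y. W a s y) = 1"
    and c: "0 < c" and avg: "\<And>a' s. a' < K \<Longrightarrow> s \<in> S \<Longrightarrow> c \<le> (\<Sum>a<K. \<Sum>y\<in>Y. W a s y * G a' a y)"
  shows "\<exists>l>0. \<exists>\<theta>. 0 < \<theta> \<and> \<theta> < 1 \<and>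
    (\<forall>a'<K. \<forall>s\<in>S. (\<Sum>a<K. \<Sum>y\<in>Y. W a s y * exp (- (l * G a' a y))) \<le> real K * \<theta>)"
proof -
  define g where "g = 1 + (\<Sum>a'<K. \<Sum>a<K. \<Sum>y\<in>Y. \<bar>G a' a y\<bar>)"
  have g1: "1 \<le> g" unfolding g_def by (simp add: sum_nonneg)
  have gb: "\<bar>G a' a y\<bar> \<le> g" if "a' < K" "a < K" "y \<in> Y" for a' a y
  proof -
    have "\<bar>G a' a y\<bar> \<le> (\<Sum>y\<in>Y. \<bar>G a' a y\<bar>)" using that Y by (intro member_le_sum) auto
    also have "\<dots> \<le> (\<Sum>a<K. \<Sum>y\<in>Y. \<bar>G a' a y\<bar>)"
      using that by (intro member_le_sum[of a "{..<K}" "\<lambda>a. \<Sum>y\<in>Y. \<bar>G a' a y\<bar>"]) (auto intro: sum_nonneg)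
    also have "\<dots> \<le> (\<Sum>a'<K. \<Sum>a<K. \<Sum>y\<in>Y. \<bar>G a' a y\<bar>)"
      using that by (intro member_le_sum[of a' "{..<K}" "\<lambda>a'. \<Sum>a<K. \<Sum>y\<in>Y. \<bar>G a' a y\<bar>"]) (auto intro!: sum_nonneg)
    finally show ?thesis unfolding g_def by simp
  qed
  have K0: "0 < real K" using K by simp
  \<comment> \<open>The bound \<open>l * g \<le> 1\<close> admits the quadratic estimate of the
    exponential, and the other bound makes its quadratic term at most half of the linear gain
    \<open>l * c\<close>.\<close>
  define l where "l = min (1 / g) (c / (2 * real K * g\<^sup>2))"
  have l0: "0 < l" unfolding l_def using g1 c K0 by simp
  have "l \<le> 1 / g" unfolding l_def by (rule min.cobounded1)
  then have lg: "l * g \<le> 1" using g1 by (simp add: pos_le_divide_eq)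
  have "l \<le> c / (2 * real K * g\<^sup>2)" unfolding l_def by (rule min.cobounded2)
  then have lc: "l * (real K * g\<^sup>2) \<le> c / 2" using g1 K0 by (simp add: pos_le_divide_eq mult_ac)
  define \<theta> where "\<theta> = max (1/2) (1 - l * c / (2 * real K))"
  have \<theta>: "0 < \<theta>" "\<theta> < 1" "1 - l * c / (2 * real K) \<le> \<theta>" unfolding \<theta>_def using l0 c K0 by auto
  have "(\<Sum>a<K. \<Sum>y\<in>Y. W a s y * exp (- (l * G a' a y))) \<le> real K * \<theta>" if a': "a' < K" and s: "s \<in> S" for a' s
  proof -
    have "(\<Sum>a<K. \<Sum>y\<in>Y. W a s y * exp (- (l * G a' a y))) \<le> (\<Sum>a<K. \<Sum>y\<in>Y. W a s y * (1 + (l * g)\<^sup>2) - l * (W a s y * G a' a y))"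
    proof (intro sum_mono)
      fix a y assume a: "a \<in> {..<K}" and y: "y \<in> Y"
      have b: "\<bar>l * G a' a y\<bar> \<le> l * g" using gb[OF a' _ y, of a] a l0 by (simp add: abs_mult)
      have "exp (- (l * G a' a y)) \<le> 1 - l * G a' a y + (l * G a' a y)\<^sup>2"
        using b lg by (intro exp_minus_le) linarith
      also have "(l * G a' a y)\<^sup>2 \<le> (l * g)\<^sup>2" using b by (rule power2_le_iff_abs_le[THEN iffD2, rotated]) (use l0 g1 in auto)
      finally have "exp (- (l * G a' a y)) \<le> 1 - l * G a' a y + (l * g)\<^sup>2" by simp
      from mult_left_mono[OF this W0[OF _ s y, of a]] a
      show "W a s y * exp (- (l * G a' a y)) \<le> W a s y * (1 + (l * g)\<^sup>2) - l * (W a s y * G a' a y)"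
        by (simp add: algebra_simps)
    qed
    also have "\<dots> = (\<Sum>a<K. \<Sum>y\<in>Y. W a s y) * (1 + (l * g)\<^sup>2) - l * (\<Sum>a<K. \<Sum>y\<in>Y. W a s y * G a' a y)"
      by (simp add: sum_subtractf sum_distrib_left sum_distrib_right)
    also have "(\<Sum>a<K. \<Sum>y\<in>Y. W a s y) = real K" using W1[OF _ s] by simp
    also have "real K * (1 + (l * g)\<^sup>2) - l * (\<Sum>a<K. \<Sum>y\<in>Y. W a s y * G a' a y) \<le> real K * (1 + (l * g)\<^sup>2) - l * c"
      using avg[OF a' s] l0 by (intro diff_left_mono mult_left_mono) auto
    also have "\<dots> = real K + l * (l * (real K * g\<^sup>2)) - l * c" by (simp add: power2_eq_square algebra_simps)
    also have "\<dots> \<le> real K + l * (c / 2) - l * c" using mult_left_mono[OF lc less_imp_le[OF l0]] by linarith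
    also have "\<dots> = real K * (1 - l * c / (2 * real K))" using K0 by (simp add: field_simps)
    also have "\<dots> \<le> real K * \<theta>" using \<theta>(3) by (intro mult_left_mono) auto
    finally show ?thesis .
  qed
  then show ?thesis using l0 \<theta>(1,2) by blast
qed

text \<open>Edges \<open>(m, f)\<close> of a conflict graph, ordered such that each codeword \<open>m\<close> is drawn after all
  codewords occurring later in the list; the bad events then are conditionally independent.\<close>

fun fresh_edges :: "nat \<Rightarrow> (nat \<times> nat) list \<Rightarrow> bool" where
  "fresh_edges M [] = True"
| "fresh_edges M ((m, f) # es) \<longleftrightarrow> m < M \<and> f < M \<and> m \<noteq> f \<and> m \<notin> fst ` set es \<and> m \<notin> snd ` set es \<and> fresh_edges M es"

lemma fresh_edges_up:
  "sorted_wrt (>) ms \<Longrightarrow> (\<And>m. m \<in> set ms \<Longrightarrow> m < M \<and> f m < m) \<Longrightarrow> fresh_edges M (map (\<lambda>m. (m, f m)) ms)"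
proof (induction ms)
  case (Cons m ms)
  have "m' < m \<and> f m' < m" if "m' \<in> set ms" for m'
    using Cons.prems that by (auto intro: less_trans)
  then have "m \<notin> set ms" "m \<notin> f ` set ms" by auto
  moreover have "m < M" "f m < M" "m \<noteq> f m" using Cons.prems(2)[of m] by auto
  ultimately show ?case using Cons by (auto simp: image_image)
qed simp

lemma fresh_edges_down:
  "sorted_wrt (<) ms \<Longrightarrow> (\<And>m. m \<in> set ms \<Longrightarrow> f m < M \<and> m < f m) \<Longrightarrow> fresh_edges M (map (\<lambda>m. (m, f m)) ms)"
proof (induction ms)
  case (Cons m ms)
  have "m < m' \<and> m < f m'" if "m' \<in> set ms" for m'
    using Cons.prems that by (auto intro: less_trans)
  then have "m \<notin> set ms" "m \<notin> f ` set ms" by auto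
  moreover have "m < M" "f m < M" "m \<noteq> f m" using Cons.prems(2)[of m] by auto
  ultimately show ?case using Cons by (auto simp: image_image)
qed simp

text \<open>Bad messages are split by whether their competitor has the smaller or the larger index;
  one class has at least \<open>k\<close> members. Listed in decreasing order in the first case, in
  increasing order in the second, no message recurs in a later edge.\<close>

lemma fresh_edges_exist:
  assumes B: "B \<subseteq> {..<M}" "2 * k \<le> card B" and f: "\<And>m. m \<in> B \<Longrightarrow> f m < M \<and> f m \<noteq> m"
  shows "\<exists>es. length es = k \<and> fresh_edges M es \<and> (\<forall>e\<in>set es. fst e \<in> B \<and> snd e = f (fst e))"
proof -
  let ?U = "{m \<in> B. f m < m}" and ?D = "{m \<in> B. m < f m}"
  have fin: "finite B" using B(1) finite_subset by blast
  have "B = ?U \<union> ?D" using f by force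
  then have "card B \<le> card ?U + card ?D" by (metis card_Un_le)
  then consider "k \<le> card ?U" | "k \<le> card ?D" using B(2) by linarith
  then show ?thesis
  proof cases
    case 1
    then obtain X where X: "X \<subseteq> ?U" "card X = k" "finite X" by (meson obtain_subset_with_card_n)
    let ?ms = "rev (sorted_list_of_set X)"
    have "sorted_wrt (>) ?ms" using X(3) by (simp add: sorted_wrt_rev strict_sorted_iff[symmetric])
    then have "fresh_edges M (map (\<lambda>m. (m, f m)) ?ms)"
      by (rule fresh_edges_up) (use X B(1) in auto)
    then show ?thesis using X by (intro exI[of _ "map (\<lambda>m. (m, f m)) ?ms"]) auto
  next
    case 2
    then obtain X where X: "X \<subseteq> ?D" "card X = k" "finite X" by (meson obtain_subset_with_card_n)
    let ?ms = "sorted_list_of_set X"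
    have "sorted_wrt (<) ?ms" using X(3) by (simp add: strict_sorted_iff[symmetric])
    then have "fresh_edges M (map (\<lambda>m. (m, f m)) ?ms)"
      by (rule fresh_edges_down) (use X f in auto)
    then show ?thesis using X by (intro exI[of _ "map (\<lambda>m. (m, f m)) ?ms"]) auto
  qed
qed

text \<open>The codeword \<open>m\<close> of the first edge occurs in no other edge. Summing over it
  first, with all others fixed, yields one factor \<open>\<beta>\<close>, because the bound on bad
  inputs is uniform in the competing word.\<close>

lemma fresh_edges_count:
  assumes XX: "finite XX" and b: "0 \<le> \<beta>"
    and B: "\<And>x'. x' \<in> XX \<Longrightarrow> real (card {x \<in> XX. bad x' x}) \<le> \<beta> * real (card XX)"
    and es: "fresh_edges M es"
  shows "real (card {C \<in> PiE {..<M} (\<lambda>_. XX). \<forall>(m, f)\<in>set es. bad (C f) (C m)}) \<le> \<beta> ^ length es * real (card XX) ^ M"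
  using es
proof (induction es)
  case Nil
  show ?case by (simp add: card_PiE)
next
  case (Cons e es)
  obtain m f where e: "e = (m, f)" by (cases e)
  have mf: "m < M" "f < M" "m \<noteq> f" "m \<notin> fst ` set es" "m \<notin> snd ` set es" "fresh_edges M es" using Cons.prems unfolding e by auto
  let ?T1 = "{m}" and ?T2 = "{..<M} - {m}"
  have un: "{..<M} = ?T1 \<union> ?T2" using mf(1) by auto
  have dis: "?T1 \<inter> ?T2 = {}" by auto
  let ?P = "\<lambda>C. \<forall>(m, f)\<in>set es. bad (C f) (C m)"
  let ?PX = "PiE {..<M} (\<lambda>_. XX)"
  have fin: "finite ?PX" using XX by (intro finite_PiE) auto
  have card_ind: "real (card {C \<in> ?PX. Q C}) = (\<Sum>C\<in>?PX. if Q C then 1 else 0)" for Q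
    using fin by (simp add: sum.If_cases Int_def)
  have ed: "fst e' < M \<and> snd e' < M" if "e' \<in> set es" for e' using mf(6) that
    by (induction es rule: fresh_edges.induct) auto
  have rP: "?P C \<longleftrightarrow> ?P (restrict C ?T2)" for C
  proof -
    have "restrict C ?T2 (fst e') = C (fst e') \<and> restrict C ?T2 (snd e') = C (snd e')" if "e' \<in> set es" for e'
      using ed[OF that] mf(4,5) that by force
    then show ?thesis by (auto simp: split_beta)
  qed
  have "real (card {C \<in> ?PX. \<forall>(m, f)\<in>set (e # es). bad (C f) (C m)})
    = (\<Sum>C\<in>PiE (?T1 \<union> ?T2) (\<lambda>_. XX). if bad (restrict C ?T2 f) (restrict C ?T1 m) \<and> ?P (restrict C ?T2) then 1 else 0)"
    unfolding card_ind using mf rP by (subst un) (auto simp: e intro!: sum.cong)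
  also have "\<dots> = (\<Sum>C1\<in>PiE ?T1 (\<lambda>_. XX). \<Sum>C2\<in>PiE ?T2 (\<lambda>_. XX). if bad (C2 f) (C1 m) \<and> ?P C2 then 1 else 0)"
    by (rule sum_PiE_Un[OF dis])
  also have "\<dots> = (\<Sum>C2\<in>PiE ?T2 (\<lambda>_. XX). \<Sum>C1\<in>PiE ?T1 (\<lambda>_. XX). if bad (C2 f) (C1 m) \<and> ?P C2 then 1 else 0)"
    by (rule sum.swap)
  also have "\<dots> \<le> (\<Sum>C2\<in>PiE ?T2 (\<lambda>_. XX). \<beta> * (\<Sum>C1\<in>PiE ?T1 (\<lambda>_. XX). if ?P C2 then 1 else 0))"
  proof (rule sum_mono)
    fix C2 assume C2: "C2 \<in> PiE ?T2 (\<lambda>_. XX)"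
    have s1: "(\<Sum>C1\<in>PiE ?T1 (\<lambda>_. XX). h (C1 m)) = (\<Sum>x\<in>XX. h x)" for h :: "_ \<Rightarrow> real"
      by (rule sum.reindex_bij_witness[where i="\<lambda>x. \<lambda>t\<in>{m}. x" and j="\<lambda>C. C m"]) (auto simp: PiE_iff extensional_def fun_eq_iff)
    have "C2 f \<in> XX" using C2 mf by auto
    from B[OF this] have "(\<Sum>x\<in>XX. if bad (C2 f) x then 1 else 0) \<le> \<beta> * (\<Sum>x\<in>XX. 1)"
      using XX by (simp add: sum.If_cases Int_def)
    moreover define Q where "Q \<longleftrightarrow> ?P C2"
    ultimately show "(\<Sum>C1\<in>PiE ?T1 (\<lambda>_. XX). if bad (C2 f) (C1 m) \<and> ?P C2 then 1 else 0) \<le> \<beta> * (\<Sum>C1\<in>PiE ?T1 (\<lambda>_. XX). if ?P C2 then 1 else 0)"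
      unfolding Q_def[symmetric] s1[of "\<lambda>x. if bad (C2 f) x \<and> Q then 1 else 0"] s1[of "\<lambda>x. if Q then 1 else 0"]
      by (cases Q) simp_all
  qed
  also have "\<dots> = \<beta> * (\<Sum>C1\<in>PiE ?T1 (\<lambda>_. XX). \<Sum>C2\<in>PiE ?T2 (\<lambda>_. XX). if ?P C2 then 1 else 0)"
    unfolding sum_distrib_left[symmetric] by (subst sum.swap) (rule refl)
  also have "(\<Sum>C1\<in>PiE ?T1 (\<lambda>_. XX). \<Sum>C2\<in>PiE ?T2 (\<lambda>_. XX). if ?P C2 then 1 else 0)
     = (\<Sum>C\<in>PiE (?T1 \<union> ?T2) (\<lambda>_. XX). if ?P (restrict C ?T2) then 1 else (0::real))"
    by (rule sum_PiE_Un[OF dis, symmetric])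
  also have "\<dots> = real (card {C \<in> ?PX. ?P C})"
    unfolding card_ind un[symmetric] rP[symmetric] ..
  also have "\<beta> * \<dots> \<le> \<beta> * (\<beta> ^ length es * real (card XX) ^ M)"
    using Cons.IH[OF mf(6)] b by (rule mult_left_mono)
  finally show ?case by (simp add: mult.assoc)
qed

text \<open>A codebook with too many bad messages for some state contains a fresh list of
  \<open>k\<close> bad edges. The union bound over the states and the at most
  \<open>M ^ (2 * k)\<close> lists leaves room for a codebook without such a list.\<close>

lemma good_codebook:
  fixes bad :: "'s \<Rightarrow> 'x \<Rightarrow> 'x \<Rightarrow> bool"
  assumes XX: "finite XX" "XX \<noteq> {}" and S: "finite S" and b: "0 \<le> \<beta>"
    and B: "\<And>s x'. s \<in> S \<Longrightarrow> x' \<in> XX \<Longrightarrow> real (card {x \<in> XX. bad s x' x}) \<le> \<beta> * real (card XX)"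
    and small: "real (card S) * real M ^ (2 * k) * \<beta> ^ k < 1"
  shows "\<exists>C\<in>PiE {..<M} (\<lambda>_. XX). \<forall>s\<in>S. card {m. m < M \<and> (\<exists>m'<M. m' \<noteq> m \<and> bad s (C m') (C m))} < 2 * k"
proof (rule ccontr)
  let ?PX = "PiE {..<M} (\<lambda>_. XX)"
  let ?Bad = "\<lambda>C s. {m. m < M \<and> (\<exists>m'<M. m' \<noteq> m \<and> bad s (C m') (C m))}"
  let ?E = "{es. set es \<subseteq> {..<M} \<times> {..<M} \<and> length es = k}"
  let ?F = "{es \<in> ?E. fresh_edges M es}"
  let ?A = "\<lambda>s es. {C \<in> ?PX. \<forall>(m, f)\<in>set es. bad s (C f) (C m)}"
  assume "\<not> ?thesis"
  then have neg: "\<exists>s\<in>S. 2 * k \<le> card (?Bad C s)" if "C \<in> ?PX" for C using that by (auto simp: not_less)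
  have finE: "finite ?E" by (rule finite_lists_length_eq) simp
  have finF: "finite ?F" by (rule finite_subset[OF _ finE]) auto
  have finP: "finite ?PX" using XX by (intro finite_PiE) auto
  have "?PX \<subseteq> (\<Union>p\<in>S \<times> ?F. ?A (fst p) (snd p))"
  proof
    fix C assume C: "C \<in> ?PX"
    from neg[OF C] obtain s where s: "s \<in> S" "2 * k \<le> card (?Bad C s)" by blast
    have "\<forall>m\<in>?Bad C s. \<exists>m'<M. m' \<noteq> m \<and> bad s (C m') (C m)" by blast
    from bchoice[OF this] obtain f where f: "\<forall>m\<in>?Bad C s. f m < M \<and> f m \<noteq> m \<and> bad s (C (f m)) (C m)" by blast
    have "\<exists>es. length es = k \<and> fresh_edges M es \<and> (\<forall>e\<in>set es. fst e \<in> ?Bad C s \<and> snd e = f (fst e))"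
      by (rule fresh_edges_exist[OF _ s(2)]) (use f in auto)
    then obtain es where es: "length es = k" "fresh_edges M es" "\<forall>e\<in>set es. fst e \<in> ?Bad C s \<and> snd e = f (fst e)"
      by blast
    have e1: "es \<in> ?F" using es f by fastforce
    have e2: "C \<in> ?A s es" using C es(3) f by (auto simp: split_beta)
    show "C \<in> (\<Union>p\<in>S \<times> ?F. ?A (fst p) (snd p))"
      by (rule UN_I[of "(s, es)"]) (simp_all only: fst_conv snd_conv mem_Sigma_iff s(1) e1 e2 simp_thms)
  qed
  moreover have "finite (\<Union>p\<in>S \<times> ?F. ?A (fst p) (snd p))" by (rule finite_subset[OF _ finP]) auto
  ultimately have "card ?PX \<le> card (\<Union>p\<in>S \<times> ?F. ?A (fst p) (snd p))"
    by (intro card_mono)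
  also have "\<dots> \<le> (\<Sum>p\<in>S \<times> ?F. card (?A (fst p) (snd p)))"
    using S finF by (intro card_UN_le finite_cartesian_product)
  finally have "real (card ?PX) \<le> (\<Sum>p\<in>S \<times> ?F. real (card (?A (fst p) (snd p))))"
    unfolding of_nat_sum[symmetric] of_nat_le_iff .
  also have "\<dots> \<le> (\<Sum>p\<in>S \<times> ?F. \<beta> ^ k * real (card XX) ^ M)"
  proof (rule sum_mono)
    fix p assume p: "p \<in> S \<times> ?F"
    have "real (card (?A (fst p) (snd p))) \<le> \<beta> ^ length (snd p) * real (card XX) ^ M"
      by (rule fresh_edges_count[OF XX(1) b]) (use B p in auto)
    then show "real (card (?A (fst p) (snd p))) \<le> \<beta> ^ k * real (card XX) ^ M" using p by auto
  qed
  also have "\<dots> = real (card S) * real (card ?F) * (\<beta> ^ k * real (card XX) ^ M)"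
    by (simp add: card_cartesian_product)
  also have "\<dots> \<le> real (card S) * real M ^ (2 * k) * (\<beta> ^ k * real (card XX) ^ M)"
  proof (intro mult_right_mono mult_left_mono)
    have "card ?F \<le> card ?E" by (rule card_mono[OF finE]) auto
    also have "card ?E = (M * M) ^ k" using card_lists_length_eq[of "{..<M} \<times> {..<M}" k] by (simp add: card_cartesian_product)
    also have "(M * M) ^ k = M ^ (2 * k)" by (simp add: power_mult power2_eq_square)
    finally have "real (card ?F) \<le> real (M ^ (2 * k))" by (simp only: of_nat_le_iff)
    then show "real (card ?F) \<le> real M ^ (2 * k)" by (simp only: of_nat_power)
  qed (use b in auto)
  also have "\<dots> = (real (card S) * real M ^ (2 * k) * \<beta> ^ k) * real (card XX) ^ M" by (simp only: mult.assoc)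
  also have "\<dots> < 1 * real (card XX) ^ M"
    using small XX by (intro mult_strict_right_mono) (auto simp: card_gt_0_iff)
  finally show False using XX by (simp add: card_PiE)
qed

text \<open>The tournament decoder: \<open>m\<close> is decoded if its score beats all competitors. As \<open>G\<close> is antisymmetric
  in the two inputs, at most one message can win.\<close>

lemma tournament_error:
  fixes W :: "nat \<Rightarrow> 't \<Rightarrow> 'y \<Rightarrow> real" and G :: "nat \<Rightarrow> nat \<Rightarrow> 'y \<Rightarrow> real"
    and C :: "nat \<Rightarrow> nat \<Rightarrow> nat" and M n :: nat
  assumes Y: "finite Y" and W0: "\<And>a s y. a < K \<Longrightarrow> s \<in> S \<Longrightarrow> y \<in> Y \<Longrightarrow> 0 \<le> W a s y"
    and W1: "\<And>a s. a < K \<Longrightarrow> s \<in> S \<Longrightarrow> (\<Sum>y\<in>Y. W a s y) = 1"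
    and anti: "\<And>a' a y. G a' a y = - G a a' y" and l: "0 < l"
    and C: "\<And>m. m < M \<Longrightarrow> C m \<in> PiE {..<n} (\<lambda>_. {..<K})" and M: "1 \<le> M"
  shows "\<exists>dec. (\<forall>y. dec y < M) \<and> (\<forall>s\<in>PiE {..<n} (\<lambda>_. S). \<forall>m<M.
    1 - (\<Sum>m'\<in>{..<M} - {m}. \<Prod>t<n. \<Sum>y\<in>Y. W (C m t) (s t) y * exp (- (l * G (C m' t) (C m t) y)))
    \<le> (\<Sum>y\<in>PiE {..<n} (\<lambda>_. Y). if dec y = m then \<Prod>t<n. W (C m t) (s t) (y t) else 0))"
proof -
  define T where "T = (\<lambda>m' m y. \<Sum>t<n. G (C m' t) (C m t) (y t))"
  define win where "win = (\<lambda>m y. m < M \<and> (\<forall>m'<M. m' \<noteq> m \<longrightarrow> 0 < T m' m y))"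
  \<comment> \<open>Without a winner the output defaults to the legitimate message 0, which can only
    add to the success weight.\<close>
  define dec where "dec = (\<lambda>y. if \<exists>m. win m y then SOME m. win m y else 0)"
  have Tanti: "T m' m y = - T m m' y" for m m' y 
    unfolding T_def sum_negf[symmetric] by (rule sum.cong[OF refl]) (rule anti)
  have uniq: "m = m'" if "win m y" "win m' y" for m m' y
  proof (rule ccontr)
    assume "m \<noteq> m'"
    then have "0 < T m' m y" "0 < T m m' y" using that unfolding win_def by auto
    then show False using Tanti[of m m' y] by linarith
  qed
  have decwin: "dec y = m" if "win m y" for m y
  proof -
    have ex: "\<exists>m. win m y" using that by blast
    have "win (SOME m. win m y) y" by (rule someI_ex[OF ex])
    then have "win (dec y) y" unfolding dec_def using ex by simp
    then show ?thesis using uniq that by blast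
  qed
  have decM: "dec y < M" for y
  proof (cases "\<exists>m. win m y")
    case True
    then obtain m where "win m y" by blast
    then show ?thesis using decwin unfolding win_def by blast
  qed (use M in \<open>simp add: dec_def\<close>)
  have "1 - (\<Sum>m'\<in>{..<M} - {m}. \<Prod>t<n. \<Sum>y\<in>Y. W (C m t) (s t) y * exp (- (l * G (C m' t) (C m t) y)))
    \<le> (\<Sum>y\<in>PiE {..<n} (\<lambda>_. Y). if dec y = m then \<Prod>t<n. W (C m t) (s t) (y t) else 0)"
    if s: "s \<in> PiE {..<n} (\<lambda>_. S)" and m: "m < M" for s m
  proof -
    let ?YY = "PiE {..<n} (\<lambda>_. Y)"
    let ?P = "\<lambda>y. \<Prod>t<n. W (C m t) (s t) (y t)"
    have Cs: "C m t < K" "s t \<in> S" if "t < n" for t using C[OF m] s that by (auto simp: PiE_iff)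
    have P0: "0 \<le> ?P y" if "y \<in> ?YY" for y
      using that Cs W0 by (intro prod_nonneg) (auto simp: PiE_iff)
    have P1: "(\<Sum>y\<in>?YY. ?P y) = 1"
      using prod_sum_PiE[of "{..<n}" "\<lambda>_. Y" "\<lambda>t y. W (C m t) (s t) y"] Y W1 Cs by simp
    have e: "(\<Sum>y\<in>?YY. ?P y * exp (- (l * T m' m y))) = (\<Prod>t<n. \<Sum>y\<in>Y. W (C m t) (s t) y * exp (- (l * G (C m' t) (C m t) y)))" for m'
    proof -
      have "?P y * exp (- (l * T m' m y)) = (\<Prod>t<n. W (C m t) (s t) (y t) * exp (- (l * G (C m' t) (C m t) (y t))))" for y
        unfolding prod.distrib T_def sum_distrib_left sum_negf[symmetric] by (subst exp_sum) auto
      then show ?thesis using prod_sum_PiE[of "{..<n}" "\<lambda>_. Y" "\<lambda>t y. W (C m t) (s t) y * exp (- (l * G (C m' t) (C m t) y))"] Y by simp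
    qed
    have pt: "?P y - (\<Sum>m'\<in>{..<M} - {m}. ?P y * exp (- (l * T m' m y))) \<le> (if dec y = m then ?P y else 0)" if y: "y \<in> ?YY" for y
    proof (cases "dec y = m")
      case True
      have "0 \<le> (\<Sum>m'\<in>{..<M} - {m}. ?P y * exp (- (l * T m' m y)))" using P0[OF y] by (intro sum_nonneg) auto
      then show ?thesis using True by simp
    next
      case False
      then have "\<not> win m y" using decwin by blast
      then obtain m' where m': "m' < M" "m' \<noteq> m" "T m' m y \<le> 0" unfolding win_def using m by (auto simp: not_less)
      \<comment> \<open>The Chernoff step: a competitor that is not beaten has a tilted weight of at
        least 1, so the sum over all competitors covers the event that \<open>m\<close> does not
        win.\<close>
      have "l * T m' m y \<le> 0" using m'(3) l by (simp add: mult_nonneg_nonpos)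
      then have "?P y * 1 \<le> ?P y * exp (- (l * T m' m y))" using P0[OF y] by (intro mult_left_mono) auto
      also have "\<dots> \<le> (\<Sum>m'\<in>{..<M} - {m}. ?P y * exp (- (l * T m' m y)))"
        by (rule member_le_sum[of m' "{..<M} - {m}" "\<lambda>m'. ?P y * exp (- (l * T m' m y))"]) (use m' P0[OF y] in auto)
      finally show ?thesis using False by simp
    qed
    have "1 - (\<Sum>m'\<in>{..<M} - {m}. \<Sum>y\<in>?YY. ?P y * exp (- (l * T m' m y)))
       = (\<Sum>y\<in>?YY. ?P y - (\<Sum>m'\<in>{..<M} - {m}. ?P y * exp (- (l * T m' m y))))"
      unfolding sum_subtractf P1 by (subst sum.swap) (rule refl)
    also have "\<dots> \<le> (\<Sum>y\<in>?YY. if dec y = m then ?P y else 0)" by (rule sum_mono[OF pt])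
    finally show ?thesis unfolding e .
  qed
  then show ?thesis using decM by blast
qed

lemma root8: "0 < x \<Longrightarrow> x < 1 \<Longrightarrow> \<exists>u. 0 < u \<and> u < 1 \<and> u ^ 8 = (x::real)"
  by (rule exI[of _ "root 8 x"]) auto

text \<open>Codebooks of independent uniform words are controlled by counting. For every state word
  fewer than \<open>2 * k\<close> messages are bad, a vanishing fraction since \<open>M\<close>
  grows exponentially; each remaining message meets only small tilted pair errors.\<close>

lemma nonsymmetrizable_code:
  fixes W :: "nat \<Rightarrow> 't \<Rightarrow> 'y \<Rightarrow> real" and G :: "nat \<Rightarrow> nat \<Rightarrow> 'y \<Rightarrow> real"
  assumes Y: "finite Y" and S: "finite S" and K: "1 \<le> K"
    and W0: "\<And>a s y. a < K \<Longrightarrow> s \<in> S \<Longrightarrow> y \<in> Y \<Longrightarrow> 0 \<le> W a s y"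
    and W1: "\<And>a s. a < K \<Longrightarrow> s \<in> S \<Longrightarrow> (\<Sum>y\<in>Y. W a s y) = 1"
    and anti: "\<And>a' a y. G a' a y = - G a a' y"
    and c: "0 < c" and avg: "\<And>a' s. a' < K \<Longrightarrow> s \<in> S \<Longrightarrow> c \<le> (\<Sum>a<K. \<Sum>y\<in>Y. W a s y * G a' a y)"
  shows "\<exists>\<rho>>0. \<forall>\<eta>>0. eventually (\<lambda>n. \<exists>M C dec. 1 \<le> M \<and> \<rho> * real n \<le> log 2 (real M) \<and>
     (\<forall>m<M. C m \<in> PiE {..<n} (\<lambda>_. {..<K})) \<and> (\<forall>y. dec y < M) \<and>
     (\<forall>s\<in>PiE {..<n} (\<lambda>_. S). 1 - \<eta> \<le> 1 / real M * (\<Sum>m<M. \<Sum>y\<in>PiE {..<n} (\<lambda>_. Y).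
        if dec y = m then \<Prod>t<n. W (C m t) (s t) (y t) else 0))) sequentially"
proof -
  have "\<exists>l>0. \<exists>\<theta>. 0 < \<theta> \<and> \<theta> < 1 \<and>
    (\<forall>a'<K. \<forall>s\<in>S. (\<Sum>a<K. \<Sum>y\<in>Y. W a s y * exp (- (l * G a' a y))) \<le> real K * \<theta>)"
    by (rule tilted_average[where W=W and G=G and S=S, OF Y K W0 W1 c avg])
  then obtain l \<theta> where l: "0 < l" and \<theta>: "0 < \<theta>" "\<theta> < 1"
    and tilt': "\<forall>a'<K. \<forall>s\<in>S. (\<Sum>a<K. \<Sum>y\<in>Y. W a s y * exp (- (l * G a' a y))) \<le> real K * \<theta>"
    by (elim exE conjE) (rule that)
  have tilt: "(\<Sum>a<K. \<Sum>y\<in>Y. W a s y * exp (- (l * G a' a y))) \<le> real K * \<theta>" if "a' < K" "s \<in> S" for a' s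
    using tilt' that by blast
  \<comment> \<open>The mean pair error is at most \<open>u ^ (8 * n)\<close>. Half of the exponent
    is the threshold for \<open>bad\<close>; the other half, by Markov, bounds the fraction of bad
    inputs. With \<open>M\<close> about \<open>u ^ (-n)\<close>, each edge costs
    \<open>M * M\<close>, which leaves \<open>u ^ (2 * n)\<close> per edge; \<open>k\<close> edges
    must then beat the \<open>card S ^ n\<close> state words.\<close>
  obtain u where u: "0 < u" "u < 1" "u ^ 8 = \<theta>" using root8[OF \<theta>] by blast
  have "(\<lambda>k. real (card S) * u ^ (2 * k)) \<longlonglongrightarrow> 0"
    using u by (intro tendsto_mult_right_zero) (auto simp: power_mult power_less_one_iff abs_square_less_1 intro!: LIMSEQ_power_zero)
  then have "eventually (\<lambda>k. real (card S) * u ^ (2 * k) < 1/2) sequentially" by (rule order_tendstoD) simp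
  then obtain k where k: "real (card S) * u ^ (2 * k) < 1/2" using eventually_happens'[OF sequentially_bot] by blast
  define \<phi> where "\<phi> = (\<lambda>a' a s. \<Sum>y\<in>Y. W a s y * exp (- (l * G a' a y)))"
  have \<phi>0: "0 \<le> \<phi> a' a s" if "a < K" "s \<in> S" for a' a s
    unfolding \<phi>_def using W0 that by (intro sum_nonneg mult_nonneg_nonneg) auto
  \<comment> \<open>Half of the exponent of \<open>M\<close>; the other half absorbs the loss from
    rounding \<open>v ^ n\<close> down.\<close>
  define \<rho> where "\<rho> = log 2 (1 / u) / 2"
  have \<rho>: "0 < \<rho>" unfolding \<rho>_def using u by simp
  have "eventually (\<lambda>n. \<exists>M C dec. 1 \<le> M \<and> \<rho> * real n \<le> log 2 (real M) \<and>
     (\<forall>m<M. C m \<in> PiE {..<n} (\<lambda>_. {..<K})) \<and> (\<forall>y. dec y < M) \<and>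
     (\<forall>s\<in>PiE {..<n} (\<lambda>_. S). 1 - \<eta> \<le> 1 / real M * (\<Sum>m<M. \<Sum>y\<in>PiE {..<n} (\<lambda>_. Y).
        if dec y = m then \<Prod>t<n. W (C m t) (s t) (y t) else 0))) sequentially" if \<eta>: "0 < \<eta>" for \<eta>
  proof -
    define v where "v = 1 / u"
    have v1: "1 < v" unfolding v_def using u by simp
    have uv: "u = 1 / v" unfolding v_def using u by simp
    have "filterlim (\<lambda>n. v ^ n) at_top sequentially" using v1 by real_asymp
    then have e1: "eventually (\<lambda>n. 2 \<le> v ^ n) sequentially" by (simp add: filterlim_at_top)
    have "(\<lambda>n. 2 * real k / (v ^ n / 2) + u ^ (3 * n)) \<longlonglongrightarrow> 0"
    proof -
      have "(\<lambda>n. 4 * real k * u ^ n + (u ^ 3) ^ n) \<longlonglongrightarrow> 4 * real k * 0 + 0"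
        using u by (intro tendsto_add tendsto_mult tendsto_const LIMSEQ_power_zero)
          (auto simp: power_less_one_iff)
      moreover have "2 * real k / (v ^ n / 2) + u ^ (3 * n) = 4 * real k * u ^ n + (u ^ 3) ^ n" for n
        unfolding v_def using u by (simp add: power_divide power_mult)
      ultimately show ?thesis by simp
    qed
    then have e2: "eventually (\<lambda>n. 2 * real k / (v ^ n / 2) + u ^ (3 * n) < \<eta>) sequentially"
      using \<eta> by (intro order_tendstoD(2)[of _ 0]) auto
    have "filterlim (\<lambda>n. real n * log 2 v / 2 - 1) at_top sequentially" using v1 by real_asymp
    then have e3: "eventually (\<lambda>n. 0 \<le> real n * log 2 v / 2 - 1) sequentially" unfolding filterlim_at_top by (rule spec)
    from e1 e2 e3 eventually_ge_at_top[of 1] show ?thesis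
    proof eventually_elim
      case (elim n)
      define M where "M = nat \<lfloor>v ^ n\<rfloor>"
      have Mv: "real M \<le> v ^ n" "v ^ n - 1 \<le> real M"
      proof -
        have "0 \<le> v ^ n" using v1 by simp
        then show "real M \<le> v ^ n" "v ^ n - 1 \<le> real M" unfolding M_def by linarith+
      qed
      have Mh: "v ^ n / 2 \<le> real M" using Mv(2) elim(1) by linarith
      have M1: "1 \<le> M" using Mh elim(1) by (cases M) auto
      have rate: "\<rho> * real n \<le> log 2 (real M)"
      proof -
        have "log 2 (v ^ n / 2) \<le> log 2 (real M)" using Mh v1 M1 by (subst log_le_cancel_iff) auto
        moreover have "log 2 (v ^ n / 2) = real n * log 2 v - 1" using v1 by (simp add: log_divide log_nat_power)
        moreover have "\<rho> * real n = real n * log 2 v / 2" unfolding \<rho>_def v_def by simp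
        ultimately show ?thesis using elim(3) by linarith
      qed
      let ?XX = "PiE {..<n} (\<lambda>_. {..<K})" and ?SS = "PiE {..<n} (\<lambda>_. S)"
      define \<Phi> where "\<Phi> = (\<lambda>s x' x. \<Prod>t<n. \<phi> (x' t) (x t) (s t))"
      have \<Phi>0: "0 \<le> \<Phi> s x' x" if "s \<in> ?SS" "x \<in> ?XX" for s x' x
        unfolding \<Phi>_def using that \<phi>0 by (intro prod_nonneg) (auto simp: PiE_iff)
      define bad where "bad = (\<lambda>s x' x. u ^ (4 * n) < \<Phi> s x' x)"
      have finX: "finite ?XX" by (intro finite_PiE) auto
      have X0: "?XX \<noteq> {}" using K by (simp add: PiE_eq_empty_iff lessThan_empty_iff)
      have cX: "real (card ?XX) = real K ^ n" by (simp add: card_PiE)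
      have B: "real (card {x \<in> ?XX. bad s x' x}) \<le> u ^ (4 * n) * real (card ?XX)" if s: "s \<in> ?SS" and x': "x' \<in> ?XX" for s x'
      proof -
        \<comment> \<open>Markov's inequality; the sum of \<open>\<Phi>\<close> over all words
          factorizes into single-letter tilted sums.\<close>
        have "real (card {x \<in> ?XX. bad s x' x}) * u ^ (4 * n) = (\<Sum>x\<in>{x \<in> ?XX. bad s x' x}. u ^ (4 * n))" by simp
        also have "\<dots> \<le> (\<Sum>x\<in>{x \<in> ?XX. bad s x' x}. \<Phi> s x' x)" by (intro sum_mono) (auto simp: bad_def)
        also have "\<dots> \<le> (\<Sum>x\<in>?XX. \<Phi> s x' x)" using finX \<Phi>0[OF s] by (intro sum_mono2) auto
        also have "\<dots> = (\<Prod>t<n. \<Sum>a<K. \<phi> (x' t) a (s t))"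
          unfolding \<Phi>_def by (rule prod_sum_PiE[symmetric]) auto
        also have "\<dots> \<le> (\<Prod>t<n. real K * \<theta>)"
        proof (rule prod_mono, intro conjI)
          fix t assume t: "t \<in> {..<n}"
          have "x' t < K" "s t \<in> S" using x' s t by (auto simp: PiE_iff)
          then show "(\<Sum>a<K. \<phi> (x' t) a (s t)) \<le> real K * \<theta>" "0 \<le> (\<Sum>a<K. \<phi> (x' t) a (s t))"
            using tilt[of "x' t" "s t"] \<phi>0 by (simp add: \<phi>_def, auto intro: sum_nonneg)
        qed
        also have "\<dots> = real (card ?XX) * u ^ (4 * n) * u ^ (4 * n)"
          unfolding cX u(3)[symmetric] by (simp add: power_mult_distrib power_mult[symmetric] power_add[symmetric])
        finally show ?thesis using u by (simp add: mult.commute)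
      qed
      have small: "real (card ?SS) * real M ^ (2 * k) * (u ^ (4 * n)) ^ k < 1"
      proof -
        have "real M ^ (2 * k) * (u ^ (4 * n)) ^ k \<le> (v ^ n) ^ (2 * k) * (u ^ (4 * n)) ^ k"
          using Mv u by (intro mult_right_mono power_mono) auto
        also have "\<dots> = (u ^ (2 * k)) ^ n"
        proof -
          have "(u ^ (4 * n)) ^ k = u ^ (n * (2 * k)) * u ^ (n * (2 * k))" unfolding power_mult[symmetric] power_add[symmetric] by (simp add: algebra_simps)
          moreover have "(v ^ n) ^ (2 * k) * u ^ (n * (2 * k)) = 1"
            unfolding power_mult[symmetric] power_mult_distrib[symmetric] v_def using u by simp
          ultimately have "(v ^ n) ^ (2 * k) * (u ^ (4 * n)) ^ k = u ^ (n * (2 * k))" by (metis mult.assoc mult_1)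
          then show ?thesis by (simp add: power_mult[symmetric] mult.commute)
        qed
        finally have "real (card ?SS) * (real M ^ (2 * k) * (u ^ (4 * n)) ^ k) \<le> real (card S) ^ n * (u ^ (2 * k)) ^ n"
          by (simp add: card_PiE mult_left_mono)
        also have "\<dots> = (real (card S) * u ^ (2 * k)) ^ n" by (simp add: power_mult_distrib)
        also have "\<dots> \<le> (real (card S) * u ^ (2 * k)) ^ 1"
          using k u elim(4) by (intro power_decreasing) auto
        also have "\<dots> < 1" using k by simp
        finally show ?thesis by (simp only: mult.assoc)
      qed
      have finS: "finite ?SS" using S by (intro finite_PiE) auto
      have "\<exists>C\<in>PiE {..<M} (\<lambda>_. ?XX). \<forall>s\<in>?SS. card {m. m < M \<and> (\<exists>m'<M. m' \<noteq> m \<and> bad s (C m') (C m))} < 2 * k"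
        by (rule good_codebook[OF finX X0 finS _ B small]) (use u in simp)
      then obtain C where C: "C \<in> PiE {..<M} (\<lambda>_. ?XX)"
        and good: "\<forall>s\<in>?SS. card {m. m < M \<and> (\<exists>m'<M. m' \<noteq> m \<and> bad s (C m') (C m))} < 2 * k"
        by (elim bexE) (rule that)
      have CX: "C m \<in> ?XX" if "m < M" for m using C that by auto
      have "\<exists>dec. (\<forall>y. dec y < M) \<and> (\<forall>s\<in>?SS. \<forall>m<M. 1 - (\<Sum>m'\<in>{..<M} - {m}. \<Phi> s (C m') (C m))
          \<le> (\<Sum>y\<in>PiE {..<n} (\<lambda>_. Y). if dec y = m then \<Prod>t<n. W (C m t) (s t) (y t) else 0))"
        unfolding \<Phi>_def \<phi>_def by (rule tournament_error[where W=W and G=G and S=S and K=K, OF Y W0 W1 anti l CX M1])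
      then obtain dec where dec: "\<forall>y. dec y < M"
        and err': "\<forall>s\<in>?SS. \<forall>m<M. 1 - (\<Sum>m'\<in>{..<M} - {m}. \<Phi> s (C m') (C m))
          \<le> (\<Sum>y\<in>PiE {..<n} (\<lambda>_. Y). if dec y = m then \<Prod>t<n. W (C m t) (s t) (y t) else 0)"
        by (elim exE conjE) (rule that)
      note err = mp[OF spec[OF bspec[OF err']]]
      have fid: "1 - \<eta> \<le> 1 / real M * (\<Sum>m<M. \<Sum>y\<in>PiE {..<n} (\<lambda>_. Y). if dec y = m then \<Prod>t<n. W (C m t) (s t) (y t) else 0)"
        if s: "s \<in> ?SS" for s
      proof -
        let ?Bd = "{m. m < M \<and> (\<exists>m'<M. m' \<noteq> m \<and> bad s (C m') (C m))}"
        let ?f = "\<lambda>m. \<Sum>y\<in>PiE {..<n} (\<lambda>_. Y). if dec y = m then \<Prod>t<n. W (C m t) (s t) (y t) else 0"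
        \<comment> \<open>The union bound over all competitors of a message that is not bad; it is
          at most \<open>u ^ (3 * n)\<close>, since \<open>M\<close> is at most
          \<open>u ^ (-n)\<close>.\<close>
        define \<epsilon> where "\<epsilon> = real M * u ^ (4 * n)"
        have e0: "0 \<le> \<epsilon>" unfolding \<epsilon>_def using u by simp
        have f0: "0 \<le> ?f m" if "m < M" for m
          using CX[OF that] s W0 by (intro sum_nonneg) (auto simp: PiE_iff intro!: prod_nonneg)
        have f1: "1 - \<epsilon> \<le> ?f m" if m: "m < M" "m \<notin> ?Bd" for m
        proof -
          have "(\<Sum>m'\<in>{..<M} - {m}. \<Phi> s (C m') (C m)) \<le> (\<Sum>m'\<in>{..<M} - {m}. u ^ (4 * n))"
          proof (rule sum_mono)
            fix m' assume "m' \<in> {..<M} - {m}"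
            then have "\<not> bad s (C m') (C m)" using m by auto
            then show "\<Phi> s (C m') (C m) \<le> u ^ (4 * n)" unfolding bad_def by simp
          qed
          also have "\<dots> = real (card ({..<M} - {m})) * u ^ (4 * n)" by simp
          also have "\<dots> \<le> \<epsilon>" unfolding \<epsilon>_def using u card_mono[of "{..<M}" "{..<M} - {m}"] by (intro mult_right_mono) auto
          finally show ?thesis using err[OF s m(1)] by linarith
        qed
        define f where "f = ?f"
        define Bd where "Bd = ?Bd"
        have "(\<Sum>m<M. (1 - \<epsilon>) - (if m \<in> Bd then 1 else 0)) \<le> (\<Sum>m<M. f m)"
        proof (rule sum_mono)
          fix m assume m: "m \<in> {..<M}"
          show "(1 - \<epsilon>) - (if m \<in> Bd then 1 else 0) \<le> f m"
          proof (cases "m \<in> Bd")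
            case True
            have "0 \<le> f m" unfolding f_def by (rule f0) (use m in simp)
            then show ?thesis using True e0 by simp
          next
            case False
            have "1 - \<epsilon> \<le> f m" unfolding f_def by (rule f1) (use m False[unfolded Bd_def] in \<open>simp_all only: lessThan_iff not_False_eq_True\<close>)
            then show ?thesis using False by simp
          qed
        qed
        moreover have "(\<Sum>m<M. (1 - \<epsilon>) - (if m \<in> Bd then 1 else 0)) = real M * (1 - \<epsilon>) - real (card Bd)"
        proof -
          have "{..<M} \<inter> Bd = Bd" unfolding Bd_def by auto
          then have "(\<Sum>m<M. if m \<in> Bd then 1 else 0) = real (card Bd)" by (simp add: sum.If_cases)
          then show ?thesis unfolding sum_subtractf by (simp add: right_diff_distrib)
        qed
        moreover have "real (card Bd) \<le> 2 * real k" using bspec[OF good s] unfolding Bd_def by linarith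
        ultimately have "real M * (1 - \<epsilon>) - 2 * real k \<le> (\<Sum>m<M. f m)" by linarith
        then have "(real M * (1 - \<epsilon>) - 2 * real k) / real M \<le> (\<Sum>m<M. f m) / real M" by (rule divide_right_mono) simp
        then have "(1 - \<epsilon>) - 2 * real k / real M \<le> 1 / real M * (\<Sum>m<M. f m)"
          using M1 by (simp add: diff_divide_distrib)
        moreover have "2 * real k / real M \<le> 2 * real k / (v ^ n / 2)"
          using Mh v1 M1 by (intro divide_left_mono) auto
        moreover have "\<epsilon> \<le> u ^ (3 * n)"
        proof -
          have "\<epsilon> \<le> v ^ n * u ^ (4 * n)" unfolding \<epsilon>_def using Mv u by (intro mult_right_mono) auto
          also have "u ^ (4 * n) = u ^ n * u ^ (3 * n)" by (simp add: power_add[symmetric])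
          also have "v ^ n * (u ^ n * u ^ (3 * n)) = u ^ (3 * n)"
            unfolding v_def using u by (simp add: power_divide)
          finally show ?thesis .
        qed
        ultimately have "1 - \<eta> \<le> 1 / real M * (\<Sum>m<M. f m)" using elim(2) by linarith
        then show ?thesis unfolding f_def .
      qed
      show ?case by (rule exI[of _ M], rule exI[of _ C], rule exI[of _ dec]) (use M1 rate CX dec fid in simp)
    qed
  qed
  then show ?thesis using \<rho> by blast
qed

section \<open>Measurements for a channel that is not symmetrizable\<close>

text \<open>A positive kernel of trace 1 lies below the identity. For a single vector
  \<open>v\<close>, Lagrange's identity writes the squared length of \<open>v\<close> times the
  identity, minus the rank-one kernel of \<open>v\<close>, as half a sum of rank-one kernels over
  index pairs; summing over the vectors of \<open>M\<close> uses the trace.\<close>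

lemma gram_complement:
  assumes A: "finite A" and M: "gram A M" and tr: "(\<Sum>a\<in>A. M a a) = 1"
  shows "gram A (\<lambda>x y. (if x = y then 1 else 0) - M x y)"
proof -
  obtain vs where v: "\<forall>x\<in>A. \<forall>y\<in>A. M x y = (\<Sum>v\<leftarrow>vs. v x * cnj (v y))" using M unfolding gram_def by blast
  have one: "gram A (\<lambda>x y. (if x = y then \<Sum>C\<in>A. v C * cnj (v C) else 0) - v x * cnj (v y))" for v :: "'a \<Rightarrow> complex"
  proof -
    define u where "u = (\<lambda>C C' x. cnj (v C') * (if x = C then 1 else 0) - cnj (v C) * (if x = C' then 1 else 0))"
    have "gram A (\<lambda>x y. complex_of_real (1/2) * (\<Sum>C\<in>A. \<Sum>C'\<in>A. u C C' x * cnj (u C C' y)))"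
      by (intro gram_scale gram_sum gram_rank1) simp
    moreover have "complex_of_real (1/2) * (\<Sum>C\<in>A. \<Sum>C'\<in>A. u C C' x * cnj (u C C' y))
       = (if x = y then \<Sum>C\<in>A. v C * cnj (v C) else 0) - v x * cnj (v y)" if "x \<in> A" "y \<in> A" for x y
    proof -
      let ?d = "\<lambda>x C. if x = C then 1 else (0::complex)"
      have "u C C' x * cnj (u C C' y) = (?d x C * ?d y C) * (v C' * cnj (v C')) + (v C * cnj (v C)) * (?d x C' * ?d y C')
         - (v C * ?d x C) * (cnj (v C') * ?d y C') - (cnj (v C) * ?d y C) * (v C' * ?d x C')" for C C'
        unfolding u_def by (simp add: algebra_simps)
      then have "(\<Sum>C\<in>A. \<Sum>C'\<in>A. u C C' x * cnj (u C C' y))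
         = (\<Sum>C\<in>A. ?d x C * ?d y C) * (\<Sum>C\<in>A. v C * cnj (v C)) + (\<Sum>C\<in>A. v C * cnj (v C)) * (\<Sum>C\<in>A. ?d x C * ?d y C)
          - (\<Sum>C\<in>A. v C * ?d x C) * (\<Sum>C\<in>A. cnj (v C) * ?d y C) - (\<Sum>C\<in>A. cnj (v C) * ?d y C) * (\<Sum>C\<in>A. v C * ?d x C)"
        by (simp only: sum_subtractf sum.distrib sum_product)
      also have "(\<Sum>C\<in>A. ?d x C * ?d y C) = ?d x y"
      proof -
        have "(\<Sum>C\<in>A. ?d x C * ?d y C) = (\<Sum>C\<in>A. if C = x then ?d y C else 0)" by (rule sum.cong[OF refl]) auto
        then show ?thesis using A that by auto
      qed
      also have "(\<Sum>C\<in>A. cnj (v C) * ?d y C) = cnj (v y)"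
      proof -
        have "(\<Sum>C\<in>A. cnj (v C) * ?d y C) = (\<Sum>C\<in>A. if C = y then cnj (v C) else 0)" by (rule sum.cong[OF refl]) auto
        then show ?thesis using A that by auto
      qed
      also have "(\<Sum>C\<in>A. v C * ?d x C) = v x"
      proof -
        have "(\<Sum>C\<in>A. v C * ?d x C) = (\<Sum>C\<in>A. if C = x then v C else 0)" by (rule sum.cong[OF refl]) auto
        then show ?thesis using A that by auto
      qed
      finally show ?thesis by simp
    qed
    ultimately show ?thesis by (rule gram_cong[OF _ sym])
  qed
  have all: "gram A (\<lambda>x y. \<Sum>v\<leftarrow>ws. (if x = y then \<Sum>C\<in>A. v C * cnj (v C) else 0) - v x * cnj (v y))" for ws :: "('a \<Rightarrow> complex) list"
    by (induction ws) (auto intro: gram_0 gram_add one)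
  have dist: "(\<Sum>v\<leftarrow>ws. (if x = y then \<Sum>C\<in>A. v C * cnj (v C) else 0) - v x * cnj (v y))
     = (if x = y then \<Sum>C\<in>A. \<Sum>v\<leftarrow>ws. v C * cnj (v C) else 0) - (\<Sum>v\<leftarrow>ws. v x * cnj (v y))" for x y and ws :: "('a \<Rightarrow> complex) list"
    by (induction ws) (auto simp: sum.distrib)
  have "(\<Sum>C\<in>A. \<Sum>v\<leftarrow>vs. v C * cnj (v C)) = (\<Sum>a\<in>A. M a a)"
    by (rule sum.cong[OF refl]) (use v in simp)
  then show ?thesis using v tr by (intro gram_cong[OF all[of vs]]) (simp add: dist)
qed

text \<open>The first-order condition at the point of least norm: moving from \<open>v\<close>
  towards \<open>w\<close> must not decrease the squared norm, so its derivative at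
  \<open>t = 0\<close> is nonnegative.\<close>

lemma affine_min:
  fixes v w :: "'j \<Rightarrow> complex"
  assumes "\<And>t. 0 \<le> t \<Longrightarrow> t \<le> 1 \<Longrightarrow> (\<Sum>j\<in>J. (cmod (v j))\<^sup>2) \<le> (\<Sum>j\<in>J. (cmod (v j + of_real t * (w j - v j)))\<^sup>2)"
  shows "(\<Sum>j\<in>J. (cmod (v j))\<^sup>2) \<le> (\<Sum>j\<in>J. Re (cnj (v j) * w j))"
proof -
  define d where "d = (\<Sum>j\<in>J. Re (cnj (v j) * (w j - v j)))"
  define b where "b = (\<Sum>j\<in>J. (cmod (w j - v j))\<^sup>2)"
  have b0: "0 \<le> b" unfolding b_def by (simp add: sum_nonneg)
  have sq: "(cmod (x + of_real t * y))\<^sup>2 = (cmod x)\<^sup>2 + 2 * t * Re (cnj x * y) + t\<^sup>2 * (cmod y)\<^sup>2" for x y t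
    unfolding cmod_power2 by (simp add: power2_eq_square algebra_simps)
  have q: "0 \<le> 2 * t * d + t\<^sup>2 * b" if "0 \<le> t" "t \<le> 1" for t
    using assms[OF that] unfolding sq sum.distrib sum_distrib_left[symmetric] d_def b_def by linarith
  have "0 \<le> d"
  proof (rule ccontr)
    assume "\<not> 0 \<le> d"
    then have d: "d < 0" by simp
    define t where "t = min 1 (- d / (b + 1))"
    have t: "0 < t" "t \<le> 1" unfolding t_def using d b0 by (auto intro!: divide_neg_pos)
    have "t \<le> (- d) / (b + 1)" unfolding t_def by (rule min.cobounded2)
    then have "t * (b + 1) \<le> - d" using pos_le_divide_eq[of "b + 1" t "- d"] b0 by simp
    then have "t * b + d < 0 - 0 * t" using t by (simp add: algebra_simps)
    then have "2 * d + t * b < 0" using d by linarith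
    then have "t * (2 * d + t * b) < 0" using t by (simp add: mult_pos_neg)
    then show False using q[of t] t by (simp add: power2_eq_square algebra_simps)
  qed
  moreover have "d = (\<Sum>j\<in>J. Re (cnj (v j) * w j)) - (\<Sum>j\<in>J. (cmod (v j))\<^sup>2)"
    unfolding d_def sum_subtractf[symmetric]
    unfolding cmod_power2 by (rule sum.cong[OF refl]) (simp add: power2_eq_square algebra_simps)
  ultimately show ?thesis by simp
qed

text \<open>Coordinates outside \<open>X \<times> S\<close> are pinned to 0, so the set is a closed
  part of a product of compact sets and Tychonoff applies in the full function space.\<close>

lemma compact_stochastic:
  assumes X: "finite X" and S: "finite S"
  shows "compact {p :: 'x \<times> 's \<Rightarrow> real. p \<in> PiE UNIV (\<lambda>i. if i \<in> X \<times> S then {0..1} else {0}) \<and>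
    (\<forall>x\<in>X. (\<Sum>s\<in>S. p (x,s)) = 1)}"
proof -
  let ?C = "PiE UNIV (\<lambda>i. if i \<in> X \<times> S then {0..1} else {0 :: real})"
  have c: "compact ?C"
    unfolding compactin_euclidean_iff[symmetric] euclidean_product_topology[symmetric] compactin_PiE by auto
  have "closed {p :: 'x \<times> 's \<Rightarrow> real. (\<Sum>s\<in>S. p (x,s)) = 1}" for x
    by (intro closed_Collect_eq continuous_intros continuous_on_product_coordinates)
  then have "closed (\<Inter>x\<in>X. {p :: 'x \<times> 's \<Rightarrow> real. (\<Sum>s\<in>S. p (x,s)) = 1})" by blast
  from compact_Int_closed[OF c this] show ?thesis by (rule back_subst[of compact]) auto
qed


text \<open>If no family of distributions \<open>p x\<close> symmetrizes \<open>\<tau>\<close>, then the nonzero point of least norm among the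
  asymmetries \<open>H\<close> separates all of them from \<open>0\<close>.\<close>

lemma asymmetry_separation:
  fixes \<tau> :: "'x \<Rightarrow> 's \<Rightarrow> 'j \<Rightarrow> complex"
  assumes X: "finite X" and S: "finite S" "S \<noteq> {}" and J: "finite J"
    and no: "\<nexists>p. (\<forall>x\<in>X. (\<forall>s. 0 \<le> p x s) \<and> (\<Sum>s\<in>S. p x s) = (1::real)) \<and>
      (\<forall>x\<in>X. \<forall>x'\<in>X. \<forall>j\<in>J. (\<Sum>s\<in>S. of_real (p x s) * \<tau> x' s j) = (\<Sum>s\<in>S. of_real (p x' s) * \<tau> x s j))"
  shows "\<exists>p H c. (\<forall>x\<in>X. (\<forall>s. 0 \<le> p x s) \<and> (\<Sum>s\<in>S. p x s) = (1::real)) \<and> 0 < c \<and>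
     H = (\<lambda>x x' j. (\<Sum>s\<in>S. of_real (p x s) * \<tau> x' s j) - (\<Sum>s\<in>S. of_real (p x' s) * \<tau> x s j)) \<and>
     (\<forall>\<sigma>. (\<forall>x\<in>X. \<sigma> x \<in> S) \<longrightarrow> c \<le> (\<Sum>x\<in>X. \<Sum>x'\<in>X. \<Sum>j\<in>J. Re (cnj (H x x' j) * \<tau> x' (\<sigma> x) j)))"
proof -
  define C where "C = {p :: 'x \<times> 's \<Rightarrow> real. p \<in> PiE UNIV (\<lambda>i. if i \<in> X \<times> S then {0..1} else {0}) \<and>
    (\<forall>x\<in>X. (\<Sum>s\<in>S. p (x,s)) = 1)}"
  define V where "V = (\<lambda>(p :: 'x \<times> 's \<Rightarrow> real) (x, x', j). (\<Sum>s\<in>S. of_real (p (x,s)) * \<tau> x' s j) - (\<Sum>s\<in>S. of_real (p (x',s)) * \<tau> x s j))"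
  define Z where "Z = X \<times> X \<times> J"
  define n where "n = (\<lambda>p. \<Sum>z\<in>Z. (cmod (V p z))\<^sup>2)"
  have Cbox: "p \<in> C \<longleftrightarrow> (\<forall>i. 0 \<le> p i \<and> (i \<in> X \<times> S \<longrightarrow> p i \<le> 1) \<and> (i \<notin> X \<times> S \<longrightarrow> p i = 0)) \<and> (\<forall>x\<in>X. (\<Sum>s\<in>S. p (x,s)) = 1)" for p
  proof -
    have "p i \<in> (if Q then {0..1} else {0}) \<longleftrightarrow> 0 \<le> p i \<and> (Q \<longrightarrow> p i \<le> 1) \<and> (\<not> Q \<longrightarrow> p i = 0)" for i Q
      by (cases Q) auto
    then show ?thesis unfolding C_def PiE_iff extensional_UNIV by simp
  qed
  have CD: "0 \<le> p i" "i \<in> X \<times> S \<Longrightarrow> p i \<le> 1" "i \<notin> X \<times> S \<Longrightarrow> p i = 0" "x \<in> X \<Longrightarrow> (\<Sum>s\<in>S. p (x,s)) = 1"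
    if "p \<in> C" for p i x using that unfolding Cbox by blast+
  \<comment> \<open>Deterministic jammers are points of the convex set; testing the separation on
    them is enough for the conclusion.\<close>
  have pt: "(\<lambda>(x,s). if x \<in> X \<and> s = \<sigma> x then 1 else 0) \<in> C" if "\<forall>x\<in>X. \<sigma> x \<in> S" for \<sigma>
    unfolding Cbox using that S by auto
  obtain s0 where s0: "s0 \<in> S" using S by blast
  have "C \<noteq> {}" using pt[of "\<lambda>_. s0"] s0 by blast
  moreover have "compact C" unfolding C_def by (rule compact_stochastic[OF X S(1)])
  moreover have "continuous_on C n"
    unfolding n_def V_def split_beta
    by (intro continuous_intros continuous_on_subset[OF continuous_on_product_coordinates]) auto
  ultimately obtain P where P: "P \<in> C" and min: "\<forall>p\<in>C. n P \<le> n p" using continuous_attains_inf by blast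
  have conv: "(\<lambda>i. P i + t * (p i - P i)) \<in> C" if p: "p \<in> C" and t: "0 \<le> t" "t \<le> 1" for p t
  proof -
    have e: "P i + t * (p i - P i) = (1 - t) * P i + t * p i" for i by (simp add: algebra_simps)
    have "(1 - t) * P i + t * p i \<le> 1" if "P i \<le> 1" "p i \<le> 1" for i using convex_bound_le[OF that, of "1 - t" t] t by simp
    moreover have "0 \<le> (1 - t) * P i + t * p i" for i using CD(1)[OF P] CD(1)[OF p] t by simp
    moreover have "(\<Sum>s\<in>S. (1 - t) * P (x,s) + t * p (x,s)) = 1" if "x \<in> X" for x
      unfolding sum.distrib sum_distrib_left[symmetric] CD(4)[OF P that] CD(4)[OF p that] by simp
    moreover have "(1 - t) * P i + t * p i = 0" if "i \<notin> X \<times> S" for i using CD(3)[OF P that] CD(3)[OF p that] by simp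
    ultimately show ?thesis unfolding e Cbox using CD(2)[OF P] CD(2)[OF p] by blast
  qed
  have Vc: "V (\<lambda>i. P i + t * (p i - P i)) z = V P z + of_real t * (V p z - V P z)" for t p z
    unfolding V_def by (cases z) (simp add: algebra_simps sum.distrib sum_distrib_left sum_subtractf)
  define c where "c = n P"
  define H where "H = (\<lambda>x x' j. V P (x, x', j))"
  have sep: "c \<le> (\<Sum>z\<in>Z. Re (cnj (V P z) * V p z))" if p: "p \<in> C" for p
    unfolding c_def n_def
  proof (rule affine_min)
    fix t :: real assume t: "0 \<le> t" "t \<le> 1"
    have "n P \<le> n (\<lambda>i. P i + t * (p i - P i))" using min conv[OF p t] by blast
    then show "(\<Sum>z\<in>Z. (cmod (V P z))\<^sup>2) \<le> (\<Sum>z\<in>Z. (cmod (V P z + of_real t * (V p z - V P z)))\<^sup>2)"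
      unfolding n_def Vc .
  qed
  have finZ: "finite Z" unfolding Z_def using X J by simp
  have "0 < c"
  proof (rule ccontr)
    assume "\<not> 0 < c"
    then have "c = 0" unfolding c_def n_def using sum_nonneg[of Z "\<lambda>z. (cmod (V P z))\<^sup>2"] by simp
    then have "V P z = 0" if "z \<in> Z" for z using finZ that unfolding c_def n_def by (subst (asm) sum_nonneg_eq_0_iff) auto
    then have "V P (x, x', j) = 0" if "x \<in> X" "x' \<in> X" "j \<in> J" for x x' j using that unfolding Z_def by blast
    then have "\<forall>x\<in>X. \<forall>x'\<in>X. \<forall>j\<in>J. (\<Sum>s\<in>S. of_real (P (x,s)) * \<tau> x' s j) = (\<Sum>s\<in>S. of_real (P (x',s)) * \<tau> x s j)"
      unfolding V_def by simp
    moreover have "\<forall>x\<in>X. (\<forall>s. 0 \<le> P (x,s)) \<and> (\<Sum>s\<in>S. P (x,s)) = 1" using P unfolding Cbox by blast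
    ultimately show False using no by (auto dest: spec[of _ "\<lambda>x s. P (x,s)"])
  qed
  \<comment> \<open>The asymmetry of a deterministic jammer has two terms; as \<open>H\<close> is
    antisymmetric, both contribute the same double sum, hence the factor 1/2.\<close>
  moreover have "c / 2 \<le> (\<Sum>x\<in>X. \<Sum>x'\<in>X. \<Sum>j\<in>J. Re (cnj (H x x' j) * \<tau> x' (\<sigma> x) j))" if \<sigma>: "\<forall>x\<in>X. \<sigma> x \<in> S" for \<sigma>
  proof -
    define q where "q = (\<lambda>(x,s). if x \<in> X \<and> s = \<sigma> x then 1 else (0::real))"
    have anti: "H x x' j = - H x' x j" for x x' j unfolding H_def V_def by simp
    have pm: "(\<Sum>s\<in>S. of_real (q (x,s)) * \<tau> x' s j) = \<tau> x' (\<sigma> x) j" if "x \<in> X" for x x' j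
    proof -
      have "(\<Sum>s\<in>S. of_real (q (x,s)) * \<tau> x' s j) = (\<Sum>s\<in>S. if s = \<sigma> x then \<tau> x' s j else 0)"
        unfolding q_def using that by (intro sum.cong[OF refl]) auto
      then show ?thesis using \<sigma> S that by simp
    qed
    let ?F = "\<lambda>x x'. \<Sum>j\<in>J. Re (cnj (H x x' j) * \<tau> x' (\<sigma> x) j)"
    have "c \<le> (\<Sum>z\<in>Z. Re (cnj (V P z) * V q z))" unfolding q_def by (rule sep[OF pt[OF \<sigma>]])
    also have "\<dots> = (\<Sum>x\<in>X. \<Sum>x'\<in>X. \<Sum>j\<in>J. Re (cnj (H x x' j) * V q (x, x', j)))"
      unfolding Z_def H_def by (simp add: sum.cartesian_product split_def)
    also have "\<dots> = (\<Sum>x\<in>X. \<Sum>x'\<in>X. ?F x x' + ?F x' x)"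
    proof (intro sum.cong[OF refl])
      fix x x' assume x: "x \<in> X" "x' \<in> X"
      have "Re (cnj (H x x' j) * V q (x, x', j)) = Re (cnj (H x x' j) * \<tau> x' (\<sigma> x) j) + Re (cnj (H x' x j) * \<tau> x (\<sigma> x') j)" for j
      proof -
        have v: "V q (x, x', j) = \<tau> x' (\<sigma> x) j - \<tau> x (\<sigma> x') j" unfolding V_def by (simp only: prod.case pm[OF x(1)] pm[OF x(2)])
        show ?thesis unfolding v anti[of x' x] by (simp add: algebra_simps)
      qed
      then show "(\<Sum>j\<in>J. Re (cnj (H x x' j) * V q (x, x', j))) = ?F x x' + ?F x' x" by (simp add: sum.distrib)
    qed
    also have "\<dots> = (\<Sum>x\<in>X. \<Sum>x'\<in>X. ?F x x') + (\<Sum>x\<in>X. \<Sum>x'\<in>X. ?F x' x)" by (simp only: sum.distrib)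
    also have "(\<Sum>x\<in>X. \<Sum>x'\<in>X. ?F x' x) = (\<Sum>x\<in>X. \<Sum>x'\<in>X. ?F x x')" by (rule sum.swap)
    finally show ?thesis by linarith
  qed
  moreover have "\<forall>x\<in>X. (\<forall>s. 0 \<le> P (x,s)) \<and> (\<Sum>s\<in>S. P (x,s)) = 1" using P unfolding Cbox by blast
  moreover have "H = (\<lambda>x x' j. (\<Sum>s\<in>S. of_real (P (x,s)) * \<tau> x' s j) - (\<Sum>s\<in>S. of_real (P (x',s)) * \<tau> x s j))"
    unfolding H_def V_def by simp
  ultimately show ?thesis
    by (intro exI[of _ "\<lambda>x s. P (x,s)"] exI[of _ H] exI[of _ "c / 2"]) auto
qed

lemma pairing_units:
  assumes T: "finite T"
  shows "pairing dA dB T \<nu> P R = (\<Sum>A\<in>words dB T. \<Sum>B\<in>words dB T.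
    pairing dA dB T \<nu> P (\<lambda>A' B'. if A' = A \<and> B' = B then 1 else 0) * R A B)"
proof -
  let ?W = "words dB T"
  have fin: "finite ?W" by (rule finite_words[OF T])
  have "pairing dA dB T \<nu> P R = pairing dA dB T \<nu> P (\<lambda>A' B'. \<Sum>A\<in>?W. \<Sum>B\<in>?W. (if A' = A \<and> B' = B then R A B else 0))"
  proof -
    have "(\<Sum>A\<in>?W. \<Sum>B\<in>?W. (if A' = A \<and> B' = B then R A B else 0)) = R A' B'" if "A' \<in> ?W" "B' \<in> ?W" for A' B'
    proof -
      have "(\<Sum>A\<in>?W. \<Sum>B\<in>?W. (if A' = A \<and> B' = B then R A B else 0)) = (\<Sum>A\<in>?W. if A = A' then \<Sum>B\<in>?W. (if B = B' then R A B else 0) else 0)"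
        by (rule sum.cong[OF refl]) (auto intro: sum.cong)
      then show ?thesis using fin that by simp
    qed
    then show ?thesis unfolding pairing_def by (intro sum.cong[OF refl]) simp
  qed
  also have "\<dots> = (\<Sum>A\<in>?W. \<Sum>B\<in>?W. pairing dA dB T \<nu> P (\<lambda>A' B'. if A' = A \<and> B' = B then R A B else 0))"
    unfolding pairing_sum_right ..
  also have "\<dots> = (\<Sum>A\<in>?W. \<Sum>B\<in>?W. pairing dA dB T \<nu> P (\<lambda>A' B'. if A' = A \<and> B' = B then 1 else 0) * R A B)"
    unfolding pairing_def by (intro sum.cong[OF refl], simp only: sum_distrib_right, intro sum.cong[OF refl]) simp
  finally show ?thesis .
qed

context
  fixes N :: "'s::finite \<Rightarrow> cmap" and dA dB :: nat
  assumes dA: "1 \<le> dA" and dB: "1 \<le> dB" and N: "\<forall>s. cptp dA dB (N s)"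
begin

text \<open>The measurement has an outcome for each ordered pair of inputs, with
  \<open>E (x, x')\<close> proportional to the identity plus the conjugate of \<open>H\<close>. As
  \<open>H\<close> is a difference of mixed outputs, positivity follows from
  \<open>gram_complement\<close>; the antisymmetric parts cancel in the total. The difference of the
  outcomes \<open>(x, x')\<close> and \<open>(x', x)\<close> isolates \<open>H\<close>, so the
  separation constant becomes the expected score against the competitor \<open>x\<close>, whose
  state may depend on \<open>x\<close>.\<close>

lemma base_measurement:
  assumes ns: "\<not> l_symmetrizable dA dB N l"
  shows "\<exists>(K::nat) P E c. 1 \<le> K \<and> 0 < c \<and> (\<forall>x<K. gram (words dA {..<l}) (P x) \<and> (\<Sum>I\<in>words dA {..<l}. P x I I) = 1) \<and>
    (\<forall>y\<in>{..<K} \<times> {..<K}. gram (words dB {..<l}) (E y)) \<and>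
    (\<forall>A\<in>words dB {..<l}. \<forall>B\<in>words dB {..<l}. (\<Sum>y\<in>{..<K} \<times> {..<K}. E y A B) = (if A = B then 1 else 0)) \<and>
    (\<forall>\<sigma>. (\<forall>x<K. length (\<sigma> x) = l) \<longrightarrow> c \<le> (\<Sum>x<K. \<Sum>x'<K.
       Re (pairing dA dB {..<l} (wstate dA N (\<lambda>t. \<sigma> x ! t)) (P x') (E (x, x'))) -
       Re (pairing dA dB {..<l} (wstate dA N (\<lambda>t. \<sigma> x ! t)) (P x') (E (x', x)))))"
proof -
  let ?L = "{..<l}" and ?SS = "{ss :: 's list. length ss = l}"
  let ?WB = "words dB ?L"
  have finW: "finite ?WB" by (rule finite_words) simp
  obtain Rs where Rs: "finite Rs" "Rs \<subseteq> {\<rho>. dens_op (dA ^ l) \<rho>}"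
    and nop: "\<nexists>p :: complex mat \<Rightarrow> 's list \<Rightarrow> real. (\<forall>\<rho> \<in> Rs. (\<forall>ss. p \<rho> ss \<ge> 0) \<and> (\<Sum>ss \<in> ?SS. p \<rho> ss) = 1) \<and>
           (\<forall>\<rho> \<in> Rs. \<forall>\<sigma> \<in> Rs.
              msum (dB ^ l) (\<lambda>ss. complex_of_real (p \<rho> ss) \<cdot>\<^sub>m chan_seq dA dB N ss \<sigma>) ?SS
            = msum (dB ^ l) (\<lambda>ss. complex_of_real (p \<sigma> ss) \<cdot>\<^sub>m chan_seq dA dB N ss \<rho>) ?SS)"
    using ns unfolding l_symmetrizable_def by (auto simp only: not_all not_imp)
  have dens: "\<rho> \<in> carrier_mat (dA ^ l) (dA ^ l)" "psd \<rho>" "mtrace \<rho> = 1" if "\<rho> \<in> Rs" for \<rho>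
    using Rs(2) that unfolding dens_op_def by auto
  define Pk where "Pk = (\<lambda>(\<rho> :: complex mat) I J. \<rho> $$ (ud dA l I, ud dA l J))"
  have Pg: "gram (words dA ?L) (Pk \<rho>)" if "\<rho> \<in> Rs" for \<rho>
    using gram_vimage[OF psd_gram[OF dens(2,1)[OF that]], of "words dA ?L" "ud dA l"] ud_less[OF dA, of _ l] unfolding Pk_def by simp
  have Ptr: "(\<Sum>I\<in>words dA ?L. Pk \<rho> I I) = 1" if "\<rho> \<in> Rs" for \<rho>
  proof -
    have "(\<Sum>I\<in>words dA ?L. Pk \<rho> I I) = (\<Sum>x<dA ^ l. Pk \<rho> (dg dA l x) (dg dA l x))"
      by (rule sum_dg[OF dA, symmetric])
    also have "\<dots> = (\<Sum>x<dA ^ l. \<rho> $$ (x, x))" unfolding Pk_def by (simp add: ud_dg)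
    also have "\<dots> = 1" using dens(1,3)[OF that] unfolding mtrace_def by simp
    finally show ?thesis .
  qed
  let ?\<nu> = "\<lambda>ss. wstate dA N (\<lambda>t. ss ! t)"
  define \<tau> where "\<tau> = (\<lambda>\<rho> ss (A, B). pairing dA dB ?L (?\<nu> ss) (Pk \<rho>) (\<lambda>A' B'. if A' = A \<and> B' = B then 1 else 0))"
  have chk: "\<forall>t\<in>?L. chk dA dB (?\<nu> ss t)" for ss by (rule chk_wstate[OF dA dB N])
  have \<tau>p: "pairing dA dB ?L (?\<nu> ss) (Pk \<rho>) R = (\<Sum>A\<in>?WB. \<Sum>B\<in>?WB. \<tau> \<rho> ss (A, B) * R A B)" for ss \<rho> R
    unfolding \<tau>_def prod.case by (rule pairing_units) simp
  have \<tau>g: "gram ?WB (\<lambda>A B. \<tau> \<rho> ss (A, B))" if "\<rho> \<in> Rs" for \<rho> ss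
  proof -
    have 1: "gram ({()} \<times> words dA ?L) (\<lambda>x y. Pk \<rho> (snd x) (snd y))"
      by (rule gram_vimage[OF Pg[OF that]]) auto
    have 2: "gram (?WB \<times> ?WB) (\<lambda>x y. if fst x = snd x \<and> fst y = snd y then 1 else 0)"
      by (rule gram_cong[OF gram_rank1[of _ "\<lambda>x. if fst x = snd x then 1 else 0"]]) auto
    have "gram ({()} \<times> ?WB) (\<lambda>x y. pairing dA dB ?L (?\<nu> ss) (Pk \<rho>) (\<lambda>A' B'. if A' = snd x \<and> B' = snd y then 1 else 0))"
      using pairing_gram[of ?L dA dB "?\<nu> ss" "{()}" "\<lambda>_ _. Pk \<rho>" ?WB "\<lambda>A' B' A B. if A' = A \<and> B' = B then 1 else 0", OF chk 1 2] .
    from gram_vimage[OF this, of ?WB "\<lambda>A. ((), A)"] show ?thesis unfolding \<tau>_def by simp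
  qed
  have \<tau>tr: "(\<Sum>A\<in>?WB. \<tau> \<rho> ss (A, A)) = 1" if "\<rho> \<in> Rs" for \<rho> ss
  proof -
    have "(\<Sum>A\<in>?WB. \<tau> \<rho> ss (A, A)) = pairing dA dB ?L (?\<nu> ss) (Pk \<rho>) (\<lambda>A' B'. \<Sum>A\<in>?WB. if A' = A \<and> B' = A then 1 else 0)"
      unfolding \<tau>_def prod.case pairing_sum_right ..
    also have "\<dots> = (\<Sum>I\<in>words dA ?L. Pk \<rho> I I)"
    proof (rule pairing_ident[OF chk])
      fix A B assume "A \<in> ?WB" "B \<in> ?WB"
      then show "(\<Sum>C\<in>?WB. if A = C \<and> B = C then 1 else 0) = (if A = B then 1 else 0)"
        using finW by (cases "A = B") (auto simp: sum.delta' intro: sum.neutral)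
    qed simp
    finally show ?thesis using Ptr[OF that] by simp
  qed
  have \<tau>c: "chan_seq dA dB N ss \<rho> $$ (a,b) = \<tau> \<rho> ss (dg dB l a, dg dB l b)"
    if "\<rho> \<in> Rs" "length ss = l" "a < dB ^ l" "b < dB ^ l" for \<rho> ss a b
  proof -
    have X: "\<rho> = Matrix.mat (dA ^ l) (dA ^ l) (\<lambda>(x,y). Pk \<rho> (dg dA l x) (dg dA l y))"
      unfolding Pk_def using dens(1)[OF that(1)] by (intro eq_matI) (auto simp: ud_dg)
    have "\<tau> \<rho> ss (dg dB l a, dg dB l b) = (\<Sum>a'<dB ^ l. \<Sum>b'<dB ^ l. chan_seq dA dB N ss \<rho> $$ (a',b') *
       (if dg dB l a' = dg dB l a \<and> dg dB l b' = dg dB l b then 1 else 0))"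
      unfolding \<tau>_def prod.case by (rule pairing_chan_seq[OF dA dB N X that(2)])
    also have "\<dots> = (\<Sum>a'<dB ^ l. \<Sum>b'<dB ^ l. if a' = a then if b' = b then chan_seq dA dB N ss \<rho> $$ (a',b') else 0 else 0)"
      using inj_onD[OF dg_inj[of dB l], of _ a] inj_onD[OF dg_inj[of dB l], of _ b] that by (intro sum.cong[OF refl]) auto
    also have "\<dots> = (\<Sum>a'<dB ^ l. if a' = a then chan_seq dA dB N ss \<rho> $$ (a',b) else 0)"
      using that by (intro sum.cong[OF refl]) (simp split: if_split)
    also have "\<dots> = chan_seq dA dB N ss \<rho> $$ (a,b)" using that by simp
    finally show ?thesis ..
  qed
  have nos: "\<nexists>p. (\<forall>\<rho>\<in>Rs. (\<forall>s. 0 \<le> p \<rho> s) \<and> (\<Sum>s\<in>?SS. p \<rho> s) = (1::real)) \<and>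
      (\<forall>\<rho>\<in>Rs. \<forall>\<sigma>\<in>Rs. \<forall>j\<in>?WB \<times> ?WB. (\<Sum>s\<in>?SS. of_real (p \<rho> s) * \<tau> \<sigma> s j) = (\<Sum>s\<in>?SS. of_real (p \<sigma> s) * \<tau> \<rho> s j))"
  proof
    assume "\<exists>p. (\<forall>\<rho>\<in>Rs. (\<forall>s. 0 \<le> p \<rho> s) \<and> (\<Sum>s\<in>?SS. p \<rho> s) = (1::real)) \<and>
      (\<forall>\<rho>\<in>Rs. \<forall>\<sigma>\<in>Rs. \<forall>j\<in>?WB \<times> ?WB. (\<Sum>s\<in>?SS. of_real (p \<rho> s) * \<tau> \<sigma> s j) = (\<Sum>s\<in>?SS. of_real (p \<sigma> s) * \<tau> \<rho> s j))"
    then obtain p where p: "\<forall>\<rho>\<in>Rs. (\<forall>s. 0 \<le> p \<rho> s) \<and> (\<Sum>s\<in>?SS. p \<rho> s) = (1::real)"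
      and q: "\<And>\<rho> \<sigma> j. \<rho> \<in> Rs \<Longrightarrow> \<sigma> \<in> Rs \<Longrightarrow> j \<in> ?WB \<times> ?WB \<Longrightarrow>
         (\<Sum>s\<in>?SS. of_real (p \<rho> s) * \<tau> \<sigma> s j) = (\<Sum>s\<in>?SS. of_real (p \<sigma> s) * \<tau> \<rho> s j)"
      by blast
    have entry: "(\<Sum>ss\<in>?SS. (complex_of_real (p \<rho> ss) \<cdot>\<^sub>m chan_seq dA dB N ss \<sigma>) $$ (a,b)) = (\<Sum>ss\<in>?SS. of_real (p \<rho> ss) * \<tau> \<sigma> ss (dg dB l a, dg dB l b))"
      if "\<sigma> \<in> Rs" "a < dB ^ l" "b < dB ^ l" for \<rho> \<sigma> a b
    proof (rule sum.cong[OF refl])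
      fix ss assume ss: "ss \<in> ?SS"
      have "chan_seq dA dB N ss \<sigma> \<in> carrier_mat (dB ^ l) (dB ^ l)"
        by (rule chan_seq_carrier[OF dA dB N dens(1)[OF that(1)]]) (use ss in simp)
      then show "(complex_of_real (p \<rho> ss) \<cdot>\<^sub>m chan_seq dA dB N ss \<sigma>) $$ (a,b) = of_real (p \<rho> ss) * \<tau> \<sigma> ss (dg dB l a, dg dB l b)"
        using that ss by (subst \<tau>c[symmetric]) auto
    qed
    have "msum (dB ^ l) (\<lambda>ss. complex_of_real (p \<rho> ss) \<cdot>\<^sub>m chan_seq dA dB N ss \<sigma>) ?SS
         = msum (dB ^ l) (\<lambda>ss. complex_of_real (p \<sigma> ss) \<cdot>\<^sub>m chan_seq dA dB N ss \<rho>) ?SS" if "\<rho> \<in> Rs" "\<sigma> \<in> Rs" for \<rho> \<sigma>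
    proof (rule eq_matI)
      fix a b assume "a < dim_row (msum (dB ^ l) (\<lambda>ss. complex_of_real (p \<sigma> ss) \<cdot>\<^sub>m chan_seq dA dB N ss \<rho>) ?SS)"
        "b < dim_col (msum (dB ^ l) (\<lambda>ss. complex_of_real (p \<sigma> ss) \<cdot>\<^sub>m chan_seq dA dB N ss \<rho>) ?SS)"
      then have ab: "a < dB ^ l" "b < dB ^ l" unfolding msum_def by simp_all
      have "(dg dB l a, dg dB l b) \<in> ?WB \<times> ?WB" using dg_words[OF dB] by simp
      from q[OF that this] show "msum (dB ^ l) (\<lambda>ss. complex_of_real (p \<rho> ss) \<cdot>\<^sub>m chan_seq dA dB N ss \<sigma>) ?SS $$ (a,b)
         = msum (dB ^ l) (\<lambda>ss. complex_of_real (p \<sigma> ss) \<cdot>\<^sub>m chan_seq dA dB N ss \<rho>) ?SS $$ (a,b)"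
        unfolding msum_def using ab entry[OF that(1) ab] entry[OF that(2) ab] by simp
    qed (simp_all add: msum_def)
    then show False using nop p by blast
  qed
  obtain p H c where p: "\<forall>\<rho>\<in>Rs. (\<forall>s. 0 \<le> p \<rho> s) \<and> (\<Sum>s\<in>?SS. p \<rho> s) = (1::real)" and c: "0 < c"
    and H: "H = (\<lambda>\<rho> \<sigma> j. (\<Sum>s\<in>?SS. of_real (p \<rho> s) * \<tau> \<sigma> s j) - (\<Sum>s\<in>?SS. of_real (p \<sigma> s) * \<tau> \<rho> s j))"
    and sep: "\<forall>\<sigma>. (\<forall>\<rho>\<in>Rs. \<sigma> \<rho> \<in> ?SS) \<longrightarrow> c \<le> (\<Sum>\<rho>\<in>Rs. \<Sum>\<rho>'\<in>Rs. \<Sum>j\<in>?WB \<times> ?WB. Re (cnj (H \<rho> \<rho>' j) * \<tau> \<rho>' (\<sigma> \<rho>) j))"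
    using asymmetry_separation[OF Rs(1) finite_lists[OF dA dB N] lists_ne[OF dA dB N] _ nos] finW by blast
  have Rs0: "Rs \<noteq> {}"
  proof
    assume "Rs = {}"
    with sep have "c \<le> 0" by simp
    with c show False by simp
  qed
  define K where "K = card Rs"
  have K: "1 \<le> K" unfolding K_def using Rs(1) Rs0 by (simp add: Suc_le_eq card_gt_0_iff)
  obtain h where h: "bij_betw h {..<K} Rs" unfolding K_def using ex_bij_betw_nat_finite[OF Rs(1)] by (auto simp: atLeast0LessThan)
  have hR: "h x \<in> Rs" if "x < K" for x using h that by (auto simp: bij_betw_def)
  define E where "E = (\<lambda>(x, x') A B. complex_of_real (1 / (real K)\<^sup>2) * ((if A = B then 1 else 0) + cnj (H (h x) (h x') (A, B))))"
  have anti: "H \<rho> \<sigma> j = - H \<sigma> \<rho> j" for \<rho> \<sigma> j unfolding H by simp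
  have mix: "gram ?WB (\<lambda>A B. \<Sum>s\<in>?SS. of_real (p \<rho> s) * \<tau> \<sigma> s (A, B))"
    "(\<Sum>A\<in>?WB. \<Sum>s\<in>?SS. of_real (p \<rho> s) * \<tau> \<sigma> s (A, A)) = 1" if "\<rho> \<in> Rs" "\<sigma> \<in> Rs" for \<rho> \<sigma>
  proof -
    show "gram ?WB (\<lambda>A B. \<Sum>s\<in>?SS. of_real (p \<rho> s) * \<tau> \<sigma> s (A, B))"
      by (intro gram_sum gram_scale \<tau>g that) (use p that in blast)
    have "(\<Sum>A\<in>?WB. \<Sum>s\<in>?SS. of_real (p \<rho> s) * \<tau> \<sigma> s (A, A)) = (\<Sum>s\<in>?SS. of_real (p \<rho> s) * (\<Sum>A\<in>?WB. \<tau> \<sigma> s (A, A)))"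
      by (subst sum.swap) (simp only: sum_distrib_left)
    also have "\<dots> = of_real (\<Sum>s\<in>?SS. p \<rho> s)" by (simp add: \<tau>tr[OF that(2)])
    finally show "(\<Sum>A\<in>?WB. \<Sum>s\<in>?SS. of_real (p \<rho> s) * \<tau> \<sigma> s (A, A)) = 1" using p that by simp
  qed
  have Eg: "gram ?WB (E (x, x'))" if "x < K" "x' < K" for x x'
  proof -
    let ?M1 = "\<lambda>A B. cnj (\<Sum>s\<in>?SS. of_real (p (h x) s) * \<tau> (h x') s (A, B))"
    let ?M2 = "\<lambda>A B. cnj (\<Sum>s\<in>?SS. of_real (p (h x') s) * \<tau> (h x) s (A, B))"
    note m1 = mix[OF hR[OF that(1)] hR[OF that(2)]] and m2 = mix[OF hR[OF that(2)] hR[OF that(1)]]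
    have "(\<Sum>A\<in>?WB. ?M2 A A) = 1" unfolding cnj_sum[symmetric] m2(2) by simp
    then have "gram ?WB (\<lambda>A B. complex_of_real (1 / (real K)\<^sup>2) * (((if A = B then 1 else 0) - ?M2 A B) + ?M1 A B))"
      by (intro gram_scale gram_add gram_complement[OF finW] gram_cnj m1(1) m2(1)) simp
    then show ?thesis by (rule gram_cong) (simp add: E_def H)
  qed
  have Es: "(\<Sum>y\<in>{..<K} \<times> {..<K}. E y A B) = (if A = B then 1 else 0)" for A B
  proof -
    have z: "(\<Sum>x<K. \<Sum>x'<K. cnj (H (h x) (h x') (A, B))) = 0"
    proof -
      let ?z = "\<Sum>x<K. \<Sum>x'<K. cnj (H (h x) (h x') (A, B))"
      have "?z = (\<Sum>x'<K. \<Sum>x<K. cnj (H (h x) (h x') (A, B)))" by (rule sum.swap)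
      also have "\<dots> = (\<Sum>x'<K. \<Sum>x<K. - cnj (H (h x') (h x) (A, B)))"
        by (intro sum.cong[OF refl]) (metis anti complex_cnj_minus)
      also have "\<dots> = - ?z" by (simp only: sum_negf)
      finally show ?thesis by simp
    qed
    have "(\<Sum>y\<in>{..<K} \<times> {..<K}. E y A B) = (\<Sum>x<K. \<Sum>x'<K. E (x, x') A B)" by (simp add: sum.cartesian_product)
    also have "\<dots> = complex_of_real (1 / (real K)\<^sup>2) * ((\<Sum>x<K. \<Sum>x'<K. (if A = B then 1 else 0)) + (\<Sum>x<K. \<Sum>x'<K. cnj (H (h x) (h x') (A, B))))"
      unfolding E_def prod.case by (simp only: sum_distrib_left[symmetric] sum.distrib)
    also have "\<dots> = (if A = B then 1 else 0)" unfolding z using K by (simp add: power2_eq_square)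
    finally show ?thesis .
  qed
  define F where "F = (\<lambda>ss x x'. \<Sum>j\<in>?WB \<times> ?WB. Re (cnj (H (h x) (h x') j) * \<tau> (h x') ss j))"
  have pr: "Re (pairing dA dB ?L (?\<nu> ss) (Pk (h x')) (E (x, x'))) = 1 / (real K)\<^sup>2 * (1 + F ss x x')"
     "Re (pairing dA dB ?L (?\<nu> ss) (Pk (h x')) (E (x', x))) = 1 / (real K)\<^sup>2 * (1 - F ss x x')"
    if x: "x < K" "x' < K" for ss x x'
  proof -
    have g: "Re (pairing dA dB ?L (?\<nu> ss) (Pk (h x')) (\<lambda>A B. complex_of_real (1 / (real K)\<^sup>2) * ((if A = B then 1 else 0) + G (A, B))))
       = 1 / (real K)\<^sup>2 * (1 + (\<Sum>j\<in>?WB \<times> ?WB. Re (G j * \<tau> (h x') ss j)))" for G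
    proof -
      have d: "(\<Sum>A\<in>?WB. \<Sum>B\<in>?WB. \<tau> (h x') ss (A, B) * (if A = B then 1 else 0)) = 1"
        unfolding \<tau>p[symmetric] using pairing_ident[OF chk[of ss], of "\<lambda>A B. if A = B then 1 else 0" "Pk (h x')"] Ptr[OF hR[OF x(2)]] by simp
      have "pairing dA dB ?L (?\<nu> ss) (Pk (h x')) (\<lambda>A B. complex_of_real (1 / (real K)\<^sup>2) * ((if A = B then 1 else 0) + G (A, B)))
        = (\<Sum>A\<in>?WB. \<Sum>B\<in>?WB. complex_of_real (1 / (real K)\<^sup>2) * (\<tau> (h x') ss (A, B) * (if A = B then 1 else 0) + G (A, B) * \<tau> (h x') ss (A, B)))"
        unfolding \<tau>p by (intro sum.cong[OF refl]) (simp only: ring_distribs mult_ac)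
      also have "\<dots> = complex_of_real (1 / (real K)\<^sup>2) * (1 + (\<Sum>A\<in>?WB. \<Sum>B\<in>?WB. G (A, B) * \<tau> (h x') ss (A, B)))"
        by (simp only: sum_distrib_left[symmetric] sum.distrib d)
      finally have e: "pairing dA dB ?L (?\<nu> ss) (Pk (h x')) (\<lambda>A B. complex_of_real (1 / (real K)\<^sup>2) * ((if A = B then 1 else 0) + G (A, B)))
        = complex_of_real (1 / (real K)\<^sup>2) * (1 + (\<Sum>A\<in>?WB. \<Sum>B\<in>?WB. G (A, B) * \<tau> (h x') ss (A, B)))" .
      show ?thesis unfolding e by (simp only: sum.cartesian_product) (simp add: split_beta)
    qed
    show "Re (pairing dA dB ?L (?\<nu> ss) (Pk (h x')) (E (x, x'))) = 1 / (real K)\<^sup>2 * (1 + F ss x x')"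
      unfolding E_def F_def prod.case by (rule g)
    have n: "F ss x x' = - (\<Sum>j\<in>?WB \<times> ?WB. Re (cnj (H (h x') (h x) j) * \<tau> (h x') ss j))"
      unfolding F_def sum_negf[symmetric] anti[of "h x" "h x'"] by (rule sum.cong[OF refl]) simp
    have "Re (pairing dA dB ?L (?\<nu> ss) (Pk (h x')) (E (x', x))) = 1 / (real K)\<^sup>2 * (1 + (\<Sum>j\<in>?WB \<times> ?WB. Re (cnj (H (h x') (h x) j) * \<tau> (h x') ss j)))"
      unfolding E_def prod.case by (rule g)
    then show "Re (pairing dA dB ?L (?\<nu> ss) (Pk (h x')) (E (x', x))) = 1 / (real K)\<^sup>2 * (1 - F ss x x')" unfolding n by simp
  qed
  have fin: "2 * c / (real K)\<^sup>2 \<le> (\<Sum>x<K. \<Sum>x'<K.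
       Re (pairing dA dB ?L (?\<nu> (\<sigma> x)) (Pk (h x')) (E (x, x'))) - Re (pairing dA dB ?L (?\<nu> (\<sigma> x)) (Pk (h x')) (E (x', x))))"
    if \<sigma>: "\<forall>x<K. length (\<sigma> x) = l" for \<sigma>
  proof -
    define \<sigma>' where "\<sigma>' = (\<lambda>\<rho>. \<sigma> (inv_into {..<K} h \<rho>))"
    have inv: "inv_into {..<K} h (h x) = x" if "x < K" for x using h that by (simp add: bij_betw_def)
    have "\<forall>\<rho>\<in>Rs. \<sigma>' \<rho> \<in> ?SS"
    proof
      fix \<rho> assume "\<rho> \<in> Rs"
      then have "\<rho> \<in> h ` {..<K}" using h unfolding bij_betw_def by simp
      then obtain x where x: "\<rho> = h x" "x < K" by auto
      then show "\<sigma>' \<rho> \<in> ?SS" unfolding \<sigma>'_def using inv[OF x(2)] \<sigma> by simp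
    qed
    then have "c \<le> (\<Sum>\<rho>\<in>Rs. \<Sum>\<rho>'\<in>Rs. \<Sum>j\<in>?WB \<times> ?WB. Re (cnj (H \<rho> \<rho>' j) * \<tau> \<rho>' (\<sigma>' \<rho>) j))" by (rule mp[OF spec[OF sep]])
    also have "\<dots> = (\<Sum>x<K. \<Sum>x'<K. F (\<sigma>' (h x)) x x')" unfolding F_def sum.reindex_bij_betw[OF h, symmetric] ..
    also have "\<dots> = (\<Sum>x<K. \<Sum>x'<K. F (\<sigma> x) x x')" unfolding \<sigma>'_def by (intro sum.cong[OF refl]) (simp add: inv)
    finally have "2 / (real K)\<^sup>2 * c \<le> 2 / (real K)\<^sup>2 * (\<Sum>x<K. \<Sum>x'<K. F (\<sigma> x) x x')" by (intro mult_left_mono) auto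
    also have "\<dots> = (\<Sum>x<K. \<Sum>x'<K.
       Re (pairing dA dB ?L (?\<nu> (\<sigma> x)) (Pk (h x')) (E (x, x'))) - Re (pairing dA dB ?L (?\<nu> (\<sigma> x)) (Pk (h x')) (E (x', x))))"
      unfolding sum_distrib_left by (intro sum.cong[OF refl]) (simp add: pr diff_divide_distrib[symmetric])
    finally show ?thesis by simp
  qed
  show ?thesis
  proof (rule exI[of _ K], rule exI[of _ "\<lambda>x. Pk (h x)"], rule exI[of _ E], rule exI[of _ "2 * c / (real K)\<^sup>2"], intro conjI)
    show "0 < 2 * c / (real K)\<^sup>2" using c K by simp
    show "\<forall>x<K. gram (words dA ?L) (Pk (h x)) \<and> (\<Sum>I\<in>words dA ?L. Pk (h x) I I) = 1" using Pg Ptr hR by blast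
    show "\<forall>y\<in>{..<K} \<times> {..<K}. gram ?WB (E y)" using Eg by auto
  qed (use K Es fin in blast)+
qed

end

section \<open>Blocks of channel uses, with positions indexed by pairs of a block and an
  offset\<close>

definition blk :: "'l set \<Rightarrow> ('q \<times> 'l \<Rightarrow> nat) \<Rightarrow> 'q \<Rightarrow> 'l \<Rightarrow> nat" where
  "blk L I q = (\<lambda>t\<in>L. I (q, t))"

lemma blk_words: "I \<in> words d (Q \<times> L) \<Longrightarrow> q \<in> Q \<Longrightarrow> blk L I q \<in> words d L"
  unfolding words_def blk_def by (auto simp: PiE_iff)

lemma blk_eq_iff:
  assumes "A \<in> words d (Q \<times> L)" "B \<in> words d (Q \<times> L)"
  shows "A = B \<longleftrightarrow> (\<forall>q\<in>Q. blk L A q = blk L B q)"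
proof
  assume e: "\<forall>q\<in>Q. blk L A q = blk L B q"
  show "A = B"
  proof (rule PiE_ext[OF assms[unfolded words_def]])
    fix z assume z: "z \<in> Q \<times> L"
    then have "blk L A (fst z) (snd z) = blk L B (fst z) (snd z)" using e by auto
    then show "A z = B z" using z unfolding blk_def by auto
  qed
qed simp

lemma sum_blk:
  "(\<Sum>I\<in>words d (Q \<times> L). g (\<lambda>q\<in>Q. blk L I q)) = (\<Sum>J\<in>PiE Q (\<lambda>_. words d L). g J)"
proof (rule sum.reindex_bij_witness[where i="\<lambda>J. \<lambda>z\<in>Q \<times> L. J (fst z) (snd z)" and j="\<lambda>I. \<lambda>q\<in>Q. blk L I q"])
  fix I assume I: "I \<in> words d (Q \<times> L)"
  show "(\<lambda>z\<in>Q \<times> L. (\<lambda>q\<in>Q. blk L I q) (fst z) (snd z)) = I"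
    by (rule PiE_ext[where k="Q \<times> L" and s="\<lambda>_. {..<d}"]) (use I in \<open>auto simp: words_def blk_def PiE_iff\<close>)
  show "(\<lambda>q\<in>Q. blk L I q) \<in> PiE Q (\<lambda>_. words d L)" using blk_words[OF I] by auto
next
  fix J assume J: "J \<in> PiE Q (\<lambda>_. words d L)"
  show "(\<lambda>z\<in>Q \<times> L. J (fst z) (snd z)) \<in> words d (Q \<times> L)" using J unfolding words_def by (auto simp: PiE_iff)
  show "(\<lambda>q\<in>Q. blk L (\<lambda>z\<in>Q \<times> L. J (fst z) (snd z)) q) = J"
  proof
    fix q show "(\<lambda>q\<in>Q. blk L (\<lambda>z\<in>Q \<times> L. J (fst z) (snd z)) q) q = J q"
    proof (cases "q \<in> Q")
      case True
      then have "J q \<in> extensional L" using J unfolding words_def by (auto simp: PiE_iff)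
      then show ?thesis using True by (auto simp: blk_def extensional_def fun_eq_iff)
    qed (use J in \<open>auto simp: PiE_iff extensional_def\<close>)
  qed
qed simp

lemma sum_blk_prod:
  assumes "finite Q" "finite L"
  shows "(\<Sum>I\<in>words d (Q \<times> L). \<Prod>q\<in>Q. g q (blk L I q)) = (\<Prod>q\<in>Q. \<Sum>J\<in>words d L. g q J :: complex)"
proof -
  have "(\<Sum>I\<in>words d (Q \<times> L). \<Prod>q\<in>Q. g q (blk L I q)) = (\<Sum>I\<in>words d (Q \<times> L). \<Prod>q\<in>Q. g q ((\<lambda>q\<in>Q. blk L I q) q))"
    by (intro sum.cong prod.cong refl) simp
  also have "\<dots> = (\<Sum>J\<in>PiE Q (\<lambda>_. words d L). \<Prod>q\<in>Q. g q (J q))"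
    by (rule sum_blk[where g="\<lambda>J. \<Prod>q\<in>Q. g q (J q)"])
  also have "\<dots> = (\<Prod>q\<in>Q. \<Sum>J\<in>words d L. g q J)"
    by (rule prod_sum_PiE[symmetric]) (use assms finite_words in auto)
  finally show ?thesis .
qed

lemma pairing_blk:
  assumes Q: "finite Q" and L: "finite L"
  shows "pairing dA dB (Q \<times> L) \<nu> (\<lambda>I J. \<Prod>q\<in>Q. P q (blk L I q) (blk L J q)) (\<lambda>A B. \<Prod>q\<in>Q. R q (blk L A q) (blk L B q))
    = (\<Prod>q\<in>Q. pairing dA dB L (\<lambda>t. \<nu> (q, t)) (P q) (R q))"
proof -
  have w: "chanW (Q \<times> L) \<nu> I J A B = (\<Prod>q\<in>Q. chanW L (\<lambda>t. \<nu> (q, t)) (blk L I q) (blk L J q) (blk L A q) (blk L B q))" for I J A B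
  proof -
    have "(\<Prod>z\<in>Q \<times> L. f z) = (\<Prod>q\<in>Q. \<Prod>t\<in>L. f (q, t))" for f :: "_ \<Rightarrow> complex"
      by (simp add: prod.cartesian_product)
    then show ?thesis unfolding chanW_def blk_def by simp
  qed
  show ?thesis
    unfolding pairing_def w prod.distrib[symmetric]
    by (simp only: sum_blk_prod[OF Q L, of "\<lambda>q B. P q (blk L _ q) (blk L _ q) * chanW L (\<lambda>t. \<nu> (q, t)) (blk L _ q) (blk L _ q) (blk L _ q) B * R q (blk L _ q) B"]
      sum_blk_prod[OF Q L, of "\<lambda>q A. \<Sum>B\<in>words dB L. P q (blk L _ q) (blk L _ q) * chanW L (\<lambda>t. \<nu> (q, t)) (blk L _ q) (blk L _ q) A B * R q A B"]
      sum_blk_prod[OF Q L, of "\<lambda>q J. \<Sum>A\<in>words dB L. \<Sum>B\<in>words dB L. P q (blk L _ q) J * chanW L (\<lambda>t. \<nu> (q, t)) (blk L _ q) J A B * R q A B"]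
      sum_blk_prod[OF Q L, of "\<lambda>q I. \<Sum>J\<in>words dA L. \<Sum>A\<in>words dB L. \<Sum>B\<in>words dB L. P q I J * chanW L (\<lambda>t. \<nu> (q, t)) I J A B * R q A B"])
qed

text \<open>Each block is measured separately with \<open>E\<close>, and the tuple of outcomes is
  decoded classically. The law \<open>PS\<close> states abstractly that the outcomes
  \<open>z\<close> enumerate all labelings of the blocks, so that \<open>z\<close> may be organized
  as a nested function.\<close>

lemma block_code:
  fixes P :: "'x \<Rightarrow> 'l wkern" and E :: "'y \<Rightarrow> 'l wkern"
  assumes Q: "finite Q" and L: "finite L" and M: "1 \<le> (M::nat)" and Z: "finite Z"
    and P: "\<forall>m<M. \<forall>q\<in>Q. gram (words dA L) (P (x m q)) \<and> (\<Sum>I\<in>words dA L. P (x m q) I I) = 1"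
    and E: "\<forall>y\<in>Y. gram (words dB L) (E y)"
    and Es: "\<forall>A\<in>words dB L. \<forall>B\<in>words dB L. (\<Sum>y\<in>Y. E y A B) = (if A = B then 1 else 0)"
    and lab: "\<forall>z\<in>Z. \<forall>q\<in>Q. lab z q \<in> Y"
    and PS: "\<And>g :: _ \<Rightarrow> _ \<Rightarrow> complex. (\<Sum>z\<in>Z. \<Prod>q\<in>Q. g q (lab z q)) = (\<Prod>q\<in>Q. \<Sum>y\<in>Y. g q y)"
    and dec: "\<forall>z. dec z < M"
  shows "\<exists>p r. acode dA dB (Q \<times> L) M 1 1 p r \<and> (\<forall>\<nu>. (\<forall>t\<in>Q \<times> L. chk dA dB (\<nu> t)) \<longrightarrow>
    afid dA dB (Q \<times> L) \<nu> M 1 p r = 1 / real M * (\<Sum>m<M. \<Sum>z\<in>Z. if dec z = m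
       then \<Prod>q\<in>Q. Re (pairing dA dB L (\<lambda>t. \<nu> (q, t)) (P (x m q)) (E (lab z q))) else 0))"
proof -
  let ?p = "\<lambda>m (i::nat) (j::nat) I J. \<Prod>q\<in>Q. P (x m q) (blk L I q) (blk L J q)"
  let ?e = "\<lambda>z A B. \<Prod>q\<in>Q. E (lab z q) (blk L A q) (blk L B q)"
  let ?r = "\<lambda>m A B (a::nat) (b::nat). \<Sum>z\<in>Z. if dec z = m then ?e z A B else 0"
  have "acode dA dB (Q \<times> L) M 1 1 ?p ?r"
    unfolding acode_def
  proof (intro conjI allI impI ballI M)
    fix m assume m: "m < M"
    have "gram (words dA (Q \<times> L)) (\<lambda>I J. P (x m q) (blk L I q) (blk L J q))" if "q \<in> Q" for q
      by (rule gram_vimage[of "words dA L"]) (use P m that blk_words in auto)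
    then have "gram (words dA (Q \<times> L)) (\<lambda>I J. \<Prod>q\<in>Q. P (x m q) (blk L I q) (blk L J q))" by (intro gram_prod)
    then show "gram ({..<1} \<times> words dA (Q \<times> L)) (\<lambda>x' y. ?p m (fst x') (fst y) (snd x') (snd y))"
      by (rule gram_vimage[of _ _ _ snd]) auto
    have "gram (words dB (Q \<times> L)) (\<lambda>A B. if dec z = m then ?e z A B else 0)" if z: "z \<in> Z" for z
    proof (cases "dec z = m")
      case True
      have "gram (words dB (Q \<times> L)) (\<lambda>A B. E (lab z q) (blk L A q) (blk L B q))" if "q \<in> Q" for q
        by (rule gram_vimage[of "words dB L"]) (use E lab z that blk_words in auto)
      then have "gram (words dB (Q \<times> L)) (?e z)" by (intro gram_prod)
      then show ?thesis using True by simp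
    qed (simp add: gram_0)
    then have "gram (words dB (Q \<times> L)) (\<lambda>A B. \<Sum>z\<in>Z. if dec z = m then ?e z A B else 0)" by (intro gram_sum)
    then show "gram (words dB (Q \<times> L) \<times> {..<1}) (\<lambda>x' y. ?r m (fst x') (fst y) (snd x') (snd y))"
      by (rule gram_vimage[of _ _ _ fst]) auto
    fix i j :: nat assume "i < 1" "j < 1"
    then show "(\<Sum>I\<in>words dA (Q \<times> L). ?p m i j I I) = (if i = j then 1 else 0)"
      using P m by (simp add: sum_blk_prod[OF Q L, of "\<lambda>q I. P (x m q) I I"])
  next
    fix A B assume AB: "A \<in> words dB (Q \<times> L)" "B \<in> words dB (Q \<times> L)"
    have "(\<Sum>m<M. \<Sum>a<1. ?r m A B a a) = (\<Sum>z\<in>Z. \<Sum>m<M. if dec z = m then ?e z A B else 0)"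
    proof -
      have "(\<Sum>a<(1::nat). c) = c" for c :: complex by simp
      then show ?thesis by (simp only:) (rule sum.swap)
    qed
    also have "\<dots> = (\<Sum>z\<in>Z. ?e z A B)" by (rule sum.cong[OF refl]) (use dec in simp)
    also have "\<dots> = (\<Prod>q\<in>Q. \<Sum>y\<in>Y. E y (blk L A q) (blk L B q))" by (rule PS)
    also have "\<dots> = (\<Prod>q\<in>Q. if blk L A q = blk L B q then 1 else 0)"
    proof (rule prod.cong[OF refl])
      fix q assume "q \<in> Q"
      from blk_words[OF AB(1) this] blk_words[OF AB(2) this]
      show "(\<Sum>y\<in>Y. E y (blk L A q) (blk L B q)) = (if blk L A q = blk L B q then 1 else 0)"
        using Es by blast
    qed
    also have "\<dots> = (if A = B then 1 else 0)"
      unfolding blk_eq_iff[OF AB] using Q by (auto simp: prod_zero_iff)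
    finally show "(\<Sum>m<M. \<Sum>a<1. ?r m A B a a) = (if A = B then 1 else 0)" .
  qed simp_all
  moreover have "afid dA dB (Q \<times> L) \<nu> M 1 ?p ?r = 1 / real M * (\<Sum>m<M. \<Sum>z\<in>Z. if dec z = m
       then \<Prod>q\<in>Q. Re (pairing dA dB L (\<lambda>t. \<nu> (q, t)) (P (x m q)) (E (lab z q))) else 0)"
    if \<nu>: "\<forall>t\<in>Q \<times> L. chk dA dB (\<nu> t)" for \<nu>
  proof -
    have real: "pairing dA dB L (\<lambda>t. \<nu> (q, t)) (P (x m q)) (E (lab z q)) = of_real (Re (pairing dA dB L (\<lambda>t. \<nu> (q, t)) (P (x m q)) (E (lab z q))))"
      if "m < M" "z \<in> Z" "q \<in> Q" for m z q
    proof -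
      have "0 \<le> pairing dA dB L (\<lambda>t. \<nu> (q, t)) (P (x m q)) (E (lab z q))"
        by (rule pairing_nonneg) (use \<nu> P E lab that in auto)
      then show ?thesis by (simp add: less_eq_complex_def complex_eq_iff)
    qed
    have "Re (pairing dA dB (Q \<times> L) \<nu> (?p m 0 0) (\<lambda>A B. ?r m A B 0 0)) = (\<Sum>z\<in>Z. if dec z = m
       then \<Prod>q\<in>Q. Re (pairing dA dB L (\<lambda>t. \<nu> (q, t)) (P (x m q)) (E (lab z q))) else 0)" if m: "m < M" for m
    proof -
      have "pairing dA dB (Q \<times> L) \<nu> (?p m 0 0) (\<lambda>A B. ?r m A B 0 0)
         = (\<Sum>z\<in>Z. pairing dA dB (Q \<times> L) \<nu> (?p m 0 0) (\<lambda>A B. if dec z = m then ?e z A B else 0))"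
        by (rule pairing_sum_right)
      also have "\<dots> = (\<Sum>z\<in>Z. of_real (if dec z = m
         then \<Prod>q\<in>Q. Re (pairing dA dB L (\<lambda>t. \<nu> (q, t)) (P (x m q)) (E (lab z q))) else 0))"
      proof (rule sum.cong[OF refl])
        fix z assume z: "z \<in> Z"
        show "pairing dA dB (Q \<times> L) \<nu> (?p m 0 0) (\<lambda>A B. if dec z = m then ?e z A B else 0)
          = of_real (if dec z = m then \<Prod>q\<in>Q. Re (pairing dA dB L (\<lambda>t. \<nu> (q, t)) (P (x m q)) (E (lab z q))) else 0)"
        proof (cases "dec z = m")
          case True
          have "pairing dA dB (Q \<times> L) \<nu> (?p m 0 0) (?e z) = (\<Prod>q\<in>Q. pairing dA dB L (\<lambda>t. \<nu> (q, t)) (P (x m q)) (E (lab z q)))"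
            by (rule pairing_blk[OF Q L])
          also have "\<dots> = of_real (\<Prod>q\<in>Q. Re (pairing dA dB L (\<lambda>t. \<nu> (q, t)) (P (x m q)) (E (lab z q))))"
            unfolding of_real_prod by (rule prod.cong[OF refl], rule real[OF m z])
          finally show ?thesis using True by simp
        qed (simp add: pairing_zero_right)
      qed
      finally show ?thesis unfolding of_real_sum[symmetric] by simp
    qed
    then show ?thesis unfolding afid_def cfid_def by simp
  qed
  ultimately show ?thesis by (intro exI[of _ ?p] exI[of _ ?r]) blast
qed

text \<open>Supplies the law \<open>PS\<close> of \<open>block_code\<close> when outcomes are
  grouped first by super-letter and then by block within it.\<close>

lemma prod_sum_nested:
  fixes g :: "'a \<times> 'b \<Rightarrow> 'y \<Rightarrow> complex"
  assumes "finite A" "finite B" "finite Y"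
  shows "(\<Sum>z\<in>PiE A (\<lambda>_. PiE B (\<lambda>_. Y)). \<Prod>q\<in>A \<times> B. g q (z (fst q) (snd q))) = (\<Prod>q\<in>A \<times> B. \<Sum>y\<in>Y. g q y)"
proof -
  have "(\<Sum>z\<in>PiE A (\<lambda>_. PiE B (\<lambda>_. Y)). \<Prod>q\<in>A \<times> B. g q (z (fst q) (snd q)))
     = (\<Sum>z\<in>PiE A (\<lambda>_. PiE B (\<lambda>_. Y)). \<Prod>a\<in>A. \<Prod>b\<in>B. g (a, b) (z a b))"
    using assms by (simp add: prod.Sigma split_def)
  also have "\<dots> = (\<Prod>a\<in>A. \<Sum>u\<in>PiE B (\<lambda>_. Y). \<Prod>b\<in>B. g (a, b) (u b))"
    by (rule prod_sum_PiE[symmetric]) (use assms in \<open>auto intro!: finite_PiE\<close>)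
  also have "\<dots> = (\<Prod>a\<in>A. \<Prod>b\<in>B. \<Sum>y\<in>Y. g (a, b) y)"
    by (intro prod.cong[OF refl] prod_sum_PiE[symmetric]) (use assms in auto)
  also have "\<dots> = (\<Prod>q\<in>A \<times> B. \<Sum>y\<in>Y. g q y)" using assms by (simp add: prod.Sigma split_def)
  finally show ?thesis .
qed

lemma sum_PiE_marginal:
  fixes w :: "'a \<Rightarrow> 'y \<Rightarrow> real"
  assumes A: "finite A" and Y: "finite Y" and w: "\<And>i. i \<in> A \<Longrightarrow> (\<Sum>y\<in>Y. w i y) = 1" and k: "k \<in> A"
  shows "(\<Sum>u\<in>PiE A (\<lambda>_. Y). (\<Prod>i\<in>A. w i (u i)) * h (u k)) = (\<Sum>y\<in>Y. w k y * h y)"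
proof -
  let ?h = "\<lambda>i y. if i = k then h y else 1"
  have "(\<Sum>u\<in>PiE A (\<lambda>_. Y). (\<Prod>i\<in>A. w i (u i)) * h (u k)) = (\<Sum>u\<in>PiE A (\<lambda>_. Y). \<Prod>i\<in>A. w i (u i) * ?h i (u i))"
    using A k by (intro sum.cong[OF refl]) (simp add: prod.distrib)
  also have "\<dots> = (\<Prod>i\<in>A. \<Sum>y\<in>Y. w i y * ?h i y)"
    by (rule prod_sum_PiE[symmetric]) (use A Y in auto)
  also have "\<dots> = (\<Sum>y\<in>Y. w k y * h y) * (\<Prod>i\<in>A - {k}. \<Sum>y\<in>Y. w i y * ?h i y)"
    by (subst prod.remove[OF A k]) simp
  also have "(\<Prod>i\<in>A - {k}. \<Sum>y\<in>Y. w i y * ?h i y) = 1" by (rule prod.neutral) (use w in auto)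
  finally show ?thesis by simp
qed

lemma bij_shift: "k < K \<Longrightarrow> bij_betw (\<lambda>a. (a + k) mod K) {..<K} {..<(K::nat)}"
proof -
  assume k: "k < K"
  have "(\<lambda>a. (a + k) mod K) ` {..<K} = {..<K}"
  proof (intro equalityI subsetI)
    fix x assume x: "x \<in> {..<K}"
    have "((x + (K - k)) mod K + k) mod K = (x + (K - k) + k) mod K" by (rule mod_add_left_eq)
    also have "x + (K - k) + k = x + K" using k by simp
    finally have "x = ((x + (K - k)) mod K + k) mod K" using x by simp
    then show "x \<in> (\<lambda>a. (a + k) mod K) ` {..<K}" by (rule image_eqI[of _ _ "(x + (K - k)) mod K"]) (use k in simp)
  qed (use k in auto)
  then show ?thesis unfolding bij_betw_def by (simp add: eq_card_imp_inj_on)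
qed

lemma shift_sum:
  assumes "k < K"
  shows "(\<Sum>a<K. f ((a + k) mod K)) = (\<Sum>x<(K::nat). f x)"
  by (rule sum.reindex_bij_betw[OF bij_shift[OF assms]])

text \<open>The \<open>K\<close> cyclic shifts of the base inputs form one super-letter: whatever the jammer does, the competing
  letter then meets every state assignment \<open>x \<mapsto> \<sigma> x\<close> it can face within the same block.\<close>

lemma shift_channel:
  fixes K :: nat and v :: "nat \<Rightarrow> 't \<Rightarrow> nat \<times> nat \<Rightarrow> real"
  defines "Y \<equiv> {..<K} \<times> {..<K}"
  assumes K: "1 \<le> K" 
    and v1: "\<And>x ss. x < K \<Longrightarrow> ss \<in> SS \<Longrightarrow> (\<Sum>y\<in>Y. v x ss y) = 1"
    and sep: "\<And>\<sigma>. (\<forall>x<K. \<sigma> x \<in> SS) \<Longrightarrow> c \<le> (\<Sum>x<K. \<Sum>x'<K. v x' (\<sigma> x) (x, x') - v x' (\<sigma> x) (x', x))"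
    and a': "a' < K" and s: "s \<in> PiE {..<K} (\<lambda>_. SS)"
  defines "g \<equiv> \<lambda>(x::nat) x' y. (if y = (x, x') then 1 else 0) - (if y = (x', x) then 1 else (0::real))"
  shows "c \<le> (\<Sum>a<K. \<Sum>y\<in>PiE {..<K} (\<lambda>_. Y).
     (\<Prod>k<K. v ((a + k) mod K) (s k) (y k)) * (\<Sum>k<K. g ((a' + k) mod K) ((a + k) mod K) (y k)))"
proof -
  have fY: "finite Y" unfolding Y_def by simp
  have K0: "0 < K" using K by simp
  have sS: "s k \<in> SS" if "k < K" for k using s that by auto
  define f where "f = (\<lambda>x x' ss. v x' ss (x, x') - v x' ss (x', x))"
  have vg: "(\<Sum>y\<in>Y. v x' ss y * g x x' y) = f x x' ss" if "x < K" "x' < K" for x x' ss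
  proof -
    have "(\<Sum>y\<in>Y. v x' ss y * g x x' y) = (\<Sum>y\<in>Y. if y = (x, x') then v x' ss y else 0) - (\<Sum>y\<in>Y. if y = (x', x) then v x' ss y else 0)"
      unfolding sum_subtractf[symmetric] g_def by (rule sum.cong[OF refl]) (simp only: right_diff_distrib mult_1_right mult_zero_right if_distrib[of "\<lambda>u. v x' ss _ * u"])
    then show ?thesis using fY that unfolding f_def Y_def by simp
  qed
  have "(\<Sum>a<K. \<Sum>y\<in>PiE {..<K} (\<lambda>_. Y). (\<Prod>k<K. v ((a + k) mod K) (s k) (y k)) * (\<Sum>k<K. g ((a' + k) mod K) ((a + k) mod K) (y k)))
    = (\<Sum>a<K. \<Sum>k<K. f ((a' + k) mod K) ((a + k) mod K) (s k))"
  proof (rule sum.cong[OF refl])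
    fix a
    have "(\<Sum>y\<in>PiE {..<K} (\<lambda>_. Y). (\<Prod>k<K. v ((a + k) mod K) (s k) (y k)) * (\<Sum>k<K. g ((a' + k) mod K) ((a + k) mod K) (y k)))
      = (\<Sum>k<K. \<Sum>y\<in>PiE {..<K} (\<lambda>_. Y). (\<Prod>k<K. v ((a + k) mod K) (s k) (y k)) * g ((a' + k) mod K) ((a + k) mod K) (y k))"
      unfolding sum_distrib_left by (rule sum.swap)
    also have "\<dots> = (\<Sum>k<K. f ((a' + k) mod K) ((a + k) mod K) (s k))"
    proof (rule sum.cong[OF refl])
      fix k assume k: "k \<in> {..<K}"
      have "(\<Sum>y\<in>PiE {..<K} (\<lambda>_. Y). (\<Prod>k<K. v ((a + k) mod K) (s k) (y k)) * g ((a' + k) mod K) ((a + k) mod K) (y k))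
         = (\<Sum>y\<in>Y. v ((a + k) mod K) (s k) y * g ((a' + k) mod K) ((a + k) mod K) y)"
        by (rule sum_PiE_marginal[where w="\<lambda>k. v ((a + k) mod K) (s k)", OF _ fY _ k]) (use v1 sS K0 in auto)
      also have "\<dots> = f ((a' + k) mod K) ((a + k) mod K) (s k)" by (rule vg) (use K0 in simp_all)
      finally show "(\<Sum>y\<in>PiE {..<K} (\<lambda>_. Y). (\<Prod>k<K. v ((a + k) mod K) (s k) (y k)) * g ((a' + k) mod K) ((a + k) mod K) (y k))
         = f ((a' + k) mod K) ((a + k) mod K) (s k)" .
    qed
    finally show "(\<Sum>y\<in>PiE {..<K} (\<lambda>_. Y). (\<Prod>k<K. v ((a + k) mod K) (s k) (y k)) * (\<Sum>k<K. g ((a' + k) mod K) ((a + k) mod K) (y k)))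
      = (\<Sum>k<K. f ((a' + k) mod K) ((a + k) mod K) (s k))" .
  qed
  also have "\<dots> = (\<Sum>k<K. \<Sum>a<K. f ((a' + k) mod K) ((a + k) mod K) (s k))" by (rule sum.swap)
  also have "\<dots> = (\<Sum>k<K. \<Sum>x'<K. f ((a' + k) mod K) x' (s k))"
    by (rule sum.cong[OF refl], rule shift_sum) simp
  \<comment> \<open>For fixed \<open>a'\<close> the index \<open>a' + k\<close> modulo
    \<open>K\<close> runs through every competitor \<open>x\<close> exactly once, so the states of
    the blocks form an assignment \<open>x \<mapsto> \<sigma> x\<close>, to which the separation
    hypothesis applies.\<close>
  also have "\<dots> = (\<Sum>x<K. \<Sum>x'<K. f x x' (s (inv_into {..<K} (\<lambda>k. (k + a') mod K) x)))"
    unfolding shift_sum[OF a', symmetric, of "\<lambda>x. \<Sum>x'<K. f x x' (s (inv_into {..<K} (\<lambda>k. (k + a') mod K) x))"]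
  proof (intro sum.cong[OF refl])
    fix k x' assume "k \<in> {..<K}"
    then have "inv_into {..<K} (\<lambda>k. (k + a') mod K) ((k + a') mod K) = k"
      using inv_into_f_f[of "\<lambda>k. (k + a') mod K" "{..<K}" k] bij_shift[OF a'] unfolding bij_betw_def by simp
    then show "f ((a' + k) mod K) x' (s k) = f ((k + a') mod K) x' (s (inv_into {..<K} (\<lambda>k. (k + a') mod K) ((k + a') mod K)))"
      by (simp only: add.commute)
  qed
  finally have e: "(\<Sum>a<K. \<Sum>y\<in>PiE {..<K} (\<lambda>_. Y). (\<Prod>k<K. v ((a + k) mod K) (s k) (y k)) * (\<Sum>k<K. g ((a' + k) mod K) ((a + k) mod K) (y k)))
     = (\<Sum>x<K. \<Sum>x'<K. f x x' (s (inv_into {..<K} (\<lambda>k. (k + a') mod K) x)))" .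
  show ?thesis unfolding e unfolding f_def
  proof (rule sep, intro allI impI)
    fix x assume "x < K"
    then have "x \<in> (\<lambda>k. (k + a') mod K) ` {..<K}" using bij_shift[OF a'] unfolding bij_betw_def by simp
    from inv_into_into[OF this] show "s (inv_into {..<K} (\<lambda>k. (k + a') mod K) x) \<in> SS" using sS by simp
  qed
qed

context
  fixes N :: "'s::finite \<Rightarrow> cmap" and dA dB :: nat
  assumes dA: "1 \<le> dA" and dB: "1 \<le> dB" and N: "\<forall>s. cptp dA dB (N s)"
begin

text \<open>A super-letter \<open>a\<close> occupies \<open>K\<close> blocks of length
  \<open>l\<close>, carrying the base inputs \<open>a, a + 1, ...\<close> modulo \<open>K\<close>.
  \<open>W\<close> is the classical channel seen through the blockwise measurement, \<open>G\<close>
  counts the votes for \<open>a\<close> minus those for \<open>a'\<close>; the random coding result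
  for them is translated back into a code on single positions.\<close>

lemma nonsymmetrizable_imp_positive_rate:
  assumes ns: "\<not> l_symmetrizable dA dB N l" and l: "1 \<le> l"
  shows "\<exists>R>0. (R, 0) \<in> A_d dA dB N"
proof -
  let ?L = "{..<l}" and ?SS = "{ss :: 's list. length ss = l}"
  obtain K :: nat and P E c where K: "1 \<le> K" and c: "0 < c"
    and P: "\<forall>x<K. gram (words dA ?L) (P x) \<and> (\<Sum>I\<in>words dA ?L. P x I I) = 1"
    and E: "\<forall>y\<in>{..<K} \<times> {..<K}. gram (words dB ?L) (E y)"
    and Es: "\<forall>A\<in>words dB ?L. \<forall>B\<in>words dB ?L. (\<Sum>y\<in>{..<K} \<times> {..<K}. E y A B) = (if A = B then 1 else 0)"
    and sep: "\<forall>\<sigma>. (\<forall>x<K. length (\<sigma> x) = l) \<longrightarrow> c \<le> (\<Sum>x<K. \<Sum>x'<K.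
       Re (pairing dA dB ?L (wstate dA N (\<lambda>t. \<sigma> x ! t)) (P x') (E (x, x'))) -
       Re (pairing dA dB ?L (wstate dA N (\<lambda>t. \<sigma> x ! t)) (P x') (E (x', x))))"
    using base_measurement[OF dA dB N ns] by (elim exE conjE) (rule that)
  define Y where "Y = {..<K} \<times> {..<K}"
  define v where "v = (\<lambda>x ss y. Re (pairing dA dB ?L (wstate dA N (\<lambda>t. ss ! t)) (P x) (E y)))"
  define g where "g = (\<lambda>(x::nat) x' y. (if y = (x, x') then 1 else 0) - (if y = (x', x) then 1 else (0::real)))"
  define W where "W = (\<lambda>a s y. \<Prod>k<K. v ((a + k) mod K) (s k) (y k))"
  define G where "G = (\<lambda>a' a y. \<Sum>k<K. g ((a' + k) mod K) ((a + k) mod K) (y k))"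
  let ?S = "PiE {..<K} (\<lambda>_. ?SS)" and ?Y = "PiE {..<K} (\<lambda>_. Y)"
  have K0: "0 < K" using K by simp
  have fY: "finite Y" unfolding Y_def by simp
  have chk: "\<forall>t\<in>T. chk dA dB (wstate dA N s t)" for T s by (rule chk_wstate[OF dA dB N])
  have v0: "0 \<le> v x ss y" if "x < K" "y \<in> Y" for x ss y
  proof -
    have "0 \<le> pairing dA dB ?L (wstate dA N (\<lambda>t. ss ! t)) (P x) (E y)"
      by (rule pairing_nonneg[OF chk]) (use P E that Y_def in auto)
    then show ?thesis unfolding v_def by (simp add: less_eq_complex_def)
  qed
  have v1: "(\<Sum>y\<in>Y. v x ss y) = 1" if "x < K" for x ss
  proof -
    have "(\<Sum>y\<in>Y. v x ss y) = Re (pairing dA dB ?L (wstate dA N (\<lambda>t. ss ! t)) (P x) (\<lambda>A B. \<Sum>y\<in>Y. E y A B))"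
      unfolding v_def pairing_sum_right by simp
    also have "pairing dA dB ?L (wstate dA N (\<lambda>t. ss ! t)) (P x) (\<lambda>A B. \<Sum>y\<in>Y. E y A B) = (\<Sum>I\<in>words dA ?L. P x I I)"
      by (rule pairing_ident[OF chk]) (use Es in \<open>simp_all add: Y_def\<close>)
    finally show ?thesis using P that by simp
  qed
  have W0: "0 \<le> W a s y" if "a < K" "s \<in> ?S" "y \<in> ?Y" for a s y
    unfolding W_def by (intro prod_nonneg ballI v0) (use that K0 in auto)
  have W1: "(\<Sum>y\<in>?Y. W a s y) = 1" if "a < K" "s \<in> ?S" for a s
  proof -
    have "(\<Sum>y\<in>?Y. W a s y) = (\<Prod>k<K. \<Sum>y\<in>Y. v ((a + k) mod K) (s k) y)"
      unfolding W_def by (rule prod_sum_PiE[symmetric]) (use fY in auto)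
    then show ?thesis using v1 K0 by simp
  qed
  have anti: "G a' a y = - G a a' y" for a' a y
    unfolding G_def g_def sum_negf[symmetric] by (rule sum.cong[OF refl]) simp
  have avg: "c \<le> (\<Sum>a<K. \<Sum>y\<in>?Y. W a s y * G a' a y)" if "a' < K" "s \<in> ?S" for a' s
    unfolding W_def G_def g_def Y_def
  proof (rule shift_channel[OF K _ _ that])
    show "(\<Sum>y\<in>{..<K} \<times> {..<K}. v x ss y) = 1" if "x < K" for x ss using v1[OF that] unfolding Y_def .
    show "c \<le> (\<Sum>x<K. \<Sum>x'<K. v x' (\<sigma> x) (x, x') - v x' (\<sigma> x) (x', x))" if "\<forall>x<K. \<sigma> x \<in> ?SS" for \<sigma>
      using mp[OF spec[OF sep, of \<sigma>]] that unfolding v_def by simp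
  qed
  have fYY: "finite ?Y" using fY by (intro finite_PiE) auto
  have fS: "finite ?S" using finite_lists[OF dA dB N] by (intro finite_PiE) auto
  have "\<exists>\<rho>>0. \<forall>\<eta>>0. eventually (\<lambda>n. \<exists>M C dec. 1 \<le> M \<and> \<rho> * real n \<le> log 2 (real M) \<and>
     (\<forall>m<M. C m \<in> PiE {..<n} (\<lambda>_. {..<K})) \<and> (\<forall>y. dec y < M) \<and>
     (\<forall>s\<in>PiE {..<n} (\<lambda>_. ?S). 1 - \<eta> \<le> 1 / real M * (\<Sum>m<M. \<Sum>y\<in>PiE {..<n} (\<lambda>_. ?Y).
        if dec y = m then \<Prod>t<n. W (C m t) (s t) (y t) else 0))) sequentially"
    by (rule nonsymmetrizable_code[where W=W and G=G and S="?S" and Y="?Y", OF fYY fS K W0 W1 anti c avg])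
  then obtain \<rho> where \<rho>: "0 < \<rho>" and code: "\<forall>\<eta>>0. eventually (\<lambda>n. \<exists>M C dec. 1 \<le> M \<and> \<rho> * real n \<le> log 2 (real M) \<and>
     (\<forall>m<M. C m \<in> PiE {..<n} (\<lambda>_. {..<K})) \<and> (\<forall>y. dec y < M) \<and>
     (\<forall>s\<in>PiE {..<n} (\<lambda>_. ?S). 1 - \<eta> \<le> 1 / real M * (\<Sum>m<M. \<Sum>y\<in>PiE {..<n} (\<lambda>_. ?Y).
        if dec y = m then \<Prod>t<n. W (C m t) (s t) (y t) else 0))) sequentially"
    by (elim exE conjE) (rule that)
  define d where "d = K * l"
  have d: "1 \<le> d" unfolding d_def using K l by simp
  \<comment> \<open>With \<open>n = m div d\<close> at least 1, the length \<open>m\<close> is below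
    \<open>2 * n * d\<close>; the factor 2 pays for the padded remainder.\<close>
  define R where "R = \<rho> / (2 * real d)"
  have R0: "0 < R" unfolding R_def using \<rho> d by simp
  have "eventually (\<lambda>m. detgood dA dB N m (R - \<eta>) (0 - \<eta>) \<eta>) sequentially" if \<eta>: "0 < \<eta>" for \<eta>
  proof -
    have "filterlim (\<lambda>m. m div d) at_top sequentially"
      unfolding filterlim_at_top
    proof
      fix z :: nat
      show "eventually (\<lambda>m. z \<le> m div d) sequentially"
        using eventually_ge_at_top[of "z * d"] by eventually_elim (use d in \<open>simp add: less_eq_div_iff_mult_less_eq\<close>)
    qed
    from eventually_compose_filterlim[OF eventually_conj[OF mp[OF spec[OF code] \<eta>] eventually_ge_at_top[of 1]] this]
    show ?thesis
    proof eventually_elim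
      case (elim m)
      define n where "n = m div d"
      obtain M C dec where M: "1 \<le> M" and rate: "\<rho> * real n \<le> log 2 (real M)"
        and C: "\<forall>m<M. C m \<in> PiE {..<n} (\<lambda>_. {..<K})" and dec: "\<forall>y. dec y < M"
        and fid: "\<forall>s\<in>PiE {..<n} (\<lambda>_. ?S). 1 - \<eta> \<le> 1 / real M * (\<Sum>m<M. \<Sum>y\<in>PiE {..<n} (\<lambda>_. ?Y).
          if dec y = m then \<Prod>t<n. W (C m t) (s t) (y t) else 0)"
        using conjunct1[OF elim] unfolding n_def[symmetric] by (elim exE conjE) (rule that)
      have n1: "1 \<le> n" using elim unfolding n_def by blast
      let ?Q = "{..<n} \<times> {..<K}" and ?Z = "PiE {..<n} (\<lambda>_. ?Y)"
      have fZ: "finite ?Z" by (rule finite_PiE[OF _ fYY]) simp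
      let ?x = "\<lambda>m q. (C m (fst q) + snd q) mod K" and ?lab = "\<lambda>z q. z (fst q) (snd q)"
      obtain p r where a: "acode dA dB (?Q \<times> ?L) M 1 1 p r"
        and af: "\<And>\<nu>. \<forall>t\<in>?Q \<times> ?L. chk dA dB (\<nu> t) \<Longrightarrow>
          afid dA dB (?Q \<times> ?L) \<nu> M 1 p r = 1 / real M * (\<Sum>m<M. \<Sum>z\<in>?Z. if dec z = m
             then \<Prod>q\<in>?Q. Re (pairing dA dB ?L (\<lambda>t. \<nu> (q, t)) (P (?x m q)) (E (?lab z q))) else 0)"
      proof -
        have "\<exists>p r. acode dA dB (?Q \<times> ?L) M 1 1 p r \<and> (\<forall>\<nu>. (\<forall>t\<in>?Q \<times> ?L. chk dA dB (\<nu> t)) \<longrightarrow>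
          afid dA dB (?Q \<times> ?L) \<nu> M 1 p r = 1 / real M * (\<Sum>m<M. \<Sum>z\<in>?Z. if dec z = m
             then \<Prod>q\<in>?Q. Re (pairing dA dB ?L (\<lambda>t. \<nu> (q, t)) (P (?x m q)) (E (?lab z q))) else 0))"
        proof (rule block_code[where Y=Y and x="?x" and lab="?lab", OF _ _ M fZ])
          show "\<forall>m<M. \<forall>q\<in>?Q. gram (words dA ?L) (P (?x m q)) \<and> (\<Sum>I\<in>words dA ?L. P (?x m q) I I) = 1"
            using P K0 by simp
          show "\<forall>z\<in>?Z. \<forall>q\<in>?Q. ?lab z q \<in> Y" by (auto simp: PiE_iff)
          show "(\<Sum>z\<in>?Z. \<Prod>q\<in>?Q. h q (?lab z q)) = (\<Prod>q\<in>?Q. \<Sum>y\<in>Y. h q y)" for h :: "_ \<Rightarrow> _ \<Rightarrow> complex"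
            by (rule prod_sum_nested) (use fY in auto)
        qed (use E Es dec in \<open>simp_all add: Y_def\<close>)
        then show ?thesis by (elim exE conjE) (rule that, assumption, erule allE, erule (1) mp)
      qed
      define n' where "n' = n * d"
      have "card (?Q \<times> ?L) = n'" unfolding n'_def d_def by (simp add: card_cartesian_product)
      then obtain h where h: "bij_betw h (?Q \<times> ?L) {..<n'}"
        using ex_bij_betw_finite_nat[of "?Q \<times> ?L"] by (auto simp: atLeast0LessThan)
      obtain p1 r1 where a1: "acode dA dB {..<n'} M 1 1 p1 r1"
        and f1: "\<And>\<nu>. afid dA dB {..<n'} \<nu> M 1 p1 r1 = afid dA dB (?Q \<times> ?L) (\<lambda>t. \<nu> (h t)) M 1 p r"
        using acode_transport[OF h _ a] by auto
      have n'm: "n' \<le> m" unfolding n'_def n_def by simp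
      have un: "{n'..<m} \<union> {..<n'} = {..<m}" using n'm by auto
      have dis: "{n'..<m} \<inter> {..<n'} = {}" by auto
      have "\<exists>D' p' r'. acode dA dB {..<m} M 1 D' p' r' \<and>
        (\<forall>\<nu>. (\<forall>t\<in>{..<m}. chk dA dB (\<nu> t)) \<longrightarrow> afid dA dB {..<n'} \<nu> M 1 p1 r1 \<le> afid dA dB {..<m} \<nu> M 1 p' r')"
        using acode_pad[OF dis _ _ dA a1] unfolding un by simp
      then obtain D' p2 r2 where a2: "acode dA dB {..<m} M 1 D' p2 r2"
        and f2: "\<And>\<nu>. \<forall>t\<in>{..<m}. chk dA dB (\<nu> t) \<Longrightarrow> afid dA dB {..<n'} \<nu> M 1 p1 r1 \<le> afid dA dB {..<m} \<nu> M 1 p2 r2"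
        by (elim exE conjE) (rule that, assumption, erule allE, erule (1) mp)
      have good: "1 - \<eta> \<le> afid dA dB {..<m} (wstate dA N s) M 1 p2 r2" for s
      proof -
        let ?\<nu> = "wstate dA N s"
        \<comment> \<open>\<open>ss q\<close> lists the states that the jammer applies to block
          \<open>q\<close>; \<open>sb\<close> arranges them by super-letter.\<close>
        define ss where "ss = (\<lambda>q. map (\<lambda>i. s (h (q, i))) [0..<l])"
        define sb where "sb = (\<lambda>t\<in>{..<n}. \<lambda>k\<in>{..<K}. ss (t, k))"
        have sb: "sb \<in> PiE {..<n} (\<lambda>_. ?S)" unfolding sb_def ss_def by auto
        have pe: "pairing dA dB ?L (\<lambda>t. ?\<nu> (h (q, t))) P' R' = pairing dA dB ?L (wstate dA N (\<lambda>t. ss q ! t)) P' R'" for q P' R'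
          by (rule pairing_cong) (auto simp: wstate_def ss_def)
        have "\<forall>t\<in>?Q \<times> ?L. chk dA dB (?\<nu> (h t))" using chk[of UNIV s] by simp
        from af[OF this] have "afid dA dB (?Q \<times> ?L) (\<lambda>t. ?\<nu> (h t)) M 1 p r = 1 / real M * (\<Sum>m<M. \<Sum>z\<in>?Z. if dec z = m
             then \<Prod>q\<in>?Q. v (?x m q) (ss q) (?lab z q) else 0)"
          unfolding pe v_def .
        also have "\<dots> = 1 / real M * (\<Sum>m<M. \<Sum>z\<in>?Z. if dec z = m then \<Prod>t<n. W (C m t) (sb t) (z t) else 0)"
        proof -
          have "(\<Prod>q\<in>?Q. v (?x m q) (ss q) (?lab z q)) = (\<Prod>t<n. W (C m t) (sb t) (z t))" for m z
          proof -
            have "(\<Prod>q\<in>?Q. v (?x m q) (ss q) (?lab z q)) = (\<Prod>t<n. \<Prod>k<K. v (?x m (t, k)) (ss (t, k)) (?lab z (t, k)))"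
              by (simp add: prod.cartesian_product split_def)
            also have "\<dots> = (\<Prod>t<n. W (C m t) (sb t) (z t))"
              unfolding W_def sb_def by (intro prod.cong[OF refl]) simp
            finally show ?thesis .
          qed
          then show ?thesis by (simp only:)
        qed
        also have "\<dots> \<ge> 1 - \<eta>" by (rule bspec[OF fid sb])
        finally show ?thesis using f1[of ?\<nu>] f2[OF chk[of "{..<m}" s]] by linarith
      qed
      have m0: "0 < m" using n1 unfolding n_def by (metis One_nat_def div_0 gr_zeroI not_one_le_zero)
      have "R * real m \<le> \<rho> * real n"
      proof -
        have "m < (n + 1) * d" unfolding n_def using d by (simp add: dividend_less_div_times)
        also have "\<dots> \<le> (2 * n) * d" using n1 by (intro mult_right_mono) auto
        finally have "real m \<le> real (2 * n * d)" by (simp only: of_nat_le_iff less_imp_le)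
        then have "R * real m \<le> R * real (2 * n * d)" using R0 by (intro mult_left_mono) auto
        also have "\<dots> = \<rho> * real n" unfolding R_def using d by simp
        finally show ?thesis .
      qed
      then have "R \<le> log 2 (real M) / real m" using rate m0 by (simp add: pos_le_divide_eq)
      then have r1: "R - \<eta> \<le> log 2 (real M) / real m" using \<eta> by linarith
      have r2: "0 - \<eta> \<le> log 2 (real (1::nat)) / real m" using \<eta> by simp
      show ?case unfolding detgood_def
        by (rule exI[of _ M], rule exI[of _ 1], rule exI[of _ D'], rule exI[of _ p2], rule exI[of _ r2])
          (intro conjI allI a2 r1 r2 good)
    qed
  qed
  then have "(R, 0) \<in> A_d dA dB N" unfolding A_d_iff[OF dA dB N] using R0 by simp
  then show ?thesis using R0 by blast
qed

end

theorem mainTheorem2: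
  fixes N :: "'s::finite \<Rightarrow> complex mat \<Rightarrow> complex mat" and dA dB :: nat
  assumes "1 \<le> dA" and "1 \<le> dB"
    and "\<forall>s. cptp dA dB (N s)"
  shows "(A_d dA dB N \<noteq> {(0, 0)} \<longrightarrow>
            A_d dA dB N = A_r dA dB N \<and> A_r dA dB N = C_CET dA dB (conv_chan dB N))
       \<and> (A_d dA dB N = {(0, 0)} \<longleftrightarrow> symmetrizable dA dB N)"
proof (intro conjI impI iffI)
  note ctx = assms
  assume "A_d dA dB N \<noteq> {(0, 0)}"
  \<comment> \<open>The region always contains the origin, so a region different from the singleton
    must contain a nonzero pair.\<close>
  then obtain P1 P2 where P: "(P1, P2) \<in> A_d dA dB N" "(P1, P2) \<noteq> (0, 0)"
    using zero_in_A_d[OF ctx] by (metis (no_types) insertI1 singletonI subset_antisym subset_singletonD subsetI surj_pair empty_iff)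
  show r: "A_d dA dB N = A_r dA dB N"
    by (rule subset_antisym[OF A_d_subset_A_r[OF ctx] A_r_subset_A_d[OF ctx P]])
  show "A_r dA dB N = C_CET dA dB (conv_chan dB N)"
    unfolding r[symmetric] by (rule subset_antisym[OF A_d_subset_C_CET[OF ctx] C_CET_subset_A_d[OF ctx P]])
next
  assume t: "A_d dA dB N = {(0, 0)}"
  show "symmetrizable dA dB N"
    unfolding symmetrizable_def
  proof (intro allI impI, rule ccontr)
    fix l :: nat assume "1 \<le> l" "\<not> l_symmetrizable dA dB N l"
    then obtain R where "0 < R" "(R, 0) \<in> A_d dA dB N" using nonsymmetrizable_imp_positive_rate[OF assms] by blast
    then show False unfolding t by simp
  qed
next
  assume "symmetrizable dA dB N"
  then show "A_d dA dB N = {(0, 0)}" by (rule symmetrizable_imp_A_d_trivial[OF assms])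
qed

end
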